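(* Let $k$ be a field and $H$ a finite dimensional Hopf algebra over $k$. There is a natural isomorphism of categories between the category ${}_{H^*}^{H^*}\mathcal{M}_{H^*}^{H^*}$ of Hopf bimodules over $H^*$ and the category of left modules over the two-sided crossed product algebra $Y=H^*\# (H\otimes H^{op})\# H^{*op}$.
   Context: Everything is over a fixed field $k$, $\otimes=\otimes_k$, and Sweedler notation is used. $H$ has antipode $S$ (bijective, since $H$ is finite dimensional); $H^*$ is the dual Hopf algebra, with $(pq)(h)=\sum p(h_1)q(h_2)$ and $\sum p_1(h)p_2(h')=p(hh')$. $H^{op}$ and $H^{*op}$ denote opposite algebras (with $H^{op}$ having the same comultiplication as $H$). Regular actions of $H$ on $H^*$: $(h\rightharpoonup f)(h')=f(h'h)$ and $(f\leftharpoonup h')(h)=f(h'h)$. Two-sided crossed product: if $K$ is a Hopf algebra, $A$ a left $K$-module algebra and $B$ a right $K$-module algebra, then $A\# K\# B$ is the algebra with underlying space $A\otimes K\otimes B$, unit $1\#1\#1$ and multiplication $(a\# x\# b)(a'\# x'\# b')=\sum a(x_1\cdot a')\# x_2x'_1\# (b\cdot x'_2)b'$. $Y=H^*\# (H\otimes H^{op})\# H^{*op}$ is the two-sided crossed product with $K=H\otimes H^{op}$, where $A=H^*$ is a left $K$-module algebra by $(h\otimes h')\cdot f=h\rightharpoonup f\leftharpoonup h'$ and $B=H^{*op}$ is a right $K$-module algebra by $f\cdot(h\otimes h')=S(h)\rightharpoonup f\leftharpoonup S^{-1}(h')$. Explicitly its multiplication is $$(p\# (h\otimes g)\# q)(p'\#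 (h'\otimes g')\# q')=\sum p(h_1\rightharpoonup p'\leftharpoonup g_1)\# (h_2h'_1\otimes g'_1g_2)\# q'(S(h'_2)\rightharpoonup q\leftharpoonup S^{-1}(g'_2)),$$ with products in the last two positions ($g'_1g_2$ and $q'(\cdots)$) taken in $H$ and $H^*$ (not in $H^{op}$, $H^{*op}$). A Hopf bimodule over $H^*$ is a vector space $M$ that is an $H^*$-bimodule (actions $p\cdot m$, $m\cdot q$) and an $H^*$-bicomodule, with coaction $M\to H^*\otimes M\otimes H^*$, $m\mapsto\sum m_{(-1)}\otimes m_{(0)}\otimes m_{(1)}$, such that the left and right coactions are $H^*$-bimodule maps, i.e. $\sum (p\cdot m\cdot q)_{(-1)}\otimes (p\cdot m\cdot q)_{(0)}\otimes (p\cdot m\cdot q)_{(1)}=\sum p_1m_{(-1)}q_1\otimes p_2\cdot m_{(0)}\cdot q_2\otimes p_3m_{(1)}q_3$. Morphisms are linear maps that are both bimodule and bicomodule maps. "Natural" isomorphism of categories refers to an isomorphism compatible with the forgetful functors to vector spaces (the underlying vector spaces and linear maps are unchanged). *)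

theory Defs
  imports "Jordan_Normal_Form.VS_Connect"
begin

hide_const (open) Modules.module_hom

text \<open>
  The base field is a type \<open>'k\<close> of class \<open>field\<close>, viewed as the ring record \<open>class_ring\<close>; a vector
  space is a record \<open>V\<close> with \<open>vectorspace class_ring V\<close>. For a plain vector space the fields \<open>mult\<close>
  and \<open>one\<close> of the record type \<open>module\<close> carry no meaning; for an algebra they are its
  multiplication and unit.
\<close>

section \<open>Multilinear algebra\<close>

definition base_space :: "('k::field, 'k) module" where
  "base_space = \<lparr>carrier = UNIV, mult = (*), one = 1, zero = 0, add = (+), smult = (*)\<rparr>"

definition bilinear_maps ::
  "('k::field, 'a, 'x) module_scheme \<Rightarrow> ('k, 'b, 'y) module_scheme \<Rightarrow> ('k, 'c, 'z) module_scheme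
    \<Rightarrow> ('a \<Rightarrow> 'b \<Rightarrow> 'c) set" where
  "bilinear_maps V W U =
    {f. (\<forall>v\<in>carrier V. f v \<in> module_hom class_ring W U) \<and>
        (\<forall>w\<in>carrier W. (\<lambda>v. f v w) \<in> module_hom class_ring V U)}"

abbreviation bilinear_forms ::
  "('k::field, 'a, 'x) module_scheme \<Rightarrow> ('k, 'b, 'y) module_scheme \<Rightarrow> ('a \<Rightarrow> 'b \<Rightarrow> 'k) set" where
  "bilinear_forms V W \<equiv> bilinear_maps V W base_space"

text \<open>
  Over a field, two formal sums of pairs in \<open>V \<times> W\<close> represent the same element of the tensor product
  iff every bilinear form takes the same value on them. So the tensor product of \<open>V\<close> and \<open>W\<close> is
  modelled inside the dual space of the space of bilinear forms: a finite sum of pure tensors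
  \<open>v\<^sub>i \<otimes> w\<^sub>i\<close> is the functional sending a bilinear form \<open>B\<close> to the sum of the \<open>B v\<^sub>i w\<^sub>i\<close>.
\<close>

type_synonym ('k, 'a, 'b) tensor = "('a \<Rightarrow> 'b \<Rightarrow> 'k) \<Rightarrow> 'k"

definition tensor_of ::
  "('k::field, 'a, 'x) module_scheme \<Rightarrow> ('k, 'b, 'y) module_scheme \<Rightarrow> ('a \<times> 'b) list
    \<Rightarrow> ('k, 'a, 'b) tensor" where
  "tensor_of V W xs = (\<lambda>B\<in>bilinear_forms V W. \<Sum>(v, w)\<leftarrow>xs. B v w)"

abbreviation pure_tensor ::
  "('k::field, 'a, 'x) module_scheme \<Rightarrow> ('k, 'b, 'y) module_scheme \<Rightarrow> 'a \<Rightarrow> 'b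
    \<Rightarrow> ('k, 'a, 'b) tensor" where
  "pure_tensor V W v w \<equiv> tensor_of V W [(v, w)]"

definition tensor_space ::
  "('k::field, 'a, 'x) module_scheme \<Rightarrow> ('k, 'b, 'y) module_scheme
    \<Rightarrow> ('k, ('k, 'a, 'b) tensor) module" where
  "tensor_space V W =
    \<lparr>carrier = tensor_of V W ` lists (carrier V \<times> carrier W),
     mult = undefined, one = undefined,
     zero = (\<lambda>B\<in>bilinear_forms V W. 0),
     add = (\<lambda>s t. \<lambda>B\<in>bilinear_forms V W. s B + t B),
     smult = (\<lambda>c t. \<lambda>B\<in>bilinear_forms V W. c * t B)\<rparr>"

text \<open>
  \<open>sweedler V W U f t\<close> is the sum of the \<open>f v\<^sub>i w\<^sub>i\<close> in \<open>U\<close>, for any expression of \<open>t\<close> as a sum of pure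
  tensors \<open>v\<^sub>i \<otimes> w\<^sub>i\<close>. It does not depend on the expression when \<open>f\<close> is bilinear, and is only used
  in that case.
\<close>

definition sweedler ::
  "('k::field, 'a, 'x) module_scheme \<Rightarrow> ('k, 'b, 'y) module_scheme \<Rightarrow> ('k, 'c, 'z) module_scheme
    \<Rightarrow> ('a \<Rightarrow> 'b \<Rightarrow> 'c) \<Rightarrow> ('k, 'a, 'b) tensor \<Rightarrow> 'c" where
  "sweedler V W U f t =
    foldr (\<lambda>(v, w) u. f v w \<oplus>\<^bsub>U\<^esub> u)
      (SOME xs. xs \<in> lists (carrier V \<times> carrier W) \<and> tensor_of V W xs = t) \<zero>\<^bsub>U\<^esub>"

definition tensor_map where
  "tensor_map V W V' W' f g =
    sweedler V W (tensor_space V' W') (\<lambda>v w. pure_tensor V' W' (f v) (g w))"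

text \<open>Threefold tensor products are bracketed to the right.\<close>

abbreviation tensor_space3 where
  "tensor_space3 V W X \<equiv> tensor_space V (tensor_space W X)"

abbreviation pure_tensor3 where
  "pure_tensor3 V W X v w x \<equiv> pure_tensor V (tensor_space W X) v (pure_tensor W X w x)"

definition sweedler3 where
  "sweedler3 V W X U f =
    sweedler V (tensor_space W X) U (\<lambda>v s. sweedler W X U (\<lambda>w x. f v w x) s)"


section \<open>Algebras and Hopf algebras\<close>

text \<open>The locale \<open>algebra\<close> of HOL-Algebra is restricted to commutative algebras.\<close>

locale k_algebra = ring A + vectorspace class_ring A
  for A :: "('k::field, 'a, 'x) module_scheme" (structure) +
  assumes smult_mult_left: "\<lbrakk>x \<in> carrier A; y \<in> carrier A\<rbrakk> \<Longrightarrow> (c \<odot> x) \<otimes> y = c \<odot> (x \<otimes> y)"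
    and smult_mult_right: "\<lbrakk>x \<in> carrier A; y \<in> carrier A\<rbrakk> \<Longrightarrow> x \<otimes> (c \<odot> y) = c \<odot> (x \<otimes> y)"

definition opp :: "('k::field, 'a, 'x) module_scheme \<Rightarrow> ('k, 'a, 'x) module_scheme" where
  "opp A = A\<lparr>mult := \<lambda>x y. y \<otimes>\<^bsub>A\<^esub> x\<rparr>"

definition tensor_algebra ::
  "('k::field, 'a, 'x) module_scheme \<Rightarrow> ('k, 'b, 'y) module_scheme
    \<Rightarrow> ('k, ('k, 'a, 'b) tensor) module" where
  "tensor_algebra A B = (tensor_space A B)
    \<lparr>mult := \<lambda>s t.
       sweedler A B (tensor_space A B) (\<lambda>a b.
         sweedler A B (tensor_space A B) (\<lambda>a' b'.
           pure_tensor A B (a \<otimes>\<^bsub>A\<^esub> a') (b \<otimes>\<^bsub>B\<^esub> b')) t) s,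
     one := pure_tensor A B \<one>\<^bsub>A\<^esub> \<one>\<^bsub>B\<^esub>\<rparr>"

record ('k, 'a) hopf = "('k, 'a) module" +
  comult :: "'a \<Rightarrow> ('k, 'a, 'a) tensor"
  counit :: "'a \<Rightarrow> 'k"
  antipode :: "'a \<Rightarrow> 'a"

text \<open>\<open>comult3 C c\<close> is \<open>\<Sum> c\<^sub>1 \<otimes> (c\<^sub>2 \<otimes> c\<^sub>3)\<close>.\<close>

definition comult3 ::
  "('k::field, 'a, 'x) hopf_scheme \<Rightarrow> 'a \<Rightarrow> ('k, 'a, ('k, 'a, 'a) tensor) tensor" where
  "comult3 C c = sweedler C C (tensor_space3 C C C)
    (\<lambda>a b. pure_tensor C (tensor_space C C) a (comult C b)) (comult C c)"

locale coalgebra = vectorspace class_ring C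
  for C :: "('k::field, 'a, 'x) hopf_scheme" (structure) +
  assumes comult_linear: "comult C \<in> module_hom class_ring C (tensor_space C C)"
    and counit_linear: "counit C \<in> module_hom class_ring C base_space"
    and coassoc: "c \<in> carrier C \<Longrightarrow>
      sweedler C C (tensor_space3 C C C)
        (\<lambda>a b. sweedler C C (tensor_space3 C C C)
          (\<lambda>a\<^sub>1 a\<^sub>2. pure_tensor3 C C C a\<^sub>1 a\<^sub>2 b) (comult C a)) (comult C c)
      = comult3 C c"
    and counit_left: "c \<in> carrier C \<Longrightarrow> sweedler C C C (\<lambda>a b. counit C a \<odot> b) (comult C c) = c"
    and counit_right: "c \<in> carrier C \<Longrightarrow> sweedler C C C (\<lambda>a b. counit C b \<odot> a) (comult C c) = c"

locale hopf_algebra = k_algebra H + coalgebra H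
  for H :: "('k::field, 'a, 'x) hopf_scheme" (structure) +
  assumes comult_mult: "\<lbrakk>x \<in> carrier H; y \<in> carrier H\<rbrakk> \<Longrightarrow>
      comult H (x \<otimes> y) = comult H x \<otimes>\<^bsub>tensor_algebra H H\<^esub> comult H y"
    and comult_one: "comult H \<one> = \<one>\<^bsub>tensor_algebra H H\<^esub>"
    and counit_mult: "\<lbrakk>x \<in> carrier H; y \<in> carrier H\<rbrakk> \<Longrightarrow>
      counit H (x \<otimes> y) = counit H x * counit H y"
    and counit_one: "counit H \<one> = 1"
    and antipode_linear: "antipode H \<in> module_hom class_ring H H"
    and antipode_left: "x \<in> carrier H \<Longrightarrow>
      sweedler H H H (\<lambda>a b. antipode H a \<otimes> b) (comult H x) = counit H x \<odot> \<one>"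
    and antipode_right: "x \<in> carrier H \<Longrightarrow>
      sweedler H H H (\<lambda>a b. a \<otimes> antipode H b) (comult H x) = counit H x \<odot> \<one>"

text \<open>The inverse of the antipode; meaningful when the antipode is bijective.\<close>

definition antipode_inv :: "('k::field, 'a, 'x) hopf_scheme \<Rightarrow> 'a \<Rightarrow> 'a" where
  "antipode_inv H = inv_into (carrier H) (antipode H)"

definition hopf_opp :: "('k::field, 'a, 'x) hopf_scheme \<Rightarrow> ('k, 'a, 'x) hopf_scheme" where
  "hopf_opp H = (opp H)\<lparr>antipode := antipode_inv H\<rparr>"

definition hopf_tensor ::
  "('k::field, 'a, 'x) hopf_scheme \<Rightarrow> ('k, 'b, 'y) hopf_scheme
    \<Rightarrow> ('k, ('k, 'a, 'b) tensor) hopf" where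
  "hopf_tensor H K =
    (let T = tensor_algebra H K in
     module.extend T (hopf.fields
      (sweedler H K (tensor_space T T) (\<lambda>h g.
         sweedler H H (tensor_space T T) (\<lambda>h\<^sub>1 h\<^sub>2.
           sweedler K K (tensor_space T T) (\<lambda>g\<^sub>1 g\<^sub>2.
             pure_tensor T T (pure_tensor H K h\<^sub>1 g\<^sub>1) (pure_tensor H K h\<^sub>2 g\<^sub>2))
           (comult K g)) (comult H h)))
      (sweedler H K base_space (\<lambda>h g. counit H h * counit K g))
      (tensor_map H K H K (antipode H) (antipode K))))"

text \<open>
  The dual of a finite dimensional Hopf algebra. Its elements are linear forms on \<open>carrier H\<close>, taken
  to be \<open>undefined\<close> outside \<open>carrier H\<close> so that equality of elements is equality as forms.
\<close>

definition dual_space :: "('k::field, 'a, 'x) module_scheme \<Rightarrow> ('k, 'a \<Rightarrow> 'k) module" where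
  "dual_space V =
    \<lparr>carrier = module_hom class_ring V base_space \<inter> extensional (carrier V),
     mult = undefined, one = undefined,
     zero = (\<lambda>v\<in>carrier V. 0),
     add = (\<lambda>p q. \<lambda>v\<in>carrier V. p v + q v),
     smult = (\<lambda>c p. \<lambda>v\<in>carrier V. c * p v)\<rparr>"

definition dual_comult ::
  "('k::field, 'a, 'x) hopf_scheme \<Rightarrow> ('a \<Rightarrow> 'k) \<Rightarrow> ('k, 'a \<Rightarrow> 'k, 'a \<Rightarrow> 'k) tensor" where
  "dual_comult H p =
    (THE t. t \<in> carrier (tensor_space (dual_space H) (dual_space H)) \<and>
      (\<forall>h\<in>carrier H. \<forall>h'\<in>carrier H.
        sweedler (dual_space H) (dual_space H) base_space (\<lambda>p\<^sub>1 p\<^sub>2. p\<^sub>1 h * p\<^sub>2 h') t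
        = p (h \<otimes>\<^bsub>H\<^esub> h')))"

definition dual_hopf :: "('k::field, 'a, 'x) hopf_scheme \<Rightarrow> ('k, 'a \<Rightarrow> 'k) hopf" where
  "dual_hopf H =
    module.extend
      ((dual_space H)
        \<lparr>mult := \<lambda>p q. \<lambda>h\<in>carrier H.
            sweedler H H base_space (\<lambda>h\<^sub>1 h\<^sub>2. p h\<^sub>1 * q h\<^sub>2) (comult H h),
         one := restrict (counit H) (carrier H)\<rparr>)
      (hopf.fields
        (dual_comult H)
        (\<lambda>p. p \<one>\<^bsub>H\<^esub>)
        (\<lambda>p. \<lambda>h\<in>carrier H. p (antipode H h)))"


section \<open>The two-sided crossed product\<close>

text \<open>
  \<open>la\<close> is the left action of \<open>K\<close> on the module algebra \<open>A\<close> and \<open>rb\<close> the right action of \<open>K\<close> on the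
  module algebra \<open>B\<close>.
\<close>

definition two_sided_crossed_product ::
  "('k::field, 'a, 'x) module_scheme \<Rightarrow> ('k, 'c, 'y) hopf_scheme \<Rightarrow> ('k, 'b, 'z) module_scheme
    \<Rightarrow> ('c \<Rightarrow> 'a \<Rightarrow> 'a) \<Rightarrow> ('b \<Rightarrow> 'c \<Rightarrow> 'b)
    \<Rightarrow> ('k, ('k, 'a, ('k, 'c, 'b) tensor) tensor) module" where
  "two_sided_crossed_product A K B la rb =
    (let T = tensor_space3 A K B in
     T\<lparr>mult := \<lambda>s t.
         sweedler3 A K B T (\<lambda>a x b.
           sweedler3 A K B T (\<lambda>a' x' b'.
             sweedler K K T (\<lambda>x\<^sub>1 x\<^sub>2.
               sweedler K K T (\<lambda>x'\<^sub>1 x'\<^sub>2.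
                 pure_tensor3 A K B (a \<otimes>\<^bsub>A\<^esub> la x\<^sub>1 a') (x\<^sub>2 \<otimes>\<^bsub>K\<^esub> x'\<^sub>1) (rb b x'\<^sub>2 \<otimes>\<^bsub>B\<^esub> b'))
               (comult K x')) (comult K x)) t) s,
       one := pure_tensor3 A K B \<one>\<^bsub>A\<^esub> \<one>\<^bsub>K\<^esub> \<one>\<^bsub>B\<^esub>\<rparr>)"

text \<open>
  The regular actions of \<open>H\<close> on its dual: \<open>left_regular H h f\<close> maps \<open>x\<close> to \<open>f (x h)\<close>, and
  \<open>right_regular H f h\<close> maps \<open>x\<close> to \<open>f (h x)\<close>.
\<close>

definition left_regular ::
  "('k::field, 'a, 'x) hopf_scheme \<Rightarrow> 'a \<Rightarrow> ('a \<Rightarrow> 'k) \<Rightarrow> 'a \<Rightarrow> 'k" where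
  "left_regular H h f = (\<lambda>x\<in>carrier H. f (x \<otimes>\<^bsub>H\<^esub> h))"

definition right_regular ::
  "('k::field, 'a, 'x) hopf_scheme \<Rightarrow> ('a \<Rightarrow> 'k) \<Rightarrow> 'a \<Rightarrow> 'a \<Rightarrow> 'k" where
  "right_regular H f h = (\<lambda>x\<in>carrier H. f (h \<otimes>\<^bsub>H\<^esub> x))"

type_synonym ('k, 'h) Y_carrier =
  "('k, 'h \<Rightarrow> 'k, ('k, ('k, 'h, 'h) tensor, 'h \<Rightarrow> 'k) tensor) tensor"

definition Y_algebra :: "('k::field, 'h, 'x) hopf_scheme \<Rightarrow> ('k, ('k, 'h) Y_carrier) module" where
  "Y_algebra H =
    two_sided_crossed_product
      (dual_hopf H) (hopf_tensor H (hopf_opp H)) (opp (dual_hopf H))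
      (\<lambda>u f. sweedler H (hopf_opp H) (dual_hopf H)
        (\<lambda>h h'. right_regular H (left_regular H h f) h') u)
      (\<lambda>f u. sweedler H (hopf_opp H) (dual_hopf H)
        (\<lambda>h h'. right_regular H (left_regular H (antipode H h) f) (antipode_inv H h')) u)"


section \<open>Categories\<close>

record ('o, 'a) category =
  Ob :: "'o set"
  Hom :: "'o \<Rightarrow> 'o \<Rightarrow> 'a set"
  Id :: "'o \<Rightarrow> 'a"
  Comp :: "'o \<Rightarrow> 'o \<Rightarrow> 'o \<Rightarrow> 'a \<Rightarrow> 'a \<Rightarrow> 'a"
    \<comment> \<open>\<open>Comp C X Y Z g f\<close> is \<open>g\<close> after \<open>f\<close>, for \<open>f \<in> Hom C X Y\<close> and \<open>g \<in> Hom C Y Z\<close>\<close>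

locale category =
  fixes C :: "('o, 'a) category"
  assumes Id_in_Hom: "X \<in> Ob C \<Longrightarrow> Id C X \<in> Hom C X X"
    and Comp_in_Hom:
      "\<lbrakk>X \<in> Ob C; Y \<in> Ob C; Z \<in> Ob C; f \<in> Hom C X Y; g \<in> Hom C Y Z\<rbrakk>
        \<Longrightarrow> Comp C X Y Z g f \<in> Hom C X Z"
    and Comp_Id_right: "\<lbrakk>X \<in> Ob C; Y \<in> Ob C; f \<in> Hom C X Y\<rbrakk> \<Longrightarrow> Comp C X X Y f (Id C X) = f"
    and Comp_Id_left: "\<lbrakk>X \<in> Ob C; Y \<in> Ob C; f \<in> Hom C X Y\<rbrakk> \<Longrightarrow> Comp C X Y Y (Id C Y) f = f"
    and Comp_assoc:
      "\<lbrakk>X \<in> Ob C; Y \<in> Ob C; Z \<in> Ob C; W \<in> Ob C;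
        f \<in> Hom C X Y; g \<in> Hom C Y Z; h \<in> Hom C Z W\<rbrakk>
        \<Longrightarrow> Comp C X Y W (Comp C Y Z W h g) f = Comp C X Z W h (Comp C X Y Z g f)"

record ('o, 'a, 'p, 'b) cat_functor =
  on_ob :: "'o \<Rightarrow> 'p"
  on_hom :: "'o \<Rightarrow> 'o \<Rightarrow> 'a \<Rightarrow> 'b"

locale cat_functor = C: category C + D: category D
  for C :: "('o, 'a) category" and D :: "('p, 'b) category" +
  fixes F :: "('o, 'a, 'p, 'b) cat_functor"
  assumes on_ob_Ob: "X \<in> Ob C \<Longrightarrow> on_ob F X \<in> Ob D"
    and on_hom_Hom:
      "\<lbrakk>X \<in> Ob C; Y \<in> Ob C; f \<in> Hom C X Y\<rbrakk>
        \<Longrightarrow> on_hom F X Y f \<in> Hom D (on_ob F X) (on_ob F Y)"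
    and on_hom_Id: "X \<in> Ob C \<Longrightarrow> on_hom F X X (Id C X) = Id D (on_ob F X)"
    and on_hom_Comp:
      "\<lbrakk>X \<in> Ob C; Y \<in> Ob C; Z \<in> Ob C; f \<in> Hom C X Y; g \<in> Hom C Y Z\<rbrakk>
        \<Longrightarrow> on_hom F X Z (Comp C X Y Z g f)
          = Comp D (on_ob F X) (on_ob F Y) (on_ob F Z) (on_hom F Y Z g) (on_hom F X Y f)"

definition id_functor :: "('o, 'a, 'o, 'a) cat_functor" where
  "id_functor = \<lparr>on_ob = (\<lambda>X. X), on_hom = (\<lambda>X Y f. f)\<rparr>"

definition comp_functor ::
  "('p, 'b, 'q, 'c) cat_functor \<Rightarrow> ('o, 'a, 'p, 'b) cat_functor \<Rightarrow> ('o, 'a, 'q, 'c) cat_functor"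
  where
  "comp_functor G F =
    \<lparr>on_ob = (\<lambda>X. on_ob G (on_ob F X)),
     on_hom = (\<lambda>X Y f. on_hom G (on_ob F X) (on_ob F Y) (on_hom F X Y f))\<rparr>"

text \<open>Equality of functors with domain \<open>C\<close>, disregarding values outside \<open>C\<close>.\<close>

definition functor_eq ::
  "('o, 'a) category \<Rightarrow> ('o, 'a, 'p, 'b) cat_functor \<Rightarrow> ('o, 'a, 'p, 'b) cat_functor \<Rightarrow> bool" where
  "functor_eq C F G \<longleftrightarrow>
    (\<forall>X\<in>Ob C. on_ob F X = on_ob G X) \<and>
    (\<forall>X\<in>Ob C. \<forall>Y\<in>Ob C. \<forall>f\<in>Hom C X Y. on_hom F X Y f = on_hom G X Y f)"

definition category_iso ::
  "('o, 'a) category \<Rightarrow> ('p, 'b) category \<Rightarrow> ('o, 'a, 'p, 'b) cat_functor \<Rightarrow> bool" where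
  "category_iso C D F \<longleftrightarrow> cat_functor C D F \<and>
    (\<exists>G. cat_functor D C G \<and>
      functor_eq C (comp_functor G F) id_functor \<and> functor_eq D (comp_functor F G) id_functor)"

text \<open>
  Objects of the categories below are records extending \<open>module\<close> whose carrier is an arbitrary
  subset of a type \<open>'m\<close>, which plays the role of the universe. Structure maps and morphisms are
  \<open>undefined\<close> outside the relevant carriers (hence \<open>\<rightarrow>\<^sub>E\<close> and \<open>extensional\<close>), so that equality of
  objects and of morphisms is the mathematical one. The forgetful functor to vector spaces keeps the
  \<open>module\<close> part of the record (including its unused fields \<open>mult\<close> and \<open>one\<close>) and leaves morphisms
  unchanged.
\<close>

definition forgetful ::
  "(('k, 'm, 'x) module_scheme, 'm \<Rightarrow> 'm, ('k, 'm) module, 'm \<Rightarrow> 'm) cat_functor" where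
  "forgetful = \<lparr>on_ob = module.truncate, on_hom = (\<lambda>M N f. f)\<rparr>"

definition linear_maps ::
  "('k::field, 'm, 'x) module_scheme \<Rightarrow> ('k, 'n, 'y) module_scheme \<Rightarrow> ('m \<Rightarrow> 'n) set" where
  "linear_maps M N = module_hom class_ring M N \<inter> extensional (carrier M)"


section \<open>Left modules over an algebra\<close>

record ('k, 'y, 'm) left_module = "('k, 'm) module" +
  act :: "'y \<Rightarrow> 'm \<Rightarrow> 'm"

locale left_module = vectorspace class_ring M
  for Y :: "('k::field, 'y, 'x) module_scheme" and M :: "('k, 'y, 'm) left_module" +
  assumes act_funcset: "act M \<in> carrier Y \<rightarrow>\<^sub>E carrier M \<rightarrow>\<^sub>E carrier M"
    and act_bilinear: "act M \<in> bilinear_maps Y M M"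
    and act_one: "m \<in> carrier M \<Longrightarrow> act M \<one>\<^bsub>Y\<^esub> m = m"
    and act_mult: "\<lbrakk>y \<in> carrier Y; z \<in> carrier Y; m \<in> carrier M\<rbrakk> \<Longrightarrow>
      act M (y \<otimes>\<^bsub>Y\<^esub> z) m = act M y (act M z m)"

definition left_module_category ::
  "('k::field, 'y, 'x) module_scheme \<Rightarrow> (('k, 'y, 'm) left_module, 'm \<Rightarrow> 'm) category" where
  "left_module_category Y =
    \<lparr>Ob = {M. left_module Y M},
     Hom = (\<lambda>M N. {f \<in> linear_maps M N.
        \<forall>y\<in>carrier Y. \<forall>m\<in>carrier M. f (act M y m) = act N y (f m)}),
     Id = (\<lambda>M. \<lambda>m\<in>carrier M. m),
     Comp = (\<lambda>L M N g f. compose (carrier L) g f)\<rparr>"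


section \<open>Hopf bimodules\<close>

record ('k, 'p, 'm) hopf_bimodule = "('k, 'm) module" +
  lact :: "'p \<Rightarrow> 'm \<Rightarrow> 'm"
  ract :: "'m \<Rightarrow> 'p \<Rightarrow> 'm"
  lcoact :: "'m \<Rightarrow> ('k, 'p, 'm) tensor"
  rcoact :: "'m \<Rightarrow> ('k, 'm, 'p) tensor"

locale bimodule = vectorspace class_ring M
  for P :: "('k::field, 'p, 'x) module_scheme" and M :: "('k, 'p, 'm) hopf_bimodule" +
  assumes lact_funcset: "lact M \<in> carrier P \<rightarrow>\<^sub>E carrier M \<rightarrow>\<^sub>E carrier M"
    and lact_bilinear: "lact M \<in> bilinear_maps P M M"
    and lact_one: "m \<in> carrier M \<Longrightarrow> lact M \<one>\<^bsub>P\<^esub> m = m"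
    and lact_mult: "\<lbrakk>p \<in> carrier P; q \<in> carrier P; m \<in> carrier M\<rbrakk> \<Longrightarrow>
      lact M (p \<otimes>\<^bsub>P\<^esub> q) m = lact M p (lact M q m)"
    and ract_funcset: "ract M \<in> carrier M \<rightarrow>\<^sub>E carrier P \<rightarrow>\<^sub>E carrier M"
    and ract_bilinear: "ract M \<in> bilinear_maps M P M"
    and ract_one: "m \<in> carrier M \<Longrightarrow> ract M m \<one>\<^bsub>P\<^esub> = m"
    and ract_mult: "\<lbrakk>p \<in> carrier P; q \<in> carrier P; m \<in> carrier M\<rbrakk> \<Longrightarrow>
      ract M m (p \<otimes>\<^bsub>P\<^esub> q) = ract M (ract M m p) q"
    and lact_ract: "\<lbrakk>p \<in> carrier P; q \<in> carrier P; m \<in> carrier M\<rbrakk> \<Longrightarrow>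
      ract M (lact M p m) q = lact M p (ract M m q)"

text \<open>
  The two-sided coaction \<open>\<Sum> m\<^sub>(\<^sub>-\<^sub>1\<^sub>) \<otimes> (m\<^sub>(\<^sub>0\<^sub>) \<otimes> m\<^sub>(\<^sub>1\<^sub>))\<close>; that it may be formed in either order is the
  assumption \<open>coact_commute\<close> below.
\<close>

definition bicoact ::
  "('k::field, 'p, 'x) hopf_scheme \<Rightarrow> ('k, 'p, 'm) hopf_bimodule
    \<Rightarrow> 'm \<Rightarrow> ('k, 'p, ('k, 'm, 'p) tensor) tensor" where
  "bicoact P M m = sweedler P M (tensor_space3 P M P)
    (\<lambda>a n. pure_tensor P (tensor_space M P) a (rcoact M n)) (lcoact M m)"

locale bicomodule = vectorspace class_ring M
  for P :: "('k::field, 'p, 'x) hopf_scheme" and M :: "('k, 'p, 'm) hopf_bimodule" +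
  assumes lcoact_linear: "lcoact M \<in> linear_maps M (tensor_space P M)"
    and lcoact_coassoc: "m \<in> carrier M \<Longrightarrow>
      sweedler P M (tensor_space3 P P M)
        (\<lambda>a n. sweedler P P (tensor_space3 P P M)
          (\<lambda>a\<^sub>1 a\<^sub>2. pure_tensor3 P P M a\<^sub>1 a\<^sub>2 n) (comult P a)) (lcoact M m)
      = sweedler P M (tensor_space3 P P M)
        (\<lambda>a n. pure_tensor P (tensor_space P M) a (lcoact M n)) (lcoact M m)"
    and lcoact_counit: "m \<in> carrier M \<Longrightarrow>
      sweedler P M M (\<lambda>a n. counit P a \<odot>\<^bsub>M\<^esub> n) (lcoact M m) = m"
    and rcoact_linear: "rcoact M \<in> linear_maps M (tensor_space M P)"
    and rcoact_coassoc: "m \<in> carrier M \<Longrightarrow>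
      sweedler M P (tensor_space3 M P P)
        (\<lambda>n a. sweedler M P (tensor_space3 M P P)
          (\<lambda>n' b. pure_tensor3 M P P n' b a) (rcoact M n)) (rcoact M m)
      = sweedler M P (tensor_space3 M P P)
        (\<lambda>n a. pure_tensor M (tensor_space P P) n (comult P a)) (rcoact M m)"
    and rcoact_counit: "m \<in> carrier M \<Longrightarrow>
      sweedler M P M (\<lambda>n a. counit P a \<odot>\<^bsub>M\<^esub> n) (rcoact M m) = m"
    and coact_commute: "m \<in> carrier M \<Longrightarrow>
      sweedler M P (tensor_space3 P M P)
        (\<lambda>n b. sweedler P M (tensor_space3 P M P)
          (\<lambda>a n'. pure_tensor3 P M P a n' b) (lcoact M n)) (rcoact M m)
      = bicoact P M m"

locale hopf_bimodule = bimodule P M + bicomodule P M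
  for P :: "('k::field, 'p, 'x) hopf_scheme" and M :: "('k, 'p, 'm) hopf_bimodule" +
  assumes bicoact_act: "\<lbrakk>p \<in> carrier P; q \<in> carrier P; m \<in> carrier M\<rbrakk> \<Longrightarrow>
    bicoact P M (ract M (lact M p m) q) =
      sweedler3 P P P (tensor_space3 P M P) (\<lambda>p\<^sub>1 p\<^sub>2 p\<^sub>3.
        sweedler3 P M P (tensor_space3 P M P) (\<lambda>a n b.
          sweedler3 P P P (tensor_space3 P M P) (\<lambda>q\<^sub>1 q\<^sub>2 q\<^sub>3.
            pure_tensor3 P M P
              (p\<^sub>1 \<otimes>\<^bsub>P\<^esub> a \<otimes>\<^bsub>P\<^esub> q\<^sub>1) (ract M (lact M p\<^sub>2 n) q\<^sub>2) (p\<^sub>3 \<otimes>\<^bsub>P\<^esub> b \<otimes>\<^bsub>P\<^esub> q\<^sub>3))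
          (comult3 P q)) (bicoact P M m)) (comult3 P p)"

definition hopf_bimodule_category ::
  "('k::field, 'p, 'x) hopf_scheme \<Rightarrow> (('k, 'p, 'm) hopf_bimodule, 'm \<Rightarrow> 'm) category" where
  "hopf_bimodule_category P =
    \<lparr>Ob = {M. hopf_bimodule P M},
     Hom = (\<lambda>M N. {f \<in> linear_maps M N.
        \<forall>m\<in>carrier M.
          (\<forall>p\<in>carrier P. f (lact M p m) = lact N p (f m) \<and> f (ract M m p) = ract N (f m) p) \<and>
          lcoact N (f m) = tensor_map P M P N (\<lambda>p. p) f (lcoact M m) \<and>
          rcoact N (f m) = tensor_map M P N P f (\<lambda>p. p) (rcoact M m)}),
     Id = (\<lambda>M. \<lambda>m\<in>carrier M. m),
     Comp = (\<lambda>L M N g f. compose (carrier L) g f)\<rparr>"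

end

theory Submission
  imports Defs
begin

text \<open>
  Both a Hopf bimodule over \<open>H\<^sup>*\<close> and a \<open>Y\<close>-module structure on \<open>M\<close> amount to an \<open>H\<^sup>*\<close>-bimodule structure
  together with an \<open>H\<close>-bimodule structure \<open>h m g\<close> such that
  \<open>h (p m) g = \<Sum> (h\<^sub>1 \<rightharpoonup> p \<leftharpoonup> g\<^sub>1) (h\<^sub>2 m g\<^sub>2)\<close> and \<open>h (m q) g = \<Sum> (h\<^sub>1 m g\<^sub>1) (h\<^sub>2 \<rightharpoonup> q \<leftharpoonup> g\<^sub>2)\<close>.

  As \<open>H\<close> is finite dimensional, a right (left) \<open>H\<^sup>*\<close>-coaction is the same as a left (right) action of
  \<open>H\<close>: the action evaluates the coaction at elements of \<open>H\<close>, and the coaction is recovered from the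
  action by means of dual bases. Evaluating the Hopf bimodule condition at \<open>g\<close> and \<open>h\<close> gives the two
  relations. On the other side, \<open>p # (h \<otimes> g) # q\<close> acts by \<open>m \<mapsto> p (h (m q) g)\<close>. The relations of \<open>Y\<close> are
  the first relation and the second one solved for \<open>(h m g) q\<close>, which needs \<open>S\<close> and \<open>S\<^sup>-\<^sup>1\<close>. That \<open>S\<close> is
  bijective follows, as for Larson and Sweedler, from a nonzero integral \<open>L\<close> in \<open>H\<^sup>*\<close>: if \<open>S h = 0\<close>,
  then its invariance gives \<open>L(y) h = 0\<close> for all \<open>y\<close>.
\<close>

section \<open>Linear and bilinear maps\<close>

text \<open>Every sum below, over Sweedler components or over dual bases, is one operation:
  \<open>sweedler\<close> contracts a tensor with a bilinear map. Dual bases enter only through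
  their sum \<open>canon\<close>, so that both kinds of sum can be interchanged and pushed through
  linear maps by the same rules; the price is a check of multilinearity at each step. The objects
  \<open>M\<close> may have infinite dimension. Hence bases are used for \<open>H\<close> only, and
  tensors with a leg in \<open>M\<close> are compared by evaluating their dual legs at elements of
  \<open>H\<close>. The integral is a trace: for a form \<open>q\<close>, the value at
  \<open>x\<close> is the trace of the endomorphism of \<open>H\<close> that takes \<open>e\<close>
  to \<Sum> \<open>q(y\<^sub>2) y\<^sub>1\<close>, where \<open>y = x \<otimes> S (S e)\<close>. The
  square of \<open>S\<close> is what makes cyclicity of the trace yield invariance. Taken at
  \<open>S e\<close> for \<open>q\<close> dual to \<open>e\<close> and summed over dual bases, these
  values give 1, so some integral is nonzero. The inverse of \<open>S\<close> occurs beside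
  \<open>S\<close> because the elements \<open>g\<close> multiply in the opposite algebra, whose
  antipode it is.\<close>

abbreviation vsp :: "('k::field, 'a, 'x) module_scheme \<Rightarrow> bool" where
  "vsp V \<equiv> vectorspace class_ring V"

abbreviation lin ::
  "('k::field, 'a, 'x) module_scheme \<Rightarrow> ('k, 'b, 'y) module_scheme \<Rightarrow> ('a \<Rightarrow> 'b) \<Rightarrow> bool" where
  "lin V W f \<equiv> f \<in> module_hom class_ring V W"

abbreviation bil ::
  "('k::field, 'a, 'x) module_scheme \<Rightarrow> ('k, 'b, 'y) module_scheme \<Rightarrow> ('k, 'c, 'z) module_scheme
    \<Rightarrow> ('a \<Rightarrow> 'b \<Rightarrow> 'c) \<Rightarrow> bool" where
  "bil V W U f \<equiv> f \<in> bilinear_maps V W U"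

abbreviation scalars :: "('k::field, 'k) module" where
  "scalars \<equiv> base_space"

text \<open>Linearity in each variable is the side condition of all manipulations of Sweedler sums.
  These rules reduce it to the building blocks of an expression, one variable at a time.\<close>

named_theorems lin_intros

section \<open>Arithmetic in a vector space\<close>

context
  fixes V :: "('k::field, 'a, 'x) module_scheme" (structure)
  assumes V: "vsp V"
begin

interpretation vectorspace class_ring V by (fact V)

lemma vs_zero_closed [simp]: "\<zero> \<in> carrier V"
  and vs_add_closed [simp]: "x \<in> carrier V \<Longrightarrow> y \<in> carrier V \<Longrightarrow> x \<oplus> y \<in> carrier V"
  and vs_smult_closed [simp]: "x \<in> carrier V \<Longrightarrow> c \<odot> x \<in> carrier V"
  by (auto intro: smult_closed)

lemma vs_zero_left [simp]: "x \<in> carrier V \<Longrightarrow> \<zero> \<oplus> x = x"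
  and vs_zero_right [simp]: "x \<in> carrier V \<Longrightarrow> x \<oplus> \<zero> = x"
  by auto

lemma vs_assoc: "x \<in> carrier V \<Longrightarrow> y \<in> carrier V \<Longrightarrow> z \<in> carrier V \<Longrightarrow> x \<oplus> y \<oplus> z = x \<oplus> (y \<oplus> z)"
  and vs_comm: "x \<in> carrier V \<Longrightarrow> y \<in> carrier V \<Longrightarrow> x \<oplus> y = y \<oplus> x"
  and vs_lcomm: "x \<in> carrier V \<Longrightarrow> y \<in> carrier V \<Longrightarrow> z \<in> carrier V \<Longrightarrow> x \<oplus> (y \<oplus> z) = y \<oplus> (x \<oplus> z)"
  by (simp_all add: a_ac)

lemma vs_smult_add: "x \<in> carrier V \<Longrightarrow> y \<in> carrier V \<Longrightarrow> c \<odot> (x \<oplus> y) = c \<odot> x \<oplus> c \<odot> y"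
  using smult_r_distr[of c x y] by simp

lemma vs_add_smult: "x \<in> carrier V \<Longrightarrow> (c + d) \<odot> x = c \<odot> x \<oplus> d \<odot> x"
  using smult_l_distr[of c d x] by simp

lemma vs_smult_smult [simp]: "x \<in> carrier V \<Longrightarrow> c \<odot> (d \<odot> x) = (c * d) \<odot> x"
  using smult_assoc1[of c d x] by simp

lemma vs_one_smult [simp]: "x \<in> carrier V \<Longrightarrow> 1 \<odot> x = x"
  using smult_one[of x] by simp

lemma vs_zero_smult [simp]: "x \<in> carrier V \<Longrightarrow> 0 \<odot> x = \<zero>"
  using lmult_0[of x] by simp

lemma vs_smult_zero [simp]: "c \<odot> \<zero> = \<zero>"
  using rmult_0[of c] by simp

lemma vs_neg [simp]: "x \<in> carrier V \<Longrightarrow> x \<oplus> (- 1) \<odot> x = \<zero>"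
  using vs_add_smult[of x 1 "- 1"] by simp

lemma vs_cancel: "x \<in> carrier V \<Longrightarrow> y \<in> carrier V \<Longrightarrow> x \<oplus> (- 1) \<odot> y = \<zero> \<Longrightarrow> x = y"
  by (metis vs_assoc vs_comm vs_neg vs_smult_closed vs_zero_left vs_zero_right)

end

text \<open>Additive inverses come from the scalar action:
  \<open>(- 1) \<odot> x \<oplus> x = (- 1 + 1) \<odot> x = \<zero>\<close>.\<close>

lemma vspI:
  fixes V :: "('k::field, 'a, 'x) module_scheme" (structure)
  assumes "\<zero> \<in> carrier V"
    and "\<And>x y. x \<in> carrier V \<Longrightarrow> y \<in> carrier V \<Longrightarrow> x \<oplus> y \<in> carrier V"
    and "\<And>c x. x \<in> carrier V \<Longrightarrow> c \<odot> x \<in> carrier V"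
    and "\<And>x. x \<in> carrier V \<Longrightarrow> \<zero> \<oplus> x = x"
    and "\<And>x y z. x \<in> carrier V \<Longrightarrow> y \<in> carrier V \<Longrightarrow> z \<in> carrier V \<Longrightarrow> x \<oplus> y \<oplus> z = x \<oplus> (y \<oplus> z)"
    and "\<And>x y. x \<in> carrier V \<Longrightarrow> y \<in> carrier V \<Longrightarrow> x \<oplus> y = y \<oplus> x"
    and "\<And>c x y. x \<in> carrier V \<Longrightarrow> y \<in> carrier V \<Longrightarrow> c \<odot> (x \<oplus> y) = c \<odot> x \<oplus> c \<odot> y"
    and add_smult: "\<And>c d x. x \<in> carrier V \<Longrightarrow> (c + d) \<odot> x = c \<odot> x \<oplus> d \<odot> x"
    and "\<And>c d x. x \<in> carrier V \<Longrightarrow> c \<odot> (d \<odot> x) = (c * d) \<odot> x"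
    and "\<And>x. x \<in> carrier V \<Longrightarrow> 1 \<odot> x = x"
    and "\<And>x. x \<in> carrier V \<Longrightarrow> 0 \<odot> x = \<zero>"
  shows "vsp V"
proof -
  have "abelian_group V"
  proof (rule abelian_groupI)
    fix x assume x: "x \<in> carrier V"
    have "(- 1) \<odot> x \<oplus> x = \<zero>"
      using add_smult[OF x, of "- 1" 1] x assms(10,11) by simp
    then show "\<exists>y\<in>carrier V. y \<oplus> x = \<zero>" using x assms(3) by blast
  qed (use assms in auto)
  then have "Module.module class_ring V"
    unfolding Module.module_def module_axioms_def
    using assms class_cring.is_cring by (auto simp: class_ring_simps)
  then show ?thesis unfolding vectorspace_def using class_field by blast
qed

lemma vsp_cong:
  fixes V :: "('k::field, 'a, 'x) module_scheme" and V' :: "('k, 'a, 'y) module_scheme"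
  assumes "vsp V" and "carrier V' = carrier V" "\<zero>\<^bsub>V'\<^esub> = \<zero>\<^bsub>V\<^esub>" "add V' = add V"
    "module.smult V' = module.smult V"
  shows "vsp V'"
  by (rule vspI) (use assms(1) in \<open>simp_all add: assms(2-) vs_assoc vs_smult_add vs_add_smult,
    simp_all add: vs_comm\<close>)

lemma vsp_scalars [simp, lin_intros]: "vsp scalars"
  by (rule vspI) (auto simp: base_space_def algebra_simps)

lemma scalars_simps [simp]:
  "carrier scalars = UNIV" "add scalars = (+)" "\<zero>\<^bsub>scalars\<^esub> = 0" "module.smult scalars = (*)"
  by (simp_all add: base_space_def)

lemma lin_iff:
  "lin V W f \<longleftrightarrow> (\<forall>x\<in>carrier V. f x \<in> carrier W) \<and>
    (\<forall>x\<in>carrier V. \<forall>y\<in>carrier V. f (x \<oplus>\<^bsub>V\<^esub> y) = f x \<oplus>\<^bsub>W\<^esub> f y) \<and>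
    (\<forall>c. \<forall>x\<in>carrier V. f (c \<odot>\<^bsub>V\<^esub> x) = c \<odot>\<^bsub>W\<^esub> f x)"
  by (auto simp: LinearCombinations.module_hom_def class_ring_simps)

lemma linI:
  assumes "\<And>x. x \<in> carrier V \<Longrightarrow> f x \<in> carrier W"
    and "\<And>x y. x \<in> carrier V \<Longrightarrow> y \<in> carrier V \<Longrightarrow> f (x \<oplus>\<^bsub>V\<^esub> y) = f x \<oplus>\<^bsub>W\<^esub> f y"
    and "\<And>c x. x \<in> carrier V \<Longrightarrow> f (c \<odot>\<^bsub>V\<^esub> x) = c \<odot>\<^bsub>W\<^esub> f x"
  shows "lin V W f"
  using assms by (simp add: lin_iff)

lemma lin_closed: "lin V W f \<Longrightarrow> x \<in> carrier V \<Longrightarrow> f x \<in> carrier W"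
  and lin_add: "lin V W f \<Longrightarrow> x \<in> carrier V \<Longrightarrow> y \<in> carrier V \<Longrightarrow> f (x \<oplus>\<^bsub>V\<^esub> y) = f x \<oplus>\<^bsub>W\<^esub> f y"
  and lin_smult: "lin V W f \<Longrightarrow> x \<in> carrier V \<Longrightarrow> f (c \<odot>\<^bsub>V\<^esub> x) = c \<odot>\<^bsub>W\<^esub> f x"
  by (simp_all add: lin_iff)

lemma lin_zero: "vsp V \<Longrightarrow> vsp W \<Longrightarrow> lin V W f \<Longrightarrow> f \<zero>\<^bsub>V\<^esub> = \<zero>\<^bsub>W\<^esub>"
  by (metis lin_closed lin_smult vs_zero_closed vs_zero_smult)

lemma lin_cong: "(\<And>x. x \<in> carrier V \<Longrightarrow> f x = g x) \<Longrightarrow> vsp V \<Longrightarrow> lin V W f \<longleftrightarrow> lin V W g"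
  by (simp add: lin_iff)

lemma lin_id [lin_intros]: "lin V V (\<lambda>x. x)"
  by (simp add: lin_iff)

lemma lin_compose: "lin V W g \<Longrightarrow> lin X V f \<Longrightarrow> lin X W (\<lambda>x. g (f x))"
  by (simp add: lin_iff)

lemma lin_smult_right [lin_intros]:
  "vsp V \<Longrightarrow> lin X V f \<Longrightarrow> lin X V (\<lambda>x. c \<odot>\<^bsub>V\<^esub> f x)"
  by (simp add: lin_iff vs_smult_add mult.commute)

lemma lin_smult_left [lin_intros]:
  "vsp V \<Longrightarrow> lin X scalars f \<Longrightarrow> v \<in> carrier V \<Longrightarrow> lin X V (\<lambda>x. f x \<odot>\<^bsub>V\<^esub> v)"
  by (simp add: lin_iff vs_add_smult)

lemma lin_mult_right [lin_intros]: "lin X scalars f \<Longrightarrow> lin X scalars (\<lambda>x. c * f x)"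
  and lin_mult_left [lin_intros]: "lin X scalars f \<Longrightarrow> lin X scalars (\<lambda>x. f x * c)"
  by (simp_all add: lin_iff algebra_simps)

lemma bilI [lin_intros]:
  "(\<And>v. v \<in> carrier V \<Longrightarrow> lin W U (\<lambda>w. f v w)) \<Longrightarrow> (\<And>w. w \<in> carrier W \<Longrightarrow> lin V U (\<lambda>v. f v w))
    \<Longrightarrow> bil V W U f"
  by (simp add: bilinear_maps_def)

lemma bil_left: "bil V W U f \<Longrightarrow> w \<in> carrier W \<Longrightarrow> lin V U (\<lambda>v. f v w)"
  and bil_right: "bil V W U f \<Longrightarrow> v \<in> carrier V \<Longrightarrow> lin W U (f v)"
  by (simp_all add: bilinear_maps_def)

lemma bil_closed: "bil V W U f \<Longrightarrow> v \<in> carrier V \<Longrightarrow> w \<in> carrier W \<Longrightarrow> f v w \<in> carrier U"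
  by (meson bil_right lin_closed)

lemma bil_comp_left: "bil V W U f \<Longrightarrow> lin X V g \<Longrightarrow> w \<in> carrier W \<Longrightarrow> lin X U (\<lambda>x. f (g x) w)"
  using lin_compose[OF bil_left] by fast

lemma bil_comp_right: "bil V W U f \<Longrightarrow> lin X W g \<Longrightarrow> v \<in> carrier V \<Longrightarrow> lin X U (\<lambda>x. f v (g x))"
  using lin_compose[OF bil_right] by fast

lemma bil_lin: "bil V W U f \<Longrightarrow> lin U U' g \<Longrightarrow> bil V W U' (\<lambda>v w. g (f v w))"
  by (simp add: bilinear_maps_def lin_iff)

text \<open>Linear forms separate the points of an arbitrary vector space, by Zorn's lemma applied to the
  subspaces avoiding a given nonzero vector.\<close>

lemma exists_linear_form:
  fixes V :: "('k::field, 'a, 'x) module_scheme" (structure)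
  assumes V: "vsp V" and u: "u \<in> carrier V" "u \<noteq> \<zero>"
  shows "\<exists>f. lin V scalars f \<and> f u = 1"
proof -
  define sub where "sub S \<longleftrightarrow> S \<subseteq> carrier V \<and> \<zero> \<in> S \<and> (\<forall>x\<in>S. \<forall>y\<in>S. x \<oplus> y \<in> S) \<and> (\<forall>c. \<forall>x\<in>S. c \<odot> x \<in> S)"
    for S
  have "\<exists>N\<in>{S. sub S \<and> u \<notin> S}. \<forall>S\<in>{S. sub S \<and> u \<notin> S}. N \<subseteq> S \<longrightarrow> S = N"
  proof (rule subset_Zorn_nonempty)
    have "sub {\<zero>} \<and> u \<notin> {\<zero>}" unfolding sub_def using V u by auto
    then show "{S. sub S \<and> u \<notin> S} \<noteq> {}" by blast
  next
    fix \<C> assume ne: "\<C> \<noteq> {}" and ch: "subset.chain {S. sub S \<and> u \<notin> S} \<C>"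
    have m: "\<And>S. S \<in> \<C> \<Longrightarrow> sub S \<and> u \<notin> S" using ch by (auto simp: subset_chain_def)
    have "x \<oplus> y \<in> \<Union>\<C>" if xy: "x \<in> \<Union>\<C>" "y \<in> \<Union>\<C>" for x y
    proof -
      obtain S T where "S \<in> \<C>" "T \<in> \<C>" "x \<in> S" "y \<in> T" using xy by blast
      moreover from this ch have "S \<subseteq> T \<or> T \<subseteq> S" by (auto simp: subset_chain_def)
      ultimately show ?thesis using m unfolding sub_def by blast
    qed
    moreover have "\<Union>\<C> \<subseteq> carrier V" "u \<notin> \<Union>\<C>" "\<zero> \<in> \<Union>\<C>" "\<forall>c. \<forall>x\<in>\<Union>\<C>. c \<odot> x \<in> \<Union>\<C>"
      using m ne unfolding sub_def by blast+
    ultimately show "\<Union>\<C> \<in> {S. sub S \<and> u \<notin> S}" unfolding sub_def by simp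
  qed
  then obtain N where N: "sub N" "u \<notin> N" and max: "\<And>S. sub S \<Longrightarrow> u \<notin> S \<Longrightarrow> N \<subseteq> S \<Longrightarrow> S = N"
    by auto
  have NV: "\<And>x. x \<in> N \<Longrightarrow> x \<in> carrier V" and N0: "\<zero> \<in> N"
    and Nadd: "\<And>x y. x \<in> N \<Longrightarrow> y \<in> N \<Longrightarrow> x \<oplus> y \<in> N"
    and Nsm: "\<And>c x. x \<in> N \<Longrightarrow> c \<odot> x \<in> N" using N(1) unfolding sub_def by auto
  \<comment> \<open>\<open>N\<close> turns out to be a complement of the line through
    \<open>u\<close>. For \<open>v\<close> outside \<open>N\<close>, maximality puts
    \<open>u\<close> into the span of \<open>N\<close> and \<open>v\<close>; the coefficient of
    \<open>v\<close> is nonzero because \<open>u\<close> is not in \<open>N\<close>, so the equation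
    can be solved for \<open>v\<close>.\<close>
  have ex: "\<exists>c. \<exists>n\<in>N. v = n \<oplus> c \<odot> u" if v: "v \<in> carrier V" for v
  proof (cases "v \<in> N")
    case True
    then have "v = v \<oplus> 0 \<odot> u" using V u v by simp
    then show ?thesis using True by blast
  next
    case False
    define S where "S = {n \<oplus> c \<odot> v |n c. n \<in> N}"
    have NS: "N \<subseteq> S"
    proof
      fix n assume "n \<in> N"
      moreover from this have "n = n \<oplus> 0 \<odot> v" using V v NV by simp
      ultimately show "n \<in> S" unfolding S_def by blast
    qed
    have "\<zero> \<oplus> 1 \<odot> v \<in> S" unfolding S_def using N0 by blast
    then have "v \<in> S" using V v by simp
    then have neq: "S \<noteq> N" using False by blast
    have "sub S" unfolding sub_def
    proof (intro conjI ballI allI)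
      show "S \<subseteq> carrier V" unfolding S_def using V v NV by auto
      show "\<zero> \<in> S" using NS N0 by blast
    next
      fix x y assume "x \<in> S" "y \<in> S"
      then obtain n c n' c' where "n \<in> N" "n' \<in> N" "x = n \<oplus> c \<odot> v" "y = n' \<oplus> c' \<odot> v"
        unfolding S_def by blast
      moreover from this have "x \<oplus> y = (n \<oplus> n') \<oplus> (c + c') \<odot> v"
        using V v NV by (simp add: vs_assoc vs_lcomm vs_add_smult)
      ultimately show "x \<oplus> y \<in> S" unfolding S_def using Nadd by blast
    next
      fix c x assume "x \<in> S"
      then obtain n d where "n \<in> N" "x = n \<oplus> d \<odot> v" unfolding S_def by blast
      moreover from this have "c \<odot> x = c \<odot> n \<oplus> (c * d) \<odot> v"
        using V v NV by (simp add: vs_smult_add)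
      ultimately show "c \<odot> x \<in> S" unfolding S_def using Nsm by blast
    qed
    then have "u \<in> S" using max NS neq by blast
    then obtain n c where nc: "n \<in> N" "u = n \<oplus> c \<odot> v" unfolding S_def by blast
    have c: "c \<noteq> 0" using nc N(2) V v NV by auto
    have "(- inverse c) \<odot> n \<oplus> inverse c \<odot> u = ((- inverse c) \<odot> n \<oplus> inverse c \<odot> n) \<oplus> v"
      using nc V v NV c by (simp add: vs_smult_add vs_assoc)
    also have "\<dots> = v"
      using vs_add_smult[OF V NV[OF nc(1)], of "- inverse c" "inverse c", symmetric] V v NV[OF nc(1)] by simp
    finally show ?thesis using Nsm nc by metis
  qed
  \<comment> \<open>Different coefficients would put a nonzero multiple of \<open>u\<close>, and
    hence \<open>u\<close> itself, into \<open>N\<close>.\<close>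
  have uniq: "c = d" if "n \<in> N" "n' \<in> N" "n \<oplus> c \<odot> u = n' \<oplus> d \<odot> u" for n n' c d
  proof (rule ccontr)
    assume "c \<noteq> d"
    have "(n \<oplus> c \<odot> u) \<oplus> ((- d) \<odot> u \<oplus> (- 1) \<odot> n) = (n' \<oplus> d \<odot> u) \<oplus> ((- d) \<odot> u \<oplus> (- 1) \<odot> n)"
      using that by simp
    moreover have "(n \<oplus> c \<odot> u) \<oplus> ((- d) \<odot> u \<oplus> (- 1) \<odot> n) = (n \<oplus> (- 1) \<odot> n) \<oplus> (c \<odot> u \<oplus> (- d) \<odot> u)"
      using V u that(1,2) NV by (simp add: vs_assoc vs_lcomm vs_comm del: vs_neg)
    moreover have "c \<odot> u \<oplus> (- d) \<odot> u = (c - d) \<odot> u" using vs_add_smult[OF V u(1), of c "- d"] by simp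
    moreover have "(n' \<oplus> d \<odot> u) \<oplus> ((- d) \<odot> u \<oplus> (- 1) \<odot> n) = (n' \<oplus> (- 1) \<odot> n) \<oplus> (d \<odot> u \<oplus> (- d) \<odot> u)"
      using V u that(1,2) NV by (simp add: vs_assoc vs_lcomm vs_comm del: vs_neg)
    moreover have "d \<odot> u \<oplus> (- d) \<odot> u = \<zero>" using vs_add_smult[OF V u(1), of d "- d"] V u by simp
    ultimately have "(c - d) \<odot> u = n' \<oplus> (- 1) \<odot> n" using V u that NV by simp
    then have "(c - d) \<odot> u \<in> N" using Nadd Nsm that by simp
    then have "inverse (c - d) \<odot> ((c - d) \<odot> u) \<in> N" by (rule Nsm)
    then show False using N(2) V u \<open>c \<noteq> d\<close> by simp
  qed
  \<comment> \<open>The coordinate along \<open>u\<close> in the decomposition just found; its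
    kernel is \<open>N\<close>.\<close>
  define f where "f v = (THE c. \<exists>n\<in>N. v = n \<oplus> c \<odot> u)" for v
  have f: "f (n \<oplus> c \<odot> u) = c" if "n \<in> N" for n c
    unfolding f_def by (rule the_equality) (use that uniq in blast)+
  have "lin V scalars f"
  proof (rule linI)
    fix x y assume "x \<in> carrier V" "y \<in> carrier V"
    then obtain n c n' c' where *: "n \<in> N" "n' \<in> N" "x = n \<oplus> c \<odot> u" "y = n' \<oplus> c' \<odot> u"
      using ex by metis
    then have "x \<oplus> y = (n \<oplus> n') \<oplus> (c + c') \<odot> u"
      using V u NV by (simp add: vs_assoc vs_lcomm vs_add_smult)
    then show "f (x \<oplus> y) = f x \<oplus>\<^bsub>scalars\<^esub> f y" using * f Nadd by simp
  next
    fix c x assume "x \<in> carrier V"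
    then obtain n d where *: "n \<in> N" "x = n \<oplus> d \<odot> u" using ex by metis
    then have "c \<odot> x = c \<odot> n \<oplus> (c * d) \<odot> u" using V u NV by (simp add: vs_smult_add)
    then show "f (c \<odot> x) = c \<odot>\<^bsub>scalars\<^esub> f x" using * f Nsm by simp
  qed simp
  moreover have "f u = 1" using f[OF N0, of 1] V u by simp
  ultimately show ?thesis by blast
qed

text \<open>This is what makes the model of tensors as functionals on scalar bilinear forms
  faithful: a bilinear map into any space is known once its composites with all linear forms are
  known.\<close>

lemma linear_forms_separate:
  assumes V: "vsp V" and "x \<in> carrier V" "y \<in> carrier V"
    and eq: "\<And>f. lin V scalars f \<Longrightarrow> f x = f y"
  shows "x = y"
proof (rule ccontr)
  assume "x \<noteq> y"
  then have "x \<oplus>\<^bsub>V\<^esub> (- 1) \<odot>\<^bsub>V\<^esub> y \<noteq> \<zero>\<^bsub>V\<^esub>" using vs_cancel[OF V] assms by blast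
  then obtain f where f: "lin V scalars f" "f (x \<oplus>\<^bsub>V\<^esub> (- 1) \<odot>\<^bsub>V\<^esub> y) = 1"
    using exists_linear_form[OF V] assms by (metis vs_add_closed vs_smult_closed)
  then have "f x + (- 1) * f y = 1"
    using assms by (simp add: lin_add lin_smult)
  then show False using eq[OF f(1)] by simp
qed

section \<open>Tensor products\<close>

text \<open>\<open>sweedler\<close> without its choice of a representative. Facts are proved for
  lists by induction and carried over by \<open>sweedler_tensor_of\<close>.\<close>

definition list_sum :: "('k::field, 'c, 'z) module_scheme \<Rightarrow> ('a \<Rightarrow> 'b \<Rightarrow> 'c) \<Rightarrow> ('a \<times> 'b) list \<Rightarrow> 'c" where
  "list_sum U f xs = foldr (\<lambda>(v, w) u. f v w \<oplus>\<^bsub>U\<^esub> u) xs \<zero>\<^bsub>U\<^esub>"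

lemma list_sum_simps [simp]:
  "list_sum U f [] = \<zero>\<^bsub>U\<^esub>"
  "list_sum U f ((v, w) # xs) = f v w \<oplus>\<^bsub>U\<^esub> list_sum U f xs"
  by (simp_all add: list_sum_def)

lemma list_sum_closed:
  "vsp U \<Longrightarrow> bil V W U f \<Longrightarrow> xs \<in> lists (carrier V \<times> carrier W) \<Longrightarrow> list_sum U f xs \<in> carrier U"
  by (induction xs) (auto simp: bil_closed)

lemma list_sum_append:
  assumes U: "vsp U" and f: "bil V W U f"
    and ys: "ys \<in> lists (carrier V \<times> carrier W)" and xs: "xs \<in> lists (carrier V \<times> carrier W)"
  shows "list_sum U f (xs @ ys) = list_sum U f xs \<oplus>\<^bsub>U\<^esub> list_sum U f ys"
  using xs
proof (induction xs)
  case (Cons x xs)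
  obtain v w where x: "x = (v, w)" "v \<in> carrier V" "w \<in> carrier W" using Cons by auto
  show ?case
    using Cons U x bil_closed[OF f x(2,3)] list_sum_closed[OF U f] ys by (simp add: vs_assoc)
qed (simp add: U list_sum_closed[OF U f ys])

lemma list_sum_smult:
  assumes U: "vsp U" and f: "bil V W U f" and xs: "xs \<in> lists (carrier V \<times> carrier W)"
  shows "list_sum U f (map (\<lambda>(v, w). (c \<odot>\<^bsub>V\<^esub> v, w)) xs) = c \<odot>\<^bsub>U\<^esub> list_sum U f xs"
  using xs
proof (induction xs)
  case (Cons x xs)
  obtain v w where x: "x = (v, w)" "v \<in> carrier V" "w \<in> carrier W" using Cons by auto
  show ?case
    using Cons U x bil_closed[OF f x(2,3)] list_sum_closed[OF U f] lin_smult[OF bil_left[OF f x(3)] x(2)]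
    by (simp add: vs_smult_add)
qed (simp add: U)

lemma lin_list_sum:
  assumes U: "vsp U" "vsp U'" and f: "bil V W U f" and g: "lin U U' g"
    and xs: "xs \<in> lists (carrier V \<times> carrier W)"
  shows "g (list_sum U f xs) = list_sum U' (\<lambda>v w. g (f v w)) xs"
  using xs
proof (induction xs)
  case (Cons x xs)
  obtain v w where x: "x = (v, w)" "v \<in> carrier V" "w \<in> carrier W" using Cons by auto
  show ?case
    using Cons U x lin_add[OF g] bil_closed[OF f x(2,3)] list_sum_closed[OF U(1) f] by simp
qed (simp add: lin_zero[OF U g])

lemma list_sum_scalars: "list_sum scalars f xs = (\<Sum>(v, w)\<leftarrow>xs. f v w)"
  by (induction xs) auto

lemma tensor_of_apply: "bil V W scalars B \<Longrightarrow> tensor_of V W xs B = list_sum scalars B xs"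
  by (simp add: tensor_of_def list_sum_scalars)

text \<open>Independence of the chosen representative. Two lists that give the same functional have
  equal sums for every scalar bilinear form, in particular for \<open>f\<close> followed by any
  linear form \<open>g\<close> on \<open>U\<close>; linear forms then separate the two sums in
  \<open>U\<close>.\<close>

lemma sweedler_tensor_of:
  assumes U: "vsp U" and f: "bil V W U f" and xs: "xs \<in> lists (carrier V \<times> carrier W)"
  shows "sweedler V W U f (tensor_of V W xs) = list_sum U f xs"
proof -
  define ys where "ys = (SOME ys. ys \<in> lists (carrier V \<times> carrier W) \<and> tensor_of V W ys = tensor_of V W xs)"
  have ys: "ys \<in> lists (carrier V \<times> carrier W)" "tensor_of V W ys = tensor_of V W xs"
    using someI[of "\<lambda>ys. ys \<in> lists (carrier V \<times> carrier W) \<and> tensor_of V W ys = tensor_of V W xs" xs] xs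
    unfolding ys_def by auto
  have "list_sum U f ys = list_sum U f xs"
  proof (rule linear_forms_separate[OF U])
    fix g assume g: "lin U scalars g"
    have "bil V W scalars (\<lambda>v w. g (f v w))" using f g by (rule bil_lin)
    then have "list_sum scalars (\<lambda>v w. g (f v w)) ys = list_sum scalars (\<lambda>v w. g (f v w)) xs"
      using ys(2) tensor_of_apply by metis
    then show "g (list_sum U f ys) = g (list_sum U f xs)"
      using lin_list_sum[OF U vsp_scalars f g] xs ys(1) by simp
  qed (use list_sum_closed[OF U f] xs ys in blast)+
  then show ?thesis unfolding sweedler_def ys_def list_sum_def .
qed

lemma tensor_space_simps:
  "carrier (tensor_space V W) = tensor_of V W ` lists (carrier V \<times> carrier W)"
  "\<zero>\<^bsub>tensor_space V W\<^esub> = (\<lambda>B\<in>bilinear_forms V W. 0)"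
  "s \<oplus>\<^bsub>tensor_space V W\<^esub> t = (\<lambda>B\<in>bilinear_forms V W. s B + t B)"
  "c \<odot>\<^bsub>tensor_space V W\<^esub> t = (\<lambda>B\<in>bilinear_forms V W. c * t B)"
  by (simp_all add: tensor_space_def)

lemma tensor_of_eqI:
  "(\<And>B. bil V W scalars B \<Longrightarrow> list_sum scalars B xs = list_sum scalars B ys)
    \<Longrightarrow> tensor_of V W xs = tensor_of V W ys"
  unfolding tensor_of_def list_sum_scalars by (rule restrict_ext) auto

lemma tensor_of_Nil: "tensor_of V W [] = \<zero>\<^bsub>tensor_space V W\<^esub>"
  by (simp add: tensor_of_def tensor_space_simps)

lemma tensor_of_append:
  "tensor_of V W (xs @ ys) = tensor_of V W xs \<oplus>\<^bsub>tensor_space V W\<^esub> tensor_of V W ys"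
  by (auto simp: tensor_of_def tensor_space_simps)

lemma tensor_of_smult:
  assumes "xs \<in> lists (carrier V \<times> carrier W)"
  shows "tensor_of V W (map (\<lambda>(v, w). (c \<odot>\<^bsub>V\<^esub> v, w)) xs) = c \<odot>\<^bsub>tensor_space V W\<^esub> tensor_of V W xs"
  unfolding tensor_space_simps tensor_of_def[of V W "map _ _"]
proof (rule restrict_ext)
  fix B assume B: "bil V W scalars B"
  show "(\<Sum>(v, w)\<leftarrow>map (\<lambda>(v, w). (c \<odot>\<^bsub>V\<^esub> v, w)) xs. B v w) = c * tensor_of V W xs B"
    using list_sum_smult[OF vsp_scalars B assms, of c] tensor_of_apply[OF B, of xs]
    by (simp add: list_sum_scalars)
qed

lemma map_smult_lists:
  "vsp V \<Longrightarrow> xs \<in> lists (carrier V \<times> carrier W) \<Longrightarrow>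
    map (\<lambda>(v, w). (c \<odot>\<^bsub>V\<^esub> v, w)) xs \<in> lists (carrier V \<times> carrier W)"
  by (induction xs) auto

text \<open>The point with content is closure: concatenation of lists represents sums, and scaling
  the left legs represents multiples. The algebraic laws hold pointwise, on each bilinear
  form.\<close>

lemma vsp_tensor [simp, lin_intros]: "vsp V \<Longrightarrow> vsp (tensor_space V W)"
proof (rule vspI)
  assume V: "vsp V"
  show "\<zero>\<^bsub>tensor_space V W\<^esub> \<in> carrier (tensor_space V W)"
    unfolding tensor_of_Nil[symmetric] by (auto simp: tensor_space_simps)
  fix x assume "x \<in> carrier (tensor_space V W)"
  then obtain xs where xs: "xs \<in> lists (carrier V \<times> carrier W)" "x = tensor_of V W xs"
    by (auto simp: tensor_space_simps)
  show "c \<odot>\<^bsub>tensor_space V W\<^esub> x \<in> carrier (tensor_space V W)" for c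
    unfolding xs(2) tensor_of_smult[OF xs(1), symmetric] tensor_space_simps(1)
    by (rule imageI) (rule map_smult_lists[OF V xs(1)])
  show "\<zero>\<^bsub>tensor_space V W\<^esub> \<oplus>\<^bsub>tensor_space V W\<^esub> x = x" "1 \<odot>\<^bsub>tensor_space V W\<^esub> x = x"
    by (auto simp: xs(2) tensor_space_simps tensor_of_def cong: restrict_cong)
  show "0 \<odot>\<^bsub>tensor_space V W\<^esub> x = \<zero>\<^bsub>tensor_space V W\<^esub>" by (simp add: tensor_space_simps)
  show "(c + d) \<odot>\<^bsub>tensor_space V W\<^esub> x
      = c \<odot>\<^bsub>tensor_space V W\<^esub> x \<oplus>\<^bsub>tensor_space V W\<^esub> d \<odot>\<^bsub>tensor_space V W\<^esub> x"
    "c \<odot>\<^bsub>tensor_space V W\<^esub> (d \<odot>\<^bsub>tensor_space V W\<^esub> x) = (c * d) \<odot>\<^bsub>tensor_space V W\<^esub> x" for c d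
    by (auto simp: tensor_space_simps algebra_simps cong: restrict_cong)
  fix y assume "y \<in> carrier (tensor_space V W)"
  then obtain ys where ys: "ys \<in> lists (carrier V \<times> carrier W)" "y = tensor_of V W ys"
    by (auto simp: tensor_space_simps)
  have "xs @ ys \<in> lists (carrier V \<times> carrier W)" using xs ys by auto
  then show "x \<oplus>\<^bsub>tensor_space V W\<^esub> y \<in> carrier (tensor_space V W)"
    unfolding xs ys tensor_of_append[symmetric] by (simp add: tensor_space_simps(1))
qed (auto simp: tensor_space_simps algebra_simps cong: restrict_cong)

lemma pure_closed [lin_intros]:
  "v \<in> carrier V \<Longrightarrow> w \<in> carrier W \<Longrightarrow> pure_tensor V W v w \<in> carrier (tensor_space V W)"
  by (auto simp: tensor_space_simps)

lemma tensor_cases: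
  assumes "t \<in> carrier (tensor_space V W)"
  obtains xs where "xs \<in> lists (carrier V \<times> carrier W)" "t = tensor_of V W xs"
  using assms by (auto simp: tensor_space_simps)

lemma sweedler_closed [lin_intros]:
  "vsp U \<Longrightarrow> bil V W U f \<Longrightarrow> t \<in> carrier (tensor_space V W) \<Longrightarrow> sweedler V W U f t \<in> carrier U"
  by (elim tensor_cases) (simp add: sweedler_tensor_of list_sum_closed)

lemma sweedler_pure:
  assumes "vsp U" "bil V W U f" "v \<in> carrier V" "w \<in> carrier W"
  shows "sweedler V W U f (pure_tensor V W v w) = f v w"
  using assms by (subst sweedler_tensor_of) (auto simp: bil_closed)

lemmas sweedler_pure_eq = trans[OF sweedler_pure]

lemma lin_sweedler:
  assumes V: "vsp V" and U: "vsp U" and f: "bil V W U f"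
  shows "lin (tensor_space V W) U (sweedler V W U f)"
proof (rule linI)
  fix s t assume "s \<in> carrier (tensor_space V W)" "t \<in> carrier (tensor_space V W)"
  then obtain xs ys where *: "xs \<in> lists (carrier V \<times> carrier W)" "s = tensor_of V W xs"
      "ys \<in> lists (carrier V \<times> carrier W)" "t = tensor_of V W ys"
    by (metis tensor_cases)
  moreover have "xs @ ys \<in> lists (carrier V \<times> carrier W)" using * by auto
  ultimately show "sweedler V W U f (s \<oplus>\<^bsub>tensor_space V W\<^esub> t) = sweedler V W U f s \<oplus>\<^bsub>U\<^esub> sweedler V W U f t"
    unfolding * tensor_of_append[symmetric]
    by (simp only: sweedler_tensor_of[OF U f] list_sum_append[OF U f])
next
  fix c t assume "t \<in> carrier (tensor_space V W)"
  then obtain xs where *: "xs \<in> lists (carrier V \<times> carrier W)" "t = tensor_of V W xs"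
    by (metis tensor_cases)
  then show "sweedler V W U f (c \<odot>\<^bsub>tensor_space V W\<^esub> t) = c \<odot>\<^bsub>U\<^esub> sweedler V W U f t"
    using tensor_of_smult[OF *(1)] map_smult_lists[OF V *(1)]
    by (metis sweedler_tensor_of[OF U f] list_sum_smult[OF U f])
qed (use assms in \<open>auto intro: sweedler_closed\<close>)

lemma lin_sweedler_arg [lin_intros]:
  "vsp V \<Longrightarrow> vsp U \<Longrightarrow> bil V W U f \<Longrightarrow> lin X (tensor_space V W) g
    \<Longrightarrow> lin X U (\<lambda>x. sweedler V W U f (g x))"
  by (rule lin_compose[OF lin_sweedler])

text \<open>Here the parameter sits in the bilinear map and the tensor is fixed;
  \<open>lin_sweedler_arg\<close> treats the opposite case. Together they give linearity of nested
  sums.\<close>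

lemma lin_sweedler_fun [lin_intros]:
  assumes t: "t \<in> carrier (tensor_space V W)" and U: "vsp U"
    and lin: "\<And>v w. v \<in> carrier V \<Longrightarrow> w \<in> carrier W \<Longrightarrow> lin X U (\<lambda>x. f x v w)"
    and bil: "\<And>x. x \<in> carrier X \<Longrightarrow> bil V W U (f x)" and X: "vsp X"
  shows "lin X U (\<lambda>x. sweedler V W U (f x) t)"
proof -
  obtain xs where xs: "xs \<in> lists (carrier V \<times> carrier W)" and t: "t = tensor_of V W xs"
    using t by (rule tensor_cases)
  have add: "list_sum U (f (x \<oplus>\<^bsub>X\<^esub> y)) xs = list_sum U (f x) xs \<oplus>\<^bsub>U\<^esub> list_sum U (f y) xs"
    if *: "x \<in> carrier X" "y \<in> carrier X" for x y
    using xs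
  proof (induction xs)
    case (Cons z xs)
    obtain v w where z: "z = (v, w)" "v \<in> carrier V" "w \<in> carrier W" using Cons by auto
    note l = lin[OF z(2,3)]
    have c: "list_sum U (f x) xs \<in> carrier U" "list_sum U (f y) xs \<in> carrier U"
      using Cons list_sum_closed[OF U bil] * by auto
    show ?case
      using Cons U z * c by (simp add: lin_add[OF l] lin_closed[OF l] vs_assoc vs_lcomm)
  qed (simp add: U)
  have smult: "list_sum U (f (c \<odot>\<^bsub>X\<^esub> x)) xs = c \<odot>\<^bsub>U\<^esub> list_sum U (f x) xs"
    if *: "x \<in> carrier X" for x c
    using xs
  proof (induction xs)
    case (Cons z xs)
    obtain v w where z: "z = (v, w)" "v \<in> carrier V" "w \<in> carrier W" using Cons by auto
    note l = lin[OF z(2,3)]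
    have c: "list_sum U (f x) xs \<in> carrier U"
      using Cons list_sum_closed[OF U bil] * by auto
    show ?case
      using Cons U z * c by (simp add: lin_smult[OF l] lin_closed[OF l] vs_smult_add)
  qed (simp add: U)
  show ?thesis unfolding t
    by (rule linI)
      (use bil xs U X in \<open>simp_all add: sweedler_tensor_of add smult list_sum_closed[OF U bil]\<close>)
qed

lemma lin_of_sweedler:
  assumes "lin U U' g" "vsp U" "vsp U'" "bil V W U f" "t \<in> carrier (tensor_space V W)"
  shows "g (sweedler V W U f t) = sweedler V W U' (\<lambda>v w. g (f v w)) t"
proof -
  obtain xs where "xs \<in> lists (carrier V \<times> carrier W)" "t = tensor_of V W xs"
    using assms(5) by (rule tensor_cases)
  then show ?thesis
    using sweedler_tensor_of[OF assms(2,4)] sweedler_tensor_of[OF assms(3) bil_lin[OF assms(4,1)]]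
      lin_list_sum[OF assms(2,3,4,1)] by simp
qed

text \<open>It holds for maps that are not known to be bilinear, because the representative picked
  by \<open>sweedler\<close> depends on \<open>t\<close> alone and is therefore the same for
  \<open>f\<close> and \<open>g\<close>.\<close>

lemma sweedler_cong:
  assumes t: "t \<in> carrier (tensor_space V W)"
    and eq: "\<And>v w. v \<in> carrier V \<Longrightarrow> w \<in> carrier W \<Longrightarrow> f v w = g v w"
  shows "sweedler V W U f t = sweedler V W U g t"
proof -
  define xs where "xs = (SOME xs. xs \<in> lists (carrier V \<times> carrier W) \<and> tensor_of V W xs = t)"
  have "\<exists>xs. xs \<in> lists (carrier V \<times> carrier W) \<and> tensor_of V W xs = t"
    using t by (auto simp: tensor_space_simps(1))
  from someI_ex[OF this] have "xs \<in> lists (carrier V \<times> carrier W)" unfolding xs_def by blast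
  then have "list_sum U f xs = list_sum U g xs"
    by (induction xs) (auto simp: eq)
  then show ?thesis unfolding sweedler_def list_sum_def xs_def .
qed

lemma tensor_eqI:
  assumes "lin (tensor_space V W) U f" "lin (tensor_space V W) U g" "vsp V" "vsp U"
    and eq: "\<And>v w. v \<in> carrier V \<Longrightarrow> w \<in> carrier W \<Longrightarrow> f (pure_tensor V W v w) = g (pure_tensor V W v w)"
    and "t \<in> carrier (tensor_space V W)"
  shows "f t = g t"
proof -
  obtain xs where xs: "xs \<in> lists (carrier V \<times> carrier W)" "t = tensor_of V W xs"
    using assms(6) by (rule tensor_cases)
  from xs(1) have "f (tensor_of V W xs) = g (tensor_of V W xs)"
  proof (induction xs)
    case Nil
    then show ?case using assms by (simp add: tensor_of_Nil lin_zero)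
  next
    case (Cons x xs)
    obtain v w where x: "x = (v, w)" by (cases x)
    have "tensor_of V W (x # xs) = pure_tensor V W v w \<oplus>\<^bsub>tensor_space V W\<^esub> tensor_of V W xs"
      unfolding x tensor_of_append[symmetric] by simp
    moreover have "pure_tensor V W v w \<in> carrier (tensor_space V W)"
        "tensor_of V W xs \<in> carrier (tensor_space V W)"
      using Cons x by (auto simp: tensor_space_simps(1))
    ultimately show ?case using assms(1,2) Cons x eq by (simp add: lin_add)
  qed
  then show ?thesis using xs by simp
qed

lemma lin_pure_left [lin_intros]:
  assumes "vsp V" "w \<in> carrier W" "lin X V f"
  shows "lin X (tensor_space V W) (\<lambda>x. pure_tensor V W (f x) w)"
proof (rule linI)
  fix x y assume xy: "x \<in> carrier X" "y \<in> carrier X"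
  show "pure_tensor V W (f (x \<oplus>\<^bsub>X\<^esub> y)) w
      = pure_tensor V W (f x) w \<oplus>\<^bsub>tensor_space V W\<^esub> pure_tensor V W (f y) w"
    unfolding tensor_of_append[symmetric]
    by (rule tensor_of_eqI)
      (use assms xy in \<open>auto simp: lin_add lin_closed lin_add[OF bil_left]\<close>)
next
  fix c x assume x: "x \<in> carrier X"
  show "pure_tensor V W (f (c \<odot>\<^bsub>X\<^esub> x)) w = c \<odot>\<^bsub>tensor_space V W\<^esub> pure_tensor V W (f x) w"
    using tensor_of_smult[of "[(f x, w)]" V W c] assms x by (simp add: lin_smult lin_closed)
qed (use assms in \<open>auto intro!: pure_closed simp: lin_closed\<close>)

lemma lin_pure_right [lin_intros]:
  assumes "vsp V" "v \<in> carrier V" "lin X W f"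
  shows "lin X (tensor_space V W) (\<lambda>x. pure_tensor V W v (f x))"
proof (rule linI)
  fix x y assume xy: "x \<in> carrier X" "y \<in> carrier X"
  show "pure_tensor V W v (f (x \<oplus>\<^bsub>X\<^esub> y))
      = pure_tensor V W v (f x) \<oplus>\<^bsub>tensor_space V W\<^esub> pure_tensor V W v (f y)"
    unfolding tensor_of_append[symmetric]
    by (rule tensor_of_eqI)
      (use assms xy in \<open>auto simp: lin_add lin_closed lin_add[OF bil_right]\<close>)
next
  fix c x assume x: "x \<in> carrier X"
  have "pure_tensor V W v (f (c \<odot>\<^bsub>X\<^esub> x)) = tensor_of V W (map (\<lambda>(v, w). (c \<odot>\<^bsub>V\<^esub> v, w)) [(v, f x)])"
    by (rule tensor_of_eqI)
      (use assms x in \<open>auto simp: lin_smult lin_closed lin_smult[OF bil_right] lin_smult[OF bil_left]\<close>)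
  then show "pure_tensor V W v (f (c \<odot>\<^bsub>X\<^esub> x)) = c \<odot>\<^bsub>tensor_space V W\<^esub> pure_tensor V W v (f x)"
    using tensor_of_smult[of "[(v, f x)]" V W c] assms x by (simp add: lin_closed)
qed (use assms in \<open>auto intro!: pure_closed simp: lin_closed\<close>)

text \<open>Both sides are linear in \<open>t'\<close>, so \<open>t'\<close> may be taken pure, and
  then the sum over its components collapses.\<close>

lemma sweedler_swap:
  assumes V: "vsp V" and V': "vsp V'" and W': "vsp W'" and U: "vsp U" and t: "t \<in> carrier (tensor_space V W)"
    and t': "t' \<in> carrier (tensor_space V' W')"
    and W: "vsp W"
    and f: "\<And>v w. v \<in> carrier V \<Longrightarrow> w \<in> carrier W \<Longrightarrow> bil V' W' U (f v w)"
    and f': "\<And>v w. v \<in> carrier V' \<Longrightarrow> w \<in> carrier W' \<Longrightarrow> bil V W U (\<lambda>v' w'. f v' w' v w)"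
  shows "sweedler V W U (\<lambda>v w. sweedler V' W' U (f v w) t') t
    = sweedler V' W' U (\<lambda>v' w'. sweedler V W U (\<lambda>v w. f v w v' w') t) t'"
proof (rule tensor_eqI[OF _ _ V' U _ t'])
  have b: "bil V W U (\<lambda>v w. sweedler V' W' U (f v w) t')" if "t' \<in> carrier (tensor_space V' W')" for t'
    by (rule bilI; rule lin_sweedler_fun[OF that U _ _ V] lin_sweedler_fun[OF that U _ _ W]) (blast intro: f bil_right[OF f'] bil_left[OF f'])+
  have b': "bil V' W' U (\<lambda>v' w'. sweedler V W U (\<lambda>v w. f v w v' w') t)"
    by (rule bilI; rule lin_sweedler_fun[OF t U _ _ V'] lin_sweedler_fun[OF t U _ _ W']) (blast intro: f' bil_right[OF f] bil_left[OF f])+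
  show "lin (tensor_space V' W') U (\<lambda>t'. sweedler V W U (\<lambda>v w. sweedler V' W' U (f v w) t') t)"
    by (intro lin_sweedler_fun t U lin_sweedler V' f b vsp_tensor)
  show "lin (tensor_space V' W') U (sweedler V' W' U (\<lambda>v' w'. sweedler V W U (\<lambda>v w. f v w v' w') t))"
    by (intro lin_sweedler V' U b')
  fix v' w' assume *: "v' \<in> carrier V'" "w' \<in> carrier W'"
  show "sweedler V W U (\<lambda>v w. sweedler V' W' U (f v w) (pure_tensor V' W' v' w')) t =
    sweedler V' W' U (\<lambda>v' w'. sweedler V W U (\<lambda>v w. f v w v' w') t) (pure_tensor V' W' v' w')"
    unfolding sweedler_pure[OF U b' *]
    by (rule sweedler_cong[OF t])
      (simp add: sweedler_pure[OF U f] *)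
qed

text \<open>Spaces of maps and of tensors are determined by carrier, addition and scalar
  multiplication. This rule and the next ones identify everything built on
  \<open>hopf_opp H\<close>, on \<open>dual_hopf H\<close> or on a newly formed module record with
  the same construction on the underlying vector space.\<close>

lemma module_hom_cong:
  fixes V :: "('k::field, 'a, 'x) module_scheme"
  assumes "carrier V = carrier V'" "add V = add V'" "module.smult V = module.smult V'"
    and "carrier W = carrier W'" "add W = add W'" "module.smult W = module.smult W'"
  shows "module_hom class_ring V W = module_hom class_ring V' W'"
  using assms by (auto simp: lin_iff)

lemma bilinear_maps_cong:
  fixes V :: "('k::field, 'a, 'x) module_scheme"
  assumes "carrier V = carrier V'" "add V = add V'" "module.smult V = module.smult V'"
    and "carrier W = carrier W'" "add W = add W'" "module.smult W = module.smult W'"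
    and "carrier U = carrier U'" "add U = add U'" "module.smult U = module.smult U'"
  shows "bilinear_maps V W U = bilinear_maps V' W' U'"
  unfolding bilinear_maps_def
  using assms module_hom_cong[of W W' U U'] module_hom_cong[of V V' U U'] by auto

lemma tensor_of_cong:
  fixes V :: "('k::field, 'a, 'x) module_scheme"
  assumes "carrier V = carrier V'" "add V = add V'" "module.smult V = module.smult V'"
    and "carrier W = carrier W'" "add W = add W'" "module.smult W = module.smult W'"
  shows "tensor_of V W = tensor_of V' W'"
  unfolding tensor_of_def using bilinear_maps_cong[OF assms, of scalars scalars] by simp

lemma tensor_space_cong:
  fixes V :: "('k::field, 'a, 'x) module_scheme"
  assumes "carrier V = carrier V'" "add V = add V'" "module.smult V = module.smult V'"
    and "carrier W = carrier W'" "add W = add W'" "module.smult W = module.smult W'"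
  shows "tensor_space V W = tensor_space V' W'"
  unfolding tensor_space_def
  using bilinear_maps_cong[OF assms, of scalars scalars] tensor_of_cong[OF assms] assms by simp

lemma sweedler_space_cong:
  fixes V :: "('k::field, 'a, 'x) module_scheme"
  assumes "carrier V = carrier V'" "add V = add V'" "module.smult V = module.smult V'"
    and "carrier W = carrier W'" "add W = add W'" "module.smult W = module.smult W'"
    and "add U = add U'" "\<zero>\<^bsub>U\<^esub> = \<zero>\<^bsub>U'\<^esub>"
  shows "sweedler V W U = sweedler V' W' U'"
  unfolding sweedler_def using tensor_of_cong[OF assms(1-6)] assms by (intro ext) simp

lemma sweedler_smult_vector:
  assumes t: "t \<in> carrier (tensor_space V W)" and U: "vsp U" and u: "u \<in> carrier U"
    and f: "bil V W scalars f"
  shows "sweedler V W U (\<lambda>v w. f v w \<odot>\<^bsub>U\<^esub> u) t = sweedler V W scalars f t \<odot>\<^bsub>U\<^esub> u"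
  by (rule lin_of_sweedler[OF _ vsp_scalars U f t, symmetric]) (intro lin_intros U u)

lemma sweedler_smult:
  assumes t: "t \<in> carrier (tensor_space V W)" and U: "vsp U" and f: "bil V W U f"
  shows "sweedler V W U (\<lambda>v w. c \<odot>\<^bsub>U\<^esub> f v w) t = c \<odot>\<^bsub>U\<^esub> sweedler V W U f t"
  by (rule lin_of_sweedler[OF _ U U f t, symmetric]) (intro lin_intros U)

subsection \<open>The dual space\<close>

text \<open>Evaluation gets a name of its own, so that rules about it do not match arbitrary
  function application.\<close>

definition ev :: "('a \<Rightarrow> 'k) \<Rightarrow> 'a \<Rightarrow> 'k" where
  "ev p v = p v"

lemma dual_space_simps:
  "carrier (dual_space V) = module_hom class_ring V scalars \<inter> extensional (carrier V)"
  "\<zero>\<^bsub>dual_space V\<^esub> = (\<lambda>v\<in>carrier V. 0)"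
  "p \<oplus>\<^bsub>dual_space V\<^esub> q = (\<lambda>v\<in>carrier V. p v + q v)"
  "c \<odot>\<^bsub>dual_space V\<^esub> p = (\<lambda>v\<in>carrier V. c * p v)"
  by (simp_all add: dual_space_def)

lemma dual_extensional: "p \<in> carrier (dual_space V) \<Longrightarrow> (\<lambda>v\<in>carrier V. p v) = p"
  by (simp add: dual_space_simps extensional_restrict)

lemma vsp_dual [simp, lin_intros]:
  assumes V: "vsp V"
  shows "vsp (dual_space V)"
proof (rule vspI)
  fix c p q assume p: "p \<in> carrier (dual_space V)" "q \<in> carrier (dual_space V)"
  then have *: "lin V scalars p" "lin V scalars q" by (simp_all add: dual_space_simps)
  show "p \<oplus>\<^bsub>dual_space V\<^esub> q \<in> carrier (dual_space V)"
    unfolding dual_space_simps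
    using V by (auto intro!: linI simp: lin_add[OF *(1)] lin_add[OF *(2)] lin_smult[OF *(1)]
        lin_smult[OF *(2)] algebra_simps)
  show "c \<odot>\<^bsub>dual_space V\<^esub> p \<in> carrier (dual_space V)"
    unfolding dual_space_simps
    using V by (auto intro!: linI simp: lin_add[OF *(1)] lin_smult[OF *(1)] algebra_simps)
next
  show "\<zero>\<^bsub>dual_space V\<^esub> \<in> carrier (dual_space V)"
    unfolding dual_space_simps using V by (auto intro!: linI)
next
  fix p assume p: "p \<in> carrier (dual_space V)"
  show "\<zero>\<^bsub>dual_space V\<^esub> \<oplus>\<^bsub>dual_space V\<^esub> p = p" "1 \<odot>\<^bsub>dual_space V\<^esub> p = p"
    using dual_extensional[OF p] by (simp_all add: dual_space_simps cong: restrict_cong)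
qed (simp_all add: dual_space_simps algebra_simps cong: restrict_cong)

lemma dual_eqI:
  "p \<in> carrier (dual_space V) \<Longrightarrow> q \<in> carrier (dual_space V) \<Longrightarrow>
    (\<And>v. v \<in> carrier V \<Longrightarrow> ev p v = ev q v) \<Longrightarrow> p = q"
  unfolding dual_space_simps ev_def by (auto intro: extensionalityI)

lemma restrict_dual:
  "vsp V \<Longrightarrow> lin V scalars f \<Longrightarrow> (\<lambda>v\<in>carrier V. f v) \<in> carrier (dual_space V)"
  by (auto simp: dual_space_simps lin_iff)

lemma ev_add: "v \<in> carrier V \<Longrightarrow> ev (p \<oplus>\<^bsub>dual_space V\<^esub> q) v = ev p v + ev q v"
  and ev_smult: "v \<in> carrier V \<Longrightarrow> ev (c \<odot>\<^bsub>dual_space V\<^esub> p) v = c * ev p v"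
  by (simp_all add: dual_space_simps ev_def)

lemma lin_ev: "p \<in> carrier (dual_space V) \<Longrightarrow> lin V scalars (ev p)"
  by (simp add: dual_space_simps ev_def lin_iff)

lemma lin_ev_left: "v \<in> carrier V \<Longrightarrow> lin (dual_space V) scalars (\<lambda>p. ev p v)"
  by (simp add: lin_iff ev_add ev_smult)

lemma lin_dualI:
  assumes V: "vsp V" and X: "vsp X" and f: "\<And>x. x \<in> carrier X \<Longrightarrow> f x \<in> carrier (dual_space V)"
    and lin: "\<And>v. v \<in> carrier V \<Longrightarrow> lin X scalars (\<lambda>x. ev (f x) v)"
  shows "lin X (dual_space V) f"
proof (rule linI)
  fix x y assume "x \<in> carrier X" "y \<in> carrier X"
  then show "f (x \<oplus>\<^bsub>X\<^esub> y) = f x \<oplus>\<^bsub>dual_space V\<^esub> f y"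
    by (intro dual_eqI[where V = V]) (use f V X in \<open>auto simp: lin_add[OF lin] ev_add\<close>)
next
  fix c x assume "x \<in> carrier X"
  then show "f (c \<odot>\<^bsub>X\<^esub> x) = c \<odot>\<^bsub>dual_space V\<^esub> f x"
    by (intro dual_eqI[where V = V]) (use f V X in \<open>auto simp: lin_smult[OF lin] ev_smult\<close>)
qed (use f in auto)

text \<open>The tensor is the sum, over a finite basis, of each basis vector tensored with its
  coordinate form; contracting it with \<open>v\<close> is the expansion of \<open>v\<close> in
  coordinates.\<close>

lemma dual_basis_exists:
  fixes V :: "('k::field, 'a, 'x) module_scheme"
  assumes V: "vsp V" and findim: "vectorspace.fin_dim class_ring V"
  shows "\<exists>t\<in>carrier (tensor_space V (dual_space V)).
    \<forall>v\<in>carrier V. sweedler V (dual_space V) V (\<lambda>e p. ev p v \<odot>\<^bsub>V\<^esub> e) t = v"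
proof -
  interpret vectorspace class_ring V by (fact V)
  obtain B where B: "finite B" "basis B" using finite_basis_exists[OF findim] by blast
  then have BV: "B \<subseteq> carrier V" by (simp add: basis_def)
  have ex1: "\<exists>!a. a \<in> B \<rightarrow>\<^sub>E UNIV \<and> lincomb a B = v" if "v \<in> carrier V" for v
    using basis_criterion[OF B(1) BV] B that by simp
  \<comment> \<open>Coefficient functions are unique only when they are \<open>undefined\<close>
    outside \<open>B\<close>; this is why sums and multiples of them are restricted to
    \<open>B\<close> below.\<close>
  define co where "co v = (THE a. a \<in> B \<rightarrow>\<^sub>E UNIV \<and> lincomb a B = v)" for v
  have co: "co v \<in> B \<rightarrow>\<^sub>E UNIV" "lincomb (co v) B = v" if "v \<in> carrier V" for v
    using theI'[OF ex1[OF that]] unfolding co_def by auto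
  have co_eq: "co v = a" if "a \<in> B \<rightarrow>\<^sub>E UNIV" "lincomb a B = v" "v \<in> carrier V" for a v
    using ex1[OF that(3)] that co[OF that(3)] by blast
  have lin: "lin V scalars (\<lambda>v. co v b)" if b: "b \<in> B" for b
  proof (rule linI)
    fix x y assume xy: "x \<in> carrier V" "y \<in> carrier V"
    have "lincomb (\<lambda>v\<in>B. co x v + co y v) B = lincomb (\<lambda>v. co x v + co y v) B"
      by (rule lincomb_cong) (use BV in auto)
    also have "\<dots> = x \<oplus>\<^bsub>V\<^esub> y"
      using lincomb_sum[OF B(1) BV, of "co x" "co y"] co xy by simp
    finally have "co (x \<oplus>\<^bsub>V\<^esub> y) = (\<lambda>v\<in>B. co x v + co y v)"
      by (intro co_eq) (use xy V in auto)
    then show "co (x \<oplus>\<^bsub>V\<^esub> y) b = co x b \<oplus>\<^bsub>scalars\<^esub> co y b" using b by simp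
  next
    fix c x assume x: "x \<in> carrier V"
    have "lincomb (\<lambda>v\<in>B. c * co x v) B = lincomb (\<lambda>v. c * co x v) B"
      by (rule lincomb_cong) (use BV in auto)
    also have "\<dots> = c \<odot>\<^bsub>V\<^esub> x"
      using lincomb_smult[OF BV, of "co x" c] co x by simp
    finally have "co (c \<odot>\<^bsub>V\<^esub> x) = (\<lambda>v\<in>B. c * co x v)"
      by (intro co_eq) (use x V in auto)
    then show "co (c \<odot>\<^bsub>V\<^esub> x) b = c \<odot>\<^bsub>scalars\<^esub> co x b" using b by simp
  qed simp
  define p where "p b = (\<lambda>v\<in>carrier V. co v b)" for b
  have p: "p b \<in> carrier (dual_space V)" if "b \<in> B" for b
    unfolding p_def using V lin[OF that] by (rule restrict_dual)
  obtain bs where bs: "set bs = B" "distinct bs" using finite_distinct_list[OF B(1)] by blast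
  define xs where "xs = map (\<lambda>b. (b, p b)) bs"
  have xs: "xs \<in> lists (carrier V \<times> carrier (dual_space V))"
    unfolding xs_def using bs p BV by auto
  have "sweedler V (dual_space V) V (\<lambda>e p. ev p v \<odot>\<^bsub>V\<^esub> e) (tensor_of V (dual_space V) xs) = v"
    if v: "v \<in> carrier V" for v
  proof -
    have bil: "bil V (dual_space V) V (\<lambda>e p. ev p v \<odot>\<^bsub>V\<^esub> e)"
      by (intro lin_intros V lin_ev_left v)
    have "list_sum V (\<lambda>e p. ev p v \<odot>\<^bsub>V\<^esub> e) (map (\<lambda>b. (b, p b)) cs) = lincomb (co v) (set cs)"
      if "distinct cs" "set cs \<subseteq> B" for cs
      using that
    proof (induction cs)
      case (Cons c cs)
      have "lincomb (co v) ({c} \<union> set cs) = co v c \<odot>\<^bsub>V\<^esub> c \<oplus>\<^bsub>V\<^esub> lincomb (co v) (set cs)"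
        using lincomb_insert[of "set cs" "co v" c] Cons.prems BV by auto
      moreover have "ev (p c) v = co v c" using v by (simp add: ev_def p_def)
      ultimately show ?case using Cons by simp
    qed (simp add: lincomb_def)
    then show ?thesis
      using bs co[OF v] by (simp add: sweedler_tensor_of[OF V bil xs]) (simp add: xs_def)
  qed
  moreover have "tensor_of V (dual_space V) xs \<in> carrier (tensor_space V (dual_space V))"
    using xs by (simp add: tensor_space_simps(1))
  ultimately show ?thesis by blast
qed

lemmas [lin_intros] = vs_smult_closed

lemma scalars_closed [lin_intros]: "x \<in> carrier scalars"
  by simp

section \<open>Sweedler calculus in a Hopf algebra\<close>

context hopf_algebra
begin

abbreviation S where "S \<equiv> antipode H"
abbreviation eps where "eps \<equiv> counit H"
abbreviation sw where "sw U h f \<equiv> sweedler H H U f (comult H h)"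

lemma ring_H: "ring H"
  by (rule k_algebra.axioms(1)[OF k_algebra_axioms])

lemma one_closed_H [simp, lin_intros]: "\<one> \<in> carrier H"
  by (rule monoid.one_closed[OF ring.is_monoid[OF ring_H]])

lemma assoc_H: "x \<in> carrier H \<Longrightarrow> y \<in> carrier H \<Longrightarrow> z \<in> carrier H \<Longrightarrow> x \<otimes> y \<otimes> z = x \<otimes> (y \<otimes> z)"
  by (rule monoid.m_assoc[OF ring.is_monoid[OF ring_H]])

lemma vsp_H [simp, lin_intros]: "vsp H"
  by (rule vectorspace_axioms)

lemma comult_closed [simp, lin_intros]: "h \<in> carrier H \<Longrightarrow> comult H h \<in> carrier (tensor_space H H)"
  by (rule lin_closed[OF comult_linear])

lemma antipode_closed [simp, lin_intros]: "h \<in> carrier H \<Longrightarrow> S h \<in> carrier H"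
  by (rule lin_closed[OF antipode_linear])

lemma mult_closed [simp, lin_intros]: "x \<in> carrier H \<Longrightarrow> y \<in> carrier H \<Longrightarrow> x \<otimes> y \<in> carrier H"
  by (rule monoid.m_closed[OF ring.is_monoid[OF ring_H]])

lemma bil_mult: "bil H H H (\<otimes>)"
  by (rule bilI) (auto intro!: linI simp: ring.ring_simprules[OF ring_H] smult_mult_left smult_mult_right)

lemmas lin_mult [lin_intros] = bil_comp_left[OF bil_mult] bil_comp_right[OF bil_mult]
lemmas lin_comult [lin_intros] = lin_compose[OF comult_linear]
lemmas lin_antipode [lin_intros] = lin_compose[OF antipode_linear]
lemmas lin_counit [lin_intros] = lin_compose[OF counit_linear]

lemma sw_cong:
  "h \<in> carrier H \<Longrightarrow> (\<And>a b. a \<in> carrier H \<Longrightarrow> b \<in> carrier H \<Longrightarrow> f a b = g a b) \<Longrightarrow> sw U h f = sw U h g"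
  by (rule sweedler_cong) auto

lemma lin_sw: "lin U U' g \<Longrightarrow> vsp U \<Longrightarrow> vsp U' \<Longrightarrow> bil H H U f \<Longrightarrow> h \<in> carrier H \<Longrightarrow>
    g (sw U h f) = sw U' h (\<lambda>a b. g (f a b))"
  by (rule lin_of_sweedler) auto

text \<open>The coassociativity axiom is an equation between threefold tensors. Contracting both of
  its sides with the linear map \<open>?g\<close> that \<open>f\<close> induces turns it into a rule
  for an arbitrary trilinear \<open>f\<close>.\<close>

lemma sw_coassoc:
  assumes U: "vsp U" and h: "h \<in> carrier H"
    and f1: "\<And>b c. b \<in> carrier H \<Longrightarrow> c \<in> carrier H \<Longrightarrow> lin H U (\<lambda>a. f a b c)"
    and f2: "\<And>a c. a \<in> carrier H \<Longrightarrow> c \<in> carrier H \<Longrightarrow> lin H U (\<lambda>b. f a b c)"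
    and f3: "\<And>a b. a \<in> carrier H \<Longrightarrow> b \<in> carrier H \<Longrightarrow> lin H U (\<lambda>c. f a b c)"
  shows "sw U h (\<lambda>a b. sw U a (\<lambda>a\<^sub>1 a\<^sub>2. f a\<^sub>1 a\<^sub>2 b)) = sw U h (\<lambda>a b. sw U b (\<lambda>b\<^sub>1 b\<^sub>2. f a b\<^sub>1 b\<^sub>2))"
proof -
  let ?T = "tensor_space3 H H H"
  let ?g = "sweedler H (tensor_space H H) U (\<lambda>a s. sweedler H H U (f a) s)"
  have b: "bil H (tensor_space H H) U (\<lambda>a s. sweedler H H U (f a) s)"
    by (intro lin_intros U f1 f2 f3)
  have g: "lin ?T U ?g"
    by (rule lin_sweedler) (intro lin_intros U b)+
  have T: "vsp ?T" by simp
  have gp: "?g (pure_tensor H (tensor_space H H) a s) = sweedler H H U (f a) s"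
    if "a \<in> carrier H" "s \<in> carrier (tensor_space H H)" for a s
    by (rule sweedler_pure[OF U b that])
  have "?g (sw ?T h (\<lambda>a b. sw ?T a (\<lambda>a\<^sub>1 a\<^sub>2. pure_tensor3 H H H a\<^sub>1 a\<^sub>2 b)))
      = sw U h (\<lambda>a b. ?g (sw ?T a (\<lambda>a\<^sub>1 a\<^sub>2. pure_tensor3 H H H a\<^sub>1 a\<^sub>2 b)))"
    by (rule lin_sw[OF g T U _ h]) (intro lin_intros)
  also have "\<dots> = sw U h (\<lambda>a b. sw U a (\<lambda>a\<^sub>1 a\<^sub>2. f a\<^sub>1 a\<^sub>2 b))"
  proof (rule sw_cong[OF h])
    fix a b assume *: "a \<in> carrier H" "b \<in> carrier H"
    have "?g (sw ?T a (\<lambda>a\<^sub>1 a\<^sub>2. pure_tensor3 H H H a\<^sub>1 a\<^sub>2 b))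
        = sw U a (\<lambda>a\<^sub>1 a\<^sub>2. ?g (pure_tensor3 H H H a\<^sub>1 a\<^sub>2 b))"
      by (rule lin_sw[OF g T U _ *(1)]) (intro lin_intros *)
    also have "\<dots> = sw U a (\<lambda>a\<^sub>1 a\<^sub>2. f a\<^sub>1 a\<^sub>2 b)"
    proof (rule sw_cong[OF *(1)])
      fix a\<^sub>1 a\<^sub>2 assume **: "a\<^sub>1 \<in> carrier H" "a\<^sub>2 \<in> carrier H"
      have "bil H H U (f a\<^sub>1)" by (intro bilI f2 f3 **)
      then show "?g (pure_tensor3 H H H a\<^sub>1 a\<^sub>2 b) = f a\<^sub>1 a\<^sub>2 b"
        using * ** U by (simp add: gp pure_closed sweedler_pure)
    qed
    finally show "?g (sw ?T a (\<lambda>a\<^sub>1 a\<^sub>2. pure_tensor3 H H H a\<^sub>1 a\<^sub>2 b)) = sw U a (\<lambda>a\<^sub>1 a\<^sub>2. f a\<^sub>1 a\<^sub>2 b)" .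
  qed
  finally have 1: "?g (sw ?T h (\<lambda>a b. sw ?T a (\<lambda>a\<^sub>1 a\<^sub>2. pure_tensor3 H H H a\<^sub>1 a\<^sub>2 b)))
      = sw U h (\<lambda>a b. sw U a (\<lambda>a\<^sub>1 a\<^sub>2. f a\<^sub>1 a\<^sub>2 b))" .
  have "?g (comult3 H h) = sw U h (\<lambda>a b. ?g (pure_tensor H (tensor_space H H) a (comult H b)))"
    unfolding comult3_def by (rule lin_sw[OF g T U _ h]) (intro lin_intros)
  also have "\<dots> = sw U h (\<lambda>a b. sw U b (\<lambda>b\<^sub>1 b\<^sub>2. f a b\<^sub>1 b\<^sub>2))"
    by (rule sw_cong[OF h]) (simp add: gp)
  finally show ?thesis using 1 coassoc[OF h] by simp
qed

lemma sw_counit_left: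
  assumes "vsp U" "lin H U f" "h \<in> carrier H"
  shows "sw U h (\<lambda>a b. eps a \<odot>\<^bsub>U\<^esub> f b) = f h"
proof -
  have "f h = f (sw H h (\<lambda>a b. eps a \<odot> b))" using counit_left[OF assms(3)] by simp
  also have "\<dots> = sw U h (\<lambda>a b. f (eps a \<odot> b))"
    by (rule lin_sw) (intro assms lin_intros; assumption?)+
  also have "\<dots> = sw U h (\<lambda>a b. eps a \<odot>\<^bsub>U\<^esub> f b)"
    by (rule sw_cong) (simp_all add: assms lin_smult[OF assms(2)])
  finally show ?thesis by simp
qed

lemma sw_counit_right:
  assumes "vsp U" "lin H U f" "h \<in> carrier H"
  shows "sw U h (\<lambda>a b. eps b \<odot>\<^bsub>U\<^esub> f a) = f h"
proof -
  have "f h = f (sw H h (\<lambda>a b. eps b \<odot> a))" using counit_right[OF assms(3)] by simp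
  also have "\<dots> = sw U h (\<lambda>a b. f (eps b \<odot> a))"
    by (rule lin_sw) (intro assms lin_intros; assumption?)+
  also have "\<dots> = sw U h (\<lambda>a b. eps b \<odot>\<^bsub>U\<^esub> f a)"
    by (rule sw_cong) (simp_all add: assms lin_smult[OF assms(2)])
  finally show ?thesis by simp
qed

lemma sw_antipode_left:
  assumes "vsp U" "lin H U f" "h \<in> carrier H"
  shows "sw U h (\<lambda>a b. f (S a \<otimes> b)) = eps h \<odot>\<^bsub>U\<^esub> f \<one>"
proof -
  have "sw U h (\<lambda>a b. f (S a \<otimes> b)) = f (sw H h (\<lambda>a b. S a \<otimes> b))"
    by (rule lin_sw[symmetric]) (intro assms lin_intros; assumption?)+
  then show ?thesis by (simp add: antipode_left assms lin_smult[OF assms(2)])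
qed

lemma sw_antipode_right:
  assumes "vsp U" "lin H U f" "h \<in> carrier H"
  shows "sw U h (\<lambda>a b. f (a \<otimes> S b)) = eps h \<odot>\<^bsub>U\<^esub> f \<one>"
proof -
  have "sw U h (\<lambda>a b. f (a \<otimes> S b)) = f (sw H h (\<lambda>a b. a \<otimes> S b))"
    by (rule lin_sw[symmetric]) (intro assms lin_intros; assumption?)+
  then show ?thesis by (simp add: antipode_right assms lin_smult[OF assms(2)])
qed

lemma sw_one: "vsp U \<Longrightarrow> bil H H U f \<Longrightarrow> sw U \<one> f = f \<one> \<one>"
  by (simp add: comult_one tensor_algebra_def sweedler_pure)

lemma sw_mult:
  assumes U: "vsp U" and f: "bil H H U f" and x: "x \<in> carrier H" and y: "y \<in> carrier H"
  shows "sw U (x \<otimes> y) f = sw U x (\<lambda>x\<^sub>1 x\<^sub>2. sw U y (\<lambda>y\<^sub>1 y\<^sub>2. f (x\<^sub>1 \<otimes> y\<^sub>1) (x\<^sub>2 \<otimes> y\<^sub>2)))"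
proof -
  let ?T = "tensor_space H H"
  have T: "vsp ?T" by simp
  have g: "lin ?T U (sweedler H H U f)" by (rule lin_sweedler[OF vsp_H U f])
  have "comult H (x \<otimes> y) = sw ?T x (\<lambda>x\<^sub>1 x\<^sub>2. sw ?T y (\<lambda>y\<^sub>1 y\<^sub>2. pure_tensor H H (x\<^sub>1 \<otimes> y\<^sub>1) (x\<^sub>2 \<otimes> y\<^sub>2)))"
    using comult_mult[OF x y] by (simp add: tensor_algebra_def)
  then have "sw U (x \<otimes> y) f
      = sweedler H H U f (sw ?T x (\<lambda>x\<^sub>1 x\<^sub>2. sw ?T y (\<lambda>y\<^sub>1 y\<^sub>2. pure_tensor H H (x\<^sub>1 \<otimes> y\<^sub>1) (x\<^sub>2 \<otimes> y\<^sub>2))))"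
    by simp
  also have "\<dots> = sw U x (\<lambda>x\<^sub>1 x\<^sub>2. sweedler H H U f (sw ?T y (\<lambda>y\<^sub>1 y\<^sub>2. pure_tensor H H (x\<^sub>1 \<otimes> y\<^sub>1) (x\<^sub>2 \<otimes> y\<^sub>2))))"
    by (rule lin_sw[OF g T U _ x]) (intro lin_intros y)
  also have "\<dots> = sw U x (\<lambda>x\<^sub>1 x\<^sub>2. sw U y (\<lambda>y\<^sub>1 y\<^sub>2. f (x\<^sub>1 \<otimes> y\<^sub>1) (x\<^sub>2 \<otimes> y\<^sub>2)))"
  proof (rule sw_cong[OF x])
    fix a b assume *: "a \<in> carrier H" "b \<in> carrier H"
    have "sweedler H H U f (sw ?T y (\<lambda>y\<^sub>1 y\<^sub>2. pure_tensor H H (a \<otimes> y\<^sub>1) (b \<otimes> y\<^sub>2)))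
        = sw U y (\<lambda>y\<^sub>1 y\<^sub>2. sweedler H H U f (pure_tensor H H (a \<otimes> y\<^sub>1) (b \<otimes> y\<^sub>2)))"
      by (rule lin_sw[OF g T U _ y]) (intro lin_intros *)
    also have "\<dots> = sw U y (\<lambda>y\<^sub>1 y\<^sub>2. f (a \<otimes> y\<^sub>1) (b \<otimes> y\<^sub>2))"
      by (rule sw_cong[OF y]) (simp add: sweedler_pure[OF U f] *)
    finally show "sweedler H H U f (sw ?T y (\<lambda>y\<^sub>1 y\<^sub>2. pure_tensor H H (a \<otimes> y\<^sub>1) (b \<otimes> y\<^sub>2)))
      = sw U y (\<lambda>y\<^sub>1 y\<^sub>2. f (a \<otimes> y\<^sub>1) (b \<otimes> y\<^sub>2))" .
  qed
  finally show ?thesis .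
qed

lemma sw_swap:
  assumes "vsp U" "x \<in> carrier H" "y \<in> carrier H"
    and "\<And>a b. a \<in> carrier H \<Longrightarrow> b \<in> carrier H \<Longrightarrow> bil H H U (f a b)"
    and "\<And>a b. a \<in> carrier H \<Longrightarrow> b \<in> carrier H \<Longrightarrow> bil H H U (\<lambda>c d. f c d a b)"
  shows "sw U x (\<lambda>a b. sw U y (\<lambda>c d. f a b c d)) = sw U y (\<lambda>c d. sw U x (\<lambda>a b. f a b c d))"
  by (rule sweedler_swap) (use assms in auto)

text \<open>By coassociativity \<open>k\<close> is applied to the last two of three components,
  where \<open>cancel\<close> leaves a counit, and the counit axiom then removes the component.
  \<open>k\<close> may be any product of the identity with the antipode or its inverse that cancels
  in the sense of \<open>cancel\<close>.\<close>

lemma sw_absorb: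
  assumes U: "vsp U" and f: "bil H H U f" and h: "h \<in> carrier H" and k: "bil H H H k"
    and cancel: "\<And>h f. h \<in> carrier H \<Longrightarrow> lin H U f \<Longrightarrow> sw U h (\<lambda>a b. f (k a b)) = eps h \<odot>\<^bsub>U\<^esub> f \<one>"
  shows "sw U h (\<lambda>a b. sw U a (\<lambda>a\<^sub>1 a\<^sub>2. f a\<^sub>1 (k a\<^sub>2 b))) = f h \<one>"
proof -
  note fl [lin_intros] = bil_comp_left[OF f] bil_comp_right[OF f] bil_closed[OF f]
    bil_comp_left[OF k] bil_comp_right[OF k] bil_closed[OF k]
  have "sw U h (\<lambda>a b. sw U a (\<lambda>a\<^sub>1 a\<^sub>2. f a\<^sub>1 (k a\<^sub>2 b))) = sw U h (\<lambda>a b. sw U b (\<lambda>b\<^sub>1 b\<^sub>2. f a (k b\<^sub>1 b\<^sub>2)))"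
    by (rule sw_coassoc[OF U h]) (assumption | intro lin_intros; assumption?)+
  also have "\<dots> = sw U h (\<lambda>a b. eps b \<odot>\<^bsub>U\<^esub> f a \<one>)"
    by (rule sw_cong[OF h], rule cancel, assumption, rule bil_right[OF f])
  also have "\<dots> = f h \<one>"
    by (rule sw_counit_right[OF U _ h]) (assumption | intro lin_intros; assumption?)+
  finally show ?thesis .
qed

lemma sw_absorb_right:
  assumes U: "vsp U" and f: "bil H H U f" and h: "h \<in> carrier H"
  shows "sw U h (\<lambda>a b. sw U a (\<lambda>a\<^sub>1 a\<^sub>2. f a\<^sub>1 (a\<^sub>2 \<otimes> S b))) = f h \<one>"
  by (rule sw_absorb[OF U f h, where k = "\<lambda>a b. a \<otimes> S b"])
    (assumption | intro lin_intros sw_antipode_right[OF U]; assumption?)+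

lemma antipode_one: "S \<one> = \<one>"
proof -
  have "sw H \<one> (\<lambda>a b. S a \<otimes> b) = eps \<one> \<odot> \<one>" by (rule antipode_left) simp
  moreover have "sw H \<one> (\<lambda>a b. S a \<otimes> b) = S \<one> \<otimes> \<one>"
    by (rule sw_one) (intro lin_intros)+
  ultimately show ?thesis by (simp add: counit_one)
qed

lemma counit_antipode:
  assumes x: "x \<in> carrier H"
  shows "eps (S x) = eps x"
proof -
  have "eps x * eps \<one> = sw scalars x (\<lambda>a b. eps (S a \<otimes> b))"
    using sw_antipode_left[OF vsp_scalars counit_linear x] by simp
  also have "\<dots> = sw scalars x (\<lambda>a b. eps b \<odot>\<^bsub>scalars\<^esub> eps (S a))"
    by (rule sw_cong[OF x]) (simp add: counit_mult)
  also have "\<dots> = eps (S x)"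
    by (rule sw_counit_right[OF vsp_scalars _ x]) (intro lin_intros)
  finally show ?thesis by (simp add: counit_one)
qed

text \<open>Both sides are convolution inverses of the multiplication. Concretely, \<open>x\<^sub>2
  \<otimes> y\<^sub>2 \<otimes> S y\<^sub>3 \<otimes> S x\<^sub>3\<close>, which sums to counits, is
  inserted after \<open>S (x\<^sub>1 \<otimes> y\<^sub>1)\<close>; the antipode axiom for the
  product of \<open>x\<close> and \<open>y\<close> then cancels the front part and leaves
  \<open>S y \<otimes> S x\<close>.\<close>

lemma antipode_mult:
  assumes x: "x \<in> carrier H" and y: "y \<in> carrier H"
  shows "S (x \<otimes> y) = S y \<otimes> S x"
proof -
  have "S (x \<otimes> y) = S (x \<otimes> y) \<otimes> \<one>" using x y by simp
  also have "\<dots> = sw H x (\<lambda>x' x\<^sub>3. sw H x' (\<lambda>x\<^sub>1 x\<^sub>2. S (x\<^sub>1 \<otimes> y) \<otimes> (x\<^sub>2 \<otimes> S x\<^sub>3)))"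
    by (rule sw_absorb_right[symmetric, OF vsp_H _ x]) (intro lin_intros y)
  also have "\<dots> = sw H x (\<lambda>x' x\<^sub>3. sw H x' (\<lambda>x\<^sub>1 x\<^sub>2. sw H y (\<lambda>y' y\<^sub>3. sw H y' (\<lambda>y\<^sub>1 y\<^sub>2.
      S (x\<^sub>1 \<otimes> y\<^sub>1) \<otimes> (x\<^sub>2 \<otimes> ((y\<^sub>2 \<otimes> S y\<^sub>3) \<otimes> S x\<^sub>3))))))"
  proof (intro sw_cong x)
    fix x' x\<^sub>3 x\<^sub>1 x\<^sub>2 assume *: "x' \<in> carrier H" "x\<^sub>3 \<in> carrier H" "x\<^sub>1 \<in> carrier H" "x\<^sub>2 \<in> carrier H"
    show "S (x\<^sub>1 \<otimes> y) \<otimes> (x\<^sub>2 \<otimes> S x\<^sub>3) = sw H y (\<lambda>y' y\<^sub>3. sw H y' (\<lambda>y\<^sub>1 y\<^sub>2.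
      S (x\<^sub>1 \<otimes> y\<^sub>1) \<otimes> (x\<^sub>2 \<otimes> ((y\<^sub>2 \<otimes> S y\<^sub>3) \<otimes> S x\<^sub>3))))"
      using * by (subst sw_absorb_right[OF vsp_H _ y, of "\<lambda>a w. S (x\<^sub>1 \<otimes> a) \<otimes> (x\<^sub>2 \<otimes> (w \<otimes> S x\<^sub>3))"])
        ((intro lin_intros; simp), simp)
  qed
  also have "\<dots> = sw H x (\<lambda>x' x\<^sub>3. sw H x' (\<lambda>x\<^sub>1 x\<^sub>2. sw H y (\<lambda>y' y\<^sub>3. sw H y' (\<lambda>y\<^sub>1 y\<^sub>2.
      S (x\<^sub>1 \<otimes> y\<^sub>1) \<otimes> (x\<^sub>2 \<otimes> y\<^sub>2) \<otimes> (S y\<^sub>3 \<otimes> S x\<^sub>3)))))"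
    by (intro sw_cong x y) (simp_all add: assoc_H)
  also have "\<dots> = sw H x (\<lambda>x' x\<^sub>3. sw H y (\<lambda>y' y\<^sub>3. sw H x' (\<lambda>x\<^sub>1 x\<^sub>2. sw H y' (\<lambda>y\<^sub>1 y\<^sub>2.
      S (x\<^sub>1 \<otimes> y\<^sub>1) \<otimes> (x\<^sub>2 \<otimes> y\<^sub>2) \<otimes> (S y\<^sub>3 \<otimes> S x\<^sub>3)))))"
    by (rule sw_cong[OF x], rule sw_swap) (assumption | intro lin_intros y; assumption?)+
  also have "\<dots> = sw H x (\<lambda>x' x\<^sub>3. sw H y (\<lambda>y' y\<^sub>3. eps x' \<odot> (eps y' \<odot> (S y\<^sub>3 \<otimes> S x\<^sub>3))))"
  proof (intro sw_cong x y)
    fix x' x\<^sub>3 y' y\<^sub>3 assume *: "x' \<in> carrier H" "x\<^sub>3 \<in> carrier H" "y' \<in> carrier H" "y\<^sub>3 \<in> carrier H"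
    have "sw H x' (\<lambda>x\<^sub>1 x\<^sub>2. sw H y' (\<lambda>y\<^sub>1 y\<^sub>2. S (x\<^sub>1 \<otimes> y\<^sub>1) \<otimes> (x\<^sub>2 \<otimes> y\<^sub>2) \<otimes> (S y\<^sub>3 \<otimes> S x\<^sub>3)))
        = sw H (x' \<otimes> y') (\<lambda>a b. S a \<otimes> b \<otimes> (S y\<^sub>3 \<otimes> S x\<^sub>3))"
      by (rule sw_mult[symmetric]) (intro lin_intros *; simp add: *)+
    also have "\<dots> = eps (x' \<otimes> y') \<odot> (\<one> \<otimes> (S y\<^sub>3 \<otimes> S x\<^sub>3))"
      by (rule sw_antipode_left) (intro lin_intros; simp add: *)+
    finally show "sw H x' (\<lambda>x\<^sub>1 x\<^sub>2. sw H y' (\<lambda>y\<^sub>1 y\<^sub>2. S (x\<^sub>1 \<otimes> y\<^sub>1) \<otimes> (x\<^sub>2 \<otimes> y\<^sub>2) \<otimes> (S y\<^sub>3 \<otimes> S x\<^sub>3)))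
      = eps x' \<odot> (eps y' \<odot> (S y\<^sub>3 \<otimes> S x\<^sub>3))"
      using * by (simp add: counit_mult)
  qed
  also have "\<dots> = sw H x (\<lambda>x' x\<^sub>3. eps x' \<odot> (S y \<otimes> S x\<^sub>3))"
  proof (rule sw_cong[OF x])
    fix x' x\<^sub>3 assume *: "x' \<in> carrier H" "x\<^sub>3 \<in> carrier H"
    have "sw H y (\<lambda>y' y\<^sub>3. eps x' \<odot> (eps y' \<odot> (S y\<^sub>3 \<otimes> S x\<^sub>3)))
        = sw H y (\<lambda>y' y\<^sub>3. eps y' \<odot> (eps x' \<odot> (S y\<^sub>3 \<otimes> S x\<^sub>3)))"
      by (rule sw_cong[OF y]) (simp add: * mult.commute)
    also have "\<dots> = eps x' \<odot> (S y \<otimes> S x\<^sub>3)"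
      by (rule sw_counit_left) (assumption | intro lin_intros * y; assumption?)+
    finally show "sw H y (\<lambda>y' y\<^sub>3. eps x' \<odot> (eps y' \<odot> (S y\<^sub>3 \<otimes> S x\<^sub>3))) = eps x' \<odot> (S y \<otimes> S x\<^sub>3)" .
  qed
  also have "\<dots> = S y \<otimes> S x"
    by (rule sw_counit_left) (assumption | intro lin_intros x y; assumption?)+
  finally show ?thesis .
qed

lemma sw_antipode:
  assumes U: "vsp U" and f: "bil H H U f" and x: "x \<in> carrier H"
  shows "sw U (S x) f = sw U x (\<lambda>a b. f (S b) (S a))"
proof -
  note fl [lin_intros] = bil_comp_left[OF f] bil_comp_right[OF f] bil_closed[OF f]
  note U [lin_intros]
  have "sw U (S x) f = sw U (S x) (\<lambda>s\<^sub>1 s\<^sub>2. f (s\<^sub>1 \<otimes> \<one>) s\<^sub>2)"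
    by (rule sw_cong) (simp_all add: x)
  also have "\<dots> = sw U x (\<lambda>x' x\<^sub>3. sw U x' (\<lambda>x\<^sub>1 x\<^sub>2. sw U (S x\<^sub>1) (\<lambda>s\<^sub>1 s\<^sub>2. f (s\<^sub>1 \<otimes> (x\<^sub>2 \<otimes> S x\<^sub>3)) s\<^sub>2)))"
    by (rule sw_absorb_right[symmetric, OF U _ x, of "\<lambda>a w. sw U (S a) (\<lambda>s\<^sub>1 s\<^sub>2. f (s\<^sub>1 \<otimes> w) s\<^sub>2)"])
      (intro lin_intros; assumption?)
  also have "\<dots> = sw U x (\<lambda>x' x\<^sub>3. sw U x' (\<lambda>x\<^sub>1 x\<^sub>2. sw U (S x\<^sub>1) (\<lambda>s\<^sub>1 s\<^sub>2.
      sw U x\<^sub>2 (\<lambda>p q. sw U p (\<lambda>p\<^sub>1 p\<^sub>2. f (s\<^sub>1 \<otimes> (p\<^sub>1 \<otimes> S x\<^sub>3)) (s\<^sub>2 \<otimes> (p\<^sub>2 \<otimes> S q)))))))"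
  proof (intro sw_cong x antipode_closed)
    fix x\<^sub>1 x\<^sub>2 x\<^sub>3 s\<^sub>1 s\<^sub>2
    assume *: "x\<^sub>1 \<in> carrier H" "x\<^sub>2 \<in> carrier H" "x\<^sub>3 \<in> carrier H" "s\<^sub>1 \<in> carrier H" "s\<^sub>2 \<in> carrier H"
    have "f (s\<^sub>1 \<otimes> (x\<^sub>2 \<otimes> S x\<^sub>3)) (s\<^sub>2 \<otimes> \<one>) =
        sw U x\<^sub>2 (\<lambda>p q. sw U p (\<lambda>p\<^sub>1 p\<^sub>2. f (s\<^sub>1 \<otimes> (p\<^sub>1 \<otimes> S x\<^sub>3)) (s\<^sub>2 \<otimes> (p\<^sub>2 \<otimes> S q))))"
      by (rule sw_absorb_right[symmetric, OF U _ *(2), of "\<lambda>a w. f (s\<^sub>1 \<otimes> (a \<otimes> S x\<^sub>3)) (s\<^sub>2 \<otimes> w)"])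
        (intro lin_intros *; assumption?)
    then show "f (s\<^sub>1 \<otimes> (x\<^sub>2 \<otimes> S x\<^sub>3)) s\<^sub>2 =
        sw U x\<^sub>2 (\<lambda>p q. sw U p (\<lambda>p\<^sub>1 p\<^sub>2. f (s\<^sub>1 \<otimes> (p\<^sub>1 \<otimes> S x\<^sub>3)) (s\<^sub>2 \<otimes> (p\<^sub>2 \<otimes> S q))))"
      using * by simp
  qed
  also have "\<dots> = sw U x (\<lambda>x' x\<^sub>3. sw U x' (\<lambda>x\<^sub>1 x\<^sub>2. sw U x\<^sub>2 (\<lambda>p q. sw U (S x\<^sub>1) (\<lambda>s\<^sub>1 s\<^sub>2.
      sw U p (\<lambda>p\<^sub>1 p\<^sub>2. f (s\<^sub>1 \<otimes> (p\<^sub>1 \<otimes> S x\<^sub>3)) (s\<^sub>2 \<otimes> (p\<^sub>2 \<otimes> S q)))))))"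
    by (rule sw_cong[OF x], rule sw_cong, assumption, rule sw_swap[OF U]) (assumption | intro lin_intros; assumption?)+
  also have "\<dots> = sw U x (\<lambda>x' x\<^sub>3. sw U x' (\<lambda>x\<^sub>1 x\<^sub>2. sw U x\<^sub>2 (\<lambda>p q.
      sw U (S x\<^sub>1 \<otimes> p) (\<lambda>u v. f (u \<otimes> S x\<^sub>3) (v \<otimes> S q)))))"
  proof (intro sw_cong x)
    fix x\<^sub>1 x\<^sub>3 p q assume *: "x\<^sub>1 \<in> carrier H" "x\<^sub>3 \<in> carrier H" "p \<in> carrier H" "q \<in> carrier H"
    have "sw U (S x\<^sub>1 \<otimes> p) (\<lambda>u v. f (u \<otimes> S x\<^sub>3) (v \<otimes> S q)) = sw U (S x\<^sub>1) (\<lambda>s\<^sub>1 s\<^sub>2.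
      sw U p (\<lambda>p\<^sub>1 p\<^sub>2. f ((s\<^sub>1 \<otimes> p\<^sub>1) \<otimes> S x\<^sub>3) ((s\<^sub>2 \<otimes> p\<^sub>2) \<otimes> S q)))"
      by (rule sw_mult) (intro lin_intros *; assumption?)+
    also have "\<dots> = sw U (S x\<^sub>1) (\<lambda>s\<^sub>1 s\<^sub>2.
      sw U p (\<lambda>p\<^sub>1 p\<^sub>2. f (s\<^sub>1 \<otimes> (p\<^sub>1 \<otimes> S x\<^sub>3)) (s\<^sub>2 \<otimes> (p\<^sub>2 \<otimes> S q))))"
      by (intro sw_cong antipode_closed *) (simp add: assoc_H *)
    finally show "sw U (S x\<^sub>1) (\<lambda>s\<^sub>1 s\<^sub>2.
      sw U p (\<lambda>p\<^sub>1 p\<^sub>2. f (s\<^sub>1 \<otimes> (p\<^sub>1 \<otimes> S x\<^sub>3)) (s\<^sub>2 \<otimes> (p\<^sub>2 \<otimes> S q)))) =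
      sw U (S x\<^sub>1 \<otimes> p) (\<lambda>u v. f (u \<otimes> S x\<^sub>3) (v \<otimes> S q))" by simp
  qed
  also have "\<dots> = sw U x (\<lambda>x' x\<^sub>3. sw U x' (\<lambda>y q. sw U y (\<lambda>x\<^sub>1 p.
      sw U (S x\<^sub>1 \<otimes> p) (\<lambda>u v. f (u \<otimes> S x\<^sub>3) (v \<otimes> S q)))))"
    by (rule sw_cong[OF x], rule sw_coassoc[symmetric, OF U]) (assumption | intro lin_intros; assumption?)+
  also have "\<dots> = sw U x (\<lambda>x' x\<^sub>3. sw U x' (\<lambda>y q. eps y \<odot>\<^bsub>U\<^esub> f (S x\<^sub>3) (S q)))"
  proof (intro sw_cong x)
    fix x\<^sub>3 y q assume *: "x\<^sub>3 \<in> carrier H" "y \<in> carrier H" "q \<in> carrier H"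
    have b: "bil H H U (\<lambda>u v. f (u \<otimes> S x\<^sub>3) (v \<otimes> S q))" by (intro lin_intros *; assumption?)
    have "sw U y (\<lambda>x\<^sub>1 p. sw U (S x\<^sub>1 \<otimes> p) (\<lambda>u v. f (u \<otimes> S x\<^sub>3) (v \<otimes> S q)))
      = eps y \<odot>\<^bsub>U\<^esub> sw U \<one> (\<lambda>u v. f (u \<otimes> S x\<^sub>3) (v \<otimes> S q))"
      by (rule sw_antipode_left[OF U _ *(2)]) (intro lin_intros *; assumption?)
    then show "sw U y (\<lambda>x\<^sub>1 p. sw U (S x\<^sub>1 \<otimes> p) (\<lambda>u v. f (u \<otimes> S x\<^sub>3) (v \<otimes> S q)))
      = eps y \<odot>\<^bsub>U\<^esub> f (S x\<^sub>3) (S q)"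
      using * by (simp add: sw_one[OF U b])
  qed
  also have "\<dots> = sw U x (\<lambda>x' x\<^sub>3. f (S x\<^sub>3) (S x'))"
    by (rule sw_cong[OF x], rule sw_counit_left[OF U]) (assumption | intro lin_intros; assumption?)+
  finally show ?thesis .
qed

end

section \<open>Dual bases of a finite dimensional Hopf algebra\<close>

locale fin_dim_hopf = hopf_algebra H for H :: "('k::field, 'a, 'x) hopf_scheme" (structure) +
  assumes finite_dimensional: "vectorspace.fin_dim class_ring H"
begin

text \<open>\<open>canon\<close> is the sum of the \<open>e\<^sub>i \<otimes> e\<^sup>i\<close> for any pair of dual bases, so that \<open>tr\<close> below is summation
  over dual bases.\<close>

definition canon :: "('k, 'a, 'a \<Rightarrow> 'k) tensor" where
  "canon = (SOME t. t \<in> carrier (tensor_space H (dual_space H)) \<and>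
    (\<forall>v\<in>carrier H. sweedler H (dual_space H) H (\<lambda>e p. ev p v \<odot> e) t = v))"

abbreviation dual where "dual \<equiv> dual_space H"
abbreviation tr where "tr U f \<equiv> sweedler H dual U f canon"

lemma canon: "canon \<in> carrier (tensor_space H dual)"
    "v \<in> carrier H \<Longrightarrow> tr H (\<lambda>e p. ev p v \<odot> e) = v"
  using someI_ex[of "\<lambda>t. t \<in> carrier (tensor_space H (dual_space H)) \<and>
    (\<forall>v\<in>carrier H. sweedler H (dual_space H) H (\<lambda>e p. ev p v \<odot> e) t = v)"]
    dual_basis_exists[OF vsp_H finite_dimensional] unfolding canon_def by blast+

lemmas canon_closed [simp, lin_intros] = canon(1)
lemmas lin_ev_intros [lin_intros] = lin_compose[OF lin_ev_left[where V = H]] lin_compose[OF lin_ev[where V = H]]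

lemma tr_cong:
  "(\<And>e p. e \<in> carrier H \<Longrightarrow> p \<in> carrier dual \<Longrightarrow> f e p = g e p) \<Longrightarrow> tr U f = tr U g"
  by (rule sweedler_cong) auto

lemma lin_tr: "lin U U' g \<Longrightarrow> vsp U \<Longrightarrow> vsp U' \<Longrightarrow> bil H dual U f \<Longrightarrow> g (tr U f) = tr U' (\<lambda>e p. g (f e p))"
  by (rule lin_of_sweedler) auto

lemma tr_vector:
  assumes U: "vsp U" and f: "lin H U f" and v: "v \<in> carrier H"
  shows "tr U (\<lambda>e p. ev p v \<odot>\<^bsub>U\<^esub> f e) = f v"
proof -
  have "f v = f (tr H (\<lambda>e p. ev p v \<odot> e))" using canon(2)[OF v] by simp
  also have "\<dots> = tr U (\<lambda>e p. f (ev p v \<odot> e))"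
    by (rule lin_tr[OF f vsp_H U]) (intro lin_intros v; assumption?)
  also have "\<dots> = tr U (\<lambda>e p. ev p v \<odot>\<^bsub>U\<^esub> f e)"
    by (rule tr_cong) (simp add: lin_smult[OF f])
  finally show ?thesis by simp
qed

text \<open>The companion of \<open>tr_vector\<close>: the expansion of a form. As
  \<open>canon\<close> is characterised by its effect on vectors, the case of the identity is
  checked by evaluating at vectors.\<close>

lemma tr_form:
  assumes U: "vsp U" and f: "lin dual U f" and q: "q \<in> carrier dual"
  shows "tr U (\<lambda>e p. ev q e \<odot>\<^bsub>U\<^esub> f p) = f q"
proof -
  have b: "bil H dual dual (\<lambda>e p. ev q e \<odot>\<^bsub>dual\<^esub> p)" by (intro lin_intros q; assumption?)
  have "tr dual (\<lambda>e p. ev q e \<odot>\<^bsub>dual\<^esub> p) = q"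
  proof (rule dual_eqI[where V = H])
    show "tr dual (\<lambda>e p. ev q e \<odot>\<^bsub>dual\<^esub> p) \<in> carrier dual" by (intro lin_intros b)
    fix v assume v: "v \<in> carrier H"
    have "ev (tr dual (\<lambda>e p. ev q e \<odot>\<^bsub>dual\<^esub> p)) v = tr scalars (\<lambda>e p. ev (ev q e \<odot>\<^bsub>dual\<^esub> p) v)"
      by (rule lin_tr[OF lin_ev_left[OF v] _ vsp_scalars b]) simp
    also have "\<dots> = tr scalars (\<lambda>e p. ev p v \<odot>\<^bsub>scalars\<^esub> ev q e)"
      by (rule tr_cong) (simp add: ev_smult v)
    also have "\<dots> = ev q v" by (rule tr_vector[OF vsp_scalars lin_ev v]) (rule q)
    finally show "ev (tr dual (\<lambda>e p. ev q e \<odot>\<^bsub>dual\<^esub> p)) v = ev q v" .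
  qed (rule q)
  then have "f q = f (tr dual (\<lambda>e p. ev q e \<odot>\<^bsub>dual\<^esub> p))" by simp
  also have "\<dots> = tr U (\<lambda>e p. f (ev q e \<odot>\<^bsub>dual\<^esub> p))"
    by (rule lin_tr[OF f _ U b]) simp
  also have "\<dots> = tr U (\<lambda>e p. ev q e \<odot>\<^bsub>U\<^esub> f p)"
    by (rule tr_cong) (simp add: lin_smult[OF f])
  finally show ?thesis by simp
qed

lemma tr_swap:
  assumes "vsp U"
    and "\<And>a b. a \<in> carrier H \<Longrightarrow> b \<in> carrier dual \<Longrightarrow> bil H dual U (f a b)"
    and "\<And>a b. a \<in> carrier H \<Longrightarrow> b \<in> carrier dual \<Longrightarrow> bil H dual U (\<lambda>c d. f c d a b)"
  shows "tr U (\<lambda>a b. tr U (\<lambda>c d. f a b c d)) = tr U (\<lambda>c d. tr U (\<lambda>a b. f a b c d))"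
  by (rule sweedler_swap) (use assms in auto)

lemma tr_sw_swap:
  assumes "vsp U" "x \<in> carrier H"
    and "\<And>a b. a \<in> carrier H \<Longrightarrow> b \<in> carrier dual \<Longrightarrow> bil H H U (f a b)"
    and "\<And>a b. a \<in> carrier H \<Longrightarrow> b \<in> carrier H \<Longrightarrow> bil H dual U (\<lambda>c d. f c d a b)"
  shows "tr U (\<lambda>a b. sw U x (\<lambda>c d. f a b c d)) = sw U x (\<lambda>c d. tr U (\<lambda>a b. f a b c d))"
  by (rule sweedler_swap) (use assms in auto)

text \<open>Both components of \<open>comult H x\<close> are expanded in dual bases. The rule is
  applied from right to left, to introduce two sums over bases.\<close>

lemma dual_mult_identity:
  assumes U: "vsp U" and x: "x \<in> carrier H" and f: "bil H H U f"
  shows "tr U (\<lambda>e p. tr U (\<lambda>e' q. sw U x (\<lambda>a b. ev p a \<odot>\<^bsub>U\<^esub> (ev q b \<odot>\<^bsub>U\<^esub> f e e')))) = sw U x f"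
proof -
  note fl [lin_intros] = bil_comp_left[OF f] bil_comp_right[OF f] bil_closed[OF f]
  note U [lin_intros] x [lin_intros]
  let ?g = "\<lambda>p q e e' a b. ev p a \<odot>\<^bsub>U\<^esub> (ev q b \<odot>\<^bsub>U\<^esub> f e e')"
  have "tr U (\<lambda>e p. tr U (\<lambda>e' q. sw U x (?g p q e e'))) = tr U (\<lambda>e p. sw U x (\<lambda>a b. tr U (\<lambda>e' q. ?g p q e e' a b)))"
    by (rule tr_cong, rule tr_sw_swap) (assumption | intro lin_intros; assumption?)+
  also have "\<dots> = sw U x (\<lambda>a b. tr U (\<lambda>e p. tr U (\<lambda>e' q. ?g p q e e' a b)))"
    by (rule tr_sw_swap) (assumption | intro lin_intros; assumption?)+
  also have "\<dots> = sw U x f"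
  proof (rule sw_cong[OF x])
    fix a b assume *: "a \<in> carrier H" "b \<in> carrier H"
    have "tr U (\<lambda>e p. tr U (\<lambda>e' q. ?g p q e e' a b)) = tr U (\<lambda>e p. ev p a \<odot>\<^bsub>U\<^esub> f e b)"
    proof (rule tr_cong)
      fix e p assume ep: "e \<in> carrier H" "p \<in> carrier dual"
      have "tr U (\<lambda>e' q. ?g p q e e' a b) = ev p a \<odot>\<^bsub>U\<^esub> tr U (\<lambda>e' q. ev q b \<odot>\<^bsub>U\<^esub> f e e')"
        by (rule sweedler_smult) (assumption | intro lin_intros * ep; assumption?)+
      also have "tr U (\<lambda>e' q. ev q b \<odot>\<^bsub>U\<^esub> f e e') = f e b"
        by (rule tr_vector[OF U bil_right[OF f ep(1)] *(2)])
      finally show "tr U (\<lambda>e' q. ?g p q e e' a b) = ev p a \<odot>\<^bsub>U\<^esub> f e b" .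
    qed
    also have "\<dots> = f a b" by (rule tr_vector[OF U bil_left[OF f *(2)] *(1)])
    finally show "tr U (\<lambda>e p. tr U (\<lambda>e' q. ?g p q e e' a b)) = f a b" .
  qed
  finally show ?thesis .
qed

text \<open>A left integral in the dual is obtained as the trace of an endomorphism, for any form \<open>q\<close>;
  not all of these integrals can vanish.\<close>

definition trace_form :: "('a \<Rightarrow> 'k) \<Rightarrow> 'a \<Rightarrow> 'k" where
  "trace_form q x = tr scalars (\<lambda>e p. sw scalars (x \<otimes> S (S e)) (\<lambda>u v. ev p u * ev q v))"

lemma lin_trace_form:
  assumes q: "q \<in> carrier dual"
  shows "lin H scalars (trace_form q)"
  unfolding trace_form_def by (intro lin_intros q; assumption?)

text \<open>If all these forms vanished, so would the sum of \<open>trace_form q (S e')\<close> over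
  dual bases \<open>e'\<close>, \<open>q\<close>. Merging its two basis sums into one turns it into
  the sum of \<open>ev r (S (S a \<otimes> b))\<close> over the components of basis vectors, and the
  antipode axiom evaluates this to \<open>eps \<one> = 1\<close>.\<close>

lemma trace_form_nonzero: "\<exists>q\<in>carrier dual. \<exists>x\<in>carrier H. trace_form q x \<noteq> 0"
proof (rule ccontr)
  assume "\<not> ?thesis"
  then have z: "trace_form q x = 0" if "q \<in> carrier dual" "x \<in> carrier H" for q x using that by blast
  have "1 = tr scalars (\<lambda>e r. ev r \<one> \<odot>\<^bsub>scalars\<^esub> eps e)"
    using tr_vector[OF vsp_scalars counit_linear, of \<one>] by (simp add: counit_one)
  also have "\<dots> = tr scalars (\<lambda>e r. sw scalars e (\<lambda>a b. ev r (S b \<otimes> S (S a))))"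
  proof (rule tr_cong)
    fix e r assume *: "e \<in> carrier H" "r \<in> carrier dual"
    have "sw scalars e (\<lambda>a b. ev r (S b \<otimes> S (S a))) = sw scalars e (\<lambda>a b. ev r (S (S a \<otimes> b)))"
      by (rule sw_cong) (simp_all add: * antipode_mult)
    also have "\<dots> = eps e \<odot>\<^bsub>scalars\<^esub> ev r (S \<one>)"
      by (rule sw_antipode_left) (intro lin_intros *; assumption?)+
    finally show "ev r \<one> \<odot>\<^bsub>scalars\<^esub> eps e = sw scalars e (\<lambda>a b. ev r (S b \<otimes> S (S a)))"
      by (simp add: antipode_one)
  qed
  \<comment> \<open>Expanding both components of \<open>e''\<close> detaches the argument of
    \<open>r\<close> from \<open>e''\<close>, so that the sum over \<open>e''\<close> and
    \<open>r\<close> can be carried out.\<close>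
  also have "\<dots> = tr scalars (\<lambda>e'' r. tr scalars (\<lambda>e p. tr scalars (\<lambda>e' q.
      sw scalars e'' (\<lambda>a b. ev p a \<odot>\<^bsub>scalars\<^esub> (ev q b \<odot>\<^bsub>scalars\<^esub> ev r (S e' \<otimes> S (S e)))))))"
    by (rule tr_cong, rule dual_mult_identity[symmetric]) (assumption | intro lin_intros; assumption?)+
  also have "\<dots> = tr scalars (\<lambda>e p. tr scalars (\<lambda>e'' r. tr scalars (\<lambda>e' q.
      sw scalars e'' (\<lambda>a b. ev p a \<odot>\<^bsub>scalars\<^esub> (ev q b \<odot>\<^bsub>scalars\<^esub> ev r (S e' \<otimes> S (S e)))))))"
    by (rule tr_swap) (assumption | intro lin_intros; assumption?)+
  also have "\<dots> = tr scalars (\<lambda>e p. tr scalars (\<lambda>e' q. tr scalars (\<lambda>e'' r.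
      sw scalars e'' (\<lambda>a b. ev p a \<odot>\<^bsub>scalars\<^esub> (ev q b \<odot>\<^bsub>scalars\<^esub> ev r (S e' \<otimes> S (S e)))))))"
    by (rule tr_cong, rule tr_swap) (assumption | intro lin_intros; assumption?)+
  also have "\<dots> = tr scalars (\<lambda>e p. tr scalars (\<lambda>e' q.
      sw scalars (S e' \<otimes> S (S e)) (\<lambda>a b. ev p a * ev q b)))"
  proof (intro tr_cong)
    fix e p e' q assume *: "e \<in> carrier H" "p \<in> carrier dual" "e' \<in> carrier H" "q \<in> carrier dual"
    have "sw scalars (S e' \<otimes> S (S e)) (\<lambda>a b. ev p a * ev q b)
      = tr scalars (\<lambda>e'' r. ev r (S e' \<otimes> S (S e)) \<odot>\<^bsub>scalars\<^esub> sw scalars e'' (\<lambda>a b. ev p a * ev q b))"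
      by (rule tr_vector[symmetric]) (assumption | intro lin_intros *; assumption?)+
    also have "\<dots> = tr scalars (\<lambda>e'' r.
      sw scalars e'' (\<lambda>a b. ev r (S e' \<otimes> S (S e)) \<odot>\<^bsub>scalars\<^esub> (ev p a * ev q b)))"
      by (rule tr_cong, rule sweedler_smult[symmetric]) (assumption | intro lin_intros *; assumption?)+
    finally show "tr scalars (\<lambda>e'' r. sw scalars e'' (\<lambda>a b. ev p a \<odot>\<^bsub>scalars\<^esub> (ev q b \<odot>\<^bsub>scalars\<^esub> ev r (S e' \<otimes> S (S e)))))
       = sw scalars (S e' \<otimes> S (S e)) (\<lambda>a b. ev p a * ev q b)"
      by (simp add: algebra_simps)
  qed
  also have "\<dots> = tr scalars (\<lambda>e' q. trace_form q (S e'))"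
    unfolding trace_form_def by (rule tr_swap) (assumption | intro lin_intros; assumption?)+
  also have "\<dots> = tr scalars (\<lambda>e' q. 0 \<odot>\<^bsub>scalars\<^esub> ev q e')"
    by (rule tr_cong) (simp add: z)
  also have "\<dots> = 0 \<odot>\<^bsub>scalars\<^esub> tr scalars (\<lambda>e' q. ev q e')"
    by (rule sweedler_smult) (assumption | intro lin_intros; assumption?)+
  finally show False by simp
qed

lemma sw_antipode_square:
  assumes U: "vsp U" and f: "bil H H U f" and x: "x \<in> carrier H"
  shows "sw U (S (S x)) f = sw U x (\<lambda>a b. f (S (S a)) (S (S b)))"
proof -
  note fl [lin_intros] = bil_comp_left[OF f] bil_comp_right[OF f] bil_closed[OF f]
  have "sw U (S (S x)) f = sw U (S x) (\<lambda>a b. f (S b) (S a))"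
    by (rule sw_antipode[OF U f]) (simp add: x)
  also have "\<dots> = sw U x (\<lambda>a b. f (S (S a)) (S (S b)))"
    by (rule sw_antipode[OF U _ x]) (intro lin_intros; assumption?)
  finally show ?thesis .
qed

text \<open>On the right the first leg acquires the factor
  \<open>S (S c) \<otimes> S e\<^sub>1 = S (e\<^sub>1 \<otimes> S c)\<close> with
  \<open>e\<^sub>1\<close> and \<open>c\<close> adjacent components of \<open>e\<close>, so it
  cancels. This cancellation is the reason for the square of \<open>S\<close> in
  \<open>trace_form\<close>.\<close>

lemma sw_twist:
  assumes U: "vsp U" and f: "bil H H U f" and x: "x \<in> carrier H" and e: "e \<in> carrier H"
  shows "sw U x (\<lambda>a b. f a (b \<otimes> S (S e)))
    = sw U e (\<lambda>e\<^sub>1 e\<^sub>2. sw U (x \<otimes> S (S e\<^sub>2)) (\<lambda>u w. f (u \<otimes> S e\<^sub>1) w))"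
proof -
  note fl [lin_intros] = bil_comp_left[OF f] bil_comp_right[OF f] bil_closed[OF f]
  note U [lin_intros] x [lin_intros] e [lin_intros]
  have "sw U e (\<lambda>e\<^sub>1 e\<^sub>2. sw U (x \<otimes> S (S e\<^sub>2)) (\<lambda>u w. f (u \<otimes> S e\<^sub>1) w))
    = sw U e (\<lambda>e\<^sub>1 e\<^sub>2. sw U x (\<lambda>a b. sw U e\<^sub>2 (\<lambda>c d. f (a \<otimes> S (e\<^sub>1 \<otimes> S c)) (b \<otimes> S (S d)))))"
  proof (rule sw_cong[OF e])
    fix e\<^sub>1 e\<^sub>2 assume *: "e\<^sub>1 \<in> carrier H" "e\<^sub>2 \<in> carrier H"
    have "sw U (x \<otimes> S (S e\<^sub>2)) (\<lambda>u w. f (u \<otimes> S e\<^sub>1) w)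
      = sw U x (\<lambda>a b. sw U (S (S e\<^sub>2)) (\<lambda>c d. f (a \<otimes> c \<otimes> S e\<^sub>1) (b \<otimes> d)))"
      by (rule sw_mult) (assumption | intro lin_intros *; assumption?)+
    also have "\<dots> = sw U x (\<lambda>a b. sw U e\<^sub>2 (\<lambda>c d. f (a \<otimes> S (S c) \<otimes> S e\<^sub>1) (b \<otimes> S (S d))))"
      by (rule sw_cong[OF x], rule sw_antipode_square) (assumption | intro lin_intros *; assumption?)+
    also have "\<dots> = sw U x (\<lambda>a b. sw U e\<^sub>2 (\<lambda>c d. f (a \<otimes> S (e\<^sub>1 \<otimes> S c)) (b \<otimes> S (S d))))"
      by (rule sw_cong[OF x], rule sw_cong[OF *(2)]) (simp add: antipode_mult assoc_H *)
    finally show "sw U (x \<otimes> S (S e\<^sub>2)) (\<lambda>u w. f (u \<otimes> S e\<^sub>1) w) = \<dots>" .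
  qed
  also have "\<dots> = sw U x (\<lambda>a b. sw U e (\<lambda>e\<^sub>1 e\<^sub>2. sw U e\<^sub>2 (\<lambda>c d. f (a \<otimes> S (e\<^sub>1 \<otimes> S c)) (b \<otimes> S (S d)))))"
    by (rule sw_swap) (assumption | intro lin_intros; assumption?)+
  also have "\<dots> = sw U x (\<lambda>a b. sw U e (\<lambda>y d. sw U y (\<lambda>e\<^sub>1 c. f (a \<otimes> S (e\<^sub>1 \<otimes> S c)) (b \<otimes> S (S d)))))"
    by (rule sw_cong[OF x], rule sw_coassoc[symmetric]) (assumption | intro lin_intros; assumption?)+
  also have "\<dots> = sw U x (\<lambda>a b. sw U e (\<lambda>y d. eps y \<odot>\<^bsub>U\<^esub> f (a \<otimes> S \<one>) (b \<otimes> S (S d))))"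
    by (rule sw_cong[OF x], rule sw_cong[OF e], rule sw_antipode_right)
      (assumption | intro lin_intros; assumption?)+
  also have "\<dots> = sw U x (\<lambda>a b. f (a \<otimes> S \<one>) (b \<otimes> S (S e)))"
    by (rule sw_cong[OF x], rule sw_counit_left) (assumption | intro lin_intros; assumption?)+
  also have "\<dots> = sw U x (\<lambda>a b. f a (b \<otimes> S (S e)))"
    by (rule sw_cong[OF x]) (simp add: antipode_one ring.ring_simprules[OF ring_H])
  finally show ?thesis by simp
qed

text \<open>Cyclicity of the trace. After \<open>sw_twist\<close> a second dual basis is introduced
  and the first one is contracted; the vector factor then becomes \<open>u \<otimes> S c\<close> for
  adjacent components \<open>u\<close> and \<open>c\<close>, which cancels to \<open>\<one>\<close>,
  and the trace over the second basis remains.\<close>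

lemma trace_form_integral:
  assumes q: "q \<in> carrier dual" and x: "x \<in> carrier H"
  shows "sw H x (\<lambda>a b. trace_form q b \<odot> a) = trace_form q x \<odot> \<one>"
proof -
  note q [lin_intros] x [lin_intros]
  let ?k = "\<lambda>p u v. ev p u * ev q v"
  have "sw H x (\<lambda>a b. trace_form q b \<odot> a)
      = sw H x (\<lambda>a b. tr H (\<lambda>e p. sw H (b \<otimes> S (S e)) (\<lambda>u v. ?k p u v \<odot> a)))"
  proof (rule sw_cong[OF x])
    fix a b assume *: "a \<in> carrier H" "b \<in> carrier H"
    have "trace_form q b \<odot> a = tr H (\<lambda>e p. sw scalars (b \<otimes> S (S e)) (?k p) \<odot> a)"
      unfolding trace_form_def
      by (rule sweedler_smult_vector[symmetric]) (assumption | intro lin_intros *; assumption?)+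
    also have "\<dots> = tr H (\<lambda>e p. sw H (b \<otimes> S (S e)) (\<lambda>u v. ?k p u v \<odot> a))"
      by (rule tr_cong, rule sweedler_smult_vector[symmetric]) (assumption | intro lin_intros *; assumption?)+
    finally show "trace_form q b \<odot> a = \<dots>" .
  qed
  also have "\<dots> = tr H (\<lambda>e p. sw H x (\<lambda>a b. sw H (b \<otimes> S (S e)) (\<lambda>u v. ?k p u v \<odot> a)))"
    by (rule tr_sw_swap[symmetric]) (assumption | intro lin_intros; assumption?)+
  also have "\<dots> = tr H (\<lambda>e p. sw H e (\<lambda>e\<^sub>1 e\<^sub>2. sw H (x \<otimes> S (S e\<^sub>2))
      (\<lambda>u w. sw H w (\<lambda>u\<^sub>2 u\<^sub>3. ?k p u\<^sub>2 u\<^sub>3 \<odot> (u \<otimes> S e\<^sub>1)))))"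
    by (rule tr_cong, rule sw_twist) (assumption | intro lin_intros; assumption?)+
  \<comment> \<open>The component \<open>e\<^sub>2\<close> is expanded in a second dual basis
    \<open>e'\<close>, \<open>p'\<close>, which frees the pair \<open>e\<close>, \<open>p\<close>
    for contraction.\<close>
  also have "\<dots> = tr H (\<lambda>e p. sw H e (\<lambda>e\<^sub>1 e\<^sub>2. tr H (\<lambda>e' p'. ev p' e\<^sub>2 \<odot> sw H (x \<otimes> S (S e'))
      (\<lambda>u w. sw H w (\<lambda>u\<^sub>2 u\<^sub>3. ?k p u\<^sub>2 u\<^sub>3 \<odot> (u \<otimes> S e\<^sub>1))))))"
    by (rule tr_cong, rule sw_cong, assumption, rule tr_vector[symmetric])
      (assumption | intro lin_intros; assumption?)+
  also have "\<dots> = tr H (\<lambda>e p. tr H (\<lambda>e' p'. sw H e (\<lambda>e\<^sub>1 e\<^sub>2. ev p' e\<^sub>2 \<odot> sw H (x \<otimes> S (S e'))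
      (\<lambda>u w. sw H w (\<lambda>u\<^sub>2 u\<^sub>3. ?k p u\<^sub>2 u\<^sub>3 \<odot> (u \<otimes> S e\<^sub>1))))))"
    by (rule tr_cong, rule tr_sw_swap[symmetric]) (assumption | intro lin_intros; assumption?)+
  also have "\<dots> = tr H (\<lambda>e' p'. tr H (\<lambda>e p. sw H e (\<lambda>e\<^sub>1 e\<^sub>2. ev p' e\<^sub>2 \<odot> sw H (x \<otimes> S (S e'))
      (\<lambda>u w. sw H w (\<lambda>u\<^sub>2 u\<^sub>3. ?k p u\<^sub>2 u\<^sub>3 \<odot> (u \<otimes> S e\<^sub>1))))))"
    by (rule tr_swap) (assumption | intro lin_intros; assumption?)+
  also have "\<dots> = tr H (\<lambda>e' p'. sw H (x \<otimes> S (S e')) (\<lambda>u v. ?k p' u v \<odot> \<one>))"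
  proof (rule tr_cong)
    fix e' p' assume *: "e' \<in> carrier H" "p' \<in> carrier dual"
    define z where "z = x \<otimes> S (S e')"
    have z: "z \<in> carrier H" unfolding z_def using * x by simp
    note * [lin_intros] z [lin_intros]
    have "tr H (\<lambda>e p. sw H e (\<lambda>e\<^sub>1 e\<^sub>2. ev p' e\<^sub>2 \<odot> sw H z (\<lambda>u w. sw H w (\<lambda>u\<^sub>2 u\<^sub>3. ?k p u\<^sub>2 u\<^sub>3 \<odot> (u \<otimes> S e\<^sub>1)))))
      = tr H (\<lambda>e p. sw H e (\<lambda>e\<^sub>1 e\<^sub>2. sw H z (\<lambda>u w. ev p' e\<^sub>2 \<odot> sw H w (\<lambda>u\<^sub>2 u\<^sub>3. ?k p u\<^sub>2 u\<^sub>3 \<odot> (u \<otimes> S e\<^sub>1)))))"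
      by (rule tr_cong, rule sw_cong, assumption, rule sweedler_smult[symmetric])
        (assumption | intro lin_intros; assumption?)+
    also have "\<dots> = tr H (\<lambda>e p. sw H e (\<lambda>e\<^sub>1 e\<^sub>2. sw H z (\<lambda>u w. sw H w (\<lambda>u\<^sub>2 u\<^sub>3. ev p' e\<^sub>2 \<odot> (?k p u\<^sub>2 u\<^sub>3 \<odot> (u \<otimes> S e\<^sub>1))))))"
      by (rule tr_cong, rule sw_cong, assumption, rule sw_cong[OF z], rule sweedler_smult[symmetric])
        (assumption | intro lin_intros; assumption?)+
    also have "\<dots> = tr H (\<lambda>e p. sw H z (\<lambda>u w. sw H e (\<lambda>e\<^sub>1 e\<^sub>2. sw H w (\<lambda>u\<^sub>2 u\<^sub>3. ev p' e\<^sub>2 \<odot> (?k p u\<^sub>2 u\<^sub>3 \<odot> (u \<otimes> S e\<^sub>1))))))"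
      by (rule tr_cong, rule sw_swap) (assumption | intro lin_intros; assumption?)+
    also have "\<dots> = tr H (\<lambda>e p. sw H z (\<lambda>u w. sw H w (\<lambda>u\<^sub>2 u\<^sub>3. sw H e (\<lambda>e\<^sub>1 e\<^sub>2. ev p' e\<^sub>2 \<odot> (?k p u\<^sub>2 u\<^sub>3 \<odot> (u \<otimes> S e\<^sub>1))))))"
      by (rule tr_cong, rule sw_cong[OF z], rule sw_swap) (assumption | intro lin_intros; assumption?)+
    also have "\<dots> = sw H z (\<lambda>u w. tr H (\<lambda>e p. sw H w (\<lambda>u\<^sub>2 u\<^sub>3. sw H e (\<lambda>e\<^sub>1 e\<^sub>2. ev p' e\<^sub>2 \<odot> (?k p u\<^sub>2 u\<^sub>3 \<odot> (u \<otimes> S e\<^sub>1))))))"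
      by (rule tr_sw_swap) (assumption | intro lin_intros; assumption?)+
    also have "\<dots> = sw H z (\<lambda>u w. sw H w (\<lambda>u\<^sub>2 u\<^sub>3. tr H (\<lambda>e p. sw H e (\<lambda>e\<^sub>1 e\<^sub>2. ev p' e\<^sub>2 \<odot> (?k p u\<^sub>2 u\<^sub>3 \<odot> (u \<otimes> S e\<^sub>1))))))"
      by (rule sw_cong[OF z], rule tr_sw_swap) (assumption | intro lin_intros; assumption?)+
    \<comment> \<open>The sum over \<open>e\<close> and \<open>p\<close> puts
      \<open>u\<^sub>2\<close> in the place of \<open>e\<close>.\<close>
    also have "\<dots> = sw H z (\<lambda>u w. sw H w (\<lambda>u\<^sub>2 u\<^sub>3. sw H u\<^sub>2 (\<lambda>c d. (ev p' d * ev q u\<^sub>3) \<odot> (u \<otimes> S c))))"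
    proof (rule sw_cong[OF z], rule sw_cong, assumption)
      fix u w u\<^sub>2 u\<^sub>3 assume **: "u \<in> carrier H" "u\<^sub>2 \<in> carrier H" "u\<^sub>3 \<in> carrier H"
      have "tr H (\<lambda>e p. sw H e (\<lambda>e\<^sub>1 e\<^sub>2. ev p' e\<^sub>2 \<odot> (?k p u\<^sub>2 u\<^sub>3 \<odot> (u \<otimes> S e\<^sub>1))))
        = tr H (\<lambda>e p. sw H e (\<lambda>e\<^sub>1 e\<^sub>2. ev p u\<^sub>2 \<odot> ((ev p' e\<^sub>2 * ev q u\<^sub>3) \<odot> (u \<otimes> S e\<^sub>1))))"
        by (rule tr_cong, rule sw_cong, assumption) (simp add: ** algebra_simps)
      also have "\<dots> = tr H (\<lambda>e p. ev p u\<^sub>2 \<odot> sw H e (\<lambda>e\<^sub>1 e\<^sub>2. (ev p' e\<^sub>2 * ev q u\<^sub>3) \<odot> (u \<otimes> S e\<^sub>1)))"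
        by (rule tr_cong, rule sweedler_smult) (assumption | intro lin_intros **; assumption?)+
      also have "\<dots> = sw H u\<^sub>2 (\<lambda>c d. (ev p' d * ev q u\<^sub>3) \<odot> (u \<otimes> S c))"
        by (rule tr_vector) (assumption | intro lin_intros **; assumption?)+
      finally show "tr H (\<lambda>e p. sw H e (\<lambda>e\<^sub>1 e\<^sub>2. ev p' e\<^sub>2 \<odot> (?k p u\<^sub>2 u\<^sub>3 \<odot> (u \<otimes> S e\<^sub>1)))) = \<dots>" .
    qed
    \<comment> \<open>Two uses of coassociativity make \<open>u\<close> and \<open>c\<close> the two
      components of one element \<open>y\<close>, so that \<open>u \<otimes> S c\<close>
      cancels.\<close>
    also have "\<dots> = sw H z (\<lambda>u w. sw H w (\<lambda>c w'. sw H w' (\<lambda>d u\<^sub>3. (ev p' d * ev q u\<^sub>3) \<odot> (u \<otimes> S c))))"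
      by (rule sw_cong[OF z], rule sw_coassoc) (assumption | intro lin_intros; assumption?)+
    also have "\<dots> = sw H z (\<lambda>y w'. sw H y (\<lambda>u c. sw H w' (\<lambda>d u\<^sub>3. (ev p' d * ev q u\<^sub>3) \<odot> (u \<otimes> S c))))"
      by (rule sw_coassoc[symmetric]) (assumption | intro lin_intros; assumption?)+
    also have "\<dots> = sw H z (\<lambda>y w'. eps y \<odot> sw H w' (\<lambda>d u\<^sub>3. (ev p' d * ev q u\<^sub>3) \<odot> \<one>))"
      by (rule sw_cong[OF z], rule sw_antipode_right) (assumption | intro lin_intros; assumption?)+
    also have "\<dots> = sw H z (\<lambda>d u\<^sub>3. (ev p' d * ev q u\<^sub>3) \<odot> \<one>)"
      by (rule sw_counit_left) (assumption | intro lin_intros; assumption?)+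
    finally show "tr H (\<lambda>e p. sw H e (\<lambda>e\<^sub>1 e\<^sub>2. ev p' e\<^sub>2 \<odot> sw H (x \<otimes> S (S e'))
        (\<lambda>u w. sw H w (\<lambda>u\<^sub>2 u\<^sub>3. ?k p u\<^sub>2 u\<^sub>3 \<odot> (u \<otimes> S e\<^sub>1)))))
      = sw H (x \<otimes> S (S e')) (\<lambda>u v. ?k p' u v \<odot> \<one>)"
      unfolding z_def .
  qed
  also have "\<dots> = tr H (\<lambda>e p. sw scalars (x \<otimes> S (S e)) (?k p) \<odot> \<one>)"
  proof (rule tr_cong)
    fix e p assume *: "e \<in> carrier H" "p \<in> carrier dual"
    have b: "bil H H scalars (?k p)" by (assumption | intro lin_intros *; assumption?)+
    show "sw H (x \<otimes> S (S e)) (\<lambda>u v. ?k p u v \<odot> \<one>) = sw scalars (x \<otimes> S (S e)) (?k p) \<odot> \<one>"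
      by (rule sweedler_smult_vector[OF _ vsp_H one_closed_H b]) (simp add: * x)
  qed
  also have "\<dots> = trace_form q x \<odot> \<one>"
  proof -
    have "bil H dual scalars (\<lambda>e p. sw scalars (x \<otimes> S (S e)) (?k p))"
      by (assumption | intro lin_intros; assumption?)+
    then show ?thesis
      unfolding trace_form_def by (rule sweedler_smult_vector[OF canon_closed vsp_H one_closed_H])
  qed
  finally show ?thesis .
qed

text \<open>Invariance of \<open>L\<close> at \<open>x \<otimes> S h\<^sub>1\<close>, multiplied by
  \<open>h\<^sub>2\<close>, produces after renumbering the factor
  \<open>S h\<^sub>2 \<otimes> h\<^sub>3\<close>. It cancels and leaves only values of
  \<open>L\<close> at \<open>x\<^sub>2 \<otimes> S h\<close>, which are 0. This is the fact
  \<open>z\<close>, from which \<open>L y \<odot> h = \<zero>\<close> is then derived.\<close>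

lemma antipode_kernel:
  assumes h: "h \<in> carrier H" and Sh: "S h = \<zero>"
  shows "h = \<zero>"
proof -
  obtain q y where q: "q \<in> carrier dual" and y: "y \<in> carrier H" and nz: "trace_form q y \<noteq> 0"
    using trace_form_nonzero by blast
  define L where "L = trace_form q"
  have L: "lin H scalars L" unfolding L_def by (rule lin_trace_form[OF q])
  have int: "sw H x (\<lambda>a b. L b \<odot> a) = L x \<odot> \<one>" if "x \<in> carrier H" for x
    unfolding L_def by (rule trace_form_integral[OF q that])
  note lin_compose[OF L, lin_intros] h [lin_intros] y [lin_intros]
  have z: "sw H h (\<lambda>a b. L (x \<otimes> S a) \<odot> b) = \<zero>" if x: "x \<in> carrier H" for x
  proof -
    note x [lin_intros]
    have "sw H h (\<lambda>a b. L (x \<otimes> S a) \<odot> b)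
      = sw H h (\<lambda>a b. sw H x (\<lambda>x\<^sub>1 x\<^sub>2. sw H a (\<lambda>a\<^sub>1 a\<^sub>2. L (x\<^sub>2 \<otimes> S a\<^sub>1) \<odot> (x\<^sub>1 \<otimes> (S a\<^sub>2 \<otimes> b)))))"
    proof (rule sw_cong[OF h])
      fix a b assume *: "a \<in> carrier H" "b \<in> carrier H"
      note * [lin_intros]
      have "L (x \<otimes> S a) \<odot> b = (L (x \<otimes> S a) \<odot> \<one>) \<otimes> b"
        using * x by (simp add: smult_mult_left ring.ring_simprules[OF ring_H])
      also have "\<dots> = sw H (x \<otimes> S a) (\<lambda>c d. L d \<odot> c) \<otimes> b"
        using * x by (simp add: int)
      also have "\<dots> = sw H (x \<otimes> S a) (\<lambda>c d. (L d \<odot> c) \<otimes> b)"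
        by (rule lin_sw[OF bil_left[OF bil_mult]]) (assumption | intro lin_intros; assumption?)+
      also have "\<dots> = sw H x (\<lambda>x\<^sub>1 x\<^sub>2. sw H (S a) (\<lambda>c d. (L (x\<^sub>2 \<otimes> d) \<odot> (x\<^sub>1 \<otimes> c)) \<otimes> b))"
        by (rule sw_mult) (assumption | intro lin_intros; assumption?)+
      also have "\<dots> = sw H x (\<lambda>x\<^sub>1 x\<^sub>2. sw H a (\<lambda>a\<^sub>1 a\<^sub>2. (L (x\<^sub>2 \<otimes> S a\<^sub>1) \<odot> (x\<^sub>1 \<otimes> S a\<^sub>2)) \<otimes> b))"
        by (rule sw_cong[OF x], rule sw_antipode) (assumption | intro lin_intros; assumption?)+
      also have "\<dots> = sw H x (\<lambda>x\<^sub>1 x\<^sub>2. sw H a (\<lambda>a\<^sub>1 a\<^sub>2. L (x\<^sub>2 \<otimes> S a\<^sub>1) \<odot> (x\<^sub>1 \<otimes> (S a\<^sub>2 \<otimes> b))))"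
        by (rule sw_cong[OF x], rule sw_cong[OF *(1)]) (simp add: * smult_mult_left assoc_H)
      finally show "L (x \<otimes> S a) \<odot> b = \<dots>" .
    qed
    also have "\<dots> = sw H x (\<lambda>x\<^sub>1 x\<^sub>2. sw H h (\<lambda>a b. sw H a (\<lambda>a\<^sub>1 a\<^sub>2. L (x\<^sub>2 \<otimes> S a\<^sub>1) \<odot> (x\<^sub>1 \<otimes> (S a\<^sub>2 \<otimes> b)))))"
      by (rule sw_swap) (assumption | intro lin_intros; assumption?)+
    also have "\<dots> = sw H x (\<lambda>x\<^sub>1 x\<^sub>2. sw H h (\<lambda>a b. sw H b (\<lambda>b\<^sub>1 b\<^sub>2. L (x\<^sub>2 \<otimes> S a) \<odot> (x\<^sub>1 \<otimes> (S b\<^sub>1 \<otimes> b\<^sub>2)))))"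
      by (rule sw_cong[OF x], rule sw_coassoc) (assumption | intro lin_intros; assumption?)+
    also have "\<dots> = sw H x (\<lambda>x\<^sub>1 x\<^sub>2. sw H h (\<lambda>a b. eps b \<odot> (L (x\<^sub>2 \<otimes> S a) \<odot> (x\<^sub>1 \<otimes> \<one>))))"
      by (rule sw_cong[OF x], rule sw_cong[OF h], rule sw_antipode_left)
        (assumption | intro lin_intros; assumption?)+
    also have "\<dots> = sw H x (\<lambda>x\<^sub>1 x\<^sub>2. L (x\<^sub>2 \<otimes> S h) \<odot> (x\<^sub>1 \<otimes> \<one>))"
      by (rule sw_cong[OF x], rule sw_counit_right) (assumption | intro lin_intros; assumption?)+
    \<comment> \<open>The zero summand is given the form of a multiple of a bilinear expression, so
      that the scalar 0 can be taken out of the sum.\<close>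
    also have "\<dots> = sw H x (\<lambda>x\<^sub>1 x\<^sub>2. 0 \<odot> (eps x\<^sub>2 \<odot> x\<^sub>1))"
    proof (rule sw_cong[OF x])
      fix a b assume *: "a \<in> carrier H" "b \<in> carrier H"
      have "L (b \<otimes> S h) = 0"
        using lin_zero[OF vsp_H vsp_scalars lin_compose[OF L bil_right[OF bil_mult *(2)]]] Sh by simp
      then show "L (b \<otimes> S h) \<odot> (a \<otimes> \<one>) = 0 \<odot> (eps b \<odot> a)" using * by simp
    qed
    also have "\<dots> = 0 \<odot> sw H x (\<lambda>x\<^sub>1 x\<^sub>2. eps x\<^sub>2 \<odot> x\<^sub>1)"
      by (rule sweedler_smult) (assumption | intro lin_intros; assumption?)+
    also have "\<dots> = \<zero>" using counit_right[OF x] x by simp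
    finally show ?thesis .
  qed
  \<comment> \<open>\<open>L y \<odot> h\<close> is blown up by a cancelling product to the sum of
    \<open>L (y \<otimes> S (h\<^sub>1 \<otimes> S h\<^sub>2)) \<odot> h\<^sub>3\<close>, in which
    \<open>S h\<^sub>1\<close> appears as the last factor under \<open>L\<close>, as in
    \<open>z\<close>.\<close>
  have "sw H h (\<lambda>c b. eps c \<odot> (L (y \<otimes> S \<one>) \<odot> b)) = L (y \<otimes> S \<one>) \<odot> h"
    by (rule sw_counit_left) (assumption | intro lin_intros; assumption?)+
  then have "L y \<odot> h = sw H h (\<lambda>c b. eps c \<odot> (L (y \<otimes> S \<one>) \<odot> b))"
    by (simp add: antipode_one y ring.ring_simprules[OF ring_H])
  also have "\<dots> = sw H h (\<lambda>c b. sw H c (\<lambda>a b'. L (y \<otimes> S (a \<otimes> S b')) \<odot> b))"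
    by (rule sw_cong[OF h], rule sw_antipode_right[symmetric]) (assumption | intro lin_intros; assumption?)+
  also have "\<dots> = sw H h (\<lambda>a b. sw H b (\<lambda>b\<^sub>1 b\<^sub>2. L (y \<otimes> S (a \<otimes> S b\<^sub>1)) \<odot> b\<^sub>2))"
    by (rule sw_coassoc) (assumption | intro lin_intros; assumption?)+
  also have "\<dots> = sw H h (\<lambda>a b. sw H b (\<lambda>b\<^sub>1 b\<^sub>2. L (y \<otimes> S (S b\<^sub>1) \<otimes> S a) \<odot> b\<^sub>2))"
    by (rule sw_cong[OF h], rule sw_cong, assumption) (simp add: antipode_mult assoc_H y)
  \<comment> \<open>In \<open>z\<close> the element \<open>x\<close> is fixed, whereas
    \<open>S (S b\<^sub>1)\<close> varies with the sum. A dual basis splits it into the constant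
    \<open>S (S e)\<close> and the scalar \<open>ev p b\<^sub>1\<close>; the latter is absorbed into
    a linear map \<open>?g\<close> of the second component.\<close>
  also have "\<dots> = sw H h (\<lambda>a b. sw H b (\<lambda>b\<^sub>1 b\<^sub>2. tr H (\<lambda>e p. ev p b\<^sub>1 \<odot> (L (y \<otimes> S (S e) \<otimes> S a) \<odot> b\<^sub>2))))"
    by (rule sw_cong[OF h], rule sw_cong, assumption, rule tr_vector[symmetric])
      (assumption | intro lin_intros; assumption?)+
  also have "\<dots> = sw H h (\<lambda>a b. tr H (\<lambda>e p. sw H b (\<lambda>b\<^sub>1 b\<^sub>2. ev p b\<^sub>1 \<odot> (L (y \<otimes> S (S e) \<otimes> S a) \<odot> b\<^sub>2))))"
    by (rule sw_cong[OF h], rule tr_sw_swap[symmetric]) (assumption | intro lin_intros; assumption?)+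
  also have "\<dots> = tr H (\<lambda>e p. sw H h (\<lambda>a b. sw H b (\<lambda>b\<^sub>1 b\<^sub>2. ev p b\<^sub>1 \<odot> (L (y \<otimes> S (S e) \<otimes> S a) \<odot> b\<^sub>2))))"
    by (rule tr_sw_swap[symmetric]) (assumption | intro lin_intros; assumption?)+
  also have "\<dots> = tr H (\<lambda>e p. 0 \<odot> (ev p \<one> \<odot> e))"
  proof (rule tr_cong)
    fix e p assume *: "e \<in> carrier H" "p \<in> carrier dual"
    note * [lin_intros]
    let ?g = "\<lambda>b. sw H b (\<lambda>b\<^sub>1 b\<^sub>2. ev p b\<^sub>1 \<odot> b\<^sub>2)"
    have g: "lin H H ?g" by (assumption | intro lin_intros; assumption?)+
    have "sw H h (\<lambda>a b. sw H b (\<lambda>b\<^sub>1 b\<^sub>2. ev p b\<^sub>1 \<odot> (L (y \<otimes> S (S e) \<otimes> S a) \<odot> b\<^sub>2)))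
      = sw H h (\<lambda>a b. sw H b (\<lambda>b\<^sub>1 b\<^sub>2. L (y \<otimes> S (S e) \<otimes> S a) \<odot> (ev p b\<^sub>1 \<odot> b\<^sub>2)))"
      by (rule sw_cong[OF h], rule sw_cong, assumption) (simp add: mult.commute)
    also have "\<dots> = sw H h (\<lambda>a b. L (y \<otimes> S (S e) \<otimes> S a) \<odot> ?g b)"
      by (rule sw_cong[OF h], rule sweedler_smult) (assumption | intro lin_intros; assumption?)+
    also have "\<dots> = sw H h (\<lambda>a b. ?g (L (y \<otimes> S (S e) \<otimes> S a) \<odot> b))"
      by (rule sw_cong[OF h]) (simp add: lin_smult[OF g])
    also have "\<dots> = ?g (sw H h (\<lambda>a b. L (y \<otimes> S (S e) \<otimes> S a) \<odot> b))"
      by (rule lin_sw[OF g, symmetric]) (assumption | intro lin_intros; assumption?)+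
    also have "\<dots> = \<zero>"
      using z[of "y \<otimes> S (S e)"] * y lin_zero[OF vsp_H vsp_H g] by simp
    finally show "sw H h (\<lambda>a b. sw H b (\<lambda>b\<^sub>1 b\<^sub>2. ev p b\<^sub>1 \<odot> (L (y \<otimes> S (S e) \<otimes> S a) \<odot> b\<^sub>2))) = 0 \<odot> (ev p \<one> \<odot> e)"
      using * by simp
  qed
  also have "\<dots> = 0 \<odot> tr H (\<lambda>e p. ev p \<one> \<odot> e)"
    by (rule sweedler_smult) (assumption | intro lin_intros; assumption?)+
  also have "\<dots> = \<zero>" by (simp add: canon(2))
  finally have "inverse (L y) \<odot> (L y \<odot> h) = \<zero>" by simp
  then show ?thesis using nz h unfolding L_def by simp
qed

end

section \<open>Bijectivity of the antipode and identities for its inverse\<close>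

lemma inj_endomorphism_surj:
  fixes V :: "('k::field, 'a, 'x) module_scheme"
  assumes V: "vsp V" and T: "lin V V T" and fd: "vectorspace.fin_dim class_ring V"
    and i: "inj_on T (carrier V)"
  shows "T ` carrier V = carrier V"
proof -
  interpret VV: vectorspace class_ring V by (fact V)
  have "Module.module class_ring V" using V by (simp add: vectorspace_def)
  then have L: "linear_map class_ring V V T"
    using V T unfolding linear_map_def mod_hom_def mod_hom_axioms_def by blast
  obtain B where B: "finite B" "VV.basis B" using VV.finite_basis_exists[OF fd] by blast
  then have BV: "B \<subseteq> carrier V" and li: "VV.lin_indpt B" by (simp_all add: VV.basis_def)
  have TB: "T ` B \<subseteq> carrier V" using BV T by (auto simp: lin_closed)
  have inj: "inj_on T B" using i BV by (rule inj_on_subset)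
  have "VV.lin_indpt (T ` B)"
  proof (rule VV.finite_lin_indpt2)
    fix a assume a: "a \<in> T ` B \<rightarrow> carrier class_ring" and l: "VV.lincomb a (T ` B) = \<zero>\<^bsub>V\<^esub>"
    have aT: "a \<circ> T \<in> B \<rightarrow> carrier class_ring" using a by auto
    have c: "VV.lincomb (a \<circ> T) B \<in> carrier V" using BV aT by (rule VV.lincomb_closed)
    have "T (VV.lincomb (a \<circ> T) B) = T \<zero>\<^bsub>V\<^esub>"
      using linear_map.lincomb_linear_image[OF L i BV a B(1)] l lin_zero[OF V V T] by simp
    then have "VV.lincomb (a \<circ> T) B = \<zero>\<^bsub>V\<^esub>"
      using inj_onD[OF i _ c] V by simp
    then have "(a \<circ> T) \<in> B \<rightarrow> {\<zero>\<^bsub>class_ring\<^esub>}"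
      using VV.not_lindepD[OF li B(1) _ aT] by simp
    then show "\<forall>v\<in>T ` B. a v = \<zero>\<^bsub>class_ring\<^esub>" by auto
  qed (use B TB in auto)
  then have "VV.basis (T ` B)"
    using VV.dim_li_is_basis[OF fd _ TB] B card_image[OF inj] VV.dim_basis[OF B] by simp
  then have "carrier V = VV.span (T ` B)" by (simp add: VV.basis_def)
  also have "\<dots> \<subseteq> T ` carrier V"
  proof
    fix w assume "w \<in> VV.span (T ` B)"
    then obtain a where a: "a \<in> T ` B \<rightarrow> carrier class_ring" "w = VV.lincomb a (T ` B)"
      using VV.finite_span[of "T ` B"] B TB by auto
    then have "w = T (VV.lincomb (a \<circ> T) B)"
      using linear_map.lincomb_linear_image[OF L i BV a(1) B(1)] by simp
    moreover have "VV.lincomb (a \<circ> T) B \<in> carrier V"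
      using BV a by (intro VV.lincomb_closed) auto
    ultimately show "w \<in> T ` carrier V" by blast
  qed
  finally show ?thesis using T by (auto simp: lin_closed)
qed

context fin_dim_hopf
begin

lemma antipode_inj: "inj_on S (carrier H)"
proof (rule inj_onI)
  fix x y assume *: "x \<in> carrier H" "y \<in> carrier H" "S x = S y"
  have "S (x \<oplus> (- 1) \<odot> y) = S y \<oplus> (- 1) \<odot> S y"
    using * by (simp add: lin_add[OF antipode_linear] lin_smult[OF antipode_linear])
  also have "\<dots> = \<zero>" using * by (simp add: vs_neg[OF vsp_H])
  finally have "x \<oplus> (- 1) \<odot> y = \<zero>"
    by (rule antipode_kernel[rotated]) (use * in simp)
  then show "x = y" by (rule vs_cancel[OF vsp_H *(1,2)])
qed

lemma antipode_surj: "S ` carrier H = carrier H"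
  by (rule inj_endomorphism_surj[OF vsp_H antipode_linear finite_dimensional antipode_inj])

abbreviation T where "T \<equiv> antipode_inv H"

lemma antipode_inv_closed [simp, lin_intros]: "h \<in> carrier H \<Longrightarrow> T h \<in> carrier H"
  unfolding antipode_inv_def using antipode_surj by (simp add: inv_into_into)

lemma antipode_antipode_inv: "h \<in> carrier H \<Longrightarrow> S (T h) = h"
  unfolding antipode_inv_def using antipode_surj by (simp add: f_inv_into_f)

lemma antipode_inv_eqI: "h \<in> carrier H \<Longrightarrow> x \<in> carrier H \<Longrightarrow> S x = h \<Longrightarrow> T h = x"
  using inj_onD[OF antipode_inj, of "T h" x] by (simp add: antipode_antipode_inv)

lemma lin_T: "lin H H T"
  by (rule linI)
    (auto intro!: antipode_inv_eqI simp: lin_add[OF antipode_linear] lin_smult[OF antipode_linear]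
      antipode_antipode_inv)

lemmas lin_antipode_inv [lin_intros] = lin_compose[OF lin_T]

lemma antipode_inv_one: "T \<one> = \<one>"
  by (rule antipode_inv_eqI) (simp_all add: antipode_one)

lemma counit_antipode_inv: "h \<in> carrier H \<Longrightarrow> eps (T h) = eps h"
  using counit_antipode[of "T h"] by (simp add: antipode_antipode_inv)

text \<open>\<open>S\<close> is injective and reverses products, so applying it to both sides leads
  back to the antipode axiom. The components occur in the opposite order compared with the axiom for
  \<open>S\<close>.\<close>

lemma sw_antipode_inv_left:
  assumes U: "vsp U" and f: "lin H U f" and h: "h \<in> carrier H"
  shows "sw U h (\<lambda>a b. f (T b \<otimes> a)) = eps h \<odot>\<^bsub>U\<^esub> f \<one>"
proof -
  have "S (sw H h (\<lambda>a b. T b \<otimes> a)) = sw H h (\<lambda>a b. S (T b \<otimes> a))"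
    by (rule lin_sw[OF antipode_linear]) (assumption | intro lin_intros h; assumption?)+
  also have "\<dots> = sw H h (\<lambda>a b. S a \<otimes> b)"
    by (rule sw_cong[OF h]) (simp add: antipode_mult antipode_antipode_inv)
  also have "\<dots> = S (eps h \<odot> \<one>)"
    by (simp add: antipode_left h lin_smult[OF antipode_linear] antipode_one)
  finally have "sw H h (\<lambda>a b. T b \<otimes> a) = eps h \<odot> \<one>"
    by (rule inj_onD[OF antipode_inj]) (assumption | intro lin_intros h; assumption?)+
  moreover have "sw U h (\<lambda>a b. f (T b \<otimes> a)) = f (sw H h (\<lambda>a b. T b \<otimes> a))"
    by (rule lin_sw[OF f, symmetric]) (assumption | intro lin_intros h U; assumption?)+
  ultimately show ?thesis by (simp add: lin_smult[OF f])
qed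

lemma sw_antipode_inv_right:
  assumes U: "vsp U" and f: "lin H U f" and h: "h \<in> carrier H"
  shows "sw U h (\<lambda>a b. f (b \<otimes> T a)) = eps h \<odot>\<^bsub>U\<^esub> f \<one>"
proof -
  have "S (sw H h (\<lambda>a b. b \<otimes> T a)) = sw H h (\<lambda>a b. S (b \<otimes> T a))"
    by (rule lin_sw[OF antipode_linear]) (assumption | intro lin_intros h; assumption?)+
  also have "\<dots> = sw H h (\<lambda>a b. a \<otimes> S b)"
    by (rule sw_cong[OF h]) (simp add: antipode_mult antipode_antipode_inv)
  also have "\<dots> = S (eps h \<odot> \<one>)"
    by (simp add: antipode_right h lin_smult[OF antipode_linear] antipode_one)
  finally have "sw H h (\<lambda>a b. b \<otimes> T a) = eps h \<odot> \<one>"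
    by (rule inj_onD[OF antipode_inj]) (assumption | intro lin_intros h; assumption?)+
  moreover have "sw U h (\<lambda>a b. f (b \<otimes> T a)) = f (sw H h (\<lambda>a b. b \<otimes> T a))"
    by (rule lin_sw[OF f, symmetric]) (assumption | intro lin_intros h U; assumption?)+
  ultimately show ?thesis by (simp add: lin_smult[OF f])
qed

end

section \<open>The dual Hopf algebra\<close>

context fin_dim_hopf
begin

abbreviation P where "P \<equiv> dual_hopf H"
abbreviation pmult (infixl "\<star>" 70) where "p \<star> q \<equiv> p \<otimes>\<^bsub>P\<^esub> q"
abbreviation pone where "pone \<equiv> \<one>\<^bsub>P\<^esub>"

lemma dual_hopf_simps:
  "carrier P = carrier dual" "add P = add dual" "module.smult P = module.smult dual"
  "\<zero>\<^bsub>P\<^esub> = \<zero>\<^bsub>dual\<^esub>" "comult P = dual_comult H" "counit P = (\<lambda>p. ev p \<one>)"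
  by (simp_all add: dual_hopf_def module.defs hopf.defs ev_def fun_eq_iff)

lemma opp_simps:
  "carrier (opp A) = carrier A" "add (opp A) = add A" "module.smult (opp A) = module.smult A"
  "\<zero>\<^bsub>opp A\<^esub> = \<zero>\<^bsub>A\<^esub>" "\<one>\<^bsub>opp A\<^esub> = \<one>\<^bsub>A\<^esub>" "x \<otimes>\<^bsub>opp A\<^esub> y = y \<otimes>\<^bsub>A\<^esub> x"
  by (simp_all add: opp_def)

lemma hopf_opp_simps:
  "carrier (hopf_opp H) = carrier H" "add (hopf_opp H) = add H"
  "module.smult (hopf_opp H) = module.smult H" "\<zero>\<^bsub>hopf_opp H\<^esub> = \<zero>" "\<one>\<^bsub>hopf_opp H\<^esub> = \<one>"
  "x \<otimes>\<^bsub>hopf_opp H\<^esub> y = y \<otimes> x" "comult (hopf_opp H) = comult H"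
  by (simp_all add: hopf_opp_def opp_def)

lemma ev_pmult: "h \<in> carrier H \<Longrightarrow> ev (p \<star> q) h = sw scalars h (\<lambda>a b. ev p a * ev q b)"
  by (simp add: dual_hopf_def module.defs hopf.defs ev_def)

lemma pone_def: "pone = restrict eps (carrier H)"
  by (simp add: dual_hopf_def module.defs hopf.defs)

lemma ev_pone: "h \<in> carrier H \<Longrightarrow> ev pone h = eps h"
  by (simp add: pone_def ev_def)

lemma pone_closed [simp, lin_intros]: "pone \<in> carrier dual"
  unfolding pone_def by (rule restrict_dual[OF vsp_H counit_linear])

lemma pmult_closed [simp, lin_intros]:
  assumes "p \<in> carrier dual" "q \<in> carrier dual"
  shows "p \<star> q \<in> carrier dual"
proof -
  have "(\<lambda>h\<in>carrier H. sw scalars h (\<lambda>a b. ev p a * ev q b)) \<in> carrier dual"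
    by (rule restrict_dual[OF vsp_H]) (assumption | intro lin_intros assms; assumption?)+
  then show ?thesis by (simp add: dual_hopf_def module.defs hopf.defs ev_def)
qed

lemma bil_pmult: "bil dual dual dual (\<star>)"
proof (rule bilI)
  fix p assume p: "p \<in> carrier dual"
  show "lin dual dual (\<lambda>q. p \<star> q)"
  proof (rule lin_dualI)
    fix v assume v: "v \<in> carrier H"
    have "lin dual scalars (\<lambda>q. sw scalars v (\<lambda>a b. ev p a * ev q b))"
      by (assumption | intro lin_intros p v; assumption?)+
    then show "lin dual scalars (\<lambda>q. ev (p \<star> q) v)" by (simp add: ev_pmult v)
  qed (use p in simp_all)
  show "lin dual dual (\<lambda>q. q \<star> p)"
  proof (rule lin_dualI)
    fix v assume v: "v \<in> carrier H"
    have "lin dual scalars (\<lambda>q. sw scalars v (\<lambda>a b. ev q a * ev p b))"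
      by (assumption | intro lin_intros p v; assumption?)+
    then show "lin dual scalars (\<lambda>q. ev (q \<star> p) v)" by (simp add: ev_pmult v)
  qed (use p in simp_all)
qed

lemmas lin_pmult [lin_intros] = bil_comp_left[OF bil_pmult] bil_comp_right[OF bil_pmult]

lemma pmult_one_left: "p \<in> carrier dual \<Longrightarrow> pone \<star> p = p"
proof (rule dual_eqI[where V = H])
  fix v assume p: "p \<in> carrier dual" and v: "v \<in> carrier H"
  have "ev (pone \<star> p) v = sw scalars v (\<lambda>a b. eps a \<odot>\<^bsub>scalars\<^esub> ev p b)"
    unfolding ev_pmult[OF v] by (rule sw_cong[OF v]) (simp add: ev_pone)
  also have "\<dots> = ev p v" by (rule sw_counit_left[OF vsp_scalars lin_ev[OF p] v])
  finally show "ev (pone \<star> p) v = ev p v" .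
qed simp_all

lemma pmult_one_right: "p \<in> carrier dual \<Longrightarrow> p \<star> pone = p"
proof (rule dual_eqI[where V = H])
  fix v assume p: "p \<in> carrier dual" and v: "v \<in> carrier H"
  have "ev (p \<star> pone) v = sw scalars v (\<lambda>a b. eps b \<odot>\<^bsub>scalars\<^esub> ev p a)"
    unfolding ev_pmult[OF v] by (rule sw_cong[OF v]) (simp add: ev_pone)
  also have "\<dots> = ev p v" by (rule sw_counit_right[OF vsp_scalars lin_ev[OF p] v])
  finally show "ev (p \<star> pone) v = ev p v" .
qed simp_all

text \<open>In the notation of the overview,
  \<open>h \<rightharpoonup> p \<leftharpoonup> g\<close>.\<close>

definition reg :: "'a \<Rightarrow> 'a \<Rightarrow> ('a \<Rightarrow> 'k) \<Rightarrow> 'a \<Rightarrow> 'k" where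
  "reg h g p = right_regular H (left_regular H h p) g"

lemma ev_reg: "h \<in> carrier H \<Longrightarrow> g \<in> carrier H \<Longrightarrow> x \<in> carrier H \<Longrightarrow> ev (reg h g p) x = ev p (g \<otimes> x \<otimes> h)"
  by (simp add: reg_def ev_def left_regular_def right_regular_def)

lemma reg_closed [simp, lin_intros]:
  assumes "h \<in> carrier H" "g \<in> carrier H" "p \<in> carrier dual"
  shows "reg h g p \<in> carrier dual"
proof -
  have "(\<lambda>x\<in>carrier H. ev p (g \<otimes> x \<otimes> h)) \<in> carrier dual"
    by (rule restrict_dual[OF vsp_H]) (assumption | intro lin_intros assms; assumption?)+
  moreover have "(\<lambda>x\<in>carrier H. ev p (g \<otimes> x \<otimes> h)) = reg h g p"
    using assms by (simp add: reg_def ev_def left_regular_def right_regular_def cong: restrict_cong)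
  ultimately show ?thesis by simp
qed

lemma lin_reg_form:
  assumes "h \<in> carrier H" "g \<in> carrier H"
  shows "lin dual dual (reg h g)"
proof (rule lin_dualI)
  fix v assume v: "v \<in> carrier H"
  have "lin dual scalars (\<lambda>p. ev p (g \<otimes> v \<otimes> h))"
    by (assumption | intro lin_intros assms v; assumption?)+
  then show "lin dual scalars (\<lambda>p. ev (reg h g p) v)" by (simp add: ev_reg assms v)
qed (use assms in simp_all)

lemma lin_reg_left:
  assumes "g \<in> carrier H" "p \<in> carrier dual"
  shows "lin H dual (\<lambda>h. reg h g p)"
proof (rule lin_dualI)
  fix v assume v: "v \<in> carrier H"
  have "lin H scalars (\<lambda>h. ev p (g \<otimes> v \<otimes> h))"
    by (assumption | intro lin_intros assms v; assumption?)+
  then show "lin H scalars (\<lambda>h. ev (reg h g p) v)" by (simp add: lin_iff ev_reg assms v)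
qed (use assms in simp_all)

lemma lin_reg_right:
  assumes "h \<in> carrier H" "p \<in> carrier dual"
  shows "lin H dual (\<lambda>g. reg h g p)"
proof (rule lin_dualI)
  fix v assume v: "v \<in> carrier H"
  have "lin H scalars (\<lambda>g. ev p (g \<otimes> v \<otimes> h))"
    by (assumption | intro lin_intros assms v; assumption?)+
  then show "lin H scalars (\<lambda>g. ev (reg h g p) v)" by (simp add: lin_iff ev_reg assms v)
qed (use assms in simp_all)

lemmas lin_reg [lin_intros] = lin_compose[OF lin_reg_form] lin_compose[OF lin_reg_left]
  lin_compose[OF lin_reg_right]

text \<open>The second slot multiplies in reverse order: this is a left action of \<open>H\<close>
  tensored with its opposite algebra.\<close>

lemma reg_reg:
  assumes "h \<in> carrier H" "g \<in> carrier H" "h' \<in> carrier H" "g' \<in> carrier H" "p \<in> carrier dual"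
  shows "reg h g (reg h' g' p) = reg (h \<otimes> h') (g' \<otimes> g) p"
  by (rule dual_eqI[where V = H]) (use assms in \<open>simp_all add: ev_reg assoc_H\<close>)

lemma reg_one [simp]: "p \<in> carrier dual \<Longrightarrow> reg \<one> \<one> p = p"
  by (rule dual_eqI[where V = H]) (simp_all add: ev_reg ring.ring_simprules[OF ring_H])

lemma reg_pone:
  assumes "h \<in> carrier H" "g \<in> carrier H"
  shows "reg h g pone = (eps h * eps g) \<odot>\<^bsub>dual\<^esub> pone"
  by (rule dual_eqI[where V = H])
    (use assms in \<open>simp_all add: ev_reg ev_pone ev_smult counit_mult mult.commute mult.assoc\<close>)

section \<open>The two-sided crossed product\<close>

abbreviation HH where "HH \<equiv> tensor_space H H"
abbreviation YS where "YS \<equiv> tensor_space dual (tensor_space HH dual)"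
abbreviation Y where "Y \<equiv> Y_algebra H"
abbreviation K where "K \<equiv> hopf_tensor H (hopf_opp H)"

abbreviation hh :: "'a \<Rightarrow> 'a \<Rightarrow> ('k, 'a, 'a) tensor" where
  "hh \<equiv> pure_tensor H H"

abbreviation yp where
  "yp p h g q \<equiv> pure_tensor dual (tensor_space HH dual) p (pure_tensor HH dual (hh h g) q)"

lemma tensor_space_opp:
  "tensor_of H (hopf_opp H) = tensor_of H H" "tensor_space H (hopf_opp H) = HH"
  "sweedler H (hopf_opp H) U = sweedler H H U" "sweedler (hopf_opp H) (hopf_opp H) U = sweedler H H U"
  by (intro tensor_of_cong tensor_space_cong sweedler_space_cong; simp add: hopf_opp_simps)+

lemma K_simps:
  "carrier K = carrier HH" "add K = add HH" "module.smult K = module.smult HH" "\<zero>\<^bsub>K\<^esub> = \<zero>\<^bsub>HH\<^esub>"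
  "\<one>\<^bsub>K\<^esub> = hh \<one> \<one>"
  "s \<otimes>\<^bsub>K\<^esub> t = sweedler H H HH (\<lambda>a b. sweedler H H HH (\<lambda>a' b'. hh (a \<otimes> a') (b' \<otimes> b)) t) s"
  by (simp_all add: hopf_tensor_def Let_def module.defs hopf.defs tensor_algebra_def tensor_space_opp
      hopf_opp_simps)

lemma comult_K:
  "comult K = sweedler H H (tensor_space HH HH) (\<lambda>h g. sw (tensor_space HH HH) h (\<lambda>h\<^sub>1 h\<^sub>2.
    sw (tensor_space HH HH) g (\<lambda>g\<^sub>1 g\<^sub>2. pure_tensor HH HH (hh h\<^sub>1 g\<^sub>1) (hh h\<^sub>2 g\<^sub>2))))"
proof -
  let ?T = "tensor_algebra H (hopf_opp H)"
  have *: "tensor_of ?T ?T = tensor_of HH HH" "tensor_space ?T ?T = tensor_space HH HH"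
    by (intro tensor_of_cong tensor_space_cong; simp add: tensor_algebra_def tensor_space_opp)+
  show ?thesis
    by (simp add: hopf_tensor_def Let_def module.defs hopf.defs * tensor_space_opp hopf_opp_simps)
qed

definition yact where
  "yact u f = sweedler H H dual (\<lambda>h g. reg h g f) u"

text \<open>In spite of the name an action: the right action of \<open>K\<close> on the opposite
  algebra of the dual.\<close>

definition ycoact where
  "ycoact f u = sweedler H H dual (\<lambda>h g. reg (S h) (T g) f) u"

text \<open>All component spaces are replaced by \<open>dual\<close> and \<open>HH\<close>, whose
  tensor products are the same as those of the Hopf algebra records. Linearity then has to be
  established for these two spaces only.\<close>

lemma Y_alt:
  "Y = YS\<lparr>mult := \<lambda>s t.
     sweedler dual (tensor_space HH dual) YS (\<lambda>a s. sweedler HH dual YS (\<lambda>x b.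
       sweedler dual (tensor_space HH dual) YS (\<lambda>a' s'. sweedler HH dual YS (\<lambda>x' b'.
         sweedler HH HH YS (\<lambda>x\<^sub>1 x\<^sub>2. sweedler HH HH YS (\<lambda>x'\<^sub>1 x'\<^sub>2.
           pure_tensor dual (tensor_space HH dual) (a \<star> yact x\<^sub>1 a')
             (pure_tensor HH dual (x\<^sub>2 \<otimes>\<^bsub>K\<^esub> x'\<^sub>1) (b' \<star> ycoact b x'\<^sub>2)))
         (comult K x')) (comult K x)) s') t) s) s,
     one := yp pone \<one> \<one> pone\<rparr>"
proof -
  have cong: "tensor_of K (opp P) = tensor_of HH dual" "tensor_space K (opp P) = tensor_space HH dual"
    "tensor_of P X = tensor_of dual X" "tensor_space P X = tensor_space dual X"
    "sweedler P X U = sweedler dual X U" "sweedler K (opp P) U = sweedler HH dual U"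
    "sweedler K K U = sweedler HH HH U" "sweedler H H P = sweedler H H dual"
    for X :: "('k, 'b, 'z) module_scheme" and U :: "('k, 'u, 'w) module_scheme"
    by (intro tensor_of_cong tensor_space_cong sweedler_space_cong; simp add: K_simps opp_simps dual_hopf_simps)+
  show ?thesis
    unfolding Y_algebra_def two_sided_crossed_product_def Let_def sweedler3_def yact_def ycoact_def reg_def
      tensor_space_opp cong
    by (simp add: opp_simps K_simps(5))
qed

lemma vsp_HH [simp, lin_intros]: "vsp HH" by simp

lemma bil_yact: "bil HH dual dual yact"
  unfolding yact_def by (assumption | intro lin_intros; assumption?)+

lemma bil_ycoact: "bil dual HH dual ycoact"
  unfolding ycoact_def by (assumption | intro lin_intros; assumption?)+

lemma bil_K_mult: "bil HH HH HH (\<otimes>\<^bsub>K\<^esub>)"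
  unfolding K_simps by (assumption | intro lin_intros; assumption?)+

lemma comult_K_linear: "lin HH (tensor_space HH HH) (comult K)"
  unfolding comult_K by (assumption | intro lin_intros lin_sweedler; assumption?)+

lemmas Y_lin_intros =
  bil_comp_left[OF bil_yact] bil_comp_right[OF bil_yact] bil_closed[OF bil_yact]
  bil_comp_left[OF bil_ycoact] bil_comp_right[OF bil_ycoact] bil_closed[OF bil_ycoact]
  bil_comp_left[OF bil_K_mult] bil_comp_right[OF bil_K_mult] bil_closed[OF bil_K_mult]
  lin_compose[OF comult_K_linear] lin_closed[OF comult_K_linear]

lemma yact_hh: "h \<in> carrier H \<Longrightarrow> g \<in> carrier H \<Longrightarrow> f \<in> carrier dual \<Longrightarrow> yact (hh h g) f = reg h g f"
  unfolding yact_def by (rule sweedler_pure_eq) (rule refl | assumption | intro lin_intros; assumption?)+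

lemma ycoact_hh:
  "h \<in> carrier H \<Longrightarrow> g \<in> carrier H \<Longrightarrow> f \<in> carrier dual \<Longrightarrow> ycoact f (hh h g) = reg (S h) (T g) f"
  unfolding ycoact_def by (rule sweedler_pure_eq) (rule refl | assumption | intro lin_intros; assumption?)+

lemma K_mult_hh:
  assumes "h \<in> carrier H" "g \<in> carrier H" "h' \<in> carrier H" "g' \<in> carrier H"
  shows "hh h g \<otimes>\<^bsub>K\<^esub> hh h' g' = hh (h \<otimes> h') (g' \<otimes> g)"
proof -
  have "hh h g \<otimes>\<^bsub>K\<^esub> hh h' g' = sweedler H H HH (\<lambda>a' b'. hh (h \<otimes> a') (b' \<otimes> g)) (hh h' g')"
    unfolding K_simps by (rule sweedler_pure_eq) (rule refl | assumption | intro lin_intros assms; assumption?)+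
  also have "\<dots> = hh (h \<otimes> h') (g' \<otimes> g)"
    by (rule sweedler_pure_eq) (rule refl | assumption | intro lin_intros assms; assumption?)+
  finally show ?thesis .
qed

lemma sweedler_comult_K:
  assumes U: "vsp U" and f: "bil HH HH U f" and *: "h \<in> carrier H" "g \<in> carrier H"
  shows "sweedler HH HH U f (comult K (hh h g))
    = sw U h (\<lambda>h\<^sub>1 h\<^sub>2. sw U g (\<lambda>g\<^sub>1 g\<^sub>2. f (hh h\<^sub>1 g\<^sub>1) (hh h\<^sub>2 g\<^sub>2)))"
proof -
  let ?T = "tensor_space HH HH"
  let ?g = "sweedler HH HH U f"
  have T: "vsp ?T" by simp
  have g: "lin ?T U ?g" by (rule lin_sweedler[OF vsp_HH U f])
  have "comult K (hh h g) = sw ?T h (\<lambda>h\<^sub>1 h\<^sub>2. sw ?T g (\<lambda>g\<^sub>1 g\<^sub>2. pure_tensor HH HH (hh h\<^sub>1 g\<^sub>1) (hh h\<^sub>2 g\<^sub>2)))"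
    unfolding comult_K by (rule sweedler_pure_eq) (rule refl | assumption | intro lin_intros *; assumption?)+
  then have "?g (comult K (hh h g)) = ?g (sw ?T h (\<lambda>h\<^sub>1 h\<^sub>2. sw ?T g (\<lambda>g\<^sub>1 g\<^sub>2. pure_tensor HH HH (hh h\<^sub>1 g\<^sub>1) (hh h\<^sub>2 g\<^sub>2))))"
    by (rule arg_cong)
  also have "\<dots> = sw U h (\<lambda>h\<^sub>1 h\<^sub>2. ?g (sw ?T g (\<lambda>g\<^sub>1 g\<^sub>2. pure_tensor HH HH (hh h\<^sub>1 g\<^sub>1) (hh h\<^sub>2 g\<^sub>2))))"
    by (rule lin_sw[OF g T U _ *(1)]) (assumption | intro lin_intros *; assumption?)+
  also have "\<dots> = sw U h (\<lambda>h\<^sub>1 h\<^sub>2. sw U g (\<lambda>g\<^sub>1 g\<^sub>2. ?g (pure_tensor HH HH (hh h\<^sub>1 g\<^sub>1) (hh h\<^sub>2 g\<^sub>2))))"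
    by (rule sw_cong[OF *(1)], rule lin_sw[OF g T U _ *(2)]) (assumption | intro lin_intros *; assumption?)+
  also have "\<dots> = sw U h (\<lambda>h\<^sub>1 h\<^sub>2. sw U g (\<lambda>g\<^sub>1 g\<^sub>2. f (hh h\<^sub>1 g\<^sub>1) (hh h\<^sub>2 g\<^sub>2)))"
    by (rule sw_cong[OF *(1)], rule sw_cong[OF *(2)]) (simp add: sweedler_pure[OF U f] pure_closed)
  finally show ?thesis .
qed

lemma Y_simps:
  "carrier Y = carrier YS" "add Y = add YS" "module.smult Y = module.smult YS" "\<zero>\<^bsub>Y\<^esub> = \<zero>\<^bsub>YS\<^esub>"
  "\<one>\<^bsub>Y\<^esub> = yp pone \<one> \<one> pone"
  unfolding Y_alt by simp_all

text \<open>The summand of the multiplication of \<open>Y\<close> for general elements of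
  \<open>K\<close>, separated out so that its linearity in each of the six arguments can be
  stated.\<close>

definition ymult where
  "ymult a x b a' x' b' = sweedler HH HH YS (\<lambda>x\<^sub>1 x\<^sub>2. sweedler HH HH YS (\<lambda>x'\<^sub>1 x'\<^sub>2.
     pure_tensor dual (tensor_space HH dual) (a \<star> yact x\<^sub>1 a')
       (pure_tensor HH dual (x\<^sub>2 \<otimes>\<^bsub>K\<^esub> x'\<^sub>1) (b' \<star> ycoact b x'\<^sub>2)))
     (comult K x')) (comult K x)"

lemma ymult_lin1:
  "x \<in> carrier HH \<Longrightarrow> b \<in> carrier dual \<Longrightarrow> a' \<in> carrier dual \<Longrightarrow> x' \<in> carrier HH \<Longrightarrow> b' \<in> carrier dual
    \<Longrightarrow> lin dual YS (\<lambda>a. ymult a x b a' x' b')"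
  unfolding ymult_def by (assumption | intro lin_intros Y_lin_intros; assumption?)+

lemma ymult_lin2:
  "a \<in> carrier dual \<Longrightarrow> b \<in> carrier dual \<Longrightarrow> a' \<in> carrier dual \<Longrightarrow> x' \<in> carrier HH \<Longrightarrow> b' \<in> carrier dual
    \<Longrightarrow> lin HH YS (\<lambda>x. ymult a x b a' x' b')"
  unfolding ymult_def by (assumption | intro lin_intros Y_lin_intros; assumption?)+

lemma ymult_lin3:
  "a \<in> carrier dual \<Longrightarrow> x \<in> carrier HH \<Longrightarrow> a' \<in> carrier dual \<Longrightarrow> x' \<in> carrier HH \<Longrightarrow> b' \<in> carrier dual
    \<Longrightarrow> lin dual YS (\<lambda>b. ymult a x b a' x' b')"
  unfolding ymult_def by (assumption | intro lin_intros Y_lin_intros; assumption?)+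

lemma ymult_lin4:
  "a \<in> carrier dual \<Longrightarrow> x \<in> carrier HH \<Longrightarrow> b \<in> carrier dual \<Longrightarrow> x' \<in> carrier HH \<Longrightarrow> b' \<in> carrier dual
    \<Longrightarrow> lin dual YS (\<lambda>a'. ymult a x b a' x' b')"
  unfolding ymult_def by (assumption | intro lin_intros Y_lin_intros; assumption?)+

lemma ymult_lin5:
  "a \<in> carrier dual \<Longrightarrow> x \<in> carrier HH \<Longrightarrow> b \<in> carrier dual \<Longrightarrow> a' \<in> carrier dual \<Longrightarrow> b' \<in> carrier dual
    \<Longrightarrow> lin HH YS (\<lambda>x'. ymult a x b a' x' b')"
  unfolding ymult_def by (assumption | intro lin_intros Y_lin_intros; assumption?)+

lemma ymult_lin6:
  "a \<in> carrier dual \<Longrightarrow> x \<in> carrier HH \<Longrightarrow> b \<in> carrier dual \<Longrightarrow> a' \<in> carrier dual \<Longrightarrow> x' \<in> carrier HH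
    \<Longrightarrow> lin dual YS (\<lambda>b'. ymult a x b a' x' b')"
  unfolding ymult_def by (assumption | intro lin_intros Y_lin_intros; assumption?)+

lemma ymult_closed:
  "a \<in> carrier dual \<Longrightarrow> x \<in> carrier HH \<Longrightarrow> b \<in> carrier dual \<Longrightarrow> a' \<in> carrier dual \<Longrightarrow> x' \<in> carrier HH
    \<Longrightarrow> b' \<in> carrier dual \<Longrightarrow> ymult a x b a' x' b' \<in> carrier YS"
  by (rule lin_closed[OF ymult_lin1])

lemmas ymult_intros = ymult_closed lin_compose[OF ymult_lin1] lin_compose[OF ymult_lin2]
  lin_compose[OF ymult_lin3] lin_compose[OF ymult_lin4] lin_compose[OF ymult_lin5] lin_compose[OF ymult_lin6]

lemma Y_mult_alt:
  "s \<otimes>\<^bsub>Y\<^esub> t = sweedler dual (tensor_space HH dual) YS (\<lambda>a s. sweedler HH dual YS (\<lambda>x b.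
     sweedler dual (tensor_space HH dual) YS (\<lambda>a' s'. sweedler HH dual YS (\<lambda>x' b'.
       ymult a x b a' x' b') s') t) s) s"
  unfolding Y_alt ymult_def by simp

lemma bil_Y_mult: "bil YS YS YS (\<otimes>\<^bsub>Y\<^esub>)"
  unfolding Y_mult_alt by (assumption | intro lin_intros ymult_intros; assumption?)+

lemma yp_closed [lin_intros]:
  "p \<in> carrier dual \<Longrightarrow> h \<in> carrier H \<Longrightarrow> g \<in> carrier H \<Longrightarrow> q \<in> carrier dual \<Longrightarrow> yp p h g q \<in> carrier YS"
  by (intro pure_closed)

text \<open>The explicit multiplication formula of the two-sided crossed product: the four nested
  contractions are evaluated on pure tensors, and the two comultiplications of \<open>K\<close> are
  written out in components of \<open>H\<close>.\<close>

lemma Y_mult_yp: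
  assumes p: "p \<in> carrier dual" and h: "h \<in> carrier H" and g: "g \<in> carrier H" and q: "q \<in> carrier dual"
    and p': "p' \<in> carrier dual" and h': "h' \<in> carrier H" and g': "g' \<in> carrier H" and q': "q' \<in> carrier dual"
  shows "yp p h g q \<otimes>\<^bsub>Y\<^esub> yp p' h' g' q' =
    sw YS h (\<lambda>h\<^sub>1 h\<^sub>2. sw YS g (\<lambda>g\<^sub>1 g\<^sub>2. sw YS h' (\<lambda>h'\<^sub>1 h'\<^sub>2. sw YS g' (\<lambda>g'\<^sub>1 g'\<^sub>2.
      yp (p \<star> reg h\<^sub>1 g\<^sub>1 p') (h\<^sub>2 \<otimes> h'\<^sub>1) (g'\<^sub>1 \<otimes> g\<^sub>2) (q' \<star> reg (S h'\<^sub>2) (T g'\<^sub>2) q)))))"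
proof -
  let ?W = "tensor_space HH dual"
  note intros = lin_intros ymult_intros assms
  have "yp p h g q \<otimes>\<^bsub>Y\<^esub> yp p' h' g' q' = sweedler HH dual YS (\<lambda>x b.
       sweedler dual ?W YS (\<lambda>a' s'. sweedler HH dual YS (\<lambda>x' b'. ymult p x b a' x' b') s') (yp p' h' g' q'))
       (pure_tensor HH dual (hh h g) q)"
    unfolding Y_mult_alt by (rule sweedler_pure_eq) (rule refl | assumption | intro intros; assumption?)+
  also have "\<dots> = sweedler dual ?W YS (\<lambda>a' s'. sweedler HH dual YS (\<lambda>x' b'. ymult p (hh h g) q a' x' b') s') (yp p' h' g' q')"
    by (rule sweedler_pure_eq) (rule refl | assumption | intro intros; assumption?)+
  also have "\<dots> = sweedler HH dual YS (\<lambda>x' b'. ymult p (hh h g) q p' x' b') (pure_tensor HH dual (hh h' g') q')"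
    by (rule sweedler_pure_eq) (rule refl | assumption | intro intros; assumption?)+
  also have "\<dots> = ymult p (hh h g) q p' (hh h' g') q'"
    by (rule sweedler_pure_eq) (rule refl | assumption | intro intros; assumption?)+
  also have "\<dots> = sw YS h (\<lambda>h\<^sub>1 h\<^sub>2. sw YS g (\<lambda>g\<^sub>1 g\<^sub>2. sweedler HH HH YS (\<lambda>x'\<^sub>1 x'\<^sub>2.
     pure_tensor dual ?W (p \<star> yact (hh h\<^sub>1 g\<^sub>1) p') (pure_tensor HH dual (hh h\<^sub>2 g\<^sub>2 \<otimes>\<^bsub>K\<^esub> x'\<^sub>1) (q' \<star> ycoact q x'\<^sub>2)))
     (comult K (hh h' g'))))"
    unfolding ymult_def
    by (rule sweedler_comult_K) (assumption | intro lin_intros Y_lin_intros assms; assumption?)+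
  also have "\<dots> = sw YS h (\<lambda>h\<^sub>1 h\<^sub>2. sw YS g (\<lambda>g\<^sub>1 g\<^sub>2. sw YS h' (\<lambda>h'\<^sub>1 h'\<^sub>2. sw YS g' (\<lambda>g'\<^sub>1 g'\<^sub>2.
     pure_tensor dual ?W (p \<star> yact (hh h\<^sub>1 g\<^sub>1) p')
       (pure_tensor HH dual (hh h\<^sub>2 g\<^sub>2 \<otimes>\<^bsub>K\<^esub> hh h'\<^sub>1 g'\<^sub>1) (q' \<star> ycoact q (hh h'\<^sub>2 g'\<^sub>2)))))))"
    by (rule sw_cong[OF h], rule sw_cong[OF g], rule sweedler_comult_K)
      (assumption | intro lin_intros Y_lin_intros assms; assumption?)+
  also have "\<dots> = sw YS h (\<lambda>h\<^sub>1 h\<^sub>2. sw YS g (\<lambda>g\<^sub>1 g\<^sub>2. sw YS h' (\<lambda>h'\<^sub>1 h'\<^sub>2. sw YS g' (\<lambda>g'\<^sub>1 g'\<^sub>2.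
      yp (p \<star> reg h\<^sub>1 g\<^sub>1 p') (h\<^sub>2 \<otimes> h'\<^sub>1) (g'\<^sub>1 \<otimes> g\<^sub>2) (q' \<star> reg (S h'\<^sub>2) (T g'\<^sub>2) q)))))"
    by (rule sw_cong[OF h], rule sw_cong[OF g], rule sw_cong[OF h'], rule sw_cong[OF g'])
      (simp add: yact_hh ycoact_hh K_mult_hh p p' q q')
  finally show ?thesis .
qed

text \<open>The elements \<open>yp p h g' q\<close> span \<open>Y\<close>, since each of the three
  nested tensor products is spanned by pure tensors.\<close>

lemma Y_eqI:
  assumes f: "lin YS U f" and g: "lin YS U g" and U: "vsp U" and y: "y \<in> carrier YS"
    and eq: "\<And>p h g' q. p \<in> carrier dual \<Longrightarrow> h \<in> carrier H \<Longrightarrow> g' \<in> carrier H \<Longrightarrow> q \<in> carrier dual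
      \<Longrightarrow> f (yp p h g' q) = g (yp p h g' q)"
  shows "f y = g y"
proof (rule tensor_eqI[OF f g _ U _ y])
  fix p s assume p: "p \<in> carrier dual" and s: "s \<in> carrier (tensor_space HH dual)"
  note fg = lin_compose[OF f] lin_compose[OF g]
  show "f (pure_tensor dual (tensor_space HH dual) p s) = g (pure_tensor dual (tensor_space HH dual) p s)"
  proof (rule tensor_eqI[OF _ _ _ U _ s])
    fix x q assume x: "x \<in> carrier HH" and q: "q \<in> carrier dual"
    show "f (pure_tensor dual (tensor_space HH dual) p (pure_tensor HH dual x q))
      = g (pure_tensor dual (tensor_space HH dual) p (pure_tensor HH dual x q))"
      by (rule tensor_eqI[OF _ _ _ U _ x])
        (assumption | intro fg lin_intros p q eq; assumption?)+
  qed (assumption | intro fg lin_intros p; assumption?)+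
qed simp

end

text \<open>The structure on a vector space \<open>M\<close> to which both Hopf bimodules and \<open>Y\<close>-modules are reduced:
  \<open>l\<close> and \<open>r\<close> are the actions of the dual, and \<open>c h g m\<close> is the element \<open>h m g\<close> for the
  \<open>H\<close>-bimodule structure dual to the bicomodule structure.\<close>

locale action_data = fin_dim_hopf H
  for H :: "('k::field, 'a, 'x) hopf_scheme" (structure) +
  fixes M :: "('k, 'm, 'z) module_scheme"
    and l :: "('a \<Rightarrow> 'k) \<Rightarrow> 'm \<Rightarrow> 'm" and r :: "'m \<Rightarrow> ('a \<Rightarrow> 'k) \<Rightarrow> 'm"
    and c :: "'a \<Rightarrow> 'a \<Rightarrow> 'm \<Rightarrow> 'm"
  assumes vsp_M: "vsp M"
    and bil_l: "bil dual M M l"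
    and l_one: "m \<in> carrier M \<Longrightarrow> l pone m = m"
    and l_mult: "\<lbrakk>p \<in> carrier dual; q \<in> carrier dual; m \<in> carrier M\<rbrakk> \<Longrightarrow> l (p \<star> q) m = l p (l q m)"
    and bil_r: "bil M dual M r"
    and r_one: "m \<in> carrier M \<Longrightarrow> r m pone = m"
    and r_mult: "\<lbrakk>p \<in> carrier dual; q \<in> carrier dual; m \<in> carrier M\<rbrakk> \<Longrightarrow> r m (p \<star> q) = r (r m p) q"
    and l_r: "\<lbrakk>p \<in> carrier dual; q \<in> carrier dual; m \<in> carrier M\<rbrakk> \<Longrightarrow> r (l p m) q = l p (r m q)"
    and c_lin_left: "\<lbrakk>g \<in> carrier H; m \<in> carrier M\<rbrakk> \<Longrightarrow> lin H M (\<lambda>h. c h g m)"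
    and c_lin_mid: "\<lbrakk>h \<in> carrier H; m \<in> carrier M\<rbrakk> \<Longrightarrow> lin H M (\<lambda>g. c h g m)"
    and c_lin_right: "\<lbrakk>h \<in> carrier H; g \<in> carrier H\<rbrakk> \<Longrightarrow> lin M M (\<lambda>m. c h g m)"
    and c_one: "m \<in> carrier M \<Longrightarrow> c \<one> \<one> m = m"
    and c_mult: "\<lbrakk>h \<in> carrier H; g \<in> carrier H; h' \<in> carrier H; g' \<in> carrier H; m \<in> carrier M\<rbrakk> \<Longrightarrow>
      c (h \<otimes> h') (g' \<otimes> g) m = c h g (c h' g' m)"
    and c_l: "\<lbrakk>h \<in> carrier H; g \<in> carrier H; p \<in> carrier dual; m \<in> carrier M\<rbrakk> \<Longrightarrow>
      c h g (l p m) = sw M h (\<lambda>h\<^sub>1 h\<^sub>2. sw M g (\<lambda>g\<^sub>1 g\<^sub>2. l (reg h\<^sub>1 g\<^sub>1 p) (c h\<^sub>2 g\<^sub>2 m)))"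
    and c_r: "\<lbrakk>h \<in> carrier H; g \<in> carrier H; q \<in> carrier dual; m \<in> carrier M\<rbrakk> \<Longrightarrow>
      c h g (r m q) = sw M h (\<lambda>h\<^sub>1 h\<^sub>2. sw M g (\<lambda>g\<^sub>1 g\<^sub>2. r (c h\<^sub>1 g\<^sub>1 m) (reg h\<^sub>2 g\<^sub>2 q)))"

section \<open>Generators of \<open>Y\<close> and their relations\<close>

context fin_dim_hopf
begin

text \<open>The components of \<open>h\<close> and of \<open>g\<close> cancel independently. Two
  products \<open>k\<close> and \<open>k'\<close> occur because \<open>g\<close> belongs to the
  opposite algebra, where the inverse of \<open>S\<close> takes the role of
  \<open>S\<close>.\<close>

lemma sw_absorb2:
  assumes U: "vsp U" and h: "h \<in> carrier H" and g: "g \<in> carrier H"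
    and f1: "\<And>a' b'. a' \<in> carrier H \<Longrightarrow> b' \<in> carrier H \<Longrightarrow> bil H H U (\<lambda>a b. f a a' b b')"
    and f2: "\<And>a b. a \<in> carrier H \<Longrightarrow> b \<in> carrier H \<Longrightarrow> bil H H U (\<lambda>a' b'. f a a' b b')"
    and k: "bil H H H k" and k': "bil H H H k'"
    and cancel: "\<And>h f. h \<in> carrier H \<Longrightarrow> lin H U f \<Longrightarrow> sw U h (\<lambda>a b. f (k a b)) = eps h \<odot>\<^bsub>U\<^esub> f \<one>"
    and cancel': "\<And>h f. h \<in> carrier H \<Longrightarrow> lin H U f \<Longrightarrow> sw U h (\<lambda>a b. f (k' a b)) = eps h \<odot>\<^bsub>U\<^esub> f \<one>"
  shows "sw U h (\<lambda>h\<^sub>1 h\<^sub>2. sw U g (\<lambda>g\<^sub>1 g\<^sub>2. sw U h\<^sub>1 (\<lambda>a b. sw U g\<^sub>1 (\<lambda>a' b'. f a a' (k b h\<^sub>2) (k' b' g\<^sub>2)))))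
    = f h g \<one> \<one>"
proof -
  note intros = lin_intros U h g bil_comp_left[OF f1] bil_comp_right[OF f1] bil_comp_left[OF f2]
    bil_comp_right[OF f2] bil_closed[OF k] bil_closed[OF k'] bil_comp_left[OF k] bil_comp_left[OF k']
    bil_comp_right[OF k] bil_comp_right[OF k'] bil_closed[OF f1]
  have "sw U h (\<lambda>h\<^sub>1 h\<^sub>2. sw U g (\<lambda>g\<^sub>1 g\<^sub>2. sw U h\<^sub>1 (\<lambda>a b. sw U g\<^sub>1 (\<lambda>a' b'. f a a' (k b h\<^sub>2) (k' b' g\<^sub>2)))))
    = sw U h (\<lambda>h\<^sub>1 h\<^sub>2. sw U h\<^sub>1 (\<lambda>a b. sw U g (\<lambda>g\<^sub>1 g\<^sub>2. sw U g\<^sub>1 (\<lambda>a' b'. f a a' (k b h\<^sub>2) (k' b' g\<^sub>2)))))"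
    by (rule sw_cong[OF h], rule sw_swap[OF U g]) (assumption | intro intros; assumption?)+
  also have "\<dots> = sw U h (\<lambda>h\<^sub>1 h\<^sub>2. sw U h\<^sub>1 (\<lambda>a b. f a g (k b h\<^sub>2) \<one>))"
    by (rule sw_cong[OF h], rule sw_cong, assumption, rule sw_absorb[OF U _ g k' cancel'])
      (assumption | intro intros f2 U; assumption?)+
  also have "\<dots> = f h g \<one> \<one>"
    by (rule sw_absorb[OF U _ h k cancel]) (assumption | intro intros f1 g U; assumption?)+
  finally show ?thesis .
qed

text \<open>With trivial middle part the product is that of the dual tensored with its opposite
  algebra; on a \<open>Y\<close>-module this is the bimodule structure over the dual.\<close>

lemma Y_mult_units:
  assumes p: "p \<in> carrier dual" and q: "q \<in> carrier dual" and p': "p' \<in> carrier dual" and q': "q' \<in> carrier dual"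
  shows "yp p \<one> \<one> q \<otimes>\<^bsub>Y\<^esub> yp p' \<one> \<one> q' = yp (p \<star> p') \<one> \<one> (q' \<star> q)"
proof -
  note assms [lin_intros]
  have YS: "vsp YS" by simp
  have "yp p \<one> \<one> q \<otimes>\<^bsub>Y\<^esub> yp p' \<one> \<one> q' =
    sw YS \<one> (\<lambda>g\<^sub>1 g\<^sub>2. sw YS \<one> (\<lambda>h'\<^sub>1 h'\<^sub>2. sw YS \<one> (\<lambda>g'\<^sub>1 g'\<^sub>2.
      yp (p \<star> reg \<one> g\<^sub>1 p') (\<one> \<otimes> h'\<^sub>1) (g'\<^sub>1 \<otimes> g\<^sub>2) (q' \<star> reg (S h'\<^sub>2) (T g'\<^sub>2) q))))"
    unfolding Y_mult_yp[OF p one_closed_H one_closed_H q p' one_closed_H one_closed_H q']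
    by (rule sw_one) (assumption | intro lin_intros; assumption?)+
  also have "\<dots> = sw YS \<one> (\<lambda>h'\<^sub>1 h'\<^sub>2. sw YS \<one> (\<lambda>g'\<^sub>1 g'\<^sub>2.
      yp (p \<star> reg \<one> \<one> p') (\<one> \<otimes> h'\<^sub>1) (g'\<^sub>1 \<otimes> \<one>) (q' \<star> reg (S h'\<^sub>2) (T g'\<^sub>2) q)))"
    by (rule sw_one) (assumption | intro lin_intros; assumption?)+
  also have "\<dots> = sw YS \<one> (\<lambda>g'\<^sub>1 g'\<^sub>2.
      yp (p \<star> reg \<one> \<one> p') (\<one> \<otimes> \<one>) (g'\<^sub>1 \<otimes> \<one>) (q' \<star> reg (S \<one>) (T g'\<^sub>2) q))"
    by (rule sw_one) (assumption | intro lin_intros; assumption?)+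
  also have "\<dots> = yp (p \<star> reg \<one> \<one> p') (\<one> \<otimes> \<one>) (\<one> \<otimes> \<one>) (q' \<star> reg (S \<one>) (T \<one>) q)"
    by (rule sw_one) (assumption | intro lin_intros; assumption?)+
  finally show ?thesis
    by (simp add: antipode_one antipode_inv_one p' q ring.ring_simprules[OF ring_H])
qed

text \<open>With \<open>q = q' = pone\<close> this is the first relation of the overview, read
  inside \<open>Y\<close>.\<close>

lemma Y_mult_right_unit:
  assumes h: "h \<in> carrier H" and g: "g \<in> carrier H" and q: "q \<in> carrier dual"
    and p': "p' \<in> carrier dual" and q': "q' \<in> carrier dual"
  shows "yp pone h g q \<otimes>\<^bsub>Y\<^esub> yp p' \<one> \<one> q' =
    sw YS h (\<lambda>h\<^sub>1 h\<^sub>2. sw YS g (\<lambda>g\<^sub>1 g\<^sub>2. yp (reg h\<^sub>1 g\<^sub>1 p') h\<^sub>2 g\<^sub>2 (q' \<star> q)))"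
proof -
  note assms [lin_intros]
  have "yp pone h g q \<otimes>\<^bsub>Y\<^esub> yp p' \<one> \<one> q' =
    sw YS h (\<lambda>h\<^sub>1 h\<^sub>2. sw YS g (\<lambda>g\<^sub>1 g\<^sub>2. sw YS \<one> (\<lambda>g'\<^sub>1 g'\<^sub>2.
      yp (pone \<star> reg h\<^sub>1 g\<^sub>1 p') (h\<^sub>2 \<otimes> \<one>) (g'\<^sub>1 \<otimes> g\<^sub>2) (q' \<star> reg (S \<one>) (T g'\<^sub>2) q))))"
    unfolding Y_mult_yp[OF pone_closed h g q p' one_closed_H one_closed_H q']
    by (rule sw_cong[OF h], rule sw_cong[OF g], rule sw_one) (assumption | intro lin_intros; assumption?)+
  also have "\<dots> = sw YS h (\<lambda>h\<^sub>1 h\<^sub>2. sw YS g (\<lambda>g\<^sub>1 g\<^sub>2.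
      yp (pone \<star> reg h\<^sub>1 g\<^sub>1 p') (h\<^sub>2 \<otimes> \<one>) (\<one> \<otimes> g\<^sub>2) (q' \<star> reg (S \<one>) (T \<one>) q)))"
    by (rule sw_cong[OF h], rule sw_cong[OF g], rule sw_one) (assumption | intro lin_intros; assumption?)+
  also have "\<dots> = sw YS h (\<lambda>h\<^sub>1 h\<^sub>2. sw YS g (\<lambda>g\<^sub>1 g\<^sub>2. yp (reg h\<^sub>1 g\<^sub>1 p') h\<^sub>2 g\<^sub>2 (q' \<star> q)))"
    by (rule sw_cong[OF h], rule sw_cong[OF g])
      (simp add: antipode_one antipode_inv_one p' q ring.ring_simprules[OF ring_H] pmult_one_left)
  finally show ?thesis .
qed

text \<open>With \<open>p = p' = pone\<close> this is the second relation of the overview in its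
  solved form, which moves \<open>q\<close> past the middle factor.\<close>

lemma Y_mult_left_unit:
  assumes p: "p \<in> carrier dual" and q: "q \<in> carrier dual"
    and p': "p' \<in> carrier dual" and h: "h \<in> carrier H" and g: "g \<in> carrier H"
  shows "yp p \<one> \<one> q \<otimes>\<^bsub>Y\<^esub> yp p' h g pone =
    sw YS h (\<lambda>h\<^sub>1 h\<^sub>2. sw YS g (\<lambda>g\<^sub>1 g\<^sub>2. yp (p \<star> p') h\<^sub>1 g\<^sub>1 (reg (S h\<^sub>2) (T g\<^sub>2) q)))"
proof -
  note assms [lin_intros]
  have "yp p \<one> \<one> q \<otimes>\<^bsub>Y\<^esub> yp p' h g pone =
    sw YS \<one> (\<lambda>g\<^sub>1 g\<^sub>2. sw YS h (\<lambda>h'\<^sub>1 h'\<^sub>2. sw YS g (\<lambda>g'\<^sub>1 g'\<^sub>2.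
      yp (p \<star> reg \<one> g\<^sub>1 p') (\<one> \<otimes> h'\<^sub>1) (g'\<^sub>1 \<otimes> g\<^sub>2) (pone \<star> reg (S h'\<^sub>2) (T g'\<^sub>2) q))))"
    unfolding Y_mult_yp[OF p one_closed_H one_closed_H q p' h g pone_closed]
    by (rule sw_one) (assumption | intro lin_intros; assumption?)+
  also have "\<dots> = sw YS h (\<lambda>h'\<^sub>1 h'\<^sub>2. sw YS g (\<lambda>g'\<^sub>1 g'\<^sub>2.
      yp (p \<star> reg \<one> \<one> p') (\<one> \<otimes> h'\<^sub>1) (g'\<^sub>1 \<otimes> \<one>) (pone \<star> reg (S h'\<^sub>2) (T g'\<^sub>2) q)))"
    by (rule sw_one) (assumption | intro lin_intros; assumption?)+
  also have "\<dots> = sw YS h (\<lambda>h\<^sub>1 h\<^sub>2. sw YS g (\<lambda>g\<^sub>1 g\<^sub>2. yp (p \<star> p') h\<^sub>1 g\<^sub>1 (reg (S h\<^sub>2) (T g\<^sub>2) q)))"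
    by (rule sw_cong[OF h], rule sw_cong[OF g])
      (simp add: p' q ring.ring_simprules[OF ring_H] pmult_one_left)
  finally show ?thesis .
qed

lemma sw2_counit_left:
  assumes "vsp U" "h \<in> carrier H" "g \<in> carrier H"
    and f1: "\<And>g. g \<in> carrier H \<Longrightarrow> lin H U (\<lambda>h. f h g)" and f2: "\<And>h. h \<in> carrier H \<Longrightarrow> lin H U (\<lambda>g. f h g)"
  shows "sw U h (\<lambda>h\<^sub>1 h\<^sub>2. sw U g (\<lambda>g\<^sub>1 g\<^sub>2. (eps h\<^sub>1 * eps g\<^sub>1) \<odot>\<^bsub>U\<^esub> f h\<^sub>2 g\<^sub>2)) = f h g"
proof -
  have "sw U h (\<lambda>h\<^sub>1 h\<^sub>2. sw U g (\<lambda>g\<^sub>1 g\<^sub>2. (eps h\<^sub>1 * eps g\<^sub>1) \<odot>\<^bsub>U\<^esub> f h\<^sub>2 g\<^sub>2))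
    = sw U h (\<lambda>h\<^sub>1 h\<^sub>2. sw U g (\<lambda>g\<^sub>1 g\<^sub>2. eps g\<^sub>1 \<odot>\<^bsub>U\<^esub> (eps h\<^sub>1 \<odot>\<^bsub>U\<^esub> f h\<^sub>2 g\<^sub>2)))"
    by (rule sw_cong[OF assms(2)], rule sw_cong[OF assms(3)])
      (simp add: lin_closed[OF f1] assms(1) mult.commute)
  also have "\<dots> = sw U h (\<lambda>h\<^sub>1 h\<^sub>2. eps h\<^sub>1 \<odot>\<^bsub>U\<^esub> f h\<^sub>2 g)"
    by (rule sw_cong[OF assms(2)], rule sw_counit_left[OF assms(1) _ assms(3)])
      (assumption | intro lin_intros assms f2; assumption?)+
  also have "\<dots> = f h g"
    by (rule sw_counit_left[OF assms(1) f1 assms(2)]) (rule assms)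
  finally show ?thesis .
qed

lemma sw2_counit_right:
  assumes "vsp U" "h \<in> carrier H" "g \<in> carrier H"
    and f1: "\<And>g. g \<in> carrier H \<Longrightarrow> lin H U (\<lambda>h. f h g)" and f2: "\<And>h. h \<in> carrier H \<Longrightarrow> lin H U (\<lambda>g. f h g)"
  shows "sw U h (\<lambda>h\<^sub>1 h\<^sub>2. sw U g (\<lambda>g\<^sub>1 g\<^sub>2. (eps h\<^sub>2 * eps g\<^sub>2) \<odot>\<^bsub>U\<^esub> f h\<^sub>1 g\<^sub>1)) = f h g"
proof -
  have "sw U h (\<lambda>h\<^sub>1 h\<^sub>2. sw U g (\<lambda>g\<^sub>1 g\<^sub>2. (eps h\<^sub>2 * eps g\<^sub>2) \<odot>\<^bsub>U\<^esub> f h\<^sub>1 g\<^sub>1))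
    = sw U h (\<lambda>h\<^sub>1 h\<^sub>2. sw U g (\<lambda>g\<^sub>1 g\<^sub>2. eps g\<^sub>2 \<odot>\<^bsub>U\<^esub> (eps h\<^sub>2 \<odot>\<^bsub>U\<^esub> f h\<^sub>1 g\<^sub>1)))"
    by (rule sw_cong[OF assms(2)], rule sw_cong[OF assms(3)])
      (simp add: lin_closed[OF f1] assms(1) mult.commute)
  also have "\<dots> = sw U h (\<lambda>h\<^sub>1 h\<^sub>2. eps h\<^sub>2 \<odot>\<^bsub>U\<^esub> f h\<^sub>1 g)"
    by (rule sw_cong[OF assms(2)], rule sw_counit_right[OF assms(1) _ assms(3)])
      (assumption | intro lin_intros assms f2; assumption?)+
  also have "\<dots> = f h g"
    by (rule sw_counit_right[OF assms(1) f1 assms(2)]) (rule assms)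
  finally show ?thesis .
qed

lemma Y_decompose_left:
  assumes p: "p \<in> carrier dual" and h: "h \<in> carrier H" and g: "g \<in> carrier H"
  shows "yp p \<one> \<one> pone \<otimes>\<^bsub>Y\<^esub> yp pone h g pone = yp p h g pone"
proof -
  note assms [lin_intros]
  have "yp p \<one> \<one> pone \<otimes>\<^bsub>Y\<^esub> yp pone h g pone
    = sw YS h (\<lambda>h\<^sub>1 h\<^sub>2. sw YS g (\<lambda>g\<^sub>1 g\<^sub>2. (eps h\<^sub>2 * eps g\<^sub>2) \<odot>\<^bsub>YS\<^esub> yp p h\<^sub>1 g\<^sub>1 pone))"
    unfolding Y_mult_left_unit[OF p pone_closed pone_closed h g]
  proof (rule sw_cong[OF h], rule sw_cong[OF g])
    fix h\<^sub>1 h\<^sub>2 g\<^sub>1 g\<^sub>2 assume *: "h\<^sub>1 \<in> carrier H" "h\<^sub>2 \<in> carrier H" "g\<^sub>1 \<in> carrier H" "g\<^sub>2 \<in> carrier H"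
    have l: "lin dual YS (\<lambda>q. yp p h\<^sub>1 g\<^sub>1 q)" by (intro lin_intros *)
    show "yp (p \<star> pone) h\<^sub>1 g\<^sub>1 (reg (S h\<^sub>2) (T g\<^sub>2) pone) = (eps h\<^sub>2 * eps g\<^sub>2) \<odot>\<^bsub>YS\<^esub> yp p h\<^sub>1 g\<^sub>1 pone"
      using * by (simp add: reg_pone counit_antipode counit_antipode_inv pmult_one_right p lin_smult[OF l])
  qed
  also have "\<dots> = yp p h g pone"
    by (rule sw2_counit_right) (assumption | intro lin_intros; assumption?)+
  finally show ?thesis .
qed

lemma Y_decompose_right:
  assumes q: "q \<in> carrier dual" and h: "h \<in> carrier H" and g: "g \<in> carrier H"
  shows "yp pone h g pone \<otimes>\<^bsub>Y\<^esub> yp pone \<one> \<one> q = yp pone h g q"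
proof -
  note assms [lin_intros]
  have "yp pone h g pone \<otimes>\<^bsub>Y\<^esub> yp pone \<one> \<one> q
    = sw YS h (\<lambda>h\<^sub>1 h\<^sub>2. sw YS g (\<lambda>g\<^sub>1 g\<^sub>2. (eps h\<^sub>1 * eps g\<^sub>1) \<odot>\<^bsub>YS\<^esub> yp pone h\<^sub>2 g\<^sub>2 q))"
    unfolding Y_mult_right_unit[OF h g pone_closed pone_closed q]
  proof (rule sw_cong[OF h], rule sw_cong[OF g])
    fix h\<^sub>1 h\<^sub>2 g\<^sub>1 g\<^sub>2 assume *: "h\<^sub>1 \<in> carrier H" "h\<^sub>2 \<in> carrier H" "g\<^sub>1 \<in> carrier H" "g\<^sub>2 \<in> carrier H"
    have l: "lin dual YS (\<lambda>p. yp p h\<^sub>2 g\<^sub>2 q)" by (intro lin_intros *)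
    show "yp (reg h\<^sub>1 g\<^sub>1 pone) h\<^sub>2 g\<^sub>2 (q \<star> pone) = (eps h\<^sub>1 * eps g\<^sub>1) \<odot>\<^bsub>YS\<^esub> yp pone h\<^sub>2 g\<^sub>2 q"
      using * by (simp add: reg_pone pmult_one_right q lin_smult[OF l])
  qed
  also have "\<dots> = yp pone h g q"
    by (rule sw2_counit_left) (assumption | intro lin_intros; assumption?)+
  finally show ?thesis .
qed

text \<open>Together with \<open>Y_decompose_right\<close> it factors a generator into its left,
  middle and right part, so that a \<open>Y\<close>-module is determined by the actions of these
  three kinds of elements.\<close>

lemma Y_decompose:
  assumes p: "p \<in> carrier dual" and q: "q \<in> carrier dual" and h: "h \<in> carrier H" and g: "g \<in> carrier H"
  shows "yp p \<one> \<one> pone \<otimes>\<^bsub>Y\<^esub> yp pone h g q = yp p h g q"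
proof -
  note assms [lin_intros]
  let ?F = "\<lambda>h g h' g'. yp p (\<one> \<otimes> h) (g \<otimes> \<one>) (q \<star> reg (S h') (T g') pone)"
  have "yp p \<one> \<one> pone \<otimes>\<^bsub>Y\<^esub> yp pone h g q =
    sw YS \<one> (\<lambda>g\<^sub>1 g\<^sub>2. sw YS h (\<lambda>h'\<^sub>1 h'\<^sub>2. sw YS g (\<lambda>g'\<^sub>1 g'\<^sub>2.
      yp (p \<star> reg \<one> g\<^sub>1 pone) (\<one> \<otimes> h'\<^sub>1) (g'\<^sub>1 \<otimes> g\<^sub>2) (q \<star> reg (S h'\<^sub>2) (T g'\<^sub>2) pone))))"
    unfolding Y_mult_yp[OF p one_closed_H one_closed_H pone_closed pone_closed h g q]
    by (rule sw_one) (assumption | intro lin_intros; assumption?)+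
  also have "\<dots> = sw YS h (\<lambda>h'\<^sub>1 h'\<^sub>2. sw YS g (\<lambda>g'\<^sub>1 g'\<^sub>2.
      yp (p \<star> reg \<one> \<one> pone) (\<one> \<otimes> h'\<^sub>1) (g'\<^sub>1 \<otimes> \<one>) (q \<star> reg (S h'\<^sub>2) (T g'\<^sub>2) pone)))"
    by (rule sw_one) (assumption | intro lin_intros; assumption?)+
  also have "\<dots> = sw YS h (\<lambda>h\<^sub>1 h\<^sub>2. sw YS g (\<lambda>g\<^sub>1 g\<^sub>2. (eps h\<^sub>2 * eps g\<^sub>2) \<odot>\<^bsub>YS\<^esub> yp p h\<^sub>1 g\<^sub>1 q))"
  proof (rule sw_cong[OF h], rule sw_cong[OF g])
    fix h\<^sub>1 h\<^sub>2 g\<^sub>1 g\<^sub>2 assume *: "h\<^sub>1 \<in> carrier H" "h\<^sub>2 \<in> carrier H" "g\<^sub>1 \<in> carrier H" "g\<^sub>2 \<in> carrier H"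
    have l: "lin dual YS (\<lambda>q. yp p h\<^sub>1 g\<^sub>1 q)" "lin dual dual (\<lambda>p. q \<star> p)" by (intro lin_intros *)+
    show "yp (p \<star> reg \<one> \<one> pone) (\<one> \<otimes> h\<^sub>1) (g\<^sub>1 \<otimes> \<one>) (q \<star> reg (S h\<^sub>2) (T g\<^sub>2) pone)
      = (eps h\<^sub>2 * eps g\<^sub>2) \<odot>\<^bsub>YS\<^esub> yp p h\<^sub>1 g\<^sub>1 q"
      using * by (simp add: reg_pone[of "S h\<^sub>2"] counit_antipode counit_antipode_inv pmult_one_right
          p q lin_smult[OF l(1)] lin_smult[OF l(2)] ring.ring_simprules[OF ring_H])
  qed
  also have "\<dots> = yp p h g q"
    by (rule sw2_counit_right) (assumption | intro lin_intros; assumption?)+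
  finally show ?thesis .
qed

text \<open>The units of the outer algebras are fixed by \<open>K\<close> up to counits, so these
  counits remove one component of each of the four arguments and \<open>K\<close> embeds as a
  subalgebra.\<close>

lemma Y_mult_middle:
  assumes h: "h \<in> carrier H" and g: "g \<in> carrier H" and h': "h' \<in> carrier H" and g': "g' \<in> carrier H"
  shows "yp pone h g pone \<otimes>\<^bsub>Y\<^esub> yp pone h' g' pone = yp pone (h \<otimes> h') (g' \<otimes> g) pone"
proof -
  note assms [lin_intros]
  have "yp pone h g pone \<otimes>\<^bsub>Y\<^esub> yp pone h' g' pone =
    sw YS h (\<lambda>h\<^sub>1 h\<^sub>2. sw YS g (\<lambda>g\<^sub>1 g\<^sub>2. sw YS h' (\<lambda>h'\<^sub>1 h'\<^sub>2. sw YS g' (\<lambda>g'\<^sub>1 g'\<^sub>2.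
      (eps h'\<^sub>2 * eps g'\<^sub>2) \<odot>\<^bsub>YS\<^esub> ((eps h\<^sub>1 * eps g\<^sub>1) \<odot>\<^bsub>YS\<^esub> yp pone (h\<^sub>2 \<otimes> h'\<^sub>1) (g'\<^sub>1 \<otimes> g\<^sub>2) pone)))))"
    unfolding Y_mult_yp[OF pone_closed h g pone_closed pone_closed h' g' pone_closed]
  proof (rule sw_cong[OF h], rule sw_cong[OF g], rule sw_cong[OF h'], rule sw_cong[OF g'])
    fix h\<^sub>1 h\<^sub>2 g\<^sub>1 g\<^sub>2 h'\<^sub>1 h'\<^sub>2 g'\<^sub>1 g'\<^sub>2
    assume *: "h\<^sub>1 \<in> carrier H" "h\<^sub>2 \<in> carrier H" "g\<^sub>1 \<in> carrier H" "g\<^sub>2 \<in> carrier H"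
      "h'\<^sub>1 \<in> carrier H" "h'\<^sub>2 \<in> carrier H" "g'\<^sub>1 \<in> carrier H" "g'\<^sub>2 \<in> carrier H"
    have l: "lin dual YS (\<lambda>q. yp pone (h\<^sub>2 \<otimes> h'\<^sub>1) (g'\<^sub>1 \<otimes> g\<^sub>2) q)"
      "\<And>q. q \<in> carrier dual \<Longrightarrow> lin dual YS (\<lambda>p. yp p (h\<^sub>2 \<otimes> h'\<^sub>1) (g'\<^sub>1 \<otimes> g\<^sub>2) q)"
      by (intro lin_intros *; assumption?)+
    show "yp (pone \<star> reg h\<^sub>1 g\<^sub>1 pone) (h\<^sub>2 \<otimes> h'\<^sub>1) (g'\<^sub>1 \<otimes> g\<^sub>2) (pone \<star> reg (S h'\<^sub>2) (T g'\<^sub>2) pone)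
      = (eps h'\<^sub>2 * eps g'\<^sub>2) \<odot>\<^bsub>YS\<^esub> ((eps h\<^sub>1 * eps g\<^sub>1) \<odot>\<^bsub>YS\<^esub> yp pone (h\<^sub>2 \<otimes> h'\<^sub>1) (g'\<^sub>1 \<otimes> g\<^sub>2) pone)"
      using * by (simp add: reg_pone counit_antipode counit_antipode_inv pmult_one_left lin_smult[OF l(1)]
          lin_smult[OF l(2)] yp_closed ac_simps)
  qed
  also have "\<dots> = sw YS h (\<lambda>h\<^sub>1 h\<^sub>2. sw YS g (\<lambda>g\<^sub>1 g\<^sub>2.
      (eps h\<^sub>1 * eps g\<^sub>1) \<odot>\<^bsub>YS\<^esub> yp pone (h\<^sub>2 \<otimes> h') (g' \<otimes> g\<^sub>2) pone))"
    by (rule sw_cong[OF h], rule sw_cong[OF g], rule sw2_counit_right)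
      (assumption | intro lin_intros; assumption?)+
  also have "\<dots> = yp pone (h \<otimes> h') (g' \<otimes> g) pone"
    by (rule sw2_counit_left) (assumption | intro lin_intros; assumption?)+
  finally show ?thesis .
qed

end

section \<open>From the common structure to \<open>Y\<close>-modules\<close>

context action_data
begin

lemmas data_intros = bil_comp_left[OF bil_l] bil_comp_right[OF bil_l] bil_closed[OF bil_l]
  bil_comp_left[OF bil_r] bil_comp_right[OF bil_r] bil_closed[OF bil_r]
  lin_compose[OF c_lin_left] lin_compose[OF c_lin_mid] lin_compose[OF c_lin_right]
  lin_closed[OF c_lin_right] vsp_M

text \<open>This is \<open>c_r\<close> solved for the right action on \<open>h m g\<close>.
  Substituting \<open>c_r\<close> on the right-hand side produces, in consecutive components,
  \<open>reg (h\<^sub>2 \<otimes> S h\<^sub>3) (T g\<^sub>3 \<otimes> g\<^sub>2) q\<close>, and both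
  products cancel.\<close>

lemma r_c:
  assumes h: "h \<in> carrier H" and g: "g \<in> carrier H" and q: "q \<in> carrier dual" and m: "m \<in> carrier M"
  shows "r (c h g m) q = sw M h (\<lambda>h\<^sub>1 h\<^sub>2. sw M g (\<lambda>g\<^sub>1 g\<^sub>2. c h\<^sub>1 g\<^sub>1 (r m (reg (S h\<^sub>2) (T g\<^sub>2) q))))"
proof -
  note intros = lin_intros data_intros assms
  have "sw M h (\<lambda>h\<^sub>1 h\<^sub>2. sw M g (\<lambda>g\<^sub>1 g\<^sub>2. c h\<^sub>1 g\<^sub>1 (r m (reg (S h\<^sub>2) (T g\<^sub>2) q))))
    = sw M h (\<lambda>h\<^sub>1 h\<^sub>2. sw M g (\<lambda>g\<^sub>1 g\<^sub>2. sw M h\<^sub>1 (\<lambda>a b. sw M g\<^sub>1 (\<lambda>a' b'.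
        r (c a a' m) (reg (b \<otimes> S h\<^sub>2) (T g\<^sub>2 \<otimes> b') q)))))"
  proof (rule sw_cong[OF h], rule sw_cong[OF g])
    fix h\<^sub>1 h\<^sub>2 g\<^sub>1 g\<^sub>2 assume *: "h\<^sub>1 \<in> carrier H" "h\<^sub>2 \<in> carrier H" "g\<^sub>1 \<in> carrier H" "g\<^sub>2 \<in> carrier H"
    have "c h\<^sub>1 g\<^sub>1 (r m (reg (S h\<^sub>2) (T g\<^sub>2) q))
      = sw M h\<^sub>1 (\<lambda>a b. sw M g\<^sub>1 (\<lambda>a' b'. r (c a a' m) (reg b b' (reg (S h\<^sub>2) (T g\<^sub>2) q))))"
      by (rule c_r) (assumption | intro intros *; assumption?)+
    also have "\<dots> = sw M h\<^sub>1 (\<lambda>a b. sw M g\<^sub>1 (\<lambda>a' b'. r (c a a' m) (reg (b \<otimes> S h\<^sub>2) (T g\<^sub>2 \<otimes> b') q)))"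
      by (rule sw_cong[OF *(1)], rule sw_cong[OF *(3)]) (simp add: reg_reg * q)
    finally show "c h\<^sub>1 g\<^sub>1 (r m (reg (S h\<^sub>2) (T g\<^sub>2) q)) = \<dots>" .
  qed
  also have "\<dots> = r (c h g m) (reg \<one> \<one> q)"
    by (rule sw_absorb2[OF vsp_M h g, where f = "\<lambda>a a' w w'. r (c a a' m) (reg w w' q)"
          and k = "\<lambda>a b. a \<otimes> S b" and k' = "\<lambda>a b. T b \<otimes> a"])
      (rule sw_antipode_right[OF vsp_M] sw_antipode_inv_left[OF vsp_M] | assumption | intro intros; assumption?)+
  finally show ?thesis by (simp add: q)
qed

definition module_act where
  "module_act y m = sweedler dual (tensor_space HH dual) M (\<lambda>p s. sweedler HH dual M (\<lambda>x q.
     l p (sweedler H H M (\<lambda>h g. c h g (r m q)) x)) s) y"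

lemma module_act_yp:
  assumes p: "p \<in> carrier dual" and h: "h \<in> carrier H" and g: "g \<in> carrier H" and q: "q \<in> carrier dual"
    and m: "m \<in> carrier M"
  shows "module_act (yp p h g q) m = l p (c h g (r m q))"
proof -
  note intros = lin_intros data_intros assms
  have "module_act (yp p h g q) m
    = sweedler HH dual M (\<lambda>x q. l p (sweedler H H M (\<lambda>h g. c h g (r m q)) x)) (pure_tensor HH dual (hh h g) q)"
    unfolding module_act_def by (rule sweedler_pure_eq) (rule refl | assumption | intro intros; assumption?)+
  also have "\<dots> = l p (sweedler H H M (\<lambda>h g. c h g (r m q)) (hh h g))"
    by (rule sweedler_pure_eq) (rule refl | assumption | intro intros; assumption?)+
  also have "sweedler H H M (\<lambda>h g. c h g (r m q)) (hh h g) = c h g (r m q)"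
    by (rule sweedler_pure_eq) (rule refl | assumption | intro intros; assumption?)+
  finally show ?thesis .
qed

lemma bil_module_act: "bil YS M M module_act"
  unfolding module_act_def by (assumption | intro lin_intros data_intros; assumption?)+

lemmas module_act_intros = bil_comp_left[OF bil_module_act] bil_comp_right[OF bil_module_act]
  bil_closed[OF bil_module_act]

lemma module_act_one: "m \<in> carrier M \<Longrightarrow> module_act (yp pone \<one> \<one> pone) m = m"
  by (simp add: module_act_yp l_one r_one c_one)

text \<open>After expanding the product in \<open>Y\<close>, the sums over \<open>h'\<close> and
  \<open>g'\<close> are closed by \<open>r_c\<close> and those over \<open>h\<close> and
  \<open>g\<close> by \<open>c_l\<close>: the two actions of \<open>K\<close> that define the
  crossed product are made for these two relations.\<close>

lemma module_act_mult_yp: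
  assumes p: "p \<in> carrier dual" and h: "h \<in> carrier H" and g: "g \<in> carrier H" and q: "q \<in> carrier dual"
    and p': "p' \<in> carrier dual" and h': "h' \<in> carrier H" and g': "g' \<in> carrier H" and q': "q' \<in> carrier dual"
    and m: "m \<in> carrier M"
  shows "module_act (yp p h g q \<otimes>\<^bsub>Y\<^esub> yp p' h' g' q') m = module_act (yp p h g q) (module_act (yp p' h' g' q') m)"
proof -
  note intros = lin_intros data_intros assms
  \<comment> \<open>\<open>q'\<close> acts first. The right factor of \<open>Y\<close> is the
    opposite algebra, so \<open>q' \<star> x\<close> acts from the right as \<open>q'\<close>
    followed by \<open>x\<close>, and \<open>r m q'\<close> is common to all summands.\<close>
  define n where "n = r m q'"
  have n: "n \<in> carrier M" unfolding n_def by (intro intros)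
  have YS: "vsp YS" by simp
  have al: "lin YS M (\<lambda>y. module_act y m)" by (rule bil_left[OF bil_module_act m])
  let ?y = "\<lambda>h\<^sub>1 h\<^sub>2 g\<^sub>1 g\<^sub>2 h'\<^sub>1 h'\<^sub>2 g'\<^sub>1 g'\<^sub>2. yp (p \<star> reg h\<^sub>1 g\<^sub>1 p') (h\<^sub>2 \<otimes> h'\<^sub>1) (g'\<^sub>1 \<otimes> g\<^sub>2) (q' \<star> reg (S h'\<^sub>2) (T g'\<^sub>2) q)"
  have "module_act (yp p h g q \<otimes>\<^bsub>Y\<^esub> yp p' h' g' q') m
    = module_act (sw YS h (\<lambda>h\<^sub>1 h\<^sub>2. sw YS g (\<lambda>g\<^sub>1 g\<^sub>2. sw YS h' (\<lambda>h'\<^sub>1 h'\<^sub>2. sw YS g' (\<lambda>g'\<^sub>1 g'\<^sub>2.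
        ?y h\<^sub>1 h\<^sub>2 g\<^sub>1 g\<^sub>2 h'\<^sub>1 h'\<^sub>2 g'\<^sub>1 g'\<^sub>2))))) m"
    by (simp only: Y_mult_yp assms)
  also have "\<dots> = sw M h (\<lambda>h\<^sub>1 h\<^sub>2. module_act (sw YS g (\<lambda>g\<^sub>1 g\<^sub>2. sw YS h' (\<lambda>h'\<^sub>1 h'\<^sub>2. sw YS g' (\<lambda>g'\<^sub>1 g'\<^sub>2.
        ?y h\<^sub>1 h\<^sub>2 g\<^sub>1 g\<^sub>2 h'\<^sub>1 h'\<^sub>2 g'\<^sub>1 g'\<^sub>2)))) m)"
    by (rule lin_sw[OF al YS vsp_M _ h]) (assumption | intro intros; assumption?)+
  also have "\<dots> = sw M h (\<lambda>h\<^sub>1 h\<^sub>2. sw M g (\<lambda>g\<^sub>1 g\<^sub>2. module_act (sw YS h' (\<lambda>h'\<^sub>1 h'\<^sub>2. sw YS g' (\<lambda>g'\<^sub>1 g'\<^sub>2.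
        ?y h\<^sub>1 h\<^sub>2 g\<^sub>1 g\<^sub>2 h'\<^sub>1 h'\<^sub>2 g'\<^sub>1 g'\<^sub>2))) m))"
    by (rule sw_cong[OF h], rule lin_sw[OF al YS vsp_M _ g]) (assumption | intro intros; assumption?)+
  also have "\<dots> = sw M h (\<lambda>h\<^sub>1 h\<^sub>2. sw M g (\<lambda>g\<^sub>1 g\<^sub>2. sw M h' (\<lambda>h'\<^sub>1 h'\<^sub>2. module_act (sw YS g' (\<lambda>g'\<^sub>1 g'\<^sub>2.
        ?y h\<^sub>1 h\<^sub>2 g\<^sub>1 g\<^sub>2 h'\<^sub>1 h'\<^sub>2 g'\<^sub>1 g'\<^sub>2)) m)))"
    by (rule sw_cong[OF h], rule sw_cong[OF g], rule lin_sw[OF al YS vsp_M _ h'])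
      (assumption | intro intros; assumption?)+
  also have "\<dots> = sw M h (\<lambda>h\<^sub>1 h\<^sub>2. sw M g (\<lambda>g\<^sub>1 g\<^sub>2. sw M h' (\<lambda>h'\<^sub>1 h'\<^sub>2. sw M g' (\<lambda>g'\<^sub>1 g'\<^sub>2.
        module_act (?y h\<^sub>1 h\<^sub>2 g\<^sub>1 g\<^sub>2 h'\<^sub>1 h'\<^sub>2 g'\<^sub>1 g'\<^sub>2) m))))"
    by (rule sw_cong[OF h], rule sw_cong[OF g], rule sw_cong[OF h'], rule lin_sw[OF al YS vsp_M _ g'])
      (assumption | intro intros; assumption?)+
  also have "\<dots> = sw M h (\<lambda>h\<^sub>1 h\<^sub>2. sw M g (\<lambda>g\<^sub>1 g\<^sub>2. sw M h' (\<lambda>h'\<^sub>1 h'\<^sub>2. sw M g' (\<lambda>g'\<^sub>1 g'\<^sub>2.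
        l p (l (reg h\<^sub>1 g\<^sub>1 p') (c h\<^sub>2 g\<^sub>2 (c h'\<^sub>1 g'\<^sub>1 (r n (reg (S h'\<^sub>2) (T g'\<^sub>2) q)))))))))"
    unfolding n_def
    by (rule sw_cong[OF h], rule sw_cong[OF g], rule sw_cong[OF h'], rule sw_cong[OF g'])
      (simp add: module_act_yp l_mult r_mult c_mult assms bil_closed[OF bil_r] lin_closed[OF c_lin_right])
  also have "\<dots> = sw M h (\<lambda>h\<^sub>1 h\<^sub>2. sw M g (\<lambda>g\<^sub>1 g\<^sub>2.
        l p (l (reg h\<^sub>1 g\<^sub>1 p') (c h\<^sub>2 g\<^sub>2 (r (c h' g' n) q)))))"
  proof (rule sw_cong[OF h], rule sw_cong[OF g])
    fix h\<^sub>1 h\<^sub>2 g\<^sub>1 g\<^sub>2 assume *: "h\<^sub>1 \<in> carrier H" "h\<^sub>2 \<in> carrier H" "g\<^sub>1 \<in> carrier H" "g\<^sub>2 \<in> carrier H"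
    let ?L = "\<lambda>n. l p (l (reg h\<^sub>1 g\<^sub>1 p') (c h\<^sub>2 g\<^sub>2 n))"
    let ?w = "\<lambda>h'\<^sub>1 h'\<^sub>2 g'\<^sub>1 g'\<^sub>2. c h'\<^sub>1 g'\<^sub>1 (r n (reg (S h'\<^sub>2) (T g'\<^sub>2) q))"
    have L: "lin M M ?L" by (assumption | intro intros *; assumption?)+
    have "?L (r (c h' g' n) q) = ?L (sw M h' (\<lambda>h'\<^sub>1 h'\<^sub>2. sw M g' (\<lambda>g'\<^sub>1 g'\<^sub>2. ?w h'\<^sub>1 h'\<^sub>2 g'\<^sub>1 g'\<^sub>2)))"
      by (simp only: r_c assms n)
    also have "\<dots> = sw M h' (\<lambda>h'\<^sub>1 h'\<^sub>2. ?L (sw M g' (\<lambda>g'\<^sub>1 g'\<^sub>2. ?w h'\<^sub>1 h'\<^sub>2 g'\<^sub>1 g'\<^sub>2)))"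
      by (rule lin_sw[OF L vsp_M vsp_M _ h']) (assumption | intro intros * n; assumption?)+
    also have "\<dots> = sw M h' (\<lambda>h'\<^sub>1 h'\<^sub>2. sw M g' (\<lambda>g'\<^sub>1 g'\<^sub>2. ?L (?w h'\<^sub>1 h'\<^sub>2 g'\<^sub>1 g'\<^sub>2)))"
      by (rule sw_cong[OF h'], rule lin_sw[OF L vsp_M vsp_M _ g']) (assumption | intro intros * n; assumption?)+
    finally show "sw M h' (\<lambda>h'\<^sub>1 h'\<^sub>2. sw M g' (\<lambda>g'\<^sub>1 g'\<^sub>2. ?L (?w h'\<^sub>1 h'\<^sub>2 g'\<^sub>1 g'\<^sub>2))) = ?L (r (c h' g' n) q)" by simp
  qed
  also have "\<dots> = l p (c h g (l p' (r (c h' g' n) q)))"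
  proof -
    let ?n = "r (c h' g' n) q"
    have n': "?n \<in> carrier M" by (intro intros n)
    have L: "lin M M (l p)" by (rule bil_right[OF bil_l p])
    have "l p (c h g (l p' ?n)) = l p (sw M h (\<lambda>h\<^sub>1 h\<^sub>2. sw M g (\<lambda>g\<^sub>1 g\<^sub>2. l (reg h\<^sub>1 g\<^sub>1 p') (c h\<^sub>2 g\<^sub>2 ?n))))"
      by (simp only: c_l[OF h g p' n'])
    also have "\<dots> = sw M h (\<lambda>h\<^sub>1 h\<^sub>2. l p (sw M g (\<lambda>g\<^sub>1 g\<^sub>2. l (reg h\<^sub>1 g\<^sub>1 p') (c h\<^sub>2 g\<^sub>2 ?n))))"
      by (rule lin_sw[OF L vsp_M vsp_M _ h]) (assumption | intro intros n'; assumption?)+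
    also have "\<dots> = sw M h (\<lambda>h\<^sub>1 h\<^sub>2. sw M g (\<lambda>g\<^sub>1 g\<^sub>2. l p (l (reg h\<^sub>1 g\<^sub>1 p') (c h\<^sub>2 g\<^sub>2 ?n))))"
      by (rule sw_cong[OF h], rule lin_sw[OF L vsp_M vsp_M _ g]) (assumption | intro intros n'; assumption?)+
    finally show ?thesis by simp
  qed
  also have "\<dots> = module_act (yp p h g q) (module_act (yp p' h' g' q') m)"
    unfolding n_def
    by (simp add: module_act_yp assms l_r bil_closed[OF bil_l] bil_closed[OF bil_r] lin_closed[OF c_lin_right])
  finally show ?thesis .
qed

lemma module_act_mult:
  assumes y: "y \<in> carrier YS" and z: "z \<in> carrier YS" and m: "m \<in> carrier M"
  shows "module_act (y \<otimes>\<^bsub>Y\<^esub> z) m = module_act y (module_act z m)"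
proof -
  note ym = bil_comp_left[OF bil_Y_mult] bil_comp_right[OF bil_Y_mult] bil_closed[OF bil_Y_mult]
  note intros = lin_intros module_act_intros ym assms
  show ?thesis
  proof (rule Y_eqI[OF _ _ vsp_M y, where f = "\<lambda>y. module_act (y \<otimes>\<^bsub>Y\<^esub> z) m"
        and g = "\<lambda>y. module_act y (module_act z m)"])
    fix p h g q assume *: "p \<in> carrier dual" "h \<in> carrier H" "g \<in> carrier H" "q \<in> carrier dual"
    show "module_act (yp p h g q \<otimes>\<^bsub>Y\<^esub> z) m = module_act (yp p h g q) (module_act z m)"
      by (rule Y_eqI[OF _ _ vsp_M z, where f = "\<lambda>z. module_act (yp p h g q \<otimes>\<^bsub>Y\<^esub> z) m"
            and g = "\<lambda>z. module_act (yp p h g q) (module_act z m)"])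
        (rule module_act_mult_yp[OF * _ _ _ _ m] | assumption | intro intros *; assumption?)+
  qed (assumption | intro intros; assumption?)+
qed

text \<open>\<open>mult\<close> and \<open>one\<close> are copied from \<open>M\<close> because the
  forgetful functor keeps them. The action is restricted to the carriers so that equality of modules
  is the mathematical one.\<close>

definition to_module :: "('k, ('k, 'a) Y_carrier, 'm) left_module" where
  "to_module = \<lparr>carrier = carrier M, mult = mult M, one = one M, zero = zero M, add = add M,
     smult = module.smult M, act = (\<lambda>y\<in>carrier Y. \<lambda>m\<in>carrier M. module_act y m)\<rparr>"

lemma to_module_simps:
  "carrier to_module = carrier M" "add to_module = add M" "module.smult to_module = module.smult M"
  "\<zero>\<^bsub>to_module\<^esub> = \<zero>\<^bsub>M\<^esub>"
  "y \<in> carrier YS \<Longrightarrow> m \<in> carrier M \<Longrightarrow> act to_module y m = module_act y m"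
  "act to_module \<in> extensional (carrier YS)" "y \<in> carrier YS \<Longrightarrow> act to_module y \<in> extensional (carrier M)"
  by (simp_all add: to_module_def Y_simps)

lemma left_module_to_module: "left_module Y to_module"
proof -
  have vs: "vsp to_module" by (rule vsp_cong[OF vsp_M]) (simp_all add: to_module_simps)
  have b: "bil YS M M (act to_module)"
    using bil_module_act
    by (simp add: bilinear_maps_def lin_iff to_module_simps vsp_M)
  show ?thesis
    unfolding left_module_def left_module_axioms_def
  proof (intro conjI allI impI)
    show "act to_module \<in> carrier Y \<rightarrow>\<^sub>E carrier to_module \<rightarrow>\<^sub>E carrier to_module"
      using bil_closed[OF bil_module_act] by (auto simp: to_module_def Y_simps)
    show "bil Y to_module to_module (act to_module)"
      using b bilinear_maps_cong[of Y YS to_module M to_module M] by (simp add: to_module_simps Y_simps)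
    show "act to_module \<one>\<^bsub>Y\<^esub> m = m" if "m \<in> carrier to_module" for m
      using that module_act_one by (simp add: Y_simps to_module_simps yp_closed)
    show "act to_module (y \<otimes>\<^bsub>Y\<^esub> z) m = act to_module y (act to_module z m)"
      if "y \<in> carrier Y" "z \<in> carrier Y" "m \<in> carrier to_module" for y z m
      using that module_act_mult bil_closed[OF bil_Y_mult] bil_closed[OF bil_module_act]
      by (simp add: Y_simps to_module_simps)
  qed (rule vs)
qed

end

section \<open>From \<open>Y\<close>-modules to the common structure\<close>

locale crossed_module = fin_dim_hopf H + N: left_module Y N
  for H :: "('k::field, 'a, 'x) hopf_scheme" (structure) and N :: "('k, ('k, 'a) Y_carrier, 'm) left_module"
begin

lemma vsp_N: "vsp N" by (rule N.vectorspace_axioms)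

lemma bil_act: "bil YS N N (act N)"
  using N.act_bilinear bilinear_maps_cong[of Y YS N N N N] by (simp add: Y_simps)

lemmas act_intros = bil_comp_left[OF bil_act] bil_comp_right[OF bil_act] bil_closed[OF bil_act] vsp_N

abbreviation la where "la p n \<equiv> act N (yp p \<one> \<one> pone) n"
abbreviation ra where "ra n q \<equiv> act N (yp pone \<one> \<one> q) n"
abbreviation ca where "ca h g n \<equiv> act N (yp pone h g pone) n"

lemma act_mult_eq:
  "y \<in> carrier YS \<Longrightarrow> z \<in> carrier YS \<Longrightarrow> n \<in> carrier N \<Longrightarrow> act N y (act N z n) = act N (y \<otimes>\<^bsub>Y\<^esub> z) n"
  using N.act_mult by (simp add: Y_simps)

lemma act_yp:
  assumes "p \<in> carrier dual" "h \<in> carrier H" "g \<in> carrier H" "q \<in> carrier dual" "n \<in> carrier N"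
  shows "act N (yp p h g q) n = la p (ca h g (ra n q))"
  using assms
  by (simp add: act_mult_eq Y_decompose_right Y_decompose yp_closed bil_closed[OF bil_act])

lemma act_sw:
  assumes n: "n \<in> carrier N" and h: "h \<in> carrier H" and g: "g \<in> carrier H"
    and b1: "\<And>a b. a \<in> carrier H \<Longrightarrow> b \<in> carrier H \<Longrightarrow> bil H H YS (f a b)"
    and b2: "\<And>a b. a \<in> carrier H \<Longrightarrow> b \<in> carrier H \<Longrightarrow> bil H H YS (\<lambda>h k. f h k a b)"
  shows "act N (sw YS h (\<lambda>h\<^sub>1 h\<^sub>2. sw YS g (\<lambda>g\<^sub>1 g\<^sub>2. f h\<^sub>1 h\<^sub>2 g\<^sub>1 g\<^sub>2))) n
    = sw N h (\<lambda>h\<^sub>1 h\<^sub>2. sw N g (\<lambda>g\<^sub>1 g\<^sub>2. act N (f h\<^sub>1 h\<^sub>2 g\<^sub>1 g\<^sub>2) n))"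
proof -
  have YS: "vsp YS" by simp
  have al: "lin YS N (\<lambda>y. act N y n)" by (rule bil_left[OF bil_act n])
  note intros = lin_intros assms bil_left[OF b1] bil_right[OF b1] bil_left[OF b2] bil_right[OF b2]
  have "act N (sw YS h (\<lambda>h\<^sub>1 h\<^sub>2. sw YS g (\<lambda>g\<^sub>1 g\<^sub>2. f h\<^sub>1 h\<^sub>2 g\<^sub>1 g\<^sub>2))) n
    = sw N h (\<lambda>h\<^sub>1 h\<^sub>2. act N (sw YS g (\<lambda>g\<^sub>1 g\<^sub>2. f h\<^sub>1 h\<^sub>2 g\<^sub>1 g\<^sub>2)) n)"
    by (rule lin_sw[OF al YS vsp_N _ h]) (assumption | intro intros; assumption?)+
  also have "\<dots> = sw N h (\<lambda>h\<^sub>1 h\<^sub>2. sw N g (\<lambda>g\<^sub>1 g\<^sub>2. act N (f h\<^sub>1 h\<^sub>2 g\<^sub>1 g\<^sub>2) n))"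
    by (rule sw_cong[OF h], rule lin_sw[OF al YS vsp_N _ g]) (assumption | intro intros; assumption?)+
  finally show ?thesis .
qed

lemma ra_ca:
  assumes h: "h \<in> carrier H" and g: "g \<in> carrier H" and q: "q \<in> carrier dual" and n: "n \<in> carrier N"
  shows "ra (ca h g n) q = sw N h (\<lambda>h\<^sub>1 h\<^sub>2. sw N g (\<lambda>g\<^sub>1 g\<^sub>2. ca h\<^sub>1 g\<^sub>1 (ra n (reg (S h\<^sub>2) (T g\<^sub>2) q))))"
proof -
  note intros = lin_intros assms
  have "ra (ca h g n) q
    = act N (sw YS h (\<lambda>h\<^sub>1 h\<^sub>2. sw YS g (\<lambda>g\<^sub>1 g\<^sub>2. yp (pone \<star> pone) h\<^sub>1 g\<^sub>1 (reg (S h\<^sub>2) (T g\<^sub>2) q)))) n"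
    by (simp add: act_mult_eq Y_mult_left_unit assms yp_closed)
  also have "\<dots> = sw N h (\<lambda>h\<^sub>1 h\<^sub>2. sw N g (\<lambda>g\<^sub>1 g\<^sub>2. act N (yp (pone \<star> pone) h\<^sub>1 g\<^sub>1 (reg (S h\<^sub>2) (T g\<^sub>2) q)) n))"
    by (rule act_sw[OF n h g]) (assumption | intro intros; assumption?)+
  also have "\<dots> = sw N h (\<lambda>h\<^sub>1 h\<^sub>2. sw N g (\<lambda>g\<^sub>1 g\<^sub>2. ca h\<^sub>1 g\<^sub>1 (ra n (reg (S h\<^sub>2) (T g\<^sub>2) q))))"
    by (rule sw_cong[OF h], rule sw_cong[OF g])
      (simp add: act_mult_eq Y_decompose_right pmult_one_left yp_closed assms)
  finally show ?thesis .
qed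

text \<open>All axioms are products of generators in \<open>Y\<close> except \<open>c_r\<close>: the
  multiplication of \<open>Y\<close> gives the solved form \<open>ra_ca\<close>, which has to be
  inverted.\<close>

sublocale action_data H N la ra ca
proof
  show "bil dual N N la" "bil N dual N ra" by (assumption | intro lin_intros act_intros; assumption?)+
  show "lin N N (\<lambda>n. ca h g n)" if "h \<in> carrier H" "g \<in> carrier H" for h g
    by (assumption | intro lin_intros act_intros that; assumption?)+
  fix n assume n: "n \<in> carrier N"
  show "la pone n = n"
    using N.act_one[OF n] by (simp add: Y_simps)
  show "la (p \<star> q) n = la p (la q n)" "ra n (p \<star> q) = ra (ra n p) q" "ra (la p n) q = la p (ra n q)"
    if "p \<in> carrier dual" "q \<in> carrier dual" for p q
    using that n by (simp_all add: act_mult_eq Y_mult_units yp_closed pmult_one_left pmult_one_right)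
  show "lin H N (\<lambda>h. ca h g n)" if "g \<in> carrier H" for g
    by (assumption | intro lin_intros act_intros n that; assumption?)+
  show "lin H N (\<lambda>g. ca h g n)" if "h \<in> carrier H" for h
    by (assumption | intro lin_intros act_intros n that; assumption?)+
  fix h g assume h: "h \<in> carrier H" and g: "g \<in> carrier H"
  note intros = lin_intros act_intros n h g
  show "ca (h \<otimes> h') (g' \<otimes> g) n = ca h g (ca h' g' n)" if "h' \<in> carrier H" "g' \<in> carrier H" for h' g'
    using that n h g by (simp add: act_mult_eq Y_mult_middle yp_closed)
  fix p assume p: "p \<in> carrier dual"
  have "ca h g (la p n) = act N (sw YS h (\<lambda>h\<^sub>1 h\<^sub>2. sw YS g (\<lambda>g\<^sub>1 g\<^sub>2. yp (reg h\<^sub>1 g\<^sub>1 p) h\<^sub>2 g\<^sub>2 (pone \<star> pone)))) n"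
    by (simp add: act_mult_eq Y_mult_right_unit h g p n yp_closed)
  also have "\<dots> = sw N h (\<lambda>h\<^sub>1 h\<^sub>2. sw N g (\<lambda>g\<^sub>1 g\<^sub>2. act N (yp (reg h\<^sub>1 g\<^sub>1 p) h\<^sub>2 g\<^sub>2 (pone \<star> pone)) n))"
    by (rule act_sw[OF n h g]) (assumption | intro intros p; assumption?)+
  also have "\<dots> = sw N h (\<lambda>h\<^sub>1 h\<^sub>2. sw N g (\<lambda>g\<^sub>1 g\<^sub>2. la (reg h\<^sub>1 g\<^sub>1 p) (ca h\<^sub>2 g\<^sub>2 n)))"
    by (rule sw_cong[OF h], rule sw_cong[OF g])
      (simp add: act_mult_eq Y_decompose_left pmult_one_left yp_closed p n)
  finally show "ca h g (la p n) = sw N h (\<lambda>h\<^sub>1 h\<^sub>2. sw N g (\<lambda>g\<^sub>1 g\<^sub>2. la (reg h\<^sub>1 g\<^sub>1 p) (ca h\<^sub>2 g\<^sub>2 n)))" .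
  \<comment> \<open>\<open>ra_ca\<close> is inverted by substituting it into the claimed sum. In
    consecutive components the products are now \<open>S h\<^sub>2 \<otimes> h\<^sub>3\<close> and
    \<open>g\<^sub>3 \<otimes> T g\<^sub>2\<close>, so the other two cancellation rules apply than
    in \<open>r_c\<close>.\<close>
  have "sw N h (\<lambda>h\<^sub>1 h\<^sub>2. sw N g (\<lambda>g\<^sub>1 g\<^sub>2. ra (ca h\<^sub>1 g\<^sub>1 n) (reg h\<^sub>2 g\<^sub>2 p)))
    = sw N h (\<lambda>h\<^sub>1 h\<^sub>2. sw N g (\<lambda>g\<^sub>1 g\<^sub>2. sw N h\<^sub>1 (\<lambda>a b. sw N g\<^sub>1 (\<lambda>a' b'.
        ca a a' (ra n (reg (S b \<otimes> h\<^sub>2) (g\<^sub>2 \<otimes> T b') p))))))"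
  proof (rule sw_cong[OF h], rule sw_cong[OF g])
    fix h\<^sub>1 h\<^sub>2 g\<^sub>1 g\<^sub>2 assume *: "h\<^sub>1 \<in> carrier H" "h\<^sub>2 \<in> carrier H" "g\<^sub>1 \<in> carrier H" "g\<^sub>2 \<in> carrier H"
    have "ra (ca h\<^sub>1 g\<^sub>1 n) (reg h\<^sub>2 g\<^sub>2 p)
      = sw N h\<^sub>1 (\<lambda>a b. sw N g\<^sub>1 (\<lambda>a' b'. ca a a' (ra n (reg (S b) (T b') (reg h\<^sub>2 g\<^sub>2 p)))))"
      by (rule ra_ca) (simp_all add: * n p)
    also have "\<dots> = sw N h\<^sub>1 (\<lambda>a b. sw N g\<^sub>1 (\<lambda>a' b'. ca a a' (ra n (reg (S b \<otimes> h\<^sub>2) (g\<^sub>2 \<otimes> T b') p))))"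
      by (rule sw_cong[OF *(1)], rule sw_cong[OF *(3)]) (simp add: reg_reg * p)
    finally show "ra (ca h\<^sub>1 g\<^sub>1 n) (reg h\<^sub>2 g\<^sub>2 p) = \<dots>" .
  qed
  also have "\<dots> = ca h g (ra n (reg \<one> \<one> p))"
    by (rule sw_absorb2[OF vsp_N h g, where f = "\<lambda>a a' w w'. ca a a' (ra n (reg w w' p))"
          and k = "\<lambda>a b. S a \<otimes> b" and k' = "\<lambda>a b. b \<otimes> T a"])
      (rule sw_antipode_left[OF vsp_N] sw_antipode_inv_right[OF vsp_N] | assumption | intro intros p; assumption?)+
  finally show "ca h g (ra n p) = sw N h (\<lambda>h\<^sub>1 h\<^sub>2. sw N g (\<lambda>g\<^sub>1 g\<^sub>2. ra (ca h\<^sub>1 g\<^sub>1 n) (reg h\<^sub>2 g\<^sub>2 p)))"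
    by (simp add: p)
qed

end

section \<open>Threefold tensor products\<close>

definition tril where
  "tril V W X U f \<longleftrightarrow> (\<forall>w\<in>carrier W. \<forall>x\<in>carrier X. lin V U (\<lambda>v. f v w x)) \<and>
    (\<forall>v\<in>carrier V. \<forall>x\<in>carrier X. lin W U (\<lambda>w. f v w x)) \<and>
    (\<forall>v\<in>carrier V. \<forall>w\<in>carrier W. lin X U (\<lambda>x. f v w x))"

lemma trilI [lin_intros]:
  "(\<And>w x. w \<in> carrier W \<Longrightarrow> x \<in> carrier X \<Longrightarrow> lin V U (\<lambda>v. f v w x)) \<Longrightarrow>
   (\<And>v x. v \<in> carrier V \<Longrightarrow> x \<in> carrier X \<Longrightarrow> lin W U (\<lambda>w. f v w x)) \<Longrightarrow>
   (\<And>v w. v \<in> carrier V \<Longrightarrow> w \<in> carrier W \<Longrightarrow> lin X U (\<lambda>x. f v w x)) \<Longrightarrow> tril V W X U f"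
  by (simp add: tril_def)

lemma tril1: "tril V W X U f \<Longrightarrow> w \<in> carrier W \<Longrightarrow> x \<in> carrier X \<Longrightarrow> lin V U (\<lambda>v. f v w x)"
  by (simp add: tril_def)

lemma tril2: "tril V W X U f \<Longrightarrow> v \<in> carrier V \<Longrightarrow> x \<in> carrier X \<Longrightarrow> lin W U (\<lambda>w. f v w x)"
  by (simp add: tril_def)

lemma tril3: "tril V W X U f \<Longrightarrow> v \<in> carrier V \<Longrightarrow> w \<in> carrier W \<Longrightarrow> lin X U (\<lambda>x. f v w x)"
  by (simp add: tril_def)

lemma bil_of_tril:
  assumes "vsp V" "vsp W" "vsp U" and f: "tril V W X U f"
  shows "bil V (tensor_space W X) U (\<lambda>v s. sweedler W X U (f v) s)"
  by (assumption | intro lin_intros assms tril1[OF f] tril2[OF f] tril3[OF f]; assumption?)+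

lemma lin_sweedler3_arg [lin_intros]:
  assumes "vsp V" "vsp W" "vsp U" "tril V W X U f" "lin Z (tensor_space3 V W X) g"
  shows "lin Z U (\<lambda>z. sweedler3 V W X U f (g z))"
  unfolding sweedler3_def by (intro lin_sweedler_arg bil_of_tril assms)

lemma lin_sweedler3_fun [lin_intros]:
  assumes t: "t \<in> carrier (tensor_space3 V W X)" and vs: "vsp V" "vsp W" "vsp U" "vsp Z"
    and lin: "\<And>v w x. v \<in> carrier V \<Longrightarrow> w \<in> carrier W \<Longrightarrow> x \<in> carrier X \<Longrightarrow> lin Z U (\<lambda>z. f z v w x)"
    and tril: "\<And>z. z \<in> carrier Z \<Longrightarrow> tril V W X U (f z)"
  shows "lin Z U (\<lambda>z. sweedler3 V W X U (f z) t)"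
  unfolding sweedler3_def
  by (rule lin_sweedler_fun[OF t vs(3) _ _ vs(4)])
    (assumption | intro lin_sweedler_fun bil_of_tril lin tril vs bilI tril2[OF tril] tril3[OF tril]; assumption?)+

lemma sweedler3_pure:
  assumes vs: "vsp V" "vsp W" "vsp U" and f: "tril V W X U f"
    and x: "v \<in> carrier V" "w \<in> carrier W" "x \<in> carrier X"
  shows "sweedler3 V W X U f (pure_tensor3 V W X v w x) = f v w x"
proof -
  have "sweedler3 V W X U f (pure_tensor3 V W X v w x) = sweedler W X U (f v) (pure_tensor W X w x)"
    unfolding sweedler3_def
    by (rule sweedler_pure_eq[OF vs(3) bil_of_tril[OF vs f] x(1) pure_closed[OF x(2,3)]]) (rule refl)
  also have "\<dots> = f v w x"
    by (rule sweedler_pure_eq[OF vs(3) _ x(2,3)])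
      (rule refl | assumption | intro bilI tril2[OF f] tril3[OF f] x; assumption?)+
  finally show ?thesis .
qed

lemmas sweedler3_pure_eq = trans[OF sweedler3_pure]

lemma tensor3_eqI:
  assumes f: "lin (tensor_space3 V W X) U f" and g: "lin (tensor_space3 V W X) U g"
    and vs: "vsp V" "vsp W" "vsp U" and t: "t \<in> carrier (tensor_space3 V W X)"
    and eq: "\<And>v w x. v \<in> carrier V \<Longrightarrow> w \<in> carrier W \<Longrightarrow> x \<in> carrier X
      \<Longrightarrow> f (pure_tensor3 V W X v w x) = g (pure_tensor3 V W X v w x)"
  shows "f t = g t"
proof (rule tensor_eqI[OF f g vs(1,3) _ t])
  fix v s assume v: "v \<in> carrier V" and s: "s \<in> carrier (tensor_space W X)"
  show "f (pure_tensor V (tensor_space W X) v s) = g (pure_tensor V (tensor_space W X) v s)"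
    by (rule tensor_eqI[OF _ _ vs(2,3) _ s])
      (assumption | intro lin_compose[OF f] lin_compose[OF g] lin_intros vs v eq; assumption?)+
qed

section \<open>Evaluation of tensors on elements of \<open>H\<close>\<close>

context fin_dim_hopf
begin

text \<open>Contraction of the dual leg at \<open>g\<close>. Applied to a coaction,
  \<open>evl\<close> and \<open>evr\<close> give the corresponding actions of
  \<open>H\<close>.\<close>

definition evl where
  "evl V g s = sweedler dual V V (\<lambda>a n. ev a g \<odot>\<^bsub>V\<^esub> n) s"

definition evr where
  "evr V g s = sweedler V dual V (\<lambda>n a. ev a g \<odot>\<^bsub>V\<^esub> n) s"

lemma lin_evl:
  assumes "vsp V" "g \<in> carrier H"
  shows "lin (tensor_space dual V) V (evl V g)"
  unfolding evl_def by (assumption | intro lin_intros assms; assumption?)+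

lemma lin_evl_left:
  assumes "vsp V" "s \<in> carrier (tensor_space dual V)"
  shows "lin H V (\<lambda>g. evl V g s)"
  unfolding evl_def by (assumption | intro lin_intros assms; assumption?)+

lemma lin_evr:
  assumes "vsp V" "g \<in> carrier H"
  shows "lin (tensor_space V dual) V (evr V g)"
  unfolding evr_def by (assumption | intro lin_intros assms; assumption?)+

lemma lin_evr_left:
  assumes "vsp V" "s \<in> carrier (tensor_space V dual)"
  shows "lin H V (\<lambda>g. evr V g s)"
  unfolding evr_def by (assumption | intro lin_intros assms; assumption?)+

lemmas ev_intros [lin_intros] = lin_compose[OF lin_evl] lin_compose[OF lin_evl_left]
  lin_compose[OF lin_evr] lin_compose[OF lin_evr_left] lin_closed[OF lin_evl] lin_closed[OF lin_evr]

lemma evl_pure: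
  assumes "vsp V" "g \<in> carrier H" "a \<in> carrier dual" "n \<in> carrier V"
  shows "evl V g (pure_tensor dual V a n) = ev a g \<odot>\<^bsub>V\<^esub> n"
  unfolding evl_def
  by (rule sweedler_pure_eq) (rule refl | assumption | intro lin_intros assms; assumption?)+

lemma evr_pure:
  assumes "vsp V" "g \<in> carrier H" "a \<in> carrier dual" "n \<in> carrier V"
  shows "evr V g (pure_tensor V dual n a) = ev a g \<odot>\<^bsub>V\<^esub> n"
  unfolding evr_def
  by (rule sweedler_pure_eq) (rule refl | assumption | intro lin_intros assms; assumption?)+

text \<open>Since \<open>H\<close> is finite dimensional, a tensor with a leg in the dual amounts to
  a linear map from \<open>H\<close> to \<open>V\<close>, and dual bases invert the passage to that
  map. It serves twice: evaluations separate tensors, and coactions can be rebuilt from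
  actions.\<close>

lemma evl_reconstruct:
  assumes V: "vsp V" and s: "s \<in> carrier (tensor_space dual V)"
  shows "tr (tensor_space dual V) (\<lambda>e p. pure_tensor dual V p (evl V e s)) = s"
proof (rule tensor_eqI[OF _ _ _ _ _ s, where U = "tensor_space dual V" and g = "\<lambda>s. s"
      and f = "\<lambda>s. tr (tensor_space dual V) (\<lambda>e p. pure_tensor dual V p (evl V e s))"])
  fix a n assume *: "a \<in> carrier dual" "n \<in> carrier V"
  have "tr (tensor_space dual V) (\<lambda>e p. pure_tensor dual V p (evl V e (pure_tensor dual V a n)))
    = tr (tensor_space dual V) (\<lambda>e p. ev a e \<odot>\<^bsub>tensor_space dual V\<^esub> pure_tensor dual V p n)"
  proof (rule tr_cong)
    fix e p assume **: "e \<in> carrier H" "p \<in> carrier dual"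
    have l: "lin V (tensor_space dual V) (\<lambda>n. pure_tensor dual V p n)" by (intro lin_intros **)
    show "pure_tensor dual V p (evl V e (pure_tensor dual V a n)) = ev a e \<odot>\<^bsub>tensor_space dual V\<^esub> pure_tensor dual V p n"
      using * ** V by (simp add: evl_pure lin_smult[OF l])
  qed
  also have "\<dots> = pure_tensor dual V a n"
    by (rule tr_form) (assumption | intro lin_intros V *; assumption?)+
  finally show "tr (tensor_space dual V) (\<lambda>e p. pure_tensor dual V p (evl V e (pure_tensor dual V a n)))
    = pure_tensor dual V a n" .
qed (assumption | intro lin_intros V; assumption?)+

lemma evr_reconstruct:
  assumes V: "vsp V" and s: "s \<in> carrier (tensor_space V dual)"
  shows "tr (tensor_space V dual) (\<lambda>e p. pure_tensor V dual (evr V e s) p) = s"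
proof (rule tensor_eqI[OF _ _ _ _ _ s, where U = "tensor_space V dual" and g = "\<lambda>s. s"
      and f = "\<lambda>s. tr (tensor_space V dual) (\<lambda>e p. pure_tensor V dual (evr V e s) p)"])
  fix n a assume *: "n \<in> carrier V" "a \<in> carrier dual"
  have "tr (tensor_space V dual) (\<lambda>e p. pure_tensor V dual (evr V e (pure_tensor V dual n a)) p)
    = tr (tensor_space V dual) (\<lambda>e p. ev a e \<odot>\<^bsub>tensor_space V dual\<^esub> pure_tensor V dual n p)"
  proof (rule tr_cong)
    fix e p assume **: "e \<in> carrier H" "p \<in> carrier dual"
    have l: "lin V (tensor_space V dual) (\<lambda>n. pure_tensor V dual n p)" by (intro lin_intros ** V)
    show "pure_tensor V dual (evr V e (pure_tensor V dual n a)) p = ev a e \<odot>\<^bsub>tensor_space V dual\<^esub> pure_tensor V dual n p"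
      using * ** V by (simp add: evr_pure lin_smult[OF l])
  qed
  also have "\<dots> = pure_tensor V dual n a"
    by (rule tr_form) (assumption | intro lin_intros V *; assumption?)+
  finally show "tr (tensor_space V dual) (\<lambda>e p. pure_tensor V dual (evr V e (pure_tensor V dual n a)) p)
    = pure_tensor V dual n a" .
qed (assumption | intro lin_intros V; assumption?)+

lemma evl_eqI:
  assumes V: "vsp V" and s: "s \<in> carrier (tensor_space dual V)" and t: "t \<in> carrier (tensor_space dual V)"
    and eq: "\<And>g. g \<in> carrier H \<Longrightarrow> evl V g s = evl V g t"
  shows "s = t"
proof -
  have "s = tr (tensor_space dual V) (\<lambda>e p. pure_tensor dual V p (evl V e s))"
    by (rule evl_reconstruct[OF V s, symmetric])
  also have "\<dots> = tr (tensor_space dual V) (\<lambda>e p. pure_tensor dual V p (evl V e t))"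
    by (rule tr_cong) (simp add: eq)
  also have "\<dots> = t" by (rule evl_reconstruct[OF V t])
  finally show ?thesis .
qed

lemma evr_eqI:
  assumes V: "vsp V" and s: "s \<in> carrier (tensor_space V dual)" and t: "t \<in> carrier (tensor_space V dual)"
    and eq: "\<And>g. g \<in> carrier H \<Longrightarrow> evr V g s = evr V g t"
  shows "s = t"
proof -
  have "s = tr (tensor_space V dual) (\<lambda>e p. pure_tensor V dual (evr V e s) p)"
    by (rule evr_reconstruct[OF V s, symmetric])
  also have "\<dots> = tr (tensor_space V dual) (\<lambda>e p. pure_tensor V dual (evr V e t) p)"
    by (rule tr_cong) (simp add: eq)
  also have "\<dots> = t" by (rule evr_reconstruct[OF V t])
  finally show ?thesis .
qed

text \<open>The first leg is evaluated at \<open>g\<close> and the last at \<open>h\<close>, in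
  accordance with \<open>h m g\<close>: a left coaction gives a right action and a right coaction a
  left action.\<close>

definition ev2 where
  "ev2 V g h s = evr V h (evl (tensor_space V dual) g s)"

lemma lin_ev2:
  assumes "vsp V" "g \<in> carrier H" "h \<in> carrier H"
  shows "lin (tensor_space3 dual V dual) V (ev2 V g h)"
  unfolding ev2_def by (assumption | intro lin_intros assms; assumption?)+

lemma lin_ev2_left:
  assumes "vsp V" "h \<in> carrier H" "s \<in> carrier (tensor_space3 dual V dual)"
  shows "lin H V (\<lambda>g. ev2 V g h s)"
  unfolding ev2_def by (assumption | intro lin_intros assms; assumption?)+

lemma lin_ev2_right:
  assumes "vsp V" "g \<in> carrier H" "s \<in> carrier (tensor_space3 dual V dual)"
  shows "lin H V (\<lambda>h. ev2 V g h s)"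
  unfolding ev2_def by (assumption | intro lin_intros assms; assumption?)+

lemmas ev2_intros [lin_intros] = lin_compose[OF lin_ev2] lin_compose[OF lin_ev2_left]
  lin_compose[OF lin_ev2_right] lin_closed[OF lin_ev2]

lemma ev2_pure:
  assumes "vsp V" "g \<in> carrier H" "h \<in> carrier H" "a \<in> carrier dual" "n \<in> carrier V" "s \<in> carrier (tensor_space V dual)"
  shows "ev2 V g h (pure_tensor dual (tensor_space V dual) a s) = ev a g \<odot>\<^bsub>V\<^esub> evr V h s"
proof -
  have "vsp (tensor_space V dual)" using assms by simp
  then show ?thesis
    using assms by (simp add: ev2_def evl_pure lin_smult[OF lin_evr])
qed

lemma ev2_pure3:
  assumes "vsp V" "g \<in> carrier H" "h \<in> carrier H" "a \<in> carrier dual" "n \<in> carrier V" "b \<in> carrier dual"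
  shows "ev2 V g h (pure_tensor3 dual V dual a n b) = (ev a g * ev b h) \<odot>\<^bsub>V\<^esub> n"
  using assms by (simp add: ev2_pure evr_pure pure_closed)

lemma ev2_eqI:
  assumes V: "vsp V" and s: "s \<in> carrier (tensor_space3 dual V dual)" and t: "t \<in> carrier (tensor_space3 dual V dual)"
    and eq: "\<And>g h. g \<in> carrier H \<Longrightarrow> h \<in> carrier H \<Longrightarrow> ev2 V g h s = ev2 V g h t"
  shows "s = t"
proof (rule evl_eqI[OF _ s t])
  show "vsp (tensor_space V dual)" using V by simp
  fix g assume g: "g \<in> carrier H"
  show "evl (tensor_space V dual) g s = evl (tensor_space V dual) g t"
    by (rule evr_eqI[OF V]) (use eq g in \<open>simp_all add: ev2_def lin_closed[OF lin_evl] V s t\<close>)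
qed

section \<open>The comultiplication of the dual\<close>

lemma P_norm:
  fixes X :: "('k, 'b, 'z) module_scheme" and U :: "('k, 'u, 'w) module_scheme" and V :: "('k, 'v, 'y) module_scheme"
  shows "tensor_of P X = tensor_of dual X" "tensor_of X P = tensor_of X dual"
    "tensor_space P X = tensor_space dual X" "tensor_space X P = tensor_space X dual"
    "sweedler P X U = sweedler dual X U" "sweedler X P U = sweedler X dual U"
    "sweedler X V P = sweedler X V dual"
  by (intro tensor_of_cong tensor_space_cong sweedler_space_cong; simp add: dual_hopf_simps)+

lemma ev_evl_dual:
  assumes "t \<in> carrier (tensor_space dual dual)" "h \<in> carrier H" "h' \<in> carrier H"
  shows "ev (evl dual h t) h' = sweedler dual dual scalars (\<lambda>p\<^sub>1 p\<^sub>2. ev p\<^sub>1 h * ev p\<^sub>2 h') t"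
    and "ev (evr dual h' t) h = sweedler dual dual scalars (\<lambda>p\<^sub>1 p\<^sub>2. ev p\<^sub>1 h * ev p\<^sub>2 h') t"
proof -
  have "ev (evl dual h t) h' = sweedler dual dual scalars (\<lambda>p\<^sub>1 p\<^sub>2. ev (ev p\<^sub>1 h \<odot>\<^bsub>dual\<^esub> p\<^sub>2) h') t"
    unfolding evl_def by (rule lin_of_sweedler[OF lin_ev_left[OF assms(3)]])
      (assumption | intro lin_intros assms; assumption?)+
  also have "\<dots> = sweedler dual dual scalars (\<lambda>p\<^sub>1 p\<^sub>2. ev p\<^sub>1 h * ev p\<^sub>2 h') t"
    by (rule sweedler_cong[OF assms(1)]) (simp add: ev_smult assms)
  finally show "ev (evl dual h t) h' = sweedler dual dual scalars (\<lambda>p\<^sub>1 p\<^sub>2. ev p\<^sub>1 h * ev p\<^sub>2 h') t" .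
  have "ev (evr dual h' t) h = sweedler dual dual scalars (\<lambda>p\<^sub>1 p\<^sub>2. ev (ev p\<^sub>2 h' \<odot>\<^bsub>dual\<^esub> p\<^sub>1) h) t"
    unfolding evr_def by (rule lin_of_sweedler[OF lin_ev_left[OF assms(2)]])
      (assumption | intro lin_intros assms; assumption?)+
  also have "\<dots> = sweedler dual dual scalars (\<lambda>p\<^sub>1 p\<^sub>2. ev p\<^sub>1 h * ev p\<^sub>2 h') t"
    by (rule sweedler_cong[OF assms(1)]) (simp add: ev_smult assms mult.commute)
  finally show "ev (evr dual h' t) h = sweedler dual dual scalars (\<lambda>p\<^sub>1 p\<^sub>2. ev p\<^sub>1 h * ev p\<^sub>2 h') t" .
qed

text \<open>\<open>dual_comult\<close> is defined by a unique description. The witness is the sum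
  over dual bases of \<open>q\<close> tensored with \<open>p \<leftharpoonup> e\<close>, and it is
  unique because evaluations separate tensors.\<close>

lemma dual_comult_eq:
  assumes p: "p \<in> carrier dual"
  shows "dual_comult H p = tr (tensor_space dual dual) (\<lambda>e q. pure_tensor dual dual q (reg \<one> e p))"
proof -
  define t where "t = tr (tensor_space dual dual) (\<lambda>e q. pure_tensor dual dual q (reg \<one> e p))"
  have b: "bil H dual (tensor_space dual dual) (\<lambda>e q. pure_tensor dual dual q (reg \<one> e p))"
    by (assumption | intro lin_intros p; assumption?)+
  have t: "t \<in> carrier (tensor_space dual dual)"
    unfolding t_def by (intro lin_intros b)
  have eq: "sweedler dual dual scalars (\<lambda>p\<^sub>1 p\<^sub>2. ev p\<^sub>1 h * ev p\<^sub>2 h') t = ev p (h \<otimes> h')"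
    if h: "h \<in> carrier H" "h' \<in> carrier H" for h h'
  proof -
    have "ev (evl dual h t) h' = tr scalars (\<lambda>e q. ev (evl dual h (pure_tensor dual dual q (reg \<one> e p))) h')"
      unfolding t_def by (rule lin_tr[OF _ _ _ b]) (assumption | intro lin_intros h; assumption?)+
    also have "\<dots> = tr scalars (\<lambda>e q. ev q h \<odot>\<^bsub>scalars\<^esub> ev (reg \<one> e p) h')"
      by (rule tr_cong) (simp add: evl_pure h p ev_smult)
    also have "\<dots> = ev (reg \<one> h p) h'"
      by (rule tr_vector) (assumption | intro lin_intros h p; assumption?)+
    also have "\<dots> = ev p (h \<otimes> h')"
      using h by (simp add: ev_reg ring.ring_simprules[OF ring_H])
    finally show ?thesis using ev_evl_dual[OF t h] by simp
  qed
  have "dual_comult H p = t"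
    unfolding dual_comult_def
  proof (rule the_equality)
    show "t \<in> carrier (tensor_space dual dual) \<and> (\<forall>h\<in>carrier H. \<forall>h'\<in>carrier H.
        sweedler dual dual scalars (\<lambda>p\<^sub>1 p\<^sub>2. p\<^sub>1 h * p\<^sub>2 h') t = p (h \<otimes> h'))"
      using t eq by (simp add: ev_def)
    fix s assume s: "s \<in> carrier (tensor_space dual dual) \<and> (\<forall>h\<in>carrier H. \<forall>h'\<in>carrier H.
        sweedler dual dual scalars (\<lambda>p\<^sub>1 p\<^sub>2. p\<^sub>1 h * p\<^sub>2 h') s = p (h \<otimes> h'))"
    then have s': "s \<in> carrier (tensor_space dual dual)"
      and e: "\<And>h h'. h \<in> carrier H \<Longrightarrow> h' \<in> carrier H \<Longrightarrow>
        sweedler dual dual scalars (\<lambda>p\<^sub>1 p\<^sub>2. ev p\<^sub>1 h * ev p\<^sub>2 h') s = ev p (h \<otimes> h')"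
      by (simp_all add: ev_def)
    show "s = t"
    proof (rule evl_eqI[OF _ s' t])
      fix g assume g: "g \<in> carrier H"
      show "evl dual g s = evl dual g t"
        by (rule dual_eqI[where V = H]) (simp_all add: ev_evl_dual s' t g e eq lin_closed[OF lin_evl])
    qed simp
  qed
  then show ?thesis unfolding t_def .
qed

lemma lin_dual_comult: "lin dual (tensor_space dual dual) (dual_comult H)"
proof -
  have "lin dual (tensor_space dual dual) (\<lambda>p. tr (tensor_space dual dual) (\<lambda>e q. pure_tensor dual dual q (reg \<one> e p)))"
    by (assumption | intro lin_intros; assumption?)+
  then show ?thesis by (simp add: lin_cong[OF dual_comult_eq])
qed

lemmas dual_comult_intros [lin_intros] = lin_compose[OF lin_dual_comult] lin_closed[OF lin_dual_comult]

lemma evl_dual_comult: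
  assumes p: "p \<in> carrier dual" and h: "h \<in> carrier H"
  shows "evl dual h (dual_comult H p) = reg \<one> h p"
proof -
  have b: "bil H dual (tensor_space dual dual) (\<lambda>e q. pure_tensor dual dual q (reg \<one> e p))"
    by (assumption | intro lin_intros p; assumption?)+
  have "evl dual h (dual_comult H p) = tr dual (\<lambda>e q. evl dual h (pure_tensor dual dual q (reg \<one> e p)))"
    unfolding dual_comult_eq[OF p]
    by (rule lin_tr[OF _ _ _ b]) (assumption | intro lin_intros lin_evl h; assumption?)+
  also have "\<dots> = tr dual (\<lambda>e q. ev q h \<odot>\<^bsub>dual\<^esub> reg \<one> e p)"
    by (rule tr_cong) (simp add: evl_pure h p)
  also have "\<dots> = reg \<one> h p"
    by (rule tr_vector) (assumption | intro lin_intros h p; assumption?)+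
  finally show ?thesis .
qed

lemma sweedler_dual_comult:
  assumes p: "p \<in> carrier dual" and h: "h \<in> carrier H" "h' \<in> carrier H"
  shows "sweedler dual dual scalars (\<lambda>p\<^sub>1 p\<^sub>2. ev p\<^sub>1 h * ev p\<^sub>2 h') (dual_comult H p) = ev p (h \<otimes> h')"
proof -
  have "dual_comult H p \<in> carrier (tensor_space dual dual)" by (intro lin_intros p)
  from ev_evl_dual(1)[OF this h] show ?thesis
    by (simp add: evl_dual_comult p h ev_reg ring.ring_simprules[OF ring_H])
qed

lemma evr_dual_comult:
  assumes p: "p \<in> carrier dual" and h: "h \<in> carrier H"
  shows "evr dual h (dual_comult H p) = reg h \<one> p"
proof (rule dual_eqI[where V = H])
  have *: "dual_comult H p \<in> carrier (tensor_space dual dual)" by (intro lin_intros p)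
  then show "evr dual h (dual_comult H p) \<in> carrier dual" by (simp add: lin_closed[OF lin_evr] h)
  fix x assume x: "x \<in> carrier H"
  show "ev (evr dual h (dual_comult H p)) x = ev (reg h \<one> p) x"
    using ev_evl_dual(2)[OF * x h] sweedler_dual_comult[OF p x h]
    by (simp add: ev_reg x h ring.ring_simprules[OF ring_H])
qed (use p h in simp)

definition dual_comult3 where
  "dual_comult3 p = sweedler dual dual (tensor_space3 dual dual dual)
    (\<lambda>a b. pure_tensor dual (tensor_space dual dual) a (dual_comult H b)) (dual_comult H p)"

lemma comult3_P: "comult3 P = dual_comult3"
  by (simp add: fun_eq_iff comult3_def dual_comult3_def P_norm dual_hopf_simps)

lemma dual_comult3_closed [lin_intros]:
  "p \<in> carrier dual \<Longrightarrow> dual_comult3 p \<in> carrier (tensor_space3 dual dual dual)"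
  unfolding dual_comult3_def by (assumption | intro lin_intros; assumption?)+

text \<open>The middle leg left over is the form with value \<open>p(g x h)\<close> at
  \<open>x\<close>. This is the origin of the regular actions in the two relations.\<close>

lemma ev2_dual_comult3:
  assumes p: "p \<in> carrier dual" and g: "g \<in> carrier H" and h: "h \<in> carrier H"
  shows "ev2 dual g h (dual_comult3 p) = reg h g p"
proof -
  have c: "dual_comult H p \<in> carrier (tensor_space dual dual)" by (intro lin_intros p)
  have "ev2 dual g h (dual_comult3 p) = sweedler dual dual dual
    (\<lambda>a b. ev2 dual g h (pure_tensor dual (tensor_space dual dual) a (dual_comult H b))) (dual_comult H p)"
    unfolding dual_comult3_def
    by (rule lin_of_sweedler[OF lin_ev2[OF vsp_dual[OF vsp_H] g h] _ _ _ c]) (assumption | intro lin_intros; assumption?)+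
  also have "\<dots> = sweedler dual dual dual (\<lambda>a b. reg h \<one> (ev a g \<odot>\<^bsub>dual\<^esub> b)) (dual_comult H p)"
    by (rule sweedler_cong[OF c])
      (simp add: ev2_pure evr_dual_comult lin_smult[OF lin_reg_form] lin_closed[OF lin_dual_comult] g h)
  also have "\<dots> = reg h \<one> (evl dual g (dual_comult H p))"
    unfolding evl_def
    by (rule lin_of_sweedler[OF lin_reg_form[OF h one_closed_H] _ _ _ c, symmetric])
      (assumption | intro lin_intros g; assumption?)+
  also have "\<dots> = reg h g p"
    by (simp add: evl_dual_comult p g reg_reg h ring.ring_simprules[OF ring_H])
  finally show ?thesis .
qed

end

section \<open>Coactions of the dual as actions of \<open>H\<close>\<close>

locale coactions = fin_dim_hopf H
  for H :: "('k::field, 'a, 'x) hopf_scheme" (structure) +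
  fixes M :: "('k, 'm, 'z) module_scheme"
    and lco :: "'m \<Rightarrow> ('k, 'a \<Rightarrow> 'k, 'm) tensor" and rco :: "'m \<Rightarrow> ('k, 'm, 'a \<Rightarrow> 'k) tensor"
  assumes vsp_M: "vsp M"
    and lco: "lin M (tensor_space dual M) lco"
    and rco: "lin M (tensor_space M dual) rco"
begin

text \<open>In Sweedler notation, \<open>m g\<close> is \<Sum>
  \<open>m\<^sub>(\<^sub>-\<^sub>1\<^sub>)(g) m\<^sub>(\<^sub>0\<^sub>)\<close>.\<close>

definition mH where "mH m g = evl M g (lco m)"
definition hM where "hM h m = evr M h (rco m)"

lemmas lco_intros = lin_compose[OF lco] lin_compose[OF rco] lin_closed[OF lco] lin_closed[OF rco] vsp_M

lemma lin_mH: "g \<in> carrier H \<Longrightarrow> lin M M (\<lambda>m. mH m g)"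
  unfolding mH_def by (assumption | intro lin_intros lco_intros; assumption?)+

lemma lin_mH_right: "m \<in> carrier M \<Longrightarrow> lin H M (mH m)"
  unfolding mH_def by (assumption | intro lin_intros lco_intros; assumption?)+

lemma lin_hM: "h \<in> carrier H \<Longrightarrow> lin M M (hM h)"
  unfolding hM_def by (assumption | intro lin_intros lco_intros; assumption?)+

lemma lin_hM_left: "m \<in> carrier M \<Longrightarrow> lin H M (\<lambda>h. hM h m)"
  unfolding hM_def by (assumption | intro lin_intros lco_intros; assumption?)+

lemma lin_evl_sum:
  assumes "vsp V" "lin M V f" "m \<in> carrier M" "g \<in> carrier H"
  shows "sweedler dual M V (\<lambda>a n. ev a g \<odot>\<^bsub>V\<^esub> f n) (lco m) = f (mH m g)"
proof -
  have c: "lco m \<in> carrier (tensor_space dual M)" by (intro lco_intros assms)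
  have "f (mH m g) = sweedler dual M V (\<lambda>a n. f (ev a g \<odot>\<^bsub>M\<^esub> n)) (lco m)"
    unfolding mH_def evl_def by (rule lin_of_sweedler[OF assms(2) vsp_M assms(1) _ c])
      (assumption | intro lin_intros vsp_M assms; assumption?)+
  also have "\<dots> = sweedler dual M V (\<lambda>a n. ev a g \<odot>\<^bsub>V\<^esub> f n) (lco m)"
    by (rule sweedler_cong[OF c]) (simp add: lin_smult[OF assms(2)])
  finally show ?thesis by simp
qed

lemma lin_evr_sum:
  assumes "vsp V" "lin M V f" "m \<in> carrier M" "h \<in> carrier H"
  shows "sweedler M dual V (\<lambda>n a. ev a h \<odot>\<^bsub>V\<^esub> f n) (rco m) = f (hM h m)"
proof -
  have c: "rco m \<in> carrier (tensor_space M dual)" by (intro lco_intros assms)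
  have "f (hM h m) = sweedler M dual V (\<lambda>n a. f (ev a h \<odot>\<^bsub>M\<^esub> n)) (rco m)"
    unfolding hM_def evr_def by (rule lin_of_sweedler[OF assms(2) vsp_M assms(1) _ c])
      (assumption | intro lin_intros vsp_M assms; assumption?)+
  also have "\<dots> = sweedler M dual V (\<lambda>n a. ev a h \<odot>\<^bsub>V\<^esub> f n) (rco m)"
    by (rule sweedler_cong[OF c]) (simp add: lin_smult[OF assms(2)])
  finally show ?thesis by simp
qed

text \<open>Here the left coaction is taken first, in \<open>two_sided_r\<close> the right one.
  Under \<open>ev2\<close> the equality of the two says that the left and right actions of
  \<open>H\<close> commute.\<close>

definition two_sided_l where
  "two_sided_l m = sweedler dual M (tensor_space3 dual M dual)
    (\<lambda>a n. pure_tensor dual (tensor_space M dual) a (rco n)) (lco m)"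

definition two_sided_r where
  "two_sided_r m = sweedler M dual (tensor_space3 dual M dual)
    (\<lambda>n b. sweedler dual M (tensor_space3 dual M dual) (\<lambda>a n'. pure_tensor3 dual M dual a n' b) (lco n)) (rco m)"

lemma two_sided_closed:
  assumes "m \<in> carrier M"
  shows "two_sided_l m \<in> carrier (tensor_space3 dual M dual)" "two_sided_r m \<in> carrier (tensor_space3 dual M dual)"
  unfolding two_sided_l_def two_sided_r_def by (assumption | intro lin_intros lco_intros assms; assumption?)+

lemma ev2_two_sided_l:
  assumes m: "m \<in> carrier M" and g: "g \<in> carrier H" and h: "h \<in> carrier H"
  shows "ev2 M g h (two_sided_l m) = hM h (mH m g)"
proof -
  have c: "lco m \<in> carrier (tensor_space dual M)" by (intro lco_intros m)
  have "ev2 M g h (two_sided_l m)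
    = sweedler dual M M (\<lambda>a n. ev2 M g h (pure_tensor dual (tensor_space M dual) a (rco n))) (lco m)"
    unfolding two_sided_l_def
    by (rule lin_of_sweedler[OF lin_ev2[OF vsp_M g h] _ vsp_M _ c]) (assumption | intro lin_intros lco_intros; assumption?)+
  also have "\<dots> = sweedler dual M M (\<lambda>a n. ev a g \<odot>\<^bsub>M\<^esub> hM h n) (lco m)"
    by (rule sweedler_cong[OF c]) (simp add: ev2_pure vsp_M g h lin_closed[OF rco] hM_def)
  also have "\<dots> = hM h (mH m g)" by (rule lin_evl_sum[OF vsp_M lin_hM[OF h] m g])
  finally show ?thesis .
qed

lemma ev2_two_sided_r:
  assumes m: "m \<in> carrier M" and g: "g \<in> carrier H" and h: "h \<in> carrier H"
  shows "ev2 M g h (two_sided_r m) = mH (hM h m) g"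
proof -
  have c: "rco m \<in> carrier (tensor_space M dual)" by (intro lco_intros m)
  note e = lin_ev2[OF vsp_M g h]
  have "ev2 M g h (two_sided_r m) = sweedler M dual M
    (\<lambda>n b. ev2 M g h (sweedler dual M (tensor_space3 dual M dual) (\<lambda>a n'. pure_tensor3 dual M dual a n' b) (lco n))) (rco m)"
    unfolding two_sided_r_def
    by (rule lin_of_sweedler[OF e _ vsp_M _ c]) (assumption | intro lin_intros lco_intros; assumption?)+
  also have "\<dots> = sweedler M dual M (\<lambda>n b. ev b h \<odot>\<^bsub>M\<^esub> mH n g) (rco m)"
  proof (rule sweedler_cong[OF c])
    fix n b assume *: "n \<in> carrier M" "b \<in> carrier dual"
    have c: "lco n \<in> carrier (tensor_space dual M)" by (intro lco_intros *)
    have "ev2 M g h (sweedler dual M (tensor_space3 dual M dual) (\<lambda>a n'. pure_tensor3 dual M dual a n' b) (lco n))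
      = sweedler dual M M (\<lambda>a n'. ev2 M g h (pure_tensor3 dual M dual a n' b)) (lco n)"
      by (rule lin_of_sweedler[OF e _ vsp_M _ c]) (assumption | intro lin_intros lco_intros *; assumption?)+
    also have "\<dots> = sweedler dual M M (\<lambda>a n'. ev a g \<odot>\<^bsub>M\<^esub> (ev b h \<odot>\<^bsub>M\<^esub> n')) (lco n)"
      by (rule sweedler_cong[OF c]) (simp add: ev2_pure3 vsp_M g h *)
    also have "\<dots> = ev b h \<odot>\<^bsub>M\<^esub> mH n g"
      by (rule lin_evl_sum[OF vsp_M _ *(1) g]) (intro lin_intros vsp_M)
    finally show "ev2 M g h (sweedler dual M (tensor_space3 dual M dual) (\<lambda>a n'. pure_tensor3 dual M dual a n' b) (lco n))
      = ev b h \<odot>\<^bsub>M\<^esub> mH n g" .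
  qed
  also have "\<dots> = mH (hM h m) g" by (rule lin_evr_sum[OF vsp_M lin_mH[OF g] m h])
  finally show ?thesis .
qed

definition evll where
  "evll g g' s = evl M g' (evl (tensor_space dual M) g s)"

lemma lin_evll: "g \<in> carrier H \<Longrightarrow> g' \<in> carrier H \<Longrightarrow> lin (tensor_space3 dual dual M) M (evll g g')"
  unfolding evll_def by (assumption | intro lin_intros vsp_M; assumption?)+

lemma evll_pure:
  assumes "g \<in> carrier H" "g' \<in> carrier H" "a \<in> carrier dual" "s \<in> carrier (tensor_space dual M)"
  shows "evll g g' (pure_tensor dual (tensor_space dual M) a s) = ev a g \<odot>\<^bsub>M\<^esub> evl M g' s"
proof -
  have "vsp (tensor_space dual M)" by simp
  then show ?thesis
    using assms by (simp add: evll_def evl_pure lin_smult[OF lin_evl] vsp_M)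
qed

lemma evll_eqI:
  assumes s: "s \<in> carrier (tensor_space3 dual dual M)" and t: "t \<in> carrier (tensor_space3 dual dual M)"
    and eq: "\<And>g g'. g \<in> carrier H \<Longrightarrow> g' \<in> carrier H \<Longrightarrow> evll g g' s = evll g g' t"
  shows "s = t"
proof (rule evl_eqI[OF _ s t])
  show V: "vsp (tensor_space dual M)" by simp
  fix g assume g: "g \<in> carrier H"
  show "evl (tensor_space dual M) g s = evl (tensor_space dual M) g t"
    by (rule evl_eqI[OF vsp_M]) (use eq g in \<open>simp_all add: evll_def lin_closed[OF lin_evl] V s t\<close>)
qed

text \<open>\<open>lassoc1\<close> and \<open>lassoc2\<close> are the two sides of coassociativity
  of the left coaction; under \<open>evll\<close> they become \<open>m (g g')\<close> and
  \<open>(m g) g'\<close>.\<close>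

definition lassoc1 where
  "lassoc1 m = sweedler dual M (tensor_space3 dual dual M)
    (\<lambda>a n. sweedler dual dual (tensor_space3 dual dual M)
      (\<lambda>a\<^sub>1 a\<^sub>2. pure_tensor3 dual dual M a\<^sub>1 a\<^sub>2 n) (dual_comult H a)) (lco m)"

definition lassoc2 where
  "lassoc2 m = sweedler dual M (tensor_space3 dual dual M)
    (\<lambda>a n. pure_tensor dual (tensor_space dual M) a (lco n)) (lco m)"

lemma lassoc_closed:
  assumes "m \<in> carrier M"
  shows "lassoc1 m \<in> carrier (tensor_space3 dual dual M)" "lassoc2 m \<in> carrier (tensor_space3 dual dual M)"
  unfolding lassoc1_def lassoc2_def by (assumption | intro lin_intros lco_intros assms; assumption?)+

lemma evll_lassoc1:
  assumes m: "m \<in> carrier M" and g: "g \<in> carrier H" and g': "g' \<in> carrier H"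
  shows "evll g g' (lassoc1 m) = mH m (g \<otimes> g')"
proof -
  have c: "lco m \<in> carrier (tensor_space dual M)" by (intro lco_intros m)
  note e = lin_evll[OF g g']
  have "evll g g' (lassoc1 m) = sweedler dual M M (\<lambda>a n. evll g g' (sweedler dual dual (tensor_space3 dual dual M)
      (\<lambda>a\<^sub>1 a\<^sub>2. pure_tensor3 dual dual M a\<^sub>1 a\<^sub>2 n) (dual_comult H a))) (lco m)"
    unfolding lassoc1_def
    by (rule lin_of_sweedler[OF e _ vsp_M _ c]) (assumption | intro lin_intros lco_intros; assumption?)+
  also have "\<dots> = sweedler dual M M (\<lambda>a n. ev a (g \<otimes> g') \<odot>\<^bsub>M\<^esub> n) (lco m)"
  proof (rule sweedler_cong[OF c])
    fix a n assume *: "a \<in> carrier dual" "n \<in> carrier M"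
    have c: "dual_comult H a \<in> carrier (tensor_space dual dual)" by (intro lin_intros *)
    have "evll g g' (sweedler dual dual (tensor_space3 dual dual M)
      (\<lambda>a\<^sub>1 a\<^sub>2. pure_tensor3 dual dual M a\<^sub>1 a\<^sub>2 n) (dual_comult H a))
      = sweedler dual dual M (\<lambda>a\<^sub>1 a\<^sub>2. evll g g' (pure_tensor3 dual dual M a\<^sub>1 a\<^sub>2 n)) (dual_comult H a)"
      by (rule lin_of_sweedler[OF e _ vsp_M _ c]) (assumption | intro lin_intros lco_intros *; assumption?)+
    also have "\<dots> = sweedler dual dual M (\<lambda>a\<^sub>1 a\<^sub>2. (ev a\<^sub>1 g * ev a\<^sub>2 g') \<odot>\<^bsub>M\<^esub> n) (dual_comult H a)"
      by (rule sweedler_cong[OF c]) (simp add: evll_pure evl_pure pure_closed vsp_M g g' *)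
    also have "\<dots> = sweedler dual dual scalars (\<lambda>a\<^sub>1 a\<^sub>2. ev a\<^sub>1 g * ev a\<^sub>2 g') (dual_comult H a) \<odot>\<^bsub>M\<^esub> n"
      by (rule sweedler_smult_vector[OF c vsp_M *(2)]) (assumption | intro lin_intros g g'; assumption?)+
    finally show "evll g g' (sweedler dual dual (tensor_space3 dual dual M)
      (\<lambda>a\<^sub>1 a\<^sub>2. pure_tensor3 dual dual M a\<^sub>1 a\<^sub>2 n) (dual_comult H a)) = ev a (g \<otimes> g') \<odot>\<^bsub>M\<^esub> n"
      by (simp add: sweedler_dual_comult * g g')
  qed
  also have "\<dots> = mH m (g \<otimes> g')"
    by (rule lin_evl_sum[OF vsp_M lin_id m]) (simp add: g g')
  finally show ?thesis .
qed

lemma evll_lassoc2: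
  assumes m: "m \<in> carrier M" and g: "g \<in> carrier H" and g': "g' \<in> carrier H"
  shows "evll g g' (lassoc2 m) = mH (mH m g) g'"
proof -
  have c: "lco m \<in> carrier (tensor_space dual M)" by (intro lco_intros m)
  have "evll g g' (lassoc2 m) = sweedler dual M M (\<lambda>a n. evll g g' (pure_tensor dual (tensor_space dual M) a (lco n))) (lco m)"
    unfolding lassoc2_def
    by (rule lin_of_sweedler[OF lin_evll[OF g g'] _ vsp_M _ c]) (assumption | intro lin_intros lco_intros; assumption?)+
  also have "\<dots> = sweedler dual M M (\<lambda>a n. ev a g \<odot>\<^bsub>M\<^esub> mH n g') (lco m)"
    by (rule sweedler_cong[OF c]) (simp add: evll_pure g g' lin_closed[OF lco] mH_def)
  also have "\<dots> = mH (mH m g) g'" by (rule lin_evl_sum[OF vsp_M lin_mH[OF g'] m g])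
  finally show ?thesis .
qed

text \<open>Threefold products are bracketed to the right, so here both dual legs lie in the inner
  tensor product. They are contracted together, and a reconstruction with two dual bases takes the
  place of two applications of \<open>evl_eqI\<close>.\<close>

definition evrr where
  "evrr h h' s = sweedler M (tensor_space dual dual) M (\<lambda>n t. ev (evl dual h t) h' \<odot>\<^bsub>M\<^esub> n) s"

lemma lin_evrr: "h \<in> carrier H \<Longrightarrow> h' \<in> carrier H \<Longrightarrow> lin (tensor_space3 M dual dual) M (evrr h h')"
  unfolding evrr_def by (assumption | intro lin_intros vsp_M; assumption?)+

lemma lin_evrr_left:
  "h' \<in> carrier H \<Longrightarrow> s \<in> carrier (tensor_space3 M dual dual) \<Longrightarrow> lin H M (\<lambda>h. evrr h h' s)"
  unfolding evrr_def by (assumption | intro lin_intros vsp_M; assumption?)+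

lemma lin_evrr_right:
  "h \<in> carrier H \<Longrightarrow> s \<in> carrier (tensor_space3 M dual dual) \<Longrightarrow> lin H M (\<lambda>h'. evrr h h' s)"
  unfolding evrr_def by (assumption | intro lin_intros vsp_M; assumption?)+

lemmas evrr_intros = lin_compose[OF lin_evrr] lin_compose[OF lin_evrr_left] lin_compose[OF lin_evrr_right]
  lin_closed[OF lin_evrr]

lemma evrr_pure:
  assumes "h \<in> carrier H" "h' \<in> carrier H" "n \<in> carrier M" "t \<in> carrier (tensor_space dual dual)"
  shows "evrr h h' (pure_tensor M (tensor_space dual dual) n t) = ev (evl dual h t) h' \<odot>\<^bsub>M\<^esub> n"
  unfolding evrr_def
  by (rule sweedler_pure_eq) (rule refl | assumption | intro lin_intros vsp_M assms; assumption?)+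

lemma evrr_pure3:
  assumes "h \<in> carrier H" "h' \<in> carrier H" "n \<in> carrier M" "b \<in> carrier dual" "a \<in> carrier dual"
  shows "evrr h h' (pure_tensor3 M dual dual n b a) = (ev b h * ev a h') \<odot>\<^bsub>M\<^esub> n"
  using assms by (simp add: evrr_pure pure_closed evl_pure ev_smult)

lemma evrr_reconstruct:
  assumes s: "s \<in> carrier (tensor_space3 M dual dual)"
  shows "tr (tensor_space3 M dual dual) (\<lambda>e p. tr (tensor_space3 M dual dual)
    (\<lambda>e' p'. pure_tensor3 M dual dual (evrr e e' s) p p')) = s"
proof (rule tensor3_eqI[OF _ _ _ _ _ s, where U = "tensor_space3 M dual dual" and g = "\<lambda>s. s"
      and f = "\<lambda>s. tr (tensor_space3 M dual dual) (\<lambda>e p. tr (tensor_space3 M dual dual)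
        (\<lambda>e' p'. pure_tensor3 M dual dual (evrr e e' s) p p'))"])
  let ?T = "tensor_space3 M dual dual"
  have T: "vsp ?T" using vsp_M by simp
  fix n b a assume *: "n \<in> carrier M" "b \<in> carrier dual" "a \<in> carrier dual"
  have "tr ?T (\<lambda>e p. tr ?T (\<lambda>e' p'. pure_tensor3 M dual dual (evrr e e' (pure_tensor3 M dual dual n b a)) p p'))
    = tr ?T (\<lambda>e p. ev b e \<odot>\<^bsub>?T\<^esub> pure_tensor3 M dual dual n p a)"
  proof (rule tr_cong)
    fix e p assume **: "e \<in> carrier H" "p \<in> carrier dual"
    have "tr ?T (\<lambda>e' p'. pure_tensor3 M dual dual (evrr e e' (pure_tensor3 M dual dual n b a)) p p')
      = tr ?T (\<lambda>e' p'. ev a e' \<odot>\<^bsub>?T\<^esub> (ev b e \<odot>\<^bsub>?T\<^esub> pure_tensor3 M dual dual n p p'))"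
    proof (rule tr_cong)
      fix e' p' assume e': "e' \<in> carrier H" "p' \<in> carrier dual"
      have l: "lin M ?T (\<lambda>n. pure_tensor3 M dual dual n p p')" by (intro lin_intros ** e' vsp_M)
      show "pure_tensor3 M dual dual (evrr e e' (pure_tensor3 M dual dual n b a)) p p'
        = ev a e' \<odot>\<^bsub>?T\<^esub> (ev b e \<odot>\<^bsub>?T\<^esub> pure_tensor3 M dual dual n p p')"
        using * ** e' T by (simp add: evrr_pure3 lin_smult[OF l] pure_closed mult.commute)
    qed
    also have "\<dots> = ev b e \<odot>\<^bsub>?T\<^esub> pure_tensor3 M dual dual n p a"
      by (rule tr_form) (assumption | intro lin_intros T vsp_M * **; assumption?)+
    finally show "tr ?T (\<lambda>e' p'. pure_tensor3 M dual dual (evrr e e' (pure_tensor3 M dual dual n b a)) p p') = \<dots>" .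
  qed
  also have "\<dots> = pure_tensor3 M dual dual n b a"
    by (rule tr_form) (assumption | intro lin_intros T vsp_M *; assumption?)+
  finally show "tr ?T (\<lambda>e p. tr ?T (\<lambda>e' p'. pure_tensor3 M dual dual (evrr e e' (pure_tensor3 M dual dual n b a)) p p'))
    = pure_tensor3 M dual dual n b a" .
qed (assumption | intro lin_intros evrr_intros vsp_M; assumption?)+

lemma evrr_eqI:
  assumes s: "s \<in> carrier (tensor_space3 M dual dual)" and t: "t \<in> carrier (tensor_space3 M dual dual)"
    and eq: "\<And>h h'. h \<in> carrier H \<Longrightarrow> h' \<in> carrier H \<Longrightarrow> evrr h h' s = evrr h h' t"
  shows "s = t"
proof -
  let ?T = "tensor_space3 M dual dual"
  have "s = tr ?T (\<lambda>e p. tr ?T (\<lambda>e' p'. pure_tensor3 M dual dual (evrr e e' s) p p'))"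
    by (rule evrr_reconstruct[OF s, symmetric])
  also have "\<dots> = tr ?T (\<lambda>e p. tr ?T (\<lambda>e' p'. pure_tensor3 M dual dual (evrr e e' t) p p'))"
    by (rule tr_cong, rule tr_cong) (simp add: eq)
  also have "\<dots> = t" by (rule evrr_reconstruct[OF t])
  finally show ?thesis .
qed

definition rassoc1 where
  "rassoc1 m = sweedler M dual (tensor_space3 M dual dual)
    (\<lambda>n a. sweedler M dual (tensor_space3 M dual dual) (\<lambda>n' b. pure_tensor3 M dual dual n' b a) (rco n)) (rco m)"

definition rassoc2 where
  "rassoc2 m = sweedler M dual (tensor_space3 M dual dual)
    (\<lambda>n a. pure_tensor M (tensor_space dual dual) n (dual_comult H a)) (rco m)"

lemma rassoc_closed:
  assumes "m \<in> carrier M"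
  shows "rassoc1 m \<in> carrier (tensor_space3 M dual dual)" "rassoc2 m \<in> carrier (tensor_space3 M dual dual)"
  unfolding rassoc1_def rassoc2_def by (assumption | intro lin_intros lco_intros assms; assumption?)+

lemma evrr_rassoc1:
  assumes m: "m \<in> carrier M" and h: "h \<in> carrier H" and h': "h' \<in> carrier H"
  shows "evrr h h' (rassoc1 m) = hM h (hM h' m)"
proof -
  have c: "rco m \<in> carrier (tensor_space M dual)" by (intro lco_intros m)
  note e = lin_evrr[OF h h']
  have "evrr h h' (rassoc1 m) = sweedler M dual M (\<lambda>n a. evrr h h'
      (sweedler M dual (tensor_space3 M dual dual) (\<lambda>n' b. pure_tensor3 M dual dual n' b a) (rco n))) (rco m)"
    unfolding rassoc1_def
    by (rule lin_of_sweedler[OF e _ vsp_M _ c]) (assumption | intro lin_intros lco_intros; assumption?)+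
  also have "\<dots> = sweedler M dual M (\<lambda>n a. ev a h' \<odot>\<^bsub>M\<^esub> hM h n) (rco m)"
  proof (rule sweedler_cong[OF c])
    fix n a assume *: "n \<in> carrier M" "a \<in> carrier dual"
    have c: "rco n \<in> carrier (tensor_space M dual)" by (intro lco_intros *)
    have "evrr h h' (sweedler M dual (tensor_space3 M dual dual) (\<lambda>n' b. pure_tensor3 M dual dual n' b a) (rco n))
      = sweedler M dual M (\<lambda>n' b. evrr h h' (pure_tensor3 M dual dual n' b a)) (rco n)"
      by (rule lin_of_sweedler[OF e _ vsp_M _ c]) (assumption | intro lin_intros lco_intros *; assumption?)+
    also have "\<dots> = sweedler M dual M (\<lambda>n' b. ev b h \<odot>\<^bsub>M\<^esub> (ev a h' \<odot>\<^bsub>M\<^esub> n')) (rco n)"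
      by (rule sweedler_cong[OF c]) (simp add: evrr_pure3 vsp_M h h' *)
    also have "\<dots> = ev a h' \<odot>\<^bsub>M\<^esub> hM h n"
      by (rule lin_evr_sum[OF vsp_M _ *(1) h]) (intro lin_intros vsp_M)
    finally show "evrr h h' (sweedler M dual (tensor_space3 M dual dual) (\<lambda>n' b. pure_tensor3 M dual dual n' b a) (rco n))
      = ev a h' \<odot>\<^bsub>M\<^esub> hM h n" .
  qed
  also have "\<dots> = hM h (hM h' m)" by (rule lin_evr_sum[OF vsp_M lin_hM[OF h] m h'])
  finally show ?thesis .
qed

lemma evrr_rassoc2:
  assumes m: "m \<in> carrier M" and h: "h \<in> carrier H" and h': "h' \<in> carrier H"
  shows "evrr h h' (rassoc2 m) = hM (h \<otimes> h') m"
proof -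
  have c: "rco m \<in> carrier (tensor_space M dual)" by (intro lco_intros m)
  have "evrr h h' (rassoc2 m) = sweedler M dual M
      (\<lambda>n a. evrr h h' (pure_tensor M (tensor_space dual dual) n (dual_comult H a))) (rco m)"
    unfolding rassoc2_def
    by (rule lin_of_sweedler[OF lin_evrr[OF h h'] _ vsp_M _ c]) (assumption | intro lin_intros lco_intros; assumption?)+
  also have "\<dots> = sweedler M dual M (\<lambda>n a. ev a (h \<otimes> h') \<odot>\<^bsub>M\<^esub> n) (rco m)"
    by (rule sweedler_cong[OF c])
      (simp add: evrr_pure h h' lin_closed[OF lin_dual_comult] evl_dual_comult ev_reg ring.ring_simprules[OF ring_H])
  also have "\<dots> = hM (h \<otimes> h') m"
    by (rule lin_evr_sum[OF vsp_M lin_id m]) (simp add: h h')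
  finally show ?thesis .
qed

end

section \<open>The Hopf bimodule condition evaluated at elements of \<open>H\<close>\<close>

locale bimodule_coactions = coactions H M lco rco
  for H :: "('k::field, 'a, 'x) hopf_scheme" (structure) and M :: "('k, 'm, 'z) module_scheme" and lco rco +
  fixes l :: "('a \<Rightarrow> 'k) \<Rightarrow> 'm \<Rightarrow> 'm" and r :: "'m \<Rightarrow> ('a \<Rightarrow> 'k) \<Rightarrow> 'm"
  assumes bil_l: "bil dual M M l" and bil_r: "bil M dual M r"
begin

lemmas lr_intros = bil_comp_left[OF bil_l] bil_comp_right[OF bil_l] bil_closed[OF bil_l]
  bil_comp_left[OF bil_r] bil_comp_right[OF bil_r] bil_closed[OF bil_r] vsp_M

text \<open>The right-hand side of the Hopf bimodule condition with its three tensors as independent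
  arguments, so that it becomes linear in each of them.\<close>

definition triple where
  "triple s t u = sweedler3 dual dual dual (tensor_space3 dual M dual) (\<lambda>p\<^sub>1 p\<^sub>2 p\<^sub>3.
    sweedler3 dual M dual (tensor_space3 dual M dual) (\<lambda>a n b.
      sweedler3 dual dual dual (tensor_space3 dual M dual) (\<lambda>q\<^sub>1 q\<^sub>2 q\<^sub>3.
        pure_tensor3 dual M dual (p\<^sub>1 \<star> a \<star> q\<^sub>1) (r (l p\<^sub>2 n) q\<^sub>2) (p\<^sub>3 \<star> b \<star> q\<^sub>3)) u) t) s"

lemma lin_triple1:
  "t \<in> carrier (tensor_space3 dual M dual) \<Longrightarrow> u \<in> carrier (tensor_space3 dual dual dual) \<Longrightarrow>
    lin (tensor_space3 dual dual dual) (tensor_space3 dual M dual) (\<lambda>s. triple s t u)"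
  unfolding triple_def by (assumption | intro lin_intros lr_intros; assumption?)+

lemma lin_triple2:
  "s \<in> carrier (tensor_space3 dual dual dual) \<Longrightarrow> u \<in> carrier (tensor_space3 dual dual dual) \<Longrightarrow>
    lin (tensor_space3 dual M dual) (tensor_space3 dual M dual) (\<lambda>t. triple s t u)"
  unfolding triple_def by (assumption | intro lin_intros lr_intros; assumption?)+

lemma lin_triple3:
  "s \<in> carrier (tensor_space3 dual dual dual) \<Longrightarrow> t \<in> carrier (tensor_space3 dual M dual) \<Longrightarrow>
    lin (tensor_space3 dual dual dual) (tensor_space3 dual M dual) (\<lambda>u. triple s t u)"
  unfolding triple_def by (assumption | intro lin_intros lr_intros; assumption?)+

lemma triple_pure:
  assumes "p\<^sub>1 \<in> carrier dual" "p\<^sub>2 \<in> carrier dual" "p\<^sub>3 \<in> carrier dual" "a \<in> carrier dual" "n \<in> carrier M"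
    "b \<in> carrier dual" "q\<^sub>1 \<in> carrier dual" "q\<^sub>2 \<in> carrier dual" "q\<^sub>3 \<in> carrier dual"
  shows "triple (pure_tensor3 dual dual dual p\<^sub>1 p\<^sub>2 p\<^sub>3) (pure_tensor3 dual M dual a n b) (pure_tensor3 dual dual dual q\<^sub>1 q\<^sub>2 q\<^sub>3)
    = pure_tensor3 dual M dual (p\<^sub>1 \<star> a \<star> q\<^sub>1) (r (l p\<^sub>2 n) q\<^sub>2) (p\<^sub>3 \<star> b \<star> q\<^sub>3)"
proof -
  let ?T = "tensor_space3 dual M dual"
  note intros = lin_intros lr_intros assms
  have "triple (pure_tensor3 dual dual dual p\<^sub>1 p\<^sub>2 p\<^sub>3) (pure_tensor3 dual M dual a n b) (pure_tensor3 dual dual dual q\<^sub>1 q\<^sub>2 q\<^sub>3)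
    = sweedler3 dual M dual ?T (\<lambda>a n b.
      sweedler3 dual dual dual ?T (\<lambda>q\<^sub>1 q\<^sub>2 q\<^sub>3.
        pure_tensor3 dual M dual (p\<^sub>1 \<star> a \<star> q\<^sub>1) (r (l p\<^sub>2 n) q\<^sub>2) (p\<^sub>3 \<star> b \<star> q\<^sub>3)) (pure_tensor3 dual dual dual q\<^sub>1 q\<^sub>2 q\<^sub>3))
      (pure_tensor3 dual M dual a n b)"
    unfolding triple_def by (rule sweedler3_pure_eq) (rule refl | assumption | intro intros; assumption?)+
  also have "\<dots> = sweedler3 dual dual dual ?T (\<lambda>q\<^sub>1 q\<^sub>2 q\<^sub>3.
        pure_tensor3 dual M dual (p\<^sub>1 \<star> a \<star> q\<^sub>1) (r (l p\<^sub>2 n) q\<^sub>2) (p\<^sub>3 \<star> b \<star> q\<^sub>3)) (pure_tensor3 dual dual dual q\<^sub>1 q\<^sub>2 q\<^sub>3)"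
    by (rule sweedler3_pure_eq) (rule refl | assumption | intro intros; assumption?)+
  also have "\<dots> = pure_tensor3 dual M dual (p\<^sub>1 \<star> a \<star> q\<^sub>1) (r (l p\<^sub>2 n) q\<^sub>2) (p\<^sub>3 \<star> b \<star> q\<^sub>3)"
    by (rule sweedler3_pure_eq) (rule refl | assumption | intro intros; assumption?)+
  finally show ?thesis .
qed

text \<open>The value of \<open>triple\<close> at \<open>g\<close> and \<open>h\<close>: a product
  of three forms is evaluated at \<open>g\<close> through three components of \<open>g\<close>,
  bracketed to the left like the products in \<open>triple\<close>, and likewise at
  \<open>h\<close>.\<close>

definition split_act where
  "split_act h g s t u = sw M h (\<lambda>v h\<^sub>3. sw M g (\<lambda>w g\<^sub>3. sw M v (\<lambda>h\<^sub>1 h\<^sub>2. sw M w (\<lambda>g\<^sub>1 g\<^sub>2.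
    r (l (ev2 dual g\<^sub>1 h\<^sub>1 s) (ev2 M g\<^sub>2 h\<^sub>2 t)) (ev2 dual g\<^sub>3 h\<^sub>3 u)))))"

lemma lin_split_act1:
  "h \<in> carrier H \<Longrightarrow> g \<in> carrier H \<Longrightarrow> t \<in> carrier (tensor_space3 dual M dual) \<Longrightarrow>
    u \<in> carrier (tensor_space3 dual dual dual) \<Longrightarrow> lin (tensor_space3 dual dual dual) M (\<lambda>s. split_act h g s t u)"
  unfolding split_act_def by (assumption | intro lin_intros lr_intros; assumption?)+

lemma lin_split_act2:
  "h \<in> carrier H \<Longrightarrow> g \<in> carrier H \<Longrightarrow> s \<in> carrier (tensor_space3 dual dual dual) \<Longrightarrow>
    u \<in> carrier (tensor_space3 dual dual dual) \<Longrightarrow> lin (tensor_space3 dual M dual) M (\<lambda>t. split_act h g s t u)"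
  unfolding split_act_def by (assumption | intro lin_intros lr_intros; assumption?)+

lemma lin_split_act3:
  "h \<in> carrier H \<Longrightarrow> g \<in> carrier H \<Longrightarrow> s \<in> carrier (tensor_space3 dual dual dual) \<Longrightarrow>
    t \<in> carrier (tensor_space3 dual M dual) \<Longrightarrow> lin (tensor_space3 dual dual dual) M (\<lambda>u. split_act h g s t u)"
  unfolding split_act_def by (assumption | intro lin_intros lr_intros; assumption?)+

lemma sw_pmult_smult:
  "p \<in> carrier dual \<Longrightarrow> q \<in> carrier dual \<Longrightarrow> h \<in> carrier H \<Longrightarrow> n \<in> carrier M \<Longrightarrow>
    sw M h (\<lambda>a b. (ev p a * ev q b) \<odot>\<^bsub>M\<^esub> n) = ev (p \<star> q) h \<odot>\<^bsub>M\<^esub> n"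
  unfolding ev_pmult
  by (rule sweedler_smult_vector[OF comult_closed vsp_M]) (assumption | intro lin_intros; assumption?)+

text \<open>On pure tensors all forms become scalars in front of one vector, and the four sums fold
  from the inside outwards, each by the definition of the product of the dual.\<close>

lemma split_act_pure:
  assumes *: "p\<^sub>1 \<in> carrier dual" "p\<^sub>2 \<in> carrier dual" "p\<^sub>3 \<in> carrier dual" "a \<in> carrier dual" "n \<in> carrier M"
    "b \<in> carrier dual" "q\<^sub>1 \<in> carrier dual" "q\<^sub>2 \<in> carrier dual" "q\<^sub>3 \<in> carrier dual"
    and h: "h \<in> carrier H" and g: "g \<in> carrier H"
  shows "split_act h g (pure_tensor3 dual dual dual p\<^sub>1 p\<^sub>2 p\<^sub>3) (pure_tensor3 dual M dual a n b) (pure_tensor3 dual dual dual q\<^sub>1 q\<^sub>2 q\<^sub>3)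
    = (ev (p\<^sub>1 \<star> a \<star> q\<^sub>1) g * ev (p\<^sub>3 \<star> b \<star> q\<^sub>3) h) \<odot>\<^bsub>M\<^esub> r (l p\<^sub>2 n) q\<^sub>2"
proof -
  define x where "x = r (l p\<^sub>2 n) q\<^sub>2"
  have x: "x \<in> carrier M" unfolding x_def by (intro lr_intros *)
  have ll: "l (c \<odot>\<^bsub>dual\<^esub> p\<^sub>2) (d \<odot>\<^bsub>M\<^esub> n) = (c * d) \<odot>\<^bsub>M\<^esub> l p\<^sub>2 n" for c d
    using * vsp_M by (simp add: lin_smult[OF bil_left[OF bil_l]] lin_smult[OF bil_right[OF bil_l]]
        bil_closed[OF bil_l] mult.commute)
  have rr: "r (c \<odot>\<^bsub>M\<^esub> l p\<^sub>2 n) (d \<odot>\<^bsub>dual\<^esub> q\<^sub>2) = (c * d) \<odot>\<^bsub>M\<^esub> x" for c d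
    unfolding x_def using * vsp_M by (simp add: lin_smult[OF bil_left[OF bil_r]] lin_smult[OF bil_right[OF bil_r]]
        bil_closed[OF bil_l] bil_closed[OF bil_r] mult.commute)
  have "split_act h g (pure_tensor3 dual dual dual p\<^sub>1 p\<^sub>2 p\<^sub>3) (pure_tensor3 dual M dual a n b) (pure_tensor3 dual dual dual q\<^sub>1 q\<^sub>2 q\<^sub>3)
    = sw M h (\<lambda>v h\<^sub>3. sw M g (\<lambda>w g\<^sub>3. sw M v (\<lambda>h\<^sub>1 h\<^sub>2. sw M w (\<lambda>g\<^sub>1 g\<^sub>2.
        (ev p\<^sub>1 g\<^sub>1 * ev a g\<^sub>2) \<odot>\<^bsub>M\<^esub> ((ev p\<^sub>3 h\<^sub>1 * ev b h\<^sub>2 * (ev q\<^sub>1 g\<^sub>3 * ev q\<^sub>3 h\<^sub>3)) \<odot>\<^bsub>M\<^esub> x)))))"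
    unfolding split_act_def
    by (rule sw_cong[OF h], rule sw_cong[OF g], rule sw_cong, assumption, rule sw_cong, assumption)
      (simp add: ev2_pure3 vsp_M * ll rr x ac_simps)
  also have "\<dots> = sw M h (\<lambda>v h\<^sub>3. sw M g (\<lambda>w g\<^sub>3. sw M v (\<lambda>h\<^sub>1 h\<^sub>2.
        (ev p\<^sub>3 h\<^sub>1 * ev b h\<^sub>2) \<odot>\<^bsub>M\<^esub> ((ev (p\<^sub>1 \<star> a) w * (ev q\<^sub>1 g\<^sub>3 * ev q\<^sub>3 h\<^sub>3)) \<odot>\<^bsub>M\<^esub> x))))"
    by (rule sw_cong[OF h], rule sw_cong[OF g], rule sw_cong, assumption, subst sw_pmult_smult)
      (simp_all add: vsp_M * x ac_simps)
  also have "\<dots> = sw M h (\<lambda>v h\<^sub>3. sw M g (\<lambda>w g\<^sub>3.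
        (ev (p\<^sub>1 \<star> a) w * ev q\<^sub>1 g\<^sub>3) \<odot>\<^bsub>M\<^esub> ((ev (p\<^sub>3 \<star> b) v * ev q\<^sub>3 h\<^sub>3) \<odot>\<^bsub>M\<^esub> x)))"
    by (rule sw_cong[OF h], rule sw_cong[OF g], subst sw_pmult_smult)
      (simp_all add: vsp_M * x ac_simps)
  also have "\<dots> = sw M h (\<lambda>v h\<^sub>3. (ev (p\<^sub>3 \<star> b) v * ev q\<^sub>3 h\<^sub>3) \<odot>\<^bsub>M\<^esub> (ev (p\<^sub>1 \<star> a \<star> q\<^sub>1) g \<odot>\<^bsub>M\<^esub> x))"
    by (rule sw_cong[OF h], subst sw_pmult_smult) (simp_all add: vsp_M * x g ac_simps)
  also have "\<dots> = ev (p\<^sub>3 \<star> b \<star> q\<^sub>3) h \<odot>\<^bsub>M\<^esub> (ev (p\<^sub>1 \<star> a \<star> q\<^sub>1) g \<odot>\<^bsub>M\<^esub> x)"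
    by (rule sw_pmult_smult) (simp_all add: vsp_M * x h)
  finally show ?thesis unfolding x_def[symmetric] using x vsp_M by (simp add: mult.commute)
qed

text \<open>Both sides are linear in each of the three tensors, which may therefore be replaced by
  pure ones in turn.\<close>

lemma ev2_triple:
  assumes h: "h \<in> carrier H" and g: "g \<in> carrier H" and s: "s \<in> carrier (tensor_space3 dual dual dual)"
    and t: "t \<in> carrier (tensor_space3 dual M dual)" and u: "u \<in> carrier (tensor_space3 dual dual dual)"
  shows "ev2 M g h (triple s t u) = split_act h g s t u"
proof (rule tensor3_eqI[where f = "\<lambda>s. ev2 M g h (triple s t u)" and g = "\<lambda>s. split_act h g s t u",
      OF _ lin_split_act1[OF h g t u] _ _ _ s])
  note e = lin_compose[OF lin_ev2[OF vsp_M g h]]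
  show "lin (tensor_space3 dual dual dual) M (\<lambda>s. ev2 M g h (triple s t u))"
    by (rule e[OF lin_triple1[OF t u]])
  fix p\<^sub>1 p\<^sub>2 p\<^sub>3 assume p: "p\<^sub>1 \<in> carrier dual" "p\<^sub>2 \<in> carrier dual" "p\<^sub>3 \<in> carrier dual"
  define s where "s = pure_tensor3 dual dual dual p\<^sub>1 p\<^sub>2 p\<^sub>3"
  have s: "s \<in> carrier (tensor_space3 dual dual dual)" unfolding s_def by (intro pure_closed p)
  have "ev2 M g h (triple s t u) = split_act h g s t u"
  proof (rule tensor3_eqI[where f = "\<lambda>t. ev2 M g h (triple s t u)" and g = "\<lambda>t. split_act h g s t u",
        OF e[OF lin_triple2[OF s u]] lin_split_act2[OF h g s u] _ _ _ t])
    fix a n b assume ab: "a \<in> carrier dual" "n \<in> carrier M" "b \<in> carrier dual"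
    define t where "t = pure_tensor3 dual M dual a n b"
    have t: "t \<in> carrier (tensor_space3 dual M dual)" unfolding t_def by (intro pure_closed ab)
    have "ev2 M g h (triple s t u) = split_act h g s t u"
    proof (rule tensor3_eqI[where f = "\<lambda>u. ev2 M g h (triple s t u)" and g = "\<lambda>u. split_act h g s t u",
        OF e[OF lin_triple3[OF s t]] lin_split_act3[OF h g s t] _ _ _ u])
      fix q\<^sub>1 q\<^sub>2 q\<^sub>3 assume q: "q\<^sub>1 \<in> carrier dual" "q\<^sub>2 \<in> carrier dual" "q\<^sub>3 \<in> carrier dual"
      have "r (l p\<^sub>2 n) q\<^sub>2 \<in> carrier M" by (intro lr_intros p ab q)
      then show "ev2 M g h (triple s t (pure_tensor3 dual dual dual q\<^sub>1 q\<^sub>2 q\<^sub>3))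
        = split_act h g s t (pure_tensor3 dual dual dual q\<^sub>1 q\<^sub>2 q\<^sub>3)"
        unfolding s_def t_def
        by (simp add: triple_pure split_act_pure p ab q h g ev2_pure3 vsp_M)
    qed (simp_all add: vsp_M)
    then show "ev2 M g h (triple s (pure_tensor3 dual M dual a n b) u)
      = split_act h g s (pure_tensor3 dual M dual a n b) u"
      unfolding t_def .
  qed (simp_all add: vsp_M)
  then show "ev2 M g h (triple (pure_tensor3 dual dual dual p\<^sub>1 p\<^sub>2 p\<^sub>3) t u)
    = split_act h g (pure_tensor3 dual dual dual p\<^sub>1 p\<^sub>2 p\<^sub>3) t u"
    unfolding s_def .
qed (simp_all add: vsp_M)

lemma split_act_eq:
  assumes h: "h \<in> carrier H" and g: "g \<in> carrier H" and p: "p \<in> carrier dual" and q: "q \<in> carrier dual"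
    and m: "m \<in> carrier M"
  shows "split_act h g (dual_comult3 p) (two_sided_l m) (dual_comult3 q)
    = sw M h (\<lambda>v h\<^sub>3. sw M g (\<lambda>w g\<^sub>3. sw M v (\<lambda>h\<^sub>1 h\<^sub>2. sw M w (\<lambda>g\<^sub>1 g\<^sub>2.
        r (l (reg h\<^sub>1 g\<^sub>1 p) (hM h\<^sub>2 (mH m g\<^sub>2))) (reg h\<^sub>3 g\<^sub>3 q)))))"
  unfolding split_act_def
  by (rule sw_cong[OF h], rule sw_cong[OF g], rule sw_cong, assumption, rule sw_cong, assumption)
    (simp add: ev2_dual_comult3 ev2_two_sided_l m p q)

end

section \<open>Hopf bimodules\<close>

context fin_dim_hopf
begin

text \<open>The element \<open>h m g\<close>, written directly in terms of the coactions so that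
  \<open>Y_module\<close> can be defined for every record.\<close>

definition two_sided_act where
  "two_sided_act M h g m = evr M h (rcoact M (evl M g (lcoact M m)))"

lemma P_bilinear:
  fixes V :: "('k, 'v, 'y) module_scheme" and W :: "('k, 'w, 'z) module_scheme"
  shows "bilinear_maps P V W = bilinear_maps dual V W" "bilinear_maps V P W = bilinear_maps V dual W"
  by (intro bilinear_maps_cong; simp add: dual_hopf_simps)+

end

section \<open>From Hopf bimodules to the common structure\<close>

locale dual_hopf_bimodule = fin_dim_hopf H + B: hopf_bimodule "dual_hopf H" M
  for H :: "('k::field, 'a, 'x) hopf_scheme" (structure) and M :: "('k, 'a \<Rightarrow> 'k, 'm) hopf_bimodule"
begin

sublocale bimodule_coactions H M "lcoact M" "rcoact M" "lact M" "ract M"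
proof
  show "lin M (tensor_space dual M) (lcoact M)" "lin M (tensor_space M dual) (rcoact M)"
    using B.lcoact_linear B.rcoact_linear by (simp_all add: linear_maps_def P_norm)
  show "bil dual M M (lact M)" "bil M dual M (ract M)"
    using B.lact_bilinear B.ract_bilinear by (simp_all add: P_bilinear)
qed

lemma two_sided_act_eq: "two_sided_act M h g m = hM h (mH m g)"
  by (simp add: two_sided_act_def hM_def mH_def)

lemma bicoact_eq: "bicoact P M m = two_sided_l m"
  by (simp add: bicoact_def two_sided_l_def P_norm)

lemma mH_mult: "m \<in> carrier M \<Longrightarrow> g \<in> carrier H \<Longrightarrow> g' \<in> carrier H \<Longrightarrow> mH m (g \<otimes> g') = mH (mH m g) g'"
  using B.lcoact_coassoc[of m] evll_lassoc1[of m g g'] evll_lassoc2[of m g g']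
  by (simp add: lassoc1_def lassoc2_def P_norm dual_hopf_simps)

lemma hM_mult: "m \<in> carrier M \<Longrightarrow> h \<in> carrier H \<Longrightarrow> h' \<in> carrier H \<Longrightarrow> hM (h \<otimes> h') m = hM h (hM h' m)"
  using B.rcoact_coassoc[of m] evrr_rassoc1[of m h h'] evrr_rassoc2[of m h h']
  by (simp add: rassoc1_def rassoc2_def P_norm dual_hopf_simps)

lemma mH_one: "m \<in> carrier M \<Longrightarrow> mH m \<one> = m"
  using B.lcoact_counit[of m] by (simp add: mH_def evl_def P_norm dual_hopf_simps)

lemma hM_one: "m \<in> carrier M \<Longrightarrow> hM \<one> m = m"
  using B.rcoact_counit[of m] by (simp add: hM_def evr_def P_norm dual_hopf_simps)

lemma hM_mH: "m \<in> carrier M \<Longrightarrow> g \<in> carrier H \<Longrightarrow> h \<in> carrier H \<Longrightarrow> hM h (mH m g) = mH (hM h m) g"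
  using B.coact_commute[of m] ev2_two_sided_l[of m g h] ev2_two_sided_r[of m g h]
  by (simp add: bicoact_eq two_sided_r_def P_norm)

lemma mH_closed: "m \<in> carrier M \<Longrightarrow> g \<in> carrier H \<Longrightarrow> mH m g \<in> carrier M"
  by (rule lin_closed[OF lin_mH])

lemma hM_closed: "m \<in> carrier M \<Longrightarrow> g \<in> carrier H \<Longrightarrow> hM g m \<in> carrier M"
  by (rule lin_closed[OF lin_hM])

text \<open>The evaluated Hopf bimodule condition in full; the relations \<open>c_l\<close> and
  \<open>c_r\<close> are its cases \<open>q = pone\<close> and \<open>p = pone\<close>.\<close>

lemma two_sided_act_bimodule:
  assumes h: "h \<in> carrier H" and g: "g \<in> carrier H" and p: "p \<in> carrier dual" and q: "q \<in> carrier dual"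
    and m: "m \<in> carrier M"
  shows "two_sided_act M h g (ract M (lact M p m) q)
    = sw M h (\<lambda>v h\<^sub>3. sw M g (\<lambda>w g\<^sub>3. sw M v (\<lambda>h\<^sub>1 h\<^sub>2. sw M w (\<lambda>g\<^sub>1 g\<^sub>2.
        ract M (lact M (reg h\<^sub>1 g\<^sub>1 p) (two_sided_act M h\<^sub>2 g\<^sub>2 m)) (reg h\<^sub>3 g\<^sub>3 q)))))"
proof -
  have n: "ract M (lact M p m) q \<in> carrier M" by (intro lr_intros p q m)
  have "two_sided_act M h g (ract M (lact M p m) q) = ev2 M g h (two_sided_l (ract M (lact M p m) q))"
    by (simp add: ev2_two_sided_l n g h two_sided_act_eq)
  also have "two_sided_l (ract M (lact M p m) q) = triple (dual_comult3 p) (two_sided_l m) (dual_comult3 q)"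
    using B.bicoact_act[of p q m] p q m
    by (simp add: bicoact_eq comult3_P dual_hopf_simps triple_def sweedler3_def P_norm)
  also have "ev2 M g h (triple (dual_comult3 p) (two_sided_l m) (dual_comult3 q))
    = split_act h g (dual_comult3 p) (two_sided_l m) (dual_comult3 q)"
    by (rule ev2_triple) (simp_all add: h g p q m dual_comult3_closed two_sided_closed)
  finally show ?thesis by (simp add: split_act_eq h g p q m two_sided_act_eq)
qed

sublocale D: action_data H M "lact M" "ract M" "two_sided_act M"
proof
  fix m assume m: "m \<in> carrier M"
  show "lact M pone m = m" "ract M m pone = m" using B.lact_one B.ract_one m by simp_all
  show "lact M (p \<star> q) m = lact M p (lact M q m)" "ract M m (p \<star> q) = ract M (ract M m p) q"
      "ract M (lact M p m) q = lact M p (ract M m q)"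
    if "p \<in> carrier dual" "q \<in> carrier dual" for p q
    using that m B.lact_mult B.ract_mult B.lact_ract by (simp_all add: dual_hopf_simps)
  show "two_sided_act M \<one> \<one> m = m" using m by (simp add: two_sided_act_eq hM_one mH_one)
  show "lin H M (\<lambda>h. two_sided_act M h g m)" if "g \<in> carrier H" for g
    unfolding two_sided_act_eq by (intro lin_hM_left mH_closed m that)
  show "lin H M (\<lambda>g. two_sided_act M h g m)" if "h \<in> carrier H" for h
    unfolding two_sided_act_eq by (intro lin_compose[OF lin_hM lin_mH_right] m that)
  fix h g assume h: "h \<in> carrier H" and g: "g \<in> carrier H"
  show "two_sided_act M (h \<otimes> h') (g' \<otimes> g) m = two_sided_act M h g (two_sided_act M h' g' m)"
    if "h' \<in> carrier H" "g' \<in> carrier H" for h' g'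
    using that h g m by (simp add: two_sided_act_eq hM_mult mH_mult hM_mH mH_closed hM_closed)
  fix p assume p: "p \<in> carrier dual"
  note lin_ts = lin_compose[OF lin_hM] lin_compose[OF lin_mH_right] lin_compose[OF lin_hM_left]
  note intros = lin_intros lr_intros lin_ts mH_closed hM_closed h g p m
  \<comment> \<open>A right action of \<open>pone\<close> is inserted.
    \<open>reg h\<^sub>3 g\<^sub>3 pone\<close> is a counit multiple of \<open>pone\<close>, so the
    counit axiom removes the third components.\<close>
  have "two_sided_act M h g (lact M p m) = two_sided_act M h g (ract M (lact M p m) pone)"
    using B.ract_one[of "lact M p m"] bil_closed[OF bil_l p m] by simp
  also have "\<dots> = sw M h (\<lambda>v h\<^sub>3. sw M g (\<lambda>w g\<^sub>3. sw M v (\<lambda>h\<^sub>1 h\<^sub>2. sw M w (\<lambda>g\<^sub>1 g\<^sub>2.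
        (eps h\<^sub>3 * eps g\<^sub>3) \<odot>\<^bsub>M\<^esub> lact M (reg h\<^sub>1 g\<^sub>1 p) (two_sided_act M h\<^sub>2 g\<^sub>2 m)))))"
    unfolding two_sided_act_bimodule[OF h g p pone_closed m]
    by (rule sw_cong[OF h], rule sw_cong[OF g], rule sw_cong, assumption, rule sw_cong, assumption)
      (simp add: reg_pone lin_smult[OF bil_right[OF bil_r]] bil_closed[OF bil_l] p m two_sided_act_eq
        mH_closed hM_closed B.ract_one)
  also have "\<dots> = sw M h (\<lambda>v h\<^sub>3. sw M g (\<lambda>w g\<^sub>3. sw M v (\<lambda>h\<^sub>1 h\<^sub>2. (eps h\<^sub>3 * eps g\<^sub>3) \<odot>\<^bsub>M\<^esub> sw M w (\<lambda>g\<^sub>1 g\<^sub>2.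
        lact M (reg h\<^sub>1 g\<^sub>1 p) (two_sided_act M h\<^sub>2 g\<^sub>2 m)))))"
    unfolding two_sided_act_eq
    by (rule sw_cong[OF h], rule sw_cong[OF g], rule sw_cong, assumption, rule sweedler_smult)
      (assumption | intro intros; assumption?)+
  also have "\<dots> = sw M h (\<lambda>v h\<^sub>3. sw M g (\<lambda>w g\<^sub>3. (eps h\<^sub>3 * eps g\<^sub>3) \<odot>\<^bsub>M\<^esub> sw M v (\<lambda>h\<^sub>1 h\<^sub>2. sw M w (\<lambda>g\<^sub>1 g\<^sub>2.
        lact M (reg h\<^sub>1 g\<^sub>1 p) (two_sided_act M h\<^sub>2 g\<^sub>2 m)))))"
    unfolding two_sided_act_eq
    by (rule sw_cong[OF h], rule sw_cong[OF g], rule sweedler_smult)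
      (assumption | intro intros; assumption?)+
  also have "\<dots> = sw M h (\<lambda>h\<^sub>1 h\<^sub>2. sw M g (\<lambda>g\<^sub>1 g\<^sub>2. lact M (reg h\<^sub>1 g\<^sub>1 p) (two_sided_act M h\<^sub>2 g\<^sub>2 m)))"
    unfolding two_sided_act_eq
    by (rule sw2_counit_right) (assumption | intro intros; assumption?)+
  finally show "two_sided_act M h g (lact M p m)
    = sw M h (\<lambda>h\<^sub>1 h\<^sub>2. sw M g (\<lambda>g\<^sub>1 g\<^sub>2. lact M (reg h\<^sub>1 g\<^sub>1 p) (two_sided_act M h\<^sub>2 g\<^sub>2 m)))" .
  have "two_sided_act M h g (ract M m p) = two_sided_act M h g (ract M (lact M pone m) p)"
    using B.lact_one[OF m] by simp
  also have "\<dots> = sw M h (\<lambda>v h\<^sub>3. sw M g (\<lambda>w g\<^sub>3. sw M v (\<lambda>h\<^sub>1 h\<^sub>2. sw M w (\<lambda>g\<^sub>1 g\<^sub>2.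
        (eps h\<^sub>1 * eps g\<^sub>1) \<odot>\<^bsub>M\<^esub> ract M (two_sided_act M h\<^sub>2 g\<^sub>2 m) (reg h\<^sub>3 g\<^sub>3 p)))))"
    unfolding two_sided_act_bimodule[OF h g pone_closed p m]
    by (rule sw_cong[OF h], rule sw_cong[OF g], rule sw_cong, assumption, rule sw_cong, assumption)
      (simp add: reg_pone lin_smult[OF bil_left[OF bil_l]] lin_smult[OF bil_left[OF bil_r]]
        bil_closed[OF bil_l] p m two_sided_act_eq mH_closed hM_closed B.lact_one)
  also have "\<dots> = sw M h (\<lambda>v h\<^sub>3. sw M g (\<lambda>w g\<^sub>3. ract M (two_sided_act M v w m) (reg h\<^sub>3 g\<^sub>3 p)))"
    unfolding two_sided_act_eq
    by (rule sw_cong[OF h], rule sw_cong[OF g], rule sw2_counit_left)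
      (assumption | intro intros; assumption?)+
  finally show "two_sided_act M h g (ract M m p)
    = sw M h (\<lambda>h\<^sub>1 h\<^sub>2. sw M g (\<lambda>g\<^sub>1 g\<^sub>2. ract M (two_sided_act M h\<^sub>1 g\<^sub>1 m) (reg h\<^sub>2 g\<^sub>2 p)))" .
next
  show "lin M M (\<lambda>m. two_sided_act M h g m)" if "h \<in> carrier H" "g \<in> carrier H" for h g
    unfolding two_sided_act_eq by (intro lin_compose[OF lin_hM lin_mH] that)
qed (rule bil_l bil_r)+

text \<open>This is the formula by which \<open>to_bimodule\<close> forms its left coaction, so the
  original coaction is recovered exactly from the \<open>Y\<close>-module.\<close>

lemma lcoact_reconstruct:
  assumes m: "m \<in> carrier M"
  shows "lcoact M m = tr (tensor_space dual M) (\<lambda>e p. pure_tensor dual M p (two_sided_act M \<one> e m))"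
proof -
  have "lcoact M m = tr (tensor_space dual M) (\<lambda>e p. pure_tensor dual M p (evl M e (lcoact M m)))"
    by (rule evl_reconstruct[symmetric, OF vsp_M]) (intro lco_intros m)
  also have "\<dots> = tr (tensor_space dual M) (\<lambda>e p. pure_tensor dual M p (two_sided_act M \<one> e m))"
    by (rule tr_cong) (simp add: two_sided_act_eq hM_one mH_closed m mH_def[symmetric])
  finally show ?thesis .
qed

lemma rcoact_reconstruct:
  assumes m: "m \<in> carrier M"
  shows "rcoact M m = tr (tensor_space M dual) (\<lambda>e p. pure_tensor M dual (two_sided_act M e \<one> m) p)"
proof -
  have "rcoact M m = tr (tensor_space M dual) (\<lambda>e p. pure_tensor M dual (evr M e (rcoact M m)) p)"
    by (rule evr_reconstruct[symmetric, OF vsp_M]) (intro lco_intros m)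
  also have "\<dots> = tr (tensor_space M dual) (\<lambda>e p. pure_tensor M dual (two_sided_act M e \<one> m) p)"
    by (rule tr_cong) (simp add: two_sided_act_eq mH_one m hM_def[symmetric])
  finally show ?thesis .
qed

end

section \<open>From the common structure to Hopf bimodules\<close>

locale bimodule_from_data = action_data H B "lact B" "ract B" c
  for H :: "('k::field, 'a, 'x) hopf_scheme" (structure) and B :: "('k, 'a \<Rightarrow> 'k, 'm) hopf_bimodule" and c +
  assumes lact_ext: "lact B \<in> carrier dual \<rightarrow>\<^sub>E carrier B \<rightarrow>\<^sub>E carrier B"
    and ract_ext: "ract B \<in> carrier B \<rightarrow>\<^sub>E carrier dual \<rightarrow>\<^sub>E carrier B"
    and lcoact_eq: "m \<in> carrier B \<Longrightarrow>
      lcoact B m = tr (tensor_space dual B) (\<lambda>e p. pure_tensor dual B p (c \<one> e m))"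
    and rcoact_eq: "m \<in> carrier B \<Longrightarrow>
      rcoact B m = tr (tensor_space B dual) (\<lambda>e p. pure_tensor B dual (c e \<one> m) p)"
    and lcoact_ext: "lcoact B \<in> extensional (carrier B)"
    and rcoact_ext: "rcoact B \<in> extensional (carrier B)"
begin

sublocale bimodule_coactions H B "lcoact B" "rcoact B" "lact B" "ract B"
proof (intro bimodule_coactions.intro coactions.intro coactions_axioms.intro bimodule_coactions_axioms.intro)
  have "lin B (tensor_space dual B) (\<lambda>m. tr (tensor_space dual B) (\<lambda>e p. pure_tensor dual B p (c \<one> e m)))"
    "lin B (tensor_space B dual) (\<lambda>m. tr (tensor_space B dual) (\<lambda>e p. pure_tensor B dual (c e \<one> m) p))"
    by (assumption | intro lin_intros data_intros; assumption?)+
  then show "lin B (tensor_space dual B) (lcoact B)" "lin B (tensor_space B dual) (rcoact B)"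
    by (simp_all add: lin_cong[OF lcoact_eq vsp_M] lin_cong[OF rcoact_eq vsp_M])
qed (rule vsp_M bil_l bil_r fin_dim_hopf_axioms)+

lemma c_closed: "h \<in> carrier H \<Longrightarrow> g \<in> carrier H \<Longrightarrow> m \<in> carrier B \<Longrightarrow> c h g m \<in> carrier B"
  by (rule lin_closed[OF c_lin_right])

lemma mH_eq:
  assumes m: "m \<in> carrier B" and g: "g \<in> carrier H"
  shows "mH m g = c \<one> g m"
proof -
  have b: "bil H dual (tensor_space dual B) (\<lambda>e p. pure_tensor dual B p (c \<one> e m))"
    by (assumption | intro lin_intros data_intros m; assumption?)+
  have "mH m g = tr B (\<lambda>e p. evl B g (pure_tensor dual B p (c \<one> e m)))"
    unfolding mH_def lcoact_eq[OF m]
    by (rule lin_tr[OF lin_evl[OF vsp_M g] _ vsp_M b]) simp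
  also have "\<dots> = tr B (\<lambda>e p. ev p g \<odot>\<^bsub>B\<^esub> c \<one> e m)"
    by (rule tr_cong) (simp add: evl_pure vsp_M g m c_closed)
  also have "\<dots> = c \<one> g m"
    by (rule tr_vector) (assumption | intro lin_intros data_intros m g; assumption?)+
  finally show ?thesis .
qed

lemma hM_eq:
  assumes m: "m \<in> carrier B" and h: "h \<in> carrier H"
  shows "hM h m = c h \<one> m"
proof -
  have b: "bil H dual (tensor_space B dual) (\<lambda>e p. pure_tensor B dual (c e \<one> m) p)"
    by (assumption | intro lin_intros data_intros m; assumption?)+
  have "hM h m = tr B (\<lambda>e p. evr B h (pure_tensor B dual (c e \<one> m) p))"
    unfolding hM_def rcoact_eq[OF m]
    by (rule lin_tr[OF lin_evr[OF vsp_M h] _ vsp_M b]) (simp add: vsp_M)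
  also have "\<dots> = tr B (\<lambda>e p. ev p h \<odot>\<^bsub>B\<^esub> c e \<one> m)"
    by (rule tr_cong) (simp add: evr_pure vsp_M h m c_closed)
  also have "\<dots> = c h \<one> m"
    by (rule tr_vector) (assumption | intro lin_intros data_intros m h; assumption?)+
  finally show ?thesis .
qed

lemma one_H_simps: "h \<in> carrier H \<Longrightarrow> \<one> \<otimes> h = h" "h \<in> carrier H \<Longrightarrow> h \<otimes> \<one> = h"
  by (simp_all add: ring.ring_simprules[OF ring_H])

text \<open>\<open>c\<close> is a single action of \<open>H\<close> tensored with its opposite
  algebra, and in either order the elements for \<open>h\<close> and for \<open>g\<close> multiply
  to the one for the pair.\<close>

lemma hM_mH_eq:
  assumes m: "m \<in> carrier B" and h: "h \<in> carrier H" and g: "g \<in> carrier H"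
  shows "hM h (mH m g) = c h g m" "mH (hM h m) g = c h g m"
  using c_mult[of h \<one> \<one> g m] c_mult[of \<one> g h \<one> m] assms
  by (simp_all add: mH_eq hM_eq c_closed one_H_simps)

lemma two_sided_act_from_data:
  "m \<in> carrier B \<Longrightarrow> h \<in> carrier H \<Longrightarrow> g \<in> carrier H \<Longrightarrow> two_sided_act B h g m = c h g m"
  using hM_mH_eq(1) by (simp add: two_sided_act_def hM_def mH_def)

text \<open>Coassociativity, compatibility of the coactions and the Hopf bimodule condition are
  equations between tensors with dual legs; evaluating these legs at elements of \<open>H\<close>
  turns them into axioms of \<open>action_data\<close>. The counit axioms are evaluations at
  \<open>\<one>\<close>.\<close>

lemma hopf_bimodule: "hopf_bimodule P B"
proof -
  note mH_closed = lin_closed[OF lin_mH] and hM_closed = lin_closed[OF lin_hM]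
  have "bimodule P B"
    unfolding bimodule_def bimodule_axioms_def
    using vsp_M lact_ext ract_ext bil_l bil_r l_one l_mult r_one r_mult l_r
    by (simp add: P_bilinear dual_hopf_simps)
  moreover have "bicomodule P B"
    unfolding bicomodule_def bicomodule_axioms_def
  proof (intro conjI allI impI)
    show "vsp B" by (rule vsp_M)
    show "lcoact B \<in> linear_maps B (tensor_space P B)" "rcoact B \<in> linear_maps B (tensor_space B P)"
      using lco rco lcoact_ext rcoact_ext by (simp_all add: linear_maps_def P_norm)
    fix m assume m: "m \<in> carrier B"
    have "lassoc1 m = lassoc2 m"
    proof (rule evll_eqI)
      fix g g' assume g: "g \<in> carrier H" "g' \<in> carrier H"
      have "c \<one> (g \<otimes> g') m = c \<one> g' (c \<one> g m)"
        using c_mult[of \<one> g' \<one> g m] g m by (simp add: one_H_simps)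
      then show "evll g g' (lassoc1 m) = evll g g' (lassoc2 m)"
        using g m by (simp add: evll_lassoc1 evll_lassoc2 mH_eq c_closed)
    qed (simp_all add: lassoc_closed m)
    then show "sweedler P B (tensor_space3 P P B) (\<lambda>a n. sweedler P P (tensor_space3 P P B)
        (\<lambda>a\<^sub>1 a\<^sub>2. pure_tensor3 P P B a\<^sub>1 a\<^sub>2 n) (comult P a)) (lcoact B m)
      = sweedler P B (tensor_space3 P P B) (\<lambda>a n. pure_tensor P (tensor_space P B) a (lcoact B n)) (lcoact B m)"
      by (simp add: lassoc1_def lassoc2_def P_norm dual_hopf_simps)
    have "rassoc1 m = rassoc2 m"
    proof (rule evrr_eqI)
      fix h h' assume h: "h \<in> carrier H" "h' \<in> carrier H"
      have "c (h \<otimes> h') \<one> m = c h \<one> (c h' \<one> m)"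
        using c_mult[of h \<one> h' \<one> m] h m by (simp add: one_H_simps)
      then show "evrr h h' (rassoc1 m) = evrr h h' (rassoc2 m)"
        using h m by (simp add: evrr_rassoc1 evrr_rassoc2 hM_eq c_closed)
    qed (simp_all add: rassoc_closed m)
    then show "sweedler B P (tensor_space3 B P P) (\<lambda>n a. sweedler B P (tensor_space3 B P P)
        (\<lambda>n' b. pure_tensor3 B P P n' b a) (rcoact B n)) (rcoact B m)
      = sweedler B P (tensor_space3 B P P) (\<lambda>n a. pure_tensor B (tensor_space P P) n (comult P a)) (rcoact B m)"
      by (simp add: rassoc1_def rassoc2_def P_norm dual_hopf_simps)
    show "sweedler P B B (\<lambda>a n. counit P a \<odot>\<^bsub>B\<^esub> n) (lcoact B m) = m"
      using mH_eq[OF m one_closed_H] c_one[OF m] by (simp add: mH_def evl_def P_norm dual_hopf_simps)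
    show "sweedler B P B (\<lambda>n a. counit P a \<odot>\<^bsub>B\<^esub> n) (rcoact B m) = m"
      using hM_eq[OF m one_closed_H] c_one[OF m] by (simp add: hM_def evr_def P_norm dual_hopf_simps)
    have "two_sided_r m = two_sided_l m"
      by (rule ev2_eqI[OF vsp_M])
        (simp_all add: two_sided_closed m ev2_two_sided_l ev2_two_sided_r hM_mH_eq)
    then show "sweedler B P (tensor_space3 P B P) (\<lambda>n b. sweedler P B (tensor_space3 P B P)
        (\<lambda>a n'. pure_tensor3 P B P a n' b) (lcoact B n)) (rcoact B m) = bicoact P B m"
      by (simp add: bicoact_def two_sided_l_def two_sided_r_def P_norm)
  qed
  moreover have "hopf_bimodule_axioms P B"
    unfolding hopf_bimodule_axioms_def
  proof (intro allI impI)
    fix p q m assume "p \<in> carrier P" "q \<in> carrier P" and m: "m \<in> carrier B"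
    then have p: "p \<in> carrier dual" and q: "q \<in> carrier dual" by (simp_all add: dual_hopf_simps)
    have n: "ract B (lact B p m) q \<in> carrier B" by (intro lr_intros p q m)
    have "two_sided_l (ract B (lact B p m) q) = triple (dual_comult3 p) (two_sided_l m) (dual_comult3 q)"
    proof (rule ev2_eqI[OF vsp_M])
      show "triple (dual_comult3 p) (two_sided_l m) (dual_comult3 q) \<in> carrier (tensor_space3 dual B dual)"
        by (rule lin_closed[OF lin_triple1]) (simp_all add: two_sided_closed m dual_comult3_closed p q)
      fix g h assume g: "g \<in> carrier H" and h: "h \<in> carrier H"
      have "ev2 B g h (triple (dual_comult3 p) (two_sided_l m) (dual_comult3 q))
        = split_act h g (dual_comult3 p) (two_sided_l m) (dual_comult3 q)"
        by (rule ev2_triple) (simp_all add: h g p q m dual_comult3_closed two_sided_closed)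
      also have "\<dots> = sw B h (\<lambda>v h\<^sub>3. sw B g (\<lambda>w g\<^sub>3. sw B v (\<lambda>h\<^sub>1 h\<^sub>2. sw B w (\<lambda>g\<^sub>1 g\<^sub>2.
        ract B (lact B (reg h\<^sub>1 g\<^sub>1 p) (c h\<^sub>2 g\<^sub>2 m)) (reg h\<^sub>3 g\<^sub>3 q)))))"
        unfolding split_act_eq[OF h g p q m]
        by (rule sw_cong[OF h], rule sw_cong[OF g], rule sw_cong, assumption, rule sw_cong, assumption)
          (simp add: hM_mH_eq m)
      \<comment> \<open>The inner sums are closed by \<open>c_l\<close> under the right action of
        \<open>reg h\<^sub>3 g\<^sub>3 q\<close>, which commutes with them by linearity;
        \<open>c_r\<close> then closes the outer sums.\<close>
      also have "\<dots> = sw B h (\<lambda>v h\<^sub>3. sw B g (\<lambda>w g\<^sub>3. ract B (c v w (lact B p m)) (reg h\<^sub>3 g\<^sub>3 q)))"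
      proof (rule sw_cong[OF h], rule sw_cong[OF g])
        fix v h\<^sub>3 w g\<^sub>3 assume *: "v \<in> carrier H" "h\<^sub>3 \<in> carrier H" "w \<in> carrier H" "g\<^sub>3 \<in> carrier H"
        let ?q = "reg h\<^sub>3 g\<^sub>3 q"
        have q': "?q \<in> carrier dual" using * q by simp
        note intros = lin_intros data_intros * p q' m
        have "ract B (c v w (lact B p m)) ?q = ract B (sw B v (\<lambda>h\<^sub>1 h\<^sub>2. sw B w (\<lambda>g\<^sub>1 g\<^sub>2.
            lact B (reg h\<^sub>1 g\<^sub>1 p) (c h\<^sub>2 g\<^sub>2 m)))) ?q"
          by (simp only: c_l * p m)
        also have "\<dots> = sw B v (\<lambda>h\<^sub>1 h\<^sub>2. ract B (sw B w (\<lambda>g\<^sub>1 g\<^sub>2. lact B (reg h\<^sub>1 g\<^sub>1 p) (c h\<^sub>2 g\<^sub>2 m))) ?q)"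
          by (rule lin_sw[OF bil_left[OF bil_r q'] vsp_M vsp_M _ *(1)]) (assumption | intro intros; assumption?)+
        also have "\<dots> = sw B v (\<lambda>h\<^sub>1 h\<^sub>2. sw B w (\<lambda>g\<^sub>1 g\<^sub>2. ract B (lact B (reg h\<^sub>1 g\<^sub>1 p) (c h\<^sub>2 g\<^sub>2 m)) ?q))"
          by (rule sw_cong[OF *(1)], rule lin_sw[OF bil_left[OF bil_r q'] vsp_M vsp_M _ *(3)])
            (assumption | intro intros; assumption?)+
        finally show "sw B v (\<lambda>h\<^sub>1 h\<^sub>2. sw B w (\<lambda>g\<^sub>1 g\<^sub>2. ract B (lact B (reg h\<^sub>1 g\<^sub>1 p) (c h\<^sub>2 g\<^sub>2 m)) ?q))
          = ract B (c v w (lact B p m)) ?q" by simp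
      qed
      also have "\<dots> = c h g (ract B (lact B p m) q)"
        by (rule c_r[symmetric]) (simp_all add: h g q bil_closed[OF bil_l p m])
      also have "\<dots> = ev2 B g h (two_sided_l (ract B (lact B p m) q))"
        by (simp add: ev2_two_sided_l n g h hM_mH_eq)
      finally show "ev2 B g h (two_sided_l (ract B (lact B p m) q))
        = ev2 B g h (triple (dual_comult3 p) (two_sided_l m) (dual_comult3 q))" by simp
    qed (simp add: two_sided_closed n)
    then show "bicoact P B (ract B (lact B p m) q) =
      sweedler3 P P P (tensor_space3 P B P) (\<lambda>p\<^sub>1 p\<^sub>2 p\<^sub>3.
        sweedler3 P B P (tensor_space3 P B P) (\<lambda>a n b.
          sweedler3 P P P (tensor_space3 P B P) (\<lambda>q\<^sub>1 q\<^sub>2 q\<^sub>3.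
            pure_tensor3 P B P (p\<^sub>1 \<star> a \<star> q\<^sub>1) (ract B (lact B p\<^sub>2 n) q\<^sub>2) (p\<^sub>3 \<star> b \<star> q\<^sub>3))
          (comult3 P q)) (bicoact P B m)) (comult3 P p)"
      by (simp add: bicoact_def two_sided_l_def comult3_P dual_hopf_simps triple_def sweedler3_def P_norm)
  qed
  ultimately show ?thesis unfolding hopf_bimodule_def by blast
qed

end

section \<open>The isomorphism of categories\<close>

text \<open>\<open>to_bimodule\<close> restricts the actions to the carriers, so they agree with the
  actions of the \<open>Y\<close>-module only there. This lemma carries the structure over to the
  new record.\<close>

lemma action_data_cong:
  assumes data: "action_data H M l r c"
    and eq: "carrier B = carrier M" "add B = add M" "module.smult B = module.smult M" "\<zero>\<^bsub>B\<^esub> = \<zero>\<^bsub>M\<^esub>"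
    and l: "\<And>p m. p \<in> carrier (dual_space H) \<Longrightarrow> m \<in> carrier M \<Longrightarrow> l' p m = l p m"
    and r: "\<And>p m. p \<in> carrier (dual_space H) \<Longrightarrow> m \<in> carrier M \<Longrightarrow> r' m p = r m p"
  shows "action_data H B l' r' c"
proof -
  interpret action_data H M l r c by (rule data)
  have bil: "bilinear_maps dual B B = bilinear_maps dual M M" "bilinear_maps B dual B = bilinear_maps M dual M"
    by (intro bilinear_maps_cong; simp add: eq)+
  have lin: "module_hom class_ring H B = module_hom class_ring H M" "module_hom class_ring B B = module_hom class_ring M M"
    by (intro module_hom_cong; simp add: eq)+
  have sw: "sweedler H H B = sweedler H H M"
    by (intro sweedler_space_cong; simp add: eq)
  have bl: "bil dual M M l'" and br: "bil M dual M r'"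
    using bil_l bil_r l r vsp_M by (simp_all add: bilinear_maps_def lin_iff)
  note closed = bil_closed[OF bil_l] bil_closed[OF bil_r] lin_closed[OF c_lin_right]
  show ?thesis
  proof (intro action_data.intro action_data_axioms.intro, unfold bil lin sw eq(1))
    show "vsp B" by (rule vsp_cong[OF vsp_M eq(1,4,2,3)])
    show "c h g (l' p m) = sw M h (\<lambda>h\<^sub>1 h\<^sub>2. sw M g (\<lambda>g\<^sub>1 g\<^sub>2. l' (reg h\<^sub>1 g\<^sub>1 p) (c h\<^sub>2 g\<^sub>2 m)))"
      if *: "h \<in> carrier H" "g \<in> carrier H" "p \<in> carrier dual" "m \<in> carrier M" for h g p m
    proof -
      have "c h g (l' p m) = sw M h (\<lambda>h\<^sub>1 h\<^sub>2. sw M g (\<lambda>g\<^sub>1 g\<^sub>2. l (reg h\<^sub>1 g\<^sub>1 p) (c h\<^sub>2 g\<^sub>2 m)))"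
        using c_l * l by simp
      also have "\<dots> = sw M h (\<lambda>h\<^sub>1 h\<^sub>2. sw M g (\<lambda>g\<^sub>1 g\<^sub>2. l' (reg h\<^sub>1 g\<^sub>1 p) (c h\<^sub>2 g\<^sub>2 m)))"
        by (rule sw_cong[OF *(1)], rule sw_cong[OF *(2)]) (simp add: l * closed)
      finally show ?thesis .
    qed
    show "c h g (r' m q) = sw M h (\<lambda>h\<^sub>1 h\<^sub>2. sw M g (\<lambda>g\<^sub>1 g\<^sub>2. r' (c h\<^sub>1 g\<^sub>1 m) (reg h\<^sub>2 g\<^sub>2 q)))"
      if *: "h \<in> carrier H" "g \<in> carrier H" "q \<in> carrier dual" "m \<in> carrier M" for h g q m
    proof -
      have "c h g (r' m q) = sw M h (\<lambda>h\<^sub>1 h\<^sub>2. sw M g (\<lambda>g\<^sub>1 g\<^sub>2. r (c h\<^sub>1 g\<^sub>1 m) (reg h\<^sub>2 g\<^sub>2 q)))"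
        using c_r * r by simp
      also have "\<dots> = sw M h (\<lambda>h\<^sub>1 h\<^sub>2. sw M g (\<lambda>g\<^sub>1 g\<^sub>2. r' (c h\<^sub>1 g\<^sub>1 m) (reg h\<^sub>2 g\<^sub>2 q)))"
        by (rule sw_cong[OF *(1)], rule sw_cong[OF *(2)]) (simp add: r * closed)
      finally show ?thesis .
    qed
  qed (use bl br l_one l_mult r_one r_mult l_r c_lin_left c_lin_mid c_lin_right c_one c_mult
      in \<open>simp_all add: l r closed fin_dim_hopf_axioms\<close>)
qed

section \<open>The Hopf bimodule of a \<open>Y\<close>-module\<close>

context crossed_module
begin

text \<open>The coactions invert evaluation by dual bases: on the left the sum of \<open>p\<close>
  tensored with \<open>m e\<close>, on the right the sum of \<open>e m\<close> tensored with
  \<open>p\<close>.\<close>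

definition to_bimodule :: "('k, 'a \<Rightarrow> 'k, 'm) hopf_bimodule" where
  "to_bimodule = \<lparr>carrier = carrier N, mult = mult N, one = one N, zero = zero N, add = add N,
     smult = module.smult N,
     lact = \<lambda>p\<in>carrier dual. \<lambda>m\<in>carrier N. la p m,
     ract = \<lambda>m\<in>carrier N. \<lambda>p\<in>carrier dual. ra m p,
     lcoact = \<lambda>m\<in>carrier N. tr (tensor_space dual N) (\<lambda>e p. pure_tensor dual N p (ca \<one> e m)),
     rcoact = \<lambda>m\<in>carrier N. tr (tensor_space N dual) (\<lambda>e p. pure_tensor N dual (ca e \<one> m) p)\<rparr>"

lemma to_bimodule_simps:
  "carrier to_bimodule = carrier N" "add to_bimodule = add N"
  "module.smult to_bimodule = module.smult N" "\<zero>\<^bsub>to_bimodule\<^esub> = \<zero>\<^bsub>N\<^esub>"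
  "p \<in> carrier dual \<Longrightarrow> m \<in> carrier N \<Longrightarrow> lact to_bimodule p m = la p m"
  "p \<in> carrier dual \<Longrightarrow> m \<in> carrier N \<Longrightarrow> ract to_bimodule m p = ra m p"
  by (simp_all add: to_bimodule_def)

lemma to_bimodule_maps:
  "lact to_bimodule = (\<lambda>p\<in>carrier dual. \<lambda>m\<in>carrier N. la p m)"
  "ract to_bimodule = (\<lambda>m\<in>carrier N. \<lambda>p\<in>carrier dual. ra m p)"
  "lcoact to_bimodule = (\<lambda>m\<in>carrier N. tr (tensor_space dual N) (\<lambda>e p. pure_tensor dual N p (ca \<one> e m)))"
  "rcoact to_bimodule = (\<lambda>m\<in>carrier N. tr (tensor_space N dual) (\<lambda>e p. pure_tensor N dual (ca e \<one> m) p))"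
  by (simp_all add: to_bimodule_def)

lemma to_bimodule_spaces:
  fixes X :: "('k, 'b, 'z) module_scheme" and U :: "('k, 'u, 'w) module_scheme"
  shows "tensor_of X to_bimodule = tensor_of X N" "tensor_of to_bimodule X = tensor_of N X"
    "tensor_space X to_bimodule = tensor_space X N" "tensor_space to_bimodule X = tensor_space N X"
  by (intro tensor_of_cong tensor_space_cong; simp add: to_bimodule_simps)+

lemma bimodule_from_data_to_bimodule: "bimodule_from_data H to_bimodule ca"
proof (intro bimodule_from_data.intro bimodule_from_data_axioms.intro)
  show "action_data H to_bimodule (lact to_bimodule) (ract to_bimodule) ca"
    by (rule action_data_cong[OF action_data_axioms]) (simp_all add: to_bimodule_simps)
qed (use bil_closed[OF bil_l] bil_closed[OF bil_r] in
    \<open>auto simp: to_bimodule_spaces to_bimodule_simps(1) to_bimodule_maps\<close>)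

lemma hopf_bimodule_to_bimodule: "hopf_bimodule P to_bimodule"
  by (rule bimodule_from_data.hopf_bimodule[OF bimodule_from_data_to_bimodule])

end

section \<open>Comparison of objects and of morphisms\<close>

context fin_dim_hopf
begin

definition Y_module :: "('k, 'a \<Rightarrow> 'k, 'm) hopf_bimodule \<Rightarrow> ('k, ('k, 'a) Y_carrier, 'm) left_module" where
  "Y_module M = action_data.to_module H M (lact M) (ract M) (two_sided_act M)"

lemma dual_hopf_bimoduleI: "hopf_bimodule P M \<Longrightarrow> dual_hopf_bimodule H M"
  by (intro dual_hopf_bimodule.intro fin_dim_hopf_axioms)

lemma crossed_moduleI: "left_module Y N \<Longrightarrow> crossed_module H N"
  by (intro crossed_module.intro fin_dim_hopf_axioms)

lemma left_module_Y_module: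
  assumes "hopf_bimodule P M"
  shows "left_module Y (Y_module M)"
proof -
  interpret dual_hopf_bimodule H M by (rule dual_hopf_bimoduleI[OF assms])
  show ?thesis unfolding Y_module_def by (rule D.left_module_to_module)
qed

lemma Y_module_to_bimodule:
  assumes "left_module Y N"
  shows "Y_module (crossed_module.to_bimodule H N) = N"
proof -
  interpret crossed_module H N by (rule crossed_moduleI[OF assms])
  interpret B: bimodule_from_data H to_bimodule ca by (rule bimodule_from_data_to_bimodule)
  interpret M: dual_hopf_bimodule H to_bimodule by (rule dual_hopf_bimoduleI[OF hopf_bimodule_to_bimodule])
  \<comment> \<open>On generators the recovered action is \<open>la p (ca h g (ra m q))\<close>,
    which is the given one by \<open>act_yp\<close>; generators span \<open>Y\<close>.\<close>
  have act: "M.D.module_act y m = act N y m" if y: "y \<in> carrier YS" and m: "m \<in> carrier N" for y m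
  proof (rule Y_eqI[OF _ _ vsp_N y, where f = "\<lambda>y. M.D.module_act y m" and g = "\<lambda>y. act N y m"])
    show "lin YS N (\<lambda>y. act N y m)" by (rule bil_left[OF bil_act m])
    have "lin YS to_bimodule (\<lambda>y. M.D.module_act y m)"
      by (rule bil_left[OF M.D.bil_module_act]) (simp add: to_bimodule_simps m)
    then show "lin YS N (\<lambda>y. M.D.module_act y m)"
      using module_hom_cong[of YS YS to_bimodule N] by (simp add: to_bimodule_simps)
    fix p h g q assume *: "p \<in> carrier dual" "h \<in> carrier H" "g \<in> carrier H" "q \<in> carrier dual"
    then have "M.D.module_act (yp p h g q) m = la p (ca h g (ra m q))"
      using m bil_closed[OF bil_r m] lin_closed[OF c_lin_right[of h g]]
      by (simp add: M.D.module_act_yp B.two_sided_act_from_data to_bimodule_simps)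
    also have "\<dots> = act N (yp p h g q) m"
      by (rule act_yp[symmetric]) (rule * m)+
    finally show "M.D.module_act (yp p h g q) m = act N (yp p h g q) m" .
  qed
  \<comment> \<open>Equality of records requires agreement of the curried actions outside the
    carriers as well, where both are \<open>undefined\<close>.\<close>
  have "(\<lambda>y\<in>carrier Y. \<lambda>m\<in>carrier N. M.D.module_act y m) = act N"
  proof (rule extensionalityI)
    show "act N \<in> extensional (carrier Y)" using N.act_funcset by (auto simp: PiE_def)
    fix y assume y: "y \<in> carrier Y"
    then have "act N y \<in> extensional (carrier N)" using N.act_funcset by (auto simp: PiE_def)
    then show "(\<lambda>y\<in>carrier Y. \<lambda>m\<in>carrier N. M.D.module_act y m) y = act N y"
      using y act by (intro extensionalityI[of _ "carrier N"]) (auto simp: Y_simps)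
  qed simp
  then show ?thesis
    unfolding Y_module_def M.D.to_module_def by (simp add: to_bimodule_def)
qed

text \<open>The actions of the dual are those of generators with middle part 1. The coactions are
  determined by the generators with trivial outer parts, through their reconstruction from dual
  bases.\<close>

lemma to_bimodule_Y_module:
  assumes "hopf_bimodule P M"
  shows "crossed_module.to_bimodule H (Y_module M) = M"
proof -
  interpret M: dual_hopf_bimodule H M by (rule dual_hopf_bimoduleI[OF assms])
  interpret N: crossed_module H "Y_module M" by (rule crossed_moduleI[OF left_module_Y_module[OF assms]])
  have simps: "carrier (Y_module M) = carrier M" "add (Y_module M) = add M"
    "module.smult (Y_module M) = module.smult M"
    by (simp_all add: Y_module_def M.D.to_module_simps)
  have spaces: "tensor_of dual (Y_module M) = tensor_of dual M" "tensor_of (Y_module M) dual = tensor_of M dual"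
    "tensor_space dual (Y_module M) = tensor_space dual M" "tensor_space (Y_module M) dual = tensor_space M dual"
    by (intro tensor_of_cong tensor_space_cong; simp add: simps)+
  have act: "act (Y_module M) (yp p h g q) m = lact M p (two_sided_act M h g (ract M m q))"
    if "p \<in> carrier dual" "h \<in> carrier H" "g \<in> carrier H" "q \<in> carrier dual" "m \<in> carrier M" for p h g q m
    using that by (simp add: Y_module_def M.D.to_module_simps yp_closed M.D.module_act_yp)
  note closed = bil_closed[OF M.bil_l] bil_closed[OF M.bil_r] lin_closed[OF M.D.c_lin_right]
  have la: "(\<lambda>p\<in>carrier dual. \<lambda>m\<in>carrier M. N.la p m) = lact M"
  proof (rule extensionalityI)
    show "lact M \<in> extensional (carrier dual)"
      using M.B.lact_funcset by (auto simp: PiE_def dual_hopf_simps)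
    fix p assume p: "p \<in> carrier dual"
    then have "lact M p \<in> extensional (carrier M)"
      using M.B.lact_funcset by (auto simp: PiE_def dual_hopf_simps)
    then show "(\<lambda>p\<in>carrier dual. \<lambda>m\<in>carrier M. N.la p m) p = lact M p"
      using p by (intro extensionalityI[of _ "carrier M"]) (auto simp: act M.D.r_one M.D.c_one)
  qed simp
  have ra: "(\<lambda>m\<in>carrier M. \<lambda>p\<in>carrier dual. N.ra m p) = ract M"
  proof (rule extensionalityI)
    show "ract M \<in> extensional (carrier M)"
      using M.B.ract_funcset by (auto simp: PiE_def dual_hopf_simps)
    fix m assume m: "m \<in> carrier M"
    then have "ract M m \<in> extensional (carrier dual)"
      using M.B.ract_funcset by (auto simp: PiE_def dual_hopf_simps)
    then show "(\<lambda>m\<in>carrier M. \<lambda>p\<in>carrier dual. N.ra m p) m = ract M m"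
      using m by (intro extensionalityI[of _ "carrier dual"]) (auto simp: act M.D.l_one M.D.c_one closed)
  qed simp
  have lco: "(\<lambda>m\<in>carrier M. tr (tensor_space dual M) (\<lambda>e p. pure_tensor dual M p (N.ca \<one> e m))) = lcoact M"
  proof (rule extensionalityI)
    show "lcoact M \<in> extensional (carrier M)" using M.B.lcoact_linear by (simp add: linear_maps_def)
    fix m assume m: "m \<in> carrier M"
    have "tr (tensor_space dual M) (\<lambda>e p. pure_tensor dual M p (N.ca \<one> e m))
      = tr (tensor_space dual M) (\<lambda>e p. pure_tensor dual M p (two_sided_act M \<one> e m))"
      by (rule tr_cong) (simp add: act m M.D.l_one M.D.r_one closed)
    then show "(\<lambda>m\<in>carrier M. tr (tensor_space dual M) (\<lambda>e p. pure_tensor dual M p (N.ca \<one> e m))) m = lcoact M m"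
      using m by (simp add: M.lcoact_reconstruct)
  qed simp
  have rco: "(\<lambda>m\<in>carrier M. tr (tensor_space M dual) (\<lambda>e p. pure_tensor M dual (N.ca e \<one> m) p)) = rcoact M"
  proof (rule extensionalityI)
    show "rcoact M \<in> extensional (carrier M)" using M.B.rcoact_linear by (simp add: linear_maps_def)
    fix m assume m: "m \<in> carrier M"
    have "tr (tensor_space M dual) (\<lambda>e p. pure_tensor M dual (N.ca e \<one> m) p)
      = tr (tensor_space M dual) (\<lambda>e p. pure_tensor M dual (two_sided_act M e \<one> m) p)"
      by (rule tr_cong) (simp add: act m M.D.l_one M.D.r_one closed)
    then show "(\<lambda>m\<in>carrier M. tr (tensor_space M dual) (\<lambda>e p. pure_tensor M dual (N.ca e \<one> m) p)) m = rcoact M m"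
      using m by (simp add: M.rcoact_reconstruct)
  qed simp
  show ?thesis
    unfolding N.to_bimodule_def spaces simps la ra lco rco
    by (simp add: Y_module_def M.D.to_module_def)
qed

text \<open>Evaluating the coactions at elements of \<open>H\<close> turns comodule maps into \<open>H\<close>-linear maps.\<close>

lemma coact_hom_iff:
  assumes M: "coactions H M lM rM" and N: "coactions H N lN rN" and f: "lin M N f" and m: "m \<in> carrier M"
  shows "lN (f m) = tensor_map P M P N (\<lambda>p. p) f (lM m)
      \<longleftrightarrow> (\<forall>g\<in>carrier H. f (coactions.mH H M lM m g) = coactions.mH H N lN (f m) g)"
    and "rN (f m) = tensor_map M P N P f (\<lambda>p. p) (rM m)
      \<longleftrightarrow> (\<forall>h\<in>carrier H. f (coactions.hM H M rM h m) = coactions.hM H N rN h (f m))"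
proof -
  interpret M: coactions H M lM rM by (rule M)
  interpret N: coactions H N lN rN by (rule N)
  note fm = lin_closed[OF f m]
  have lm: "lM m \<in> carrier (tensor_space dual M)" and rm: "rM m \<in> carrier (tensor_space M dual)"
    by (intro M.lco_intros m)+
  have b: "bil dual M (tensor_space dual N) (\<lambda>a n. pure_tensor dual N a (f n))"
    "bil M dual (tensor_space N dual) (\<lambda>n a. pure_tensor N dual (f n) a)"
    by (assumption | intro lin_intros M.vsp_M N.vsp_M f lin_closed[OF f]; assumption?)+
  have lt: "evl N g (tensor_map P M P N (\<lambda>p. p) f (lM m)) = f (M.mH m g)" if g: "g \<in> carrier H" for g
  proof -
    have "evl N g (tensor_map P M P N (\<lambda>p. p) f (lM m))
      = sweedler dual M N (\<lambda>a n. evl N g (pure_tensor dual N a (f n))) (lM m)"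
      unfolding tensor_map_def P_norm
      by (rule lin_of_sweedler[OF lin_evl[OF N.vsp_M g] _ N.vsp_M b(1) lm]) simp
    also have "\<dots> = sweedler dual M N (\<lambda>a n. ev a g \<odot>\<^bsub>N\<^esub> f n) (lM m)"
      by (rule sweedler_cong[OF lm]) (simp add: evl_pure N.vsp_M g lin_closed[OF f])
    also have "\<dots> = f (M.mH m g)" by (rule M.lin_evl_sum[OF N.vsp_M f m g])
    finally show ?thesis .
  qed
  have rt: "evr N h (tensor_map M P N P f (\<lambda>p. p) (rM m)) = f (M.hM h m)" if h: "h \<in> carrier H" for h
  proof -
    have "evr N h (tensor_map M P N P f (\<lambda>p. p) (rM m))
      = sweedler M dual N (\<lambda>n a. evr N h (pure_tensor N dual (f n) a)) (rM m)"
      unfolding tensor_map_def P_norm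
      by (rule lin_of_sweedler[OF lin_evr[OF N.vsp_M h] _ N.vsp_M b(2) rm]) (simp add: N.vsp_M)
    also have "\<dots> = sweedler M dual N (\<lambda>n a. ev a h \<odot>\<^bsub>N\<^esub> f n) (rM m)"
      by (rule sweedler_cong[OF rm]) (simp add: evr_pure N.vsp_M h lin_closed[OF f])
    also have "\<dots> = f (M.hM h m)" by (rule M.lin_evr_sum[OF N.vsp_M f m h])
    finally show ?thesis .
  qed
  have lc: "tensor_map P M P N (\<lambda>p. p) f (lM m) \<in> carrier (tensor_space dual N)"
    unfolding tensor_map_def P_norm by (rule sweedler_closed[OF _ b(1) lm]) simp
  have rc: "tensor_map M P N P f (\<lambda>p. p) (rM m) \<in> carrier (tensor_space N dual)"
    unfolding tensor_map_def P_norm by (rule sweedler_closed[OF _ b(2) rm]) (simp add: N.vsp_M)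
  have lN: "lN (f m) \<in> carrier (tensor_space dual N)" and rN: "rN (f m) \<in> carrier (tensor_space N dual)"
    by (intro N.lco_intros fm)+
  have "lN (f m) = tensor_map P M P N (\<lambda>p. p) f (lM m)" if "\<forall>g\<in>carrier H. f (M.mH m g) = N.mH (f m) g"
    by (rule evl_eqI[OF N.vsp_M lN lc]) (use that in \<open>simp add: lt N.mH_def\<close>)
  moreover have "f (M.mH m g) = N.mH (f m) g"
    if "lN (f m) = tensor_map P M P N (\<lambda>p. p) f (lM m)" "g \<in> carrier H" for g
    unfolding N.mH_def that(1) by (rule lt[OF that(2), symmetric])
  ultimately show "lN (f m) = tensor_map P M P N (\<lambda>p. p) f (lM m)
      \<longleftrightarrow> (\<forall>g\<in>carrier H. f (M.mH m g) = N.mH (f m) g)" by blast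
  have "rN (f m) = tensor_map M P N P f (\<lambda>p. p) (rM m)" if "\<forall>h\<in>carrier H. f (M.hM h m) = N.hM h (f m)"
    by (rule evr_eqI[OF N.vsp_M rN rc]) (use that in \<open>simp add: rt N.hM_def\<close>)
  moreover have "f (M.hM h m) = N.hM h (f m)"
    if "rN (f m) = tensor_map M P N P f (\<lambda>p. p) (rM m)" "h \<in> carrier H" for h
    unfolding N.hM_def that(1) by (rule rt[OF that(2), symmetric])
  ultimately show "rN (f m) = tensor_map M P N P f (\<lambda>p. p) (rM m)
      \<longleftrightarrow> (\<forall>h\<in>carrier H. f (M.hM h m) = N.hM h (f m))" by blast
qed

text \<open>A linear map commutes with \<open>Y\<close> exactly if it commutes with the two actions
  of the dual and the two actions of \<open>H\<close>, and the latter conditions say that it is a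
  bicomodule map. The morphism sets coincide literally, so the functor can leave morphisms
  unchanged.\<close>

lemma Hom_Y_module:
  assumes "hopf_bimodule P M" "hopf_bimodule P N"
  shows "Hom (hopf_bimodule_category P) M N = Hom (left_module_category Y) (Y_module M) (Y_module N)"
proof -
  interpret M: dual_hopf_bimodule H M by (rule dual_hopf_bimoduleI[OF assms(1)])
  interpret N: dual_hopf_bimodule H N by (rule dual_hopf_bimoduleI[OF assms(2)])
  let ?C = "\<lambda>f. \<forall>m\<in>carrier M.
    (\<forall>p\<in>carrier dual. f (lact M p m) = lact N p (f m) \<and> f (ract M m p) = ract N (f m) p) \<and>
    (\<forall>g\<in>carrier H. f (M.mH m g) = N.mH (f m) g) \<and> (\<forall>h\<in>carrier H. f (M.hM h m) = N.hM h (f m))"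
  let ?D = "\<lambda>f. \<forall>y\<in>carrier YS. \<forall>m\<in>carrier M. f (M.D.module_act y m) = N.D.module_act y (f m)"
  have iff: "?C f \<longleftrightarrow> ?D f" if f: "lin M N f" for f
  proof
    assume C: "?C f"
    show "?D f"
    proof (intro ballI)
      fix y m assume y: "y \<in> carrier YS" and m: "m \<in> carrier M"
      show "f (M.D.module_act y m) = N.D.module_act y (f m)"
      proof (rule Y_eqI[OF _ _ N.vsp_M y, where f = "\<lambda>y. f (M.D.module_act y m)" and g = "\<lambda>y. N.D.module_act y (f m)"])
        show "lin YS N (\<lambda>y. f (M.D.module_act y m))"
          by (rule lin_compose[OF f bil_left[OF M.D.bil_module_act m]])
        show "lin YS N (\<lambda>y. N.D.module_act y (f m))"
          by (rule bil_left[OF N.D.bil_module_act lin_closed[OF f m]])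
        fix p h g q assume "p \<in> carrier dual" "h \<in> carrier H" "g \<in> carrier H" "q \<in> carrier dual"
        then show "f (M.D.module_act (yp p h g q) m) = N.D.module_act (yp p h g q) (f m)"
          using C m lin_closed[OF f m]
          by (simp add: M.D.module_act_yp N.D.module_act_yp M.two_sided_act_eq N.two_sided_act_eq
              M.mH_closed M.hM_closed bil_closed[OF M.bil_r])
      qed
    qed
  next
    assume D: "?D f"
    \<comment> \<open>Setting all but one of \<open>p\<close>, \<open>h\<close>, \<open>g\<close>,
      \<open>q\<close> to the unit isolates each of the four conditions in turn.\<close>
    have yp: "f (lact M p (two_sided_act M h g (ract M m q))) = lact N p (two_sided_act N h g (ract N (f m) q))"
      if "p \<in> carrier dual" "h \<in> carrier H" "g \<in> carrier H" "q \<in> carrier dual" "m \<in> carrier M" for p h g q m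
      using D[rule_format, OF yp_closed[OF that(1-4)] that(5)] that lin_closed[OF f]
      by (simp add: M.D.module_act_yp N.D.module_act_yp)
    show "?C f"
    proof (intro ballI conjI)
      fix m assume m: "m \<in> carrier M"
      note fm = lin_closed[OF f m]
      note one = M.D.l_one N.D.l_one M.D.r_one N.D.r_one M.D.c_one N.D.c_one
      fix p assume p: "p \<in> carrier dual"
      show "f (lact M p m) = lact N p (f m)"
        using yp[of p \<one> \<one> pone m] by (simp add: p m fm one)
      show "f (ract M m p) = ract N (f m) p"
        using yp[of pone \<one> \<one> p m] bil_closed[OF M.bil_r m p] bil_closed[OF N.bil_r fm p]
        by (simp add: p m fm one)
    next
      fix m assume m: "m \<in> carrier M"
      note fm = lin_closed[OF f m]
      note one = M.D.l_one N.D.l_one M.D.r_one N.D.r_one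
      fix g assume g: "g \<in> carrier H"
      note closed = M.mH_closed[OF m g] M.hM_closed[OF m g] N.mH_closed[OF fm g] N.hM_closed[OF fm g]
      show "f (M.mH m g) = N.mH (f m) g"
        using yp[of pone \<one> g pone m]
        by (simp add: m fm g one closed M.two_sided_act_eq N.two_sided_act_eq M.hM_one N.hM_one)
      show "f (M.hM g m) = N.hM g (f m)"
        using yp[of pone g \<one> pone m]
        by (simp add: m fm g one closed M.two_sided_act_eq N.two_sided_act_eq M.mH_one N.mH_one)
    qed
  qed
  have lin: "linear_maps (Y_module M) (Y_module N) = linear_maps M N"
    unfolding linear_maps_def Y_module_def
    using module_hom_cong[of M.D.to_module M N.D.to_module N]
    by (simp add: M.D.to_module_simps N.D.to_module_simps)
  have "Hom (left_module_category Y) (Y_module M) (Y_module N) = {f \<in> linear_maps M N. ?D f}"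
    unfolding left_module_category_def
    by (auto simp: lin Y_simps linear_maps_def lin_iff)
       (auto simp: Y_module_def M.D.to_module_simps N.D.to_module_simps)
  also have "\<dots> = {f \<in> linear_maps M N. ?C f}"
    by (rule Collect_cong, rule conj_cong[OF refl], rule iff[symmetric]) (simp add: linear_maps_def)
  also have "\<dots> = Hom (hopf_bimodule_category P) M N"
    unfolding hopf_bimodule_category_def
    using coact_hom_iff[OF M.coactions_axioms N.coactions_axioms]
    by (auto simp: dual_hopf_simps linear_maps_def)
  finally show ?thesis by simp
qed

end

section \<open>Isomorphisms of categories that fix morphisms\<close>

lemma linear_maps_compose:
  "vsp L \<Longrightarrow> f \<in> linear_maps L M \<Longrightarrow> g \<in> linear_maps M N \<Longrightarrow> compose (carrier L) g f \<in> linear_maps L N"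
  by (simp add: linear_maps_def compose_extensional) (simp add: lin_iff compose_def)

lemma category_left_module:
  fixes R :: "('k::field, 'y, 'x) module_scheme"
  shows "category (left_module_category R :: (('k, 'y, 'm) left_module, 'm \<Rightarrow> 'm) category)"
proof
  fix X :: "('k, 'y, 'm) left_module"
  assume "X \<in> Ob (left_module_category R)"
  then interpret X: left_module R X by (simp add: left_module_category_def)
  show "Id (left_module_category R) X \<in> Hom (left_module_category R) X X"
    using X.act_funcset X.vectorspace_axioms
    by (auto simp: left_module_category_def linear_maps_def lin_iff)
next
  fix X Y Z :: "('k, 'y, 'm) left_module" and f g
  assume Ob: "X \<in> Ob (left_module_category R)" "Y \<in> Ob (left_module_category R)" "Z \<in> Ob (left_module_category R)"
    and f: "f \<in> Hom (left_module_category R) X Y" and g: "g \<in> Hom (left_module_category R) Y Z"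
  interpret X: left_module R X using Ob by (simp add: left_module_category_def)
  have "f m \<in> carrier Y" if "m \<in> carrier X" for m
    using f that by (auto simp: left_module_category_def linear_maps_def lin_iff)
  moreover have "act X y m \<in> carrier X" if "y \<in> carrier R" "m \<in> carrier X" for y m
    using X.act_funcset that by auto
  ultimately show "Comp (left_module_category R) X Y Z g f \<in> Hom (left_module_category R) X Z"
    using f g linear_maps_compose[OF X.vectorspace_axioms]
    by (auto simp: left_module_category_def compose_eq)
next
  fix X Y :: "('k, 'y, 'm) left_module" and f
  assume "f \<in> Hom (left_module_category R) X Y"
  then have f: "f \<in> carrier X \<rightarrow> carrier Y" "f \<in> extensional (carrier X)"
    by (auto simp: left_module_category_def linear_maps_def lin_iff)
  show "Comp (left_module_category R) X X Y f (Id (left_module_category R) X) = f"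
    using f by (simp add: left_module_category_def compose_Id)
  show "Comp (left_module_category R) X Y Y (Id (left_module_category R) Y) f = f"
    using f by (simp add: left_module_category_def Id_compose)
next
  fix X Y Z W :: "('k, 'y, 'm) left_module" and f g h
  assume "f \<in> Hom (left_module_category R) X Y"
  then have f: "f \<in> carrier X \<rightarrow> carrier Y"
    by (auto simp: left_module_category_def linear_maps_def lin_iff)
  show "Comp (left_module_category R) X Y W (Comp (left_module_category R) Y Z W h g) f
    = Comp (left_module_category R) X Z W h (Comp (left_module_category R) X Y Z g f)"
    by (simp add: left_module_category_def) (rule compose_assoc[OF f, symmetric])
qed

text \<open>Morphism sets, identities and compositions of \<open>C\<close> are those of
  \<open>D\<close> at the images under \<open>F\<close>, so the category axioms for \<open>C\<close>
  follow from those for \<open>D\<close>. Thus Hopf bimodules inherit them from left modules.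
  \<open>G\<close> respects morphisms because \<open>F (G X) = X\<close>.\<close>

lemma category_iso_identity_on_Hom:
  assumes D: "category D"
    and F: "\<And>X. X \<in> Ob C \<Longrightarrow> F X \<in> Ob D" and G: "\<And>X. X \<in> Ob D \<Longrightarrow> G X \<in> Ob C"
    and GF: "\<And>X. X \<in> Ob C \<Longrightarrow> G (F X) = X" and FG: "\<And>X. X \<in> Ob D \<Longrightarrow> F (G X) = X"
    and Hom: "\<And>X Y. X \<in> Ob C \<Longrightarrow> Y \<in> Ob C \<Longrightarrow> Hom C X Y = Hom D (F X) (F Y)"
    and Id: "\<And>X. X \<in> Ob C \<Longrightarrow> Id C X = Id D (F X)"
    and Comp: "\<And>X Y Z. X \<in> Ob C \<Longrightarrow> Y \<in> Ob C \<Longrightarrow> Z \<in> Ob C \<Longrightarrow> Comp C X Y Z = Comp D (F X) (F Y) (F Z)"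
  shows "category_iso C D \<lparr>on_ob = F, on_hom = \<lambda>_ _ f. f\<rparr>"
proof -
  interpret D: category D by (rule D)
  have C: "category C"
    by standard (simp_all add: Hom Id Comp F D.Id_in_Hom D.Comp_in_Hom D.Comp_Id_right D.Comp_Id_left D.Comp_assoc)
  have "cat_functor C D \<lparr>on_ob = F, on_hom = \<lambda>_ _ f. f\<rparr>"
    by (intro cat_functor.intro cat_functor_axioms.intro C D) (simp_all add: F Hom Id Comp)
  moreover have "cat_functor D C \<lparr>on_ob = G, on_hom = \<lambda>_ _ f. f\<rparr>"
    by (intro cat_functor.intro cat_functor_axioms.intro C D) (simp_all add: G Hom Id Comp FG)
  ultimately show ?thesis
    unfolding category_iso_def functor_eq_def comp_functor_def id_functor_def
    by (auto simp: GF FG intro!: exI[of _ "\<lparr>on_ob = G, on_hom = \<lambda>_ _ f. f\<rparr>"])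
qed

theorem proposition2p2:
  fixes H :: "('k::field, 'h) hopf"
  assumes "hopf_algebra H"
    and "vectorspace.fin_dim class_ring H"
  shows "\<exists>F :: (('k, 'h \<Rightarrow> 'k, 'm) hopf_bimodule, 'm \<Rightarrow> 'm,
                ('k, ('k, 'h) Y_carrier, 'm) left_module, 'm \<Rightarrow> 'm) cat_functor.
    category_iso (hopf_bimodule_category (dual_hopf H)) (left_module_category (Y_algebra H)) F \<and>
    functor_eq (hopf_bimodule_category (dual_hopf H)) (comp_functor forgetful F) forgetful"
proof -
  interpret fin_dim_hopf H
    using assms by (intro fin_dim_hopf.intro fin_dim_hopf_axioms.intro)
  let ?C = "hopf_bimodule_category P :: (('k, 'h \<Rightarrow> 'k, 'm) hopf_bimodule, 'm \<Rightarrow> 'm) category"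
  let ?D = "left_module_category Y :: (('k, ('k, 'h) Y_carrier, 'm) left_module, 'm \<Rightarrow> 'm) category"
  have C: "hopf_bimodule P M" if "M \<in> Ob ?C" for M
    using that by (simp add: hopf_bimodule_category_def)
  have N: "left_module Y N" if "N \<in> Ob ?D" for N
    using that by (simp add: left_module_category_def)
  \<comment> \<open>Equality of carriers makes identities and compositions coincide; equality of the
    truncated records is compatibility with the forgetful functors.\<close>
  have part: "carrier (Y_module M) = carrier M" "module.truncate (Y_module M) = module.truncate M"
    if "M \<in> Ob ?C" for M
  proof -
    interpret M: dual_hopf_bimodule H M by (rule dual_hopf_bimoduleI[OF C[OF that]])
    show "carrier (Y_module M) = carrier M" "module.truncate (Y_module M) = module.truncate M"
      by (simp_all add: Y_module_def M.D.to_module_def module.truncate_def)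
  qed
  have "category_iso ?C ?D \<lparr>on_ob = Y_module, on_hom = \<lambda>_ _ f. f\<rparr>"
  proof (rule category_iso_identity_on_Hom[OF category_left_module, where G = "crossed_module.to_bimodule H"])
    show "crossed_module.to_bimodule H N \<in> Ob ?C" if "N \<in> Ob ?D" for N
      using crossed_module.hopf_bimodule_to_bimodule[OF crossed_moduleI[OF N[OF that]]]
      by (simp add: hopf_bimodule_category_def)
    show "Y_module M \<in> Ob ?D" if "M \<in> Ob ?C" for M
      using left_module_Y_module[OF C[OF that]] by (simp add: left_module_category_def)
    show "Id ?C M = Id ?D (Y_module M)" if "M \<in> Ob ?C" for M
      using part[OF that] by (simp add: hopf_bimodule_category_def left_module_category_def)
    show "Comp ?C L M N = Comp ?D (Y_module L) (Y_module M) (Y_module N)" if "L \<in> Ob ?C" for L M N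
      using part[OF that] by (simp add: hopf_bimodule_category_def left_module_category_def)
    show "Hom ?C M N = Hom ?D (Y_module M) (Y_module N)" if "M \<in> Ob ?C" "N \<in> Ob ?C" for M N
      by (rule Hom_Y_module[OF C[OF that(1)] C[OF that(2)]])
    show "crossed_module.to_bimodule H (Y_module M) = M" if "M \<in> Ob ?C" for M
      by (rule to_bimodule_Y_module[OF C[OF that]])
    show "Y_module (crossed_module.to_bimodule H N) = N" if "N \<in> Ob ?D" for N
      by (rule Y_module_to_bimodule[OF N[OF that]])
  qed
  moreover have "functor_eq ?C (comp_functor forgetful \<lparr>on_ob = Y_module, on_hom = \<lambda>_ _ f. f\<rparr>) forgetful"
    by (simp add: functor_eq_def comp_functor_def forgetful_def part)
  ultimately show ?thesis by blast
qed

end
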